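(* Let $m\in\mathbb{N}$, let $Q:\mathbb{R}\to\mathbb{C}^{m\times m}$ satisfy $Q(x)=Q(x)^*$ for all $x\in\mathbb{R}$ and $Q\in \mathrm{AC}_{\mathrm{loc}}(\mathbb{R})^{m\times m}$, and suppose $Q$ is periodic, that is, there is an $\omega>0$ such that $Q(x+\omega)=Q(x)$ for all $x\in\mathbb{R}$. Let $H=-I_m\frac{d^2}{dx^2}+Q$ be the associated self-adjoint operator in $L^2(\mathbb{R})^m$. If $H$ has uniform spectral multiplicity $2m$ and $\sigma(H)=[E_0,\infty)$ for some $E_0\in\mathbb{R}$, then $$Q(x)=E_0I_m\quad\text{for all }x\in\mathbb{R}.$$
   Context: $I_m$ is the identity matrix in $\mathbb{C}^m$; $M^*$ is the conjugate transpose of $M$; $\mathrm{AC}_{\mathrm{loc}}(\mathbb{R})$ denotes the locally absolutely continuous functions on $\mathbb{R}$; $\sigma(\cdot)$ denotes the spectrum. The operator $$H=-I_m\frac{d^2}{dx^2}+Q,\quad \mathrm{dom}(H)=\{g\in L^2(\mathbb{R})^m : g,g'\in \mathrm{AC}_{\mathrm{loc}}(\mathbb{R})^m,\ -g''+Qg\in L^2(\mathbb{R})^m\}$$ is self-adjoint in $L^2(\mathbb{R})^m$ (as $Q$ is bounded). Uniform spectral multiplicity $2m$ means that the spectrum of $H$ has (maximal) multiplicity $2m$ throughout $\sigma(H)$, i.e. $H$ is unitarily equivalent to multiplication by the independent variable in $L^2(\mathbb{R},d\mu;\mathbb{C}^{2m})$ for some Borel measure $\mu$. *)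

theory Defs
  imports "HOL-Analysis.Analysis"
begin

section \<open>Absolute continuity\<close>

definition absolutely_continuous_between :: "real \<Rightarrow> real \<Rightarrow> (real \<Rightarrow> complex) \<Rightarrow> bool" where
  "absolutely_continuous_between a b f \<longleftrightarrow>
     (\<forall>\<epsilon>>0. \<exists>\<delta>>0. \<forall>(n::nat) (s :: nat \<Rightarrow> real) t.
        (\<forall>i<n. a \<le> s i \<and> s i \<le> t i \<and> t i \<le> b) \<and>
        disjoint_family_on (\<lambda>i. {s i<..<t i}) {..<n} \<and>
        (\<Sum>i<n. t i - s i) < \<delta>
        \<longrightarrow> (\<Sum>i<n. cmod (f (t i) - f (s i))) < \<epsilon>)"

definition AC_loc :: "(real \<Rightarrow> complex) set" where
  "AC_loc = {f. \<forall>a b. absolutely_continuous_between a b f}"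

section \<open>Square integrable vector-valued functions\<close>

text \<open>
  Elements of \<open>L\<^sup>2(M)\<^sup>n\<close> are handled through representatives: \<open>L2 M\<close> is a set of functions, and
  equality of its elements is equality almost everywhere.  The norm of \<open>complex ^ 'n\<close> is the
  Euclidean one.
\<close>

definition L2 :: "'a measure \<Rightarrow> ('a \<Rightarrow> complex ^ 'n) set" where
  "L2 M = {f \<in> borel_measurable M. integrable M (\<lambda>x. (norm (f x))\<^sup>2)}"

definition L2_inner :: "'a measure \<Rightarrow> ('a \<Rightarrow> complex ^ 'n) \<Rightarrow> ('a \<Rightarrow> complex ^ 'n) \<Rightarrow> complex" where
  "L2_inner M f g = (\<integral>x. (\<Sum>i\<in>UNIV. f x $ i * cnj (g x $ i)) \<partial>M)"

definition L2_norm :: "'a measure \<Rightarrow> ('a \<Rightarrow> complex ^ 'n) \<Rightarrow> real" where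
  "L2_norm M f = sqrt (\<integral>x. (norm (f x))\<^sup>2 \<partial>M)"

section \<open>Unbounded operators in \<open>L\<^sup>2\<close>\<close>

text \<open>
  An operator is given by a domain \<open>D \<subseteq> L2 M\<close> and a map \<open>T\<close> sending \<open>D\<close> into \<open>L2 M\<close>.  The set
  \<open>D\<close> need not be closed under almost everywhere equality: a class belongs to the domain of the
  operator iff one of its representatives lies in \<open>D\<close>.

  A number \<open>z\<close> is in the resolvent set iff \<open>T - z\<close> maps its domain bijectively onto the whole
  space with bounded inverse.  The estimate contains both injectivity and boundedness of the
  inverse.
\<close>

definition resolvent_set ::
    "'a measure \<Rightarrow> ('a \<Rightarrow> complex ^ 'n) set \<Rightarrow> (('a \<Rightarrow> complex ^ 'n) \<Rightarrow> ('a \<Rightarrow> complex ^ 'n)) \<Rightarrow> complex set"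
  where
  "resolvent_set M D T =
     {z. (\<forall>h\<in>L2 M. \<exists>f\<in>D. AE x in M. T f x - z *s f x = h x) \<and>
         (\<exists>C. \<forall>f\<in>D. L2_norm M f \<le> C * L2_norm M (\<lambda>x. T f x - z *s f x))}"

definition spectrum ::
    "'a measure \<Rightarrow> ('a \<Rightarrow> complex ^ 'n) set \<Rightarrow> (('a \<Rightarrow> complex ^ 'n) \<Rightarrow> ('a \<Rightarrow> complex ^ 'n)) \<Rightarrow> complex set"
  where
  "spectrum M D T = - resolvent_set M D T"

text \<open>
  Linearity and preservation of the inner product make \<open>U\<close> compatible with almost everywhere
  equality, so that it induces a map on classes.
\<close>

definition unitary_map ::
    "'a measure \<Rightarrow> 'b measure \<Rightarrow> (('a \<Rightarrow> complex ^ 'n) \<Rightarrow> ('b \<Rightarrow> complex ^ 'k)) \<Rightarrow> bool" where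
  "unitary_map M N U \<longleftrightarrow>
     (\<forall>f\<in>L2 M. U f \<in> L2 N) \<and>
     (\<forall>f\<in>L2 M. \<forall>g\<in>L2 M. \<forall>a b.
        AE y in N. U (\<lambda>x. a *s f x + b *s g x) y = a *s U f y + b *s U g y) \<and>
     (\<forall>f\<in>L2 M. \<forall>g\<in>L2 M. L2_inner N (U f) (U g) = L2_inner M f g) \<and>
     (\<forall>h\<in>L2 N. \<exists>f\<in>L2 M. AE y in N. U f y = h y)"

text \<open>
  Unitary equivalence \<open>U T U\<^sup>-\<^sup>1 = T'\<close>: the map \<open>U\<close> carries the domain (of classes) of the first
  operator exactly onto that of the second one and intertwines the two actions.
\<close>

definition unitarily_equivalent ::
    "'a measure \<Rightarrow> ('a \<Rightarrow> complex ^ 'n) set \<Rightarrow> (('a \<Rightarrow> complex ^ 'n) \<Rightarrow> ('a \<Rightarrow> complex ^ 'n)) \<Rightarrow>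
     'b measure \<Rightarrow> ('b \<Rightarrow> complex ^ 'k) set \<Rightarrow> (('b \<Rightarrow> complex ^ 'k) \<Rightarrow> ('b \<Rightarrow> complex ^ 'k)) \<Rightarrow> bool"
  where
  "unitarily_equivalent M D T N D' T' \<longleftrightarrow>
     (\<exists>U. unitary_map M N U \<and>
        (\<forall>f\<in>L2 M. (\<exists>g\<in>D. AE x in M. f x = g x) \<longleftrightarrow> (\<exists>h\<in>D'. AE y in N. U f y = h y)) \<and>
        (\<forall>g\<in>D. \<forall>h\<in>D'. (AE y in N. U g y = h y) \<longrightarrow> (AE y in N. U (T g) y = T' h y)))"

definition mult_op :: "(real \<Rightarrow> complex ^ 'k) \<Rightarrow> (real \<Rightarrow> complex ^ 'k)" where
  "mult_op \<phi> = (\<lambda>x. x *\<^sub>R \<phi> x)"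

definition mult_dom :: "real measure \<Rightarrow> (real \<Rightarrow> complex ^ 'k) set" where
  "mult_dom \<mu> = {\<phi> \<in> L2 \<mu>. mult_op \<phi> \<in> L2 \<mu>}"

text \<open>
  The multiplicity is the cardinality of the index type \<open>'k\<close>, passed as a type argument.
\<close>

definition uniform_spectral_multiplicity ::
    "'k::finite itself \<Rightarrow> 'a measure \<Rightarrow> ('a \<Rightarrow> complex ^ 'n) set \<Rightarrow>
     (('a \<Rightarrow> complex ^ 'n) \<Rightarrow> ('a \<Rightarrow> complex ^ 'n)) \<Rightarrow> bool" where
  "uniform_spectral_multiplicity (_ :: 'k itself) M D T \<longleftrightarrow>
     (\<exists>\<mu> :: real measure. sets \<mu> = sets borel \<and>
        unitarily_equivalent M D T \<mu> (mult_dom \<mu> :: (real \<Rightarrow> complex ^ 'k) set) mult_op)"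

section \<open>Matrix-valued Schroedinger operators\<close>

definition conj_transpose :: "complex ^ 'n ^ 'm \<Rightarrow> complex ^ 'm ^ 'n" where
  "conj_transpose A = map_matrix cnj (transpose A)"

abbreviation vderiv :: "(real \<Rightarrow> complex ^ 'm) \<Rightarrow> real \<Rightarrow> complex ^ 'm" where
  "vderiv g \<equiv> (\<lambda>x. vector_derivative g (at x))"

text \<open>
  For \<open>g\<close> in the domain below, \<open>g''\<close> exists almost everywhere, because \<open>g'\<close> is locally absolutely
  continuous; its values on the exceptional null set are irrelevant.
\<close>

definition schroedinger ::
    "(real \<Rightarrow> complex ^ 'm ^ 'm) \<Rightarrow> (real \<Rightarrow> complex ^ 'm) \<Rightarrow> (real \<Rightarrow> complex ^ 'm)" where
  "schroedinger Q g = (\<lambda>x. - vderiv (vderiv g) x + Q x *v g x)"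

text \<open>
  A locally absolutely continuous \<open>g\<close> whose almost everywhere derivative has a locally absolutely
  continuous version is differentiable everywhere, with that version as its derivative; hence the
  pointwise differentiability requirement is no restriction.
\<close>

definition schroedinger_dom :: "(real \<Rightarrow> complex ^ 'm ^ 'm) \<Rightarrow> (real \<Rightarrow> complex ^ 'm) set" where
  "schroedinger_dom Q =
     {g \<in> L2 lebesgue.
        (\<forall>i. (\<lambda>x. g x $ i) \<in> AC_loc) \<and>
        (\<forall>x. g differentiable (at x)) \<and>
        (\<forall>i. (\<lambda>x. vderiv g x $ i) \<in> AC_loc) \<and>
        schroedinger Q g \<in> L2 lebesgue}"

end

theory Submission
  imports Defs "HOL-Complex_Analysis.Conformal_Mappings"
begin

text \<open>
  Let \<open>U\<close> be the unitary map diagonalising \<open>H\<close>, with values in \<open>L\<^sup>2(\<mu>; \<complex>\<^sup>2\<^sup>m)\<close>. The boundary values \<open>f(a)\<close> and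
  \<open>f'(a)\<close> of a function in the domain are integrals of \<open>U f\<close> against kernels, which depend on \<open>a\<close> like
  solutions of \<open>-\<psi>'' + Q \<psi> = y \<psi>\<close> and are bounded in \<open>L\<^sup>2\<close> uniformly in \<open>a\<close>. Since the multiplicity is \<open>2 m\<close>, the
  kernels at \<open>a = 0\<close> form a basis for almost every \<open>y\<close>, so that all solutions grow at most polynomially for
  almost every \<open>y\<close>, and, with constants depending only on the norm of the monodromy matrix, for every
  \<open>y \<ge> E\<^sub>0\<close>. By a Phragmen--Lindeloef argument the solutions at the energies \<open>E\<^sub>0 - \<kappa>\<^sup>2\<close> then grow at most like
  \<open>exp (\<kappa> x)\<close> times a polynomial in \<open>x\<close>. For large \<open>\<kappa>\<close> a cone argument turns this into the statement that the
  mean of \<open>q = Q - E\<^sub>0 I\<close> over a period is nonpositive.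

  On the other hand \<open>H \<ge> E\<^sub>0\<close> makes the periodic form \<open>\<integral> |g'|\<^sup>2 + \<langle>q g, g\<rangle>\<close> nonnegative. It is nonpositive at
  constants \<open>v\<close>, which are hence minimisers, so \<open>q v\<close> is orthogonal to all smooth periodic functions.
\<close>

text \<open>Multiplicity speaks about an unspecified unitary map and a measure known up to null
  sets, whereas Phragmen--Lindeloef needs a bound at every point of the real axis. No eigenfunction
  expansion is constructed: boundary values are represented through the resolvent at
  \<open>E0 - 1\<close>, and a solution enters only by moving its Cauchy data from one point to
  another. The passage from almost every to every energy works because the growth bound is a closed
  condition. Its constants depend on the norm of the monodromy matrix alone, which is achieved by a
  shortest annihilating polynomial with all roots in the closed unit disc. Multiplicity 2 m gives
  polynomial growth to all 2 m independent solutions and so to the whole monodromy matrix. Below the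
  spectrum free solutions grow like exp (\<kappa> x), and q changes the growth over a period to
  first order by a factor with exponent (integral of q) / (2 \<kappa>). A mean with a positive
  direction would therefore beat every polynomial factor. As q need not commute with itself at
  different points, a cone argument takes the place of diagonalisation.\<close>

unbundle no fps_syntax

section \<open>The Hermitian form and the Frobenius norm\<close>

definition cinner :: "complex ^ 'n \<Rightarrow> complex ^ 'n \<Rightarrow> complex" where
  "cinner u v = (\<Sum>i\<in>UNIV. u $ i * cnj (v $ i))"

text \<open>The library's inner product on complex vectors is only the real part. Norm estimates and
  derivatives use the real form; integral representations and orthogonality in the fibre need the
  complex one.\<close>

lemma Re_cinner: "Re (cinner u v) = u \<bullet> v"
  by (simp add: cinner_def inner_vec_def inner_complex_def)

lemma norm_cinner_le: "norm (cinner u v) \<le> norm u * norm v"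
proof -
  have "norm (cinner u v) \<le> (\<Sum>i\<in>UNIV. \<bar>norm (u $ i)\<bar> * \<bar>norm (v $ i)\<bar>)"
    unfolding cinner_def by (rule order_trans[OF norm_sum]) (simp add: norm_mult)
  also have "\<dots> \<le> norm u * norm v"
    unfolding norm_vec_def by (rule L2_set_mult_ineq)
  finally show ?thesis .
qed

lemma cinner_add_left: "cinner (u + v) w = cinner u w + cinner v w"
  and cinner_add_right: "cinner u (v + w) = cinner u v + cinner u w"
  and cinner_diff_left: "cinner (u - v) w = cinner u w - cinner v w"
  and cinner_diff_right: "cinner u (v - w) = cinner u v - cinner u w"
  and cinner_minus_right: "cinner u (- w) = - cinner u w"
  and cinner_scale_left: "cinner (c *s u) w = c * cinner u w"
  and cinner_scale_right: "cinner u (c *s w) = cnj c * cinner u w"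
  and cinner_scaleR_left: "cinner (r *\<^sub>R u) w = of_real r * cinner u w"
  and cinner_scaleR_right: "cinner u (r *\<^sub>R w) = of_real r * cinner u w"
  and cinner_zero_left [simp]: "cinner 0 w = 0"
  and cinner_zero_right [simp]: "cinner u 0 = 0"
  by (simp_all add: cinner_def algebra_simps sum.distrib sum_subtractf sum_negf sum_distrib_left
      vector_scaleR_component scaleR_conv_of_real[where 'a=complex])

lemma cnj_cinner: "cnj (cinner u v) = cinner v u"
  by (simp add: cinner_def mult.commute)

lemma cinner_self: "cinner u u = of_real ((norm u)\<^sup>2)"
proof -
  have "cinner u u = (\<Sum>i\<in>UNIV. of_real ((norm (u $ i))\<^sup>2))"
    by (simp only: cinner_def complex_norm_square)
  also have "\<dots> = of_real ((norm u)\<^sup>2)"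
    by (simp add: norm_vec_def L2_set_def sum_nonneg)
  finally show ?thesis .
qed

lemma bounded_bilinear_cinner: "bounded_bilinear cinner"
  by (rule bounded_bilinear.intro)
     (auto simp: cinner_add_left cinner_add_right cinner_scaleR_left cinner_scaleR_right scaleR_conv_of_real[where 'a=complex]
       intro!: exI[of _ 1] norm_cinner_le)

lemmas cinner_has_vector_derivative [derivative_intros] =
  bounded_bilinear.has_vector_derivative[OF bounded_bilinear_cinner]
lemmas continuous_on_cinner [continuous_intros] =
  bounded_bilinear.continuous_on[OF bounded_bilinear_cinner]

lemma cinner_sum_right: "cinner w (\<Sum>i\<in>A. f i) = (\<Sum>i\<in>A. cinner w (f i))"
  by (simp add: bounded_bilinear.sum_right[OF bounded_bilinear_cinner])

lemma cinner_axis: "cinner u (axis i 1) = u $ i"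
  unfolding cinner_def axis_def by (simp add: if_distrib[of "\<lambda>x. _ * cnj x"] cong: if_cong)

lemma cinner_conj_transpose: "cinner (A *v u) v = cinner u (conj_transpose A *v v)"
proof -
  have "cinner (A *v u) v = (\<Sum>i\<in>UNIV. \<Sum>j\<in>UNIV. A $ i $ j * u $ j * cnj (v $ i))"
    by (simp add: cinner_def matrix_vector_mult_def sum_distrib_right)
  also have "\<dots> = (\<Sum>j\<in>UNIV. \<Sum>i\<in>UNIV. A $ i $ j * u $ j * cnj (v $ i))"
    by (rule sum.swap)
  also have "\<dots> = cinner u (conj_transpose A *v v)"
    by (simp add: cinner_def matrix_vector_mult_def conj_transpose_def map_matrix_def transpose_def
        sum_distrib_left algebra_simps)
  finally show ?thesis .
qed

text \<open>Here \<open>norm A\<close> is the Frobenius norm, which dominates the operator norm by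
  Cauchy--Schwarz in each row.\<close>

lemma norm_matrix_vector_le:
  fixes A :: "complex ^ 'n ^ 'm"
  shows "norm (A *v x) \<le> norm A * norm x"
proof -
  have "norm ((A *v x) $ i) \<le> norm (A $ i) * norm x" for i
  proof -
    have "(A *v x) $ i = cinner (A $ i) (\<chi> j. cnj (x $ j))"
      by (simp add: cinner_def matrix_vector_mult_def)
    moreover have "norm (\<chi> j. cnj (x $ j)) = norm x"
      by (simp add: norm_vec_def)
    ultimately show ?thesis by (metis norm_cinner_le)
  qed
  then have "norm (A *v x) \<le> L2_set (\<lambda>i. norm (A $ i) * norm x) UNIV"
    unfolding norm_vec_def[of "A *v x"] by (intro L2_set_mono) auto
  also have "\<dots> = norm A * norm x"
    by (simp add: norm_vec_def[of A] L2_set_left_distrib)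
  finally show ?thesis .
qed

lemma norm_matrix_matrix_le:
  fixes A :: "complex ^ 'n ^ 'm" and B :: "complex ^ 'p ^ 'n"
  shows "norm (A ** B) \<le> norm A * norm B"
proof -
  have tr: "norm (transpose M) = norm M" for M :: "complex ^ 'a ^ 'b"
  proof -
    have "(norm (transpose M))\<^sup>2 = (norm M)\<^sup>2"
      unfolding norm_vec_def L2_set_def
      by (simp add: sum_nonneg transpose_def) (rule sum.swap)
    then show ?thesis by simp
  qed
  have c: "transpose (A ** B) $ j = A *v (transpose B $ j)" for j
    by (simp add: vec_eq_iff transpose_def matrix_matrix_mult_def matrix_vector_mult_def)
  have "norm (A ** B) = norm (transpose (A ** B))" by (simp add: tr)
  also have "\<dots> \<le> L2_set (\<lambda>j. norm A * norm (transpose B $ j)) UNIV"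
    unfolding norm_vec_def[of "transpose (A ** B)"] c
    by (intro L2_set_mono norm_matrix_vector_le) auto
  also have "\<dots> = norm A * norm (transpose B)"
    by (simp add: norm_vec_def[of "transpose B"] L2_set_right_distrib)
  finally show ?thesis by (simp add: tr)
qed

lemma bounded_bilinear_matrix_vector:
  "bounded_bilinear ((*v) :: complex ^ 'n ^ 'm \<Rightarrow> _)"
  apply (rule bounded_bilinear.intro)
  prefer 5 apply (rule exI[of _ 1], simp add: norm_matrix_vector_le)
  by
     (auto intro!: exI[of _ 1] simp: matrix_vector_mult_add_rdistrib matrix_vector_right_distrib
       vec_eq_iff matrix_vector_mult_def scaleR_sum_right sum.distrib algebra_simps)

lemma bounded_bilinear_matrix_matrix:
  "bounded_bilinear ((**) :: complex ^ 'n ^ 'm \<Rightarrow> complex ^ 'p ^ 'n \<Rightarrow> _)"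
  apply (rule bounded_bilinear.intro)
  prefer 5 apply (rule exI[of _ 1], simp add: norm_matrix_matrix_le)
  by
     (auto intro!: exI[of _ 1] simp: matrix_add_ldistrib
       vec_eq_iff matrix_matrix_mult_def scaleR_sum_right sum.distrib algebra_simps)

lemmas continuous_on_matrix_vector [continuous_intros] =
  bounded_bilinear.continuous_on[OF bounded_bilinear_matrix_vector]
lemmas continuous_on_matrix_matrix [continuous_intros] =
  bounded_bilinear.continuous_on[OF bounded_bilinear_matrix_matrix]
lemmas matrix_vector_has_vector_derivative [derivative_intros] =
  bounded_bilinear.has_vector_derivative[OF bounded_bilinear_matrix_vector]

lemma matrix_vector_mult_scaleR_complex: "(A :: complex ^ 'n ^ 'm) *v (r *\<^sub>R x) = r *\<^sub>R (A *v x)"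
  and scaleR_matrix_vector_complex: "(r *\<^sub>R A) *v x = r *\<^sub>R (A *v x)"
  by (simp_all add: bounded_bilinear.scaleR_left[OF bounded_bilinear_matrix_vector]
      bounded_bilinear.scaleR_right[OF bounded_bilinear_matrix_vector])

section \<open>Linear systems of differential equations\<close>

text \<open>The formula is the integral of \<open>g\<close> from 0 to \<open>x\<close>, rescaled to
  the fixed interval [0, 1]. It covers negative \<open>x\<close> as well, and a parameter in
  \<open>g\<close> can be treated under an integral whose domain does not move.\<close>

lemma antiderivative_scaled_integral:
  fixes g :: "real \<Rightarrow> 'b::euclidean_space"
  assumes "continuous_on UNIV g"
  shows "((\<lambda>x. x *\<^sub>R integral {0..1} (\<lambda>s. g (s * x))) has_vector_derivative g x) (at x)"
proof -
  define R where "R = \<bar>x\<bar> + 1"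
  define G where "G = (\<lambda>u. integral {-R..u} g)"
  have G: "(G has_vector_derivative g u) (at u)" if "u \<in> {-R<..<R}" for u
  proof -
    have "(G has_vector_derivative g u) (at u within {-R..R})"
      unfolding G_def
      by (rule integral_has_vector_derivative) (use that assms continuous_on_subset in auto)
    moreover have "at u within {-R..R} = at u"
      by (rule at_within_interior) (use that in auto)
    ultimately show ?thesis by simp
  qed
  have eq: "y *\<^sub>R integral {0..1} (\<lambda>s. g (s * y)) = G y - G 0" if y: "y \<in> {-R<..<R}" for y
  proof -
    have "((\<lambda>s. y *\<^sub>R g (s * y)) has_integral (G (1 * y) - G (0 * y))) {0..1}"
    proof (rule fundamental_theorem_of_calculus)
      fix s :: real assume s: "s \<in> {0..1}"
      have "\<bar>s * y\<bar> \<le> \<bar>y\<bar>" using s by (simp add: abs_mult mult_left_le_one_le)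
      then have in': "s * y \<in> {-R<..<R}" using y by auto
      have "((\<lambda>s. s * y) has_vector_derivative y) (at s within {0..1})"
        by (auto intro!: derivative_eq_intros)
      from vector_diff_chain_within[OF this has_vector_derivative_at_within[OF G[OF in']]]
      show "((\<lambda>s. G (s * y)) has_vector_derivative y *\<^sub>R g (s * y)) (at s within {0..1})"
        by (simp add: o_def)
    qed simp
    then show ?thesis by (metis integral_cmul integral_unique mult_1 mult_zero_left)
  qed
  have x: "x \<in> {-R<..<R}" by (auto simp: R_def)
  have "((\<lambda>y. G y - G 0) has_vector_derivative g x) (at x)"
    using G[OF x] by (auto intro!: derivative_eq_intros)
  then show ?thesis
    by (rule has_vector_derivative_transform_within_open[where S="{-R<..<R}"]) (use x eq in auto)
qed

text \<open>The terms of the Picard (Dyson) series of Y' = A Y, Y(0) = I, with the integral from 0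
  to \<open>x\<close> in rescaled form. The energy \<open>z\<close> is an argument because
  continuity and holomorphy in it are needed.\<close>

primrec picard :: "(complex \<Rightarrow> real \<Rightarrow> complex ^ 'k ^ 'k) \<Rightarrow> nat \<Rightarrow> complex \<Rightarrow> real \<Rightarrow> complex ^ 'k ^ 'k" where
  "picard A 0 = (\<lambda>z x. mat 1)"
| "picard A (Suc j) = (\<lambda>z x. x *\<^sub>R integral {0..1} (\<lambda>s. A z (s * x) ** picard A j z (s * x)))"

definition propagator :: "(complex \<Rightarrow> real \<Rightarrow> complex ^ 'k ^ 'k) \<Rightarrow> complex \<Rightarrow> real \<Rightarrow> complex ^ 'k ^ 'k" where
  "propagator A z x = (\<Sum>j. picard A j z x)"

lemma continuous_picard_integrand:
  fixes F :: "complex \<Rightarrow> real \<Rightarrow> 'b::real_normed_vector"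
  assumes "continuous_on UNIV (\<lambda>(z, x). F z x)"
  shows "continuous_on S (\<lambda>(p, s). F (fst p) (s * snd p))"
proof -
  have "(\<lambda>(p, s). F (fst p) (s * snd p)) = (\<lambda>(z, x). F z x) \<circ> (\<lambda>q. (fst (fst q), snd q * snd (fst q)))"
    by (auto simp: fun_eq_iff)
  moreover have "continuous_on S (\<lambda>q::(complex \<times> real) \<times> real. (fst (fst q), snd q * snd (fst q)))"
    by (intro continuous_intros)
  ultimately show ?thesis
    by (simp only:) (rule continuous_on_compose, assumption, rule continuous_on_subset[OF assms], simp)
qed

lemma continuous_on_slice:
  assumes "continuous_on UNIV (\<lambda>(z, x). F z x)"
  shows "continuous_on S (F z)"
proof -
  have "continuous_on S (\<lambda>x. (\<lambda>(z, x). F z x) (z, x))"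
    by (intro continuous_on_compose2[OF assms] continuous_intros) auto
  then show ?thesis by simp
qed

context
  fixes A :: "complex \<Rightarrow> real \<Rightarrow> complex ^ 'k ^ 'k"
  assumes cont_A: "continuous_on UNIV (\<lambda>(z, x). A z x)"
begin

lemma continuous_picard: "continuous_on UNIV (\<lambda>(z, x). picard A j z x)"
proof (induction j)
  case (Suc j)
  have "continuous_on UNIV (\<lambda>(z, x). A z x ** picard A j z x)"
    using cont_A Suc by (auto simp: split_beta intro!: continuous_intros)
  from continuous_picard_integrand[OF this]
  have "continuous_on UNIV (\<lambda>p. integral (cbox 0 1) (\<lambda>s. A (fst p) (s * snd p) ** picard A j (fst p) (s * snd p)))"
    by (intro integral_continuous_on_param) auto
  then show ?case
    by (auto simp: split_beta cbox_interval intro!: continuous_intros)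
qed (simp add: split_beta)

lemma continuous_A_picard: "continuous_on UNIV (\<lambda>(z, x). A z x ** picard A j z x)"
  using cont_A continuous_picard by (auto simp: split_beta intro!: continuous_intros)

text \<open>Factorial decay: integrating s^j over [0, 1] yields the factor 1 / (j + 1). The constant
  \<open>norm (mat 1)\<close> stays because the Frobenius norm of the identity is not 1 in
  general.\<close>

lemma norm_picard_le:
  assumes K: "\<And>x. \<bar>x\<bar> \<le> R \<Longrightarrow> norm (A z x) \<le> K" and x: "\<bar>x\<bar> \<le> R"
  shows "norm (picard A j z x) \<le> norm (mat 1 :: complex ^ 'k ^ 'k) * (K * \<bar>x\<bar>) ^ j / fact j"
  using x
proof (induction j arbitrary: x)
  case (Suc j)
  let ?c = "norm (mat 1 :: complex ^ 'k ^ 'k)"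
  let ?f = "\<lambda>s. A z (s * x) ** picard A j z (s * x)"
  let ?C = "K * (?c * (K * \<bar>x\<bar>) ^ j / fact j)"
  have K0: "K \<ge> 0" using K[OF Suc.prems] norm_ge_zero order_trans by blast
  have le: "\<bar>s * x\<bar> \<le> \<bar>x\<bar>" if "s \<in> {0..1}" for s :: real
    using that by (simp add: abs_mult mult_left_le_one_le)
  have bd: "norm (?f s) \<le> ?C * s ^ j" if s: "s \<in> {0..1}" for s
  proof -
    have "norm (?f s) \<le> norm (A z (s * x)) * norm (picard A j z (s * x))"
      by (rule norm_matrix_matrix_le)
    also have "\<dots> \<le> K * (?c * (K * \<bar>s * x\<bar>) ^ j / fact j)"
      by (intro mult_mono K Suc.IH K0) (use le[OF s] Suc.prems in auto)
    also have "\<dots> = ?C * s ^ j"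
      using s by (simp add: abs_mult power_mult_distrib)
    finally show ?thesis .
  qed
  have "((\<lambda>s::real. s ^ j) has_integral (1 ^ Suc j / Suc j - 0 ^ Suc j / Suc j)) {0..1}"
  proof (rule fundamental_theorem_of_calculus)
    fix s :: real
    have "((\<lambda>s. s ^ Suc j / Suc j) has_real_derivative (Suc j * s ^ j) / Suc j) (at s within {0..1})"
      by (intro derivative_eq_intros | simp)+
    then show "((\<lambda>s. s ^ Suc j / Suc j) has_vector_derivative s ^ j) (at s within {0..1})"
      by (simp add: has_real_derivative_iff_has_vector_derivative del: of_nat_Suc)
  qed simp
  then have int: "((\<lambda>s::real. ?C * s ^ j) has_integral ?C * (1 / (Suc j))) {0..1}"
    by (intro has_integral_mult_right) simp
  have "norm (integral {0..1} ?f) \<le> integral {0..1} (\<lambda>s::real. ?C * s ^ j)"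
  proof (rule integral_norm_bound_integral)
    have "continuous_on {0..1} ?f"
      by (rule continuous_on_compose2[OF continuous_on_slice[OF continuous_A_picard[of j], of UNIV z], of "{0..1}" "\<lambda>s. s * x"])
         (auto intro!: continuous_intros)
    then show "?f integrable_on {0..1}" by (rule integrable_continuous_real)
    show "(\<lambda>s. ?C * s ^ j) integrable_on {0..1}" using int by blast
  qed (use bd in auto)
  also have "\<dots> = ?C / Suc j" using integral_unique[OF int] by (simp only: mult_1_right times_divide_eq_right)
  finally have "\<bar>x\<bar> * norm (integral {0..1} ?f) \<le> \<bar>x\<bar> * (?C / Suc j)"
    by (intro mult_left_mono) auto
  then have "norm (picard A (Suc j) z x) \<le> \<bar>x\<bar> * (?C / Suc j)"
    by simp
  also have "\<dots> = ?c * (K * \<bar>x\<bar>) ^ Suc j / fact (Suc j)"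
    by (simp add: divide_simps)
  finally show ?case .
qed simp

text \<open>The M-test with the exponential series as majorant on compact sets. Uniformity in
  \<open>z\<close> and \<open>x\<close> together yields joint continuity and, for fixed
  \<open>x\<close>, holomorphy in \<open>z\<close>.\<close>

lemma uniform_limit_propagator:
  "uniform_limit (cball 0 r \<times> {-R..R}) (\<lambda>n (z, x). \<Sum>j<n. picard A j z x) (\<lambda>(z, x). propagator A z x) sequentially"
proof -
  have "compact (cball (0::complex) r \<times> {-R..R})" by (intro compact_Times) auto
  then have "bounded ((\<lambda>(z, x). A z x) ` (cball 0 r \<times> {-R..R}))"
    by (intro compact_imp_bounded compact_continuous_image continuous_on_subset[OF cont_A]) auto
  then obtain K where K: "\<And>z x. z \<in> cball 0 r \<Longrightarrow> \<bar>x\<bar> \<le> R \<Longrightarrow> norm (A z x) \<le> K"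
    unfolding bounded_iff by force
  let ?c = "norm (mat 1 :: complex ^ 'k ^ 'k)"
  have "uniform_limit (cball 0 r \<times> {-R..R}) (\<lambda>n p. \<Sum>j<n. picard A j (fst p) (snd p))
     (\<lambda>p. \<Sum>j. picard A j (fst p) (snd p)) sequentially"
  proof (rule Weierstrass_m_test)
    fix j p assume "p \<in> cball (0::complex) r \<times> {-R..R}"
    then obtain z x where p: "p = (z, x)" "z \<in> cball 0 r" "\<bar>x\<bar> \<le> R" by (cases p) auto
    have "K \<ge> 0" using K[OF p(2,3)] norm_ge_zero order_trans by blast
    have "norm (picard A j z x) \<le> ?c * (K * \<bar>x\<bar>) ^ j / fact j"
      by (rule norm_picard_le) (use K p in auto)
    also have "\<dots> \<le> ?c * (\<bar>K\<bar> * \<bar>R\<bar>) ^ j / fact j"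
      using p \<open>K \<ge> 0\<close> by (intro divide_right_mono mult_left_mono power_mono mult_mono) auto
    finally show "norm (picard A j (fst p) (snd p)) \<le> ?c * ((\<bar>K\<bar> * \<bar>R\<bar>) ^ j /\<^sub>R fact j)" 
      using p by (simp add: divide_simps)
  qed (intro summable_mult summable_exp_generic)
  moreover have "(\<lambda>n (z, x). \<Sum>j<n. picard A j z x) = (\<lambda>n p. \<Sum>j<n. picard A j (fst p) (snd p))"
    by (auto simp: fun_eq_iff)
  moreover have "(\<lambda>(z, x). \<Sum>j. picard A j z x) = (\<lambda>p. \<Sum>j. picard A j (fst p) (snd p))"
    by (auto simp: fun_eq_iff)
  ultimately show ?thesis by (simp add: propagator_def)
qed

lemma continuous_propagator: "continuous_on UNIV (\<lambda>(z, x). propagator A z x)"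
proof -
  have "isCont (\<lambda>(z, x). propagator A z x) (z, x)" for z x
  proof -
    let ?S = "cball (0::complex) (norm z + 1) \<times> {-(\<bar>x\<bar> + 1)..\<bar>x\<bar> + 1}"
    have "continuous_on ?S (\<lambda>(z, x). propagator A z x)"
      by (rule uniform_limit_theorem[OF _ uniform_limit_propagator])
         (auto simp: split_beta intro!: eventuallyI continuous_intros continuous_on_sum
           continuous_on_subset[OF continuous_picard, unfolded split_beta])
    moreover have "(z, x) \<in> interior ?S"
      by (auto simp: interior_Times)
    ultimately show ?thesis by (rule continuous_on_interior)
  qed
  then show ?thesis by (auto intro!: continuous_at_imp_continuous_on)
qed

lemma sums_propagator: "(\<lambda>n. \<Sum>j<n. picard A j z x) \<longlonglongrightarrow> propagator A z x"
proof -
  have "- \<bar>x\<bar> \<le> x" by (cases "x \<ge> 0") auto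
  then show ?thesis
    using tendsto_uniform_limitI[OF uniform_limit_propagator[of "norm z" "\<bar>x\<bar>"], of "(z, x)"] by simp
qed

lemma propagator_0 [simp]: "propagator A z 0 = mat 1"
proof -
  have "picard A j z 0 = (if j = 0 then mat 1 else 0)" for j by (cases j) auto
  then have "(\<lambda>j. picard A j z 0) sums mat 1" using sums_single[of 0 "\<lambda>_. mat 1"] by (simp cong: if_cong)
  then show ?thesis by (simp add: propagator_def sums_iff)
qed

text \<open>The recursion for partial sums passes to the limit under the integral. Differentiability
  in \<open>x\<close> then follows from the fundamental theorem, without termwise
  differentiation.\<close>

lemma propagator_integral_equation:
  "propagator A z x = mat 1 + x *\<^sub>R integral {0..1} (\<lambda>s. A z (s * x) ** propagator A z (s * x))"
proof -
  let ?S = "\<lambda>n y. \<Sum>j<n. picard A j z y"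
  have cA: "continuous_on S (A z)" for S by (rule continuous_on_slice[OF cont_A])
  have cc: "continuous_on {0..1} (\<lambda>s. F (s * x))" if "continuous_on UNIV F" for F :: "real \<Rightarrow> complex ^ 'k ^ 'k"
    by (rule continuous_on_compose2[OF that]) (auto intro!: continuous_intros)
  have cS: "continuous_on UNIV (?S n)" for n
    by (intro continuous_on_sum continuous_on_slice[OF continuous_picard])
  have "uniform_limit {0..1} (\<lambda>n s. ?S n (s * x)) (\<lambda>s. propagator A z (s * x)) sequentially"
  proof (rule uniform_limitI)
    fix e :: real assume "e > 0"
    show "\<forall>\<^sub>F n in sequentially. \<forall>s\<in>{0..1}. dist (?S n (s * x)) (propagator A z (s * x)) < e"
      using uniform_limitD[OF uniform_limit_propagator[of "norm z" "\<bar>x\<bar>"] \<open>e > 0\<close>]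
    proof eventually_elim
      case (elim n)
      have "\<bar>s * x\<bar> \<le> \<bar>x\<bar>" if "s \<in> {0..1}" for s :: real
        using that by (simp add: abs_mult mult_left_le_one_le)
      then have "s * x \<in> {-\<bar>x\<bar>..\<bar>x\<bar>}" if "s \<in> {0..1}" for s :: real
        using that by (fastforce simp: abs_le_iff)
      then show ?case using elim by auto
    qed
  qed
  moreover have "bounded ((\<lambda>s. A z (s * x)) ` {0..1})"
    by (intro compact_imp_bounded compact_continuous_image cc cA) auto
  moreover have "bounded ((\<lambda>s. propagator A z (s * x)) ` {0..1})"
    by (intro compact_imp_bounded compact_continuous_image cc continuous_on_slice[OF continuous_propagator]) auto
  ultimately have ul: "uniform_limit {0..1} (\<lambda>n s. A z (s * x) ** ?S n (s * x)) (\<lambda>s. A z (s * x) ** propagator A z (s * x)) sequentially"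
    by (intro bounded_bilinear.bounded_uniform_limit[OF bounded_bilinear_matrix_matrix] uniform_limit_const)
  obtain I J where I: "\<And>n. ((\<lambda>s. A z (s * x) ** ?S n (s * x)) has_integral I n) {0..1}"
    and J: "((\<lambda>s. A z (s * x) ** propagator A z (s * x)) has_integral J) {0..1}" and IJ: "I \<longlonglongrightarrow> J"
    by (rule uniform_limit_integral[OF ul]) (auto intro!: continuous_intros cc[OF cS] cc[OF cA])
  have "?S (Suc n) x = mat 1 + x *\<^sub>R I n" for n
  proof -
    have int: "(\<lambda>s. A z (s * x) ** picard A j z (s * x)) integrable_on {0..1}" for j
      by (intro integrable_continuous_real continuous_intros cc cA continuous_on_slice[OF continuous_picard])
    have "?S (Suc n) x = mat 1 + x *\<^sub>R (\<Sum>j<n. integral {0..1} (\<lambda>s. A z (s * x) ** picard A j z (s * x)))"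
      by (simp only: sum.lessThan_Suc_shift) (simp add: scaleR_sum_right)
    also have "(\<Sum>j<n. integral {0..1} (\<lambda>s. A z (s * x) ** picard A j z (s * x)))
        = integral {0..1} (\<lambda>s. \<Sum>j<n. A z (s * x) ** picard A j z (s * x))"
      using int by (simp add: integral_sum)
    also have "\<dots> = I n"
      using I[of n] by (simp add: integral_unique bounded_bilinear.sum_right[OF bounded_bilinear_matrix_matrix])
    finally show ?thesis .
  qed
  moreover have "(\<lambda>n. ?S (Suc n) x) \<longlonglongrightarrow> propagator A z x"
    using sums_propagator LIMSEQ_Suc by fastforce
  ultimately have "(\<lambda>n. mat 1 + x *\<^sub>R I n) \<longlonglongrightarrow> propagator A z x" by simp
  moreover have "(\<lambda>n. mat 1 + x *\<^sub>R I n) \<longlonglongrightarrow> mat 1 + x *\<^sub>R J"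
    by (intro tendsto_intros IJ)
  ultimately show ?thesis using J LIMSEQ_unique by (auto simp: integral_unique)
qed

lemma propagator_has_vector_derivative:
  "(propagator A z has_vector_derivative A z x ** propagator A z x) (at x)"
proof -
  have "continuous_on UNIV (\<lambda>y. A z y ** propagator A z y)"
    by (intro continuous_intros continuous_on_slice[OF cont_A] continuous_on_slice[OF continuous_propagator])
  from antiderivative_scaled_integral[OF this, of x]
  have "((\<lambda>x. mat 1 + x *\<^sub>R integral {0..1} (\<lambda>s. A z (s * x) ** propagator A z (s * x)))
      has_vector_derivative A z x ** propagator A z x) (at x)"
    by (simp only: add.commute[of "mat 1"] has_vector_derivative_add_const)
  moreover have "(\<lambda>x. mat 1 + x *\<^sub>R integral {0..1} (\<lambda>s. A z (s * x) ** propagator A z (s * x))) = propagator A z"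
    by (intro ext propagator_integral_equation[symmetric])
  ultimately show ?thesis by simp
qed

text \<open>Leibniz's rule requires a jointly continuous derivative of the integrand, so the
  induction carries such a derivative \<open>D\<close> along with differentiability.\<close>

lemma picard_has_field_derivative:
  fixes A' :: "complex \<Rightarrow> real \<Rightarrow> complex ^ 'k ^ 'k"
  assumes A': "\<And>z x i j. ((\<lambda>z. A z x $ i $ j) has_field_derivative A' z x $ i $ j) (at z)"
    and cont_A': "continuous_on UNIV (\<lambda>(z, x). A' z x)"
  shows "\<exists>D :: complex \<Rightarrow> real \<Rightarrow> complex ^ 'k ^ 'k. continuous_on UNIV (\<lambda>(z, x). D z x) \<and>
    (\<forall>z x i j. ((\<lambda>z. picard A n z x $ i $ j) has_field_derivative D z x $ i $ j) (at z))"
proof (induction n)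
  case 0
  show ?case by (intro exI[of _ "\<lambda>_ _. 0"]) (auto simp: split_beta)
next
  case (Suc n)
  then obtain D where cD: "continuous_on UNIV (\<lambda>(z, x). D z x)"
    and D: "\<And>z x i j. ((\<lambda>z. picard A n z x $ i $ j) has_field_derivative D z x $ i $ j) (at z)" by blast
  define G where "G = (\<lambda>z x. A' z x ** picard A n z x + A z x ** D z x)"
  have cG: "continuous_on UNIV (\<lambda>(z, x). G z x)"
    using cont_A cont_A' cD continuous_picard[of n] unfolding G_def
    by (auto simp: split_beta intro!: continuous_intros)
  have dG: "((\<lambda>z. (A z x ** picard A n z x) $ i $ j) has_field_derivative G z x $ i $ j) (at z)" for z x i j
    unfolding matrix_matrix_mult_def G_def
    by (auto intro!: derivative_eq_intros A' D simp: sum.distrib algebra_simps)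
  have cc: "continuous_on S (\<lambda>s. H z (s * x))" if "continuous_on UNIV (\<lambda>(z, x). H z x)"
    for H :: "complex \<Rightarrow> real \<Rightarrow> complex ^ 'k ^ 'k" and S z and x :: real
    by (rule continuous_on_compose2[OF continuous_on_slice[OF that, of UNIV z]]) (auto intro!: continuous_intros)
  have lin: "integral {0..1} (\<lambda>s. H z (s * x)) $ i $ j = integral (cbox 0 1) (\<lambda>s. H z (s * x) $ i $ j)"
    if "continuous_on UNIV (\<lambda>(z, x). H z x)"
    for H :: "complex \<Rightarrow> real \<Rightarrow> complex ^ 'k ^ 'k" and z and x :: real and i j
  proof -
    have bl: "bounded_linear (\<lambda>B::complex ^ 'k ^ 'k. B $ i $ j)"
      by (rule bounded_linear_compose[OF bounded_linear_vec_nth bounded_linear_vec_nth])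
    show ?thesis
      using integral_linear[OF integrable_continuous_real[OF cc[OF that, of "{0..1}" z x]] bl] by (simp add: o_def cbox_interval)
  qed
  have "((\<lambda>z. integral (cbox 0 1) (\<lambda>s. (A z (s * x) ** picard A n z (s * x)) $ i $ j))
      has_field_derivative integral (cbox 0 1) (\<lambda>s. G z (s * x) $ i $ j)) (at z within UNIV)" for z x i j
  proof (rule leibniz_rule_field_derivative)
    show "((\<lambda>z. (A z (t * x) ** picard A n z (t * x)) $ i $ j) has_field_derivative G z (t * x) $ i $ j) (at z within UNIV)" for z t
      using dG by simp
    show "(\<lambda>s. (A z (s * x) ** picard A n z (s * x)) $ i $ j) integrable_on cbox 0 1" for z
      unfolding cbox_interval
      by (rule integrable_continuous_real, rule continuous_on_component, rule continuous_on_component, rule cc[OF continuous_A_picard])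
    have "(\<lambda>(z, t). G z (t * x)) = (\<lambda>(z, x). G z x) \<circ> (\<lambda>q. (fst q, snd q * x))"
      by (auto simp: fun_eq_iff)
    moreover have "continuous_on UNIV (\<lambda>q::complex \<times> real. (fst q, snd q * x))"
      by (intro continuous_intros)
    ultimately have "continuous_on UNIV (\<lambda>(z, t). G z (t * x))"
      by (simp only:) (rule continuous_on_compose, assumption, rule continuous_on_subset[OF cG], simp)
    then have "continuous_on (UNIV \<times> cbox 0 1) (\<lambda>p. (\<lambda>(z, t). G z (t * x)) p $ i $ j)"
      by (intro continuous_on_component) (rule continuous_on_subset, auto)
    then show "continuous_on (UNIV \<times> cbox 0 1) (\<lambda>(z, t). G z (t * x) $ i $ j)"
      by (simp add: split_beta)
  qed auto
  then have "((\<lambda>z. picard A (Suc n) z x $ i $ j)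
      has_field_derivative (x *\<^sub>R integral {0..1} (\<lambda>s. G z (s * x))) $ i $ j) (at z)" for z x i j
    by (auto simp: lin[OF cG] lin[OF continuous_A_picard] scaleR_conv_of_real intro!: derivative_eq_intros)
  moreover have "continuous_on UNIV (\<lambda>p. integral (cbox 0 1) (\<lambda>s. G (fst p) (s * snd p)))"
    using continuous_picard_integrand[OF cG] by (intro integral_continuous_on_param) auto
  then have "continuous_on UNIV (\<lambda>(z, x). x *\<^sub>R integral {0..1} (\<lambda>s. G z (s * x)))"
    by (auto simp: split_beta cbox_interval intro!: continuous_intros)
  ultimately show ?case by (intro exI[of _ "\<lambda>z x. x *\<^sub>R integral {0..1} (\<lambda>s. G z (s * x))"]) auto
qed

text \<open>A locally uniform limit of holomorphic functions is holomorphic.\<close>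

lemma holomorphic_propagator:
  fixes A' :: "complex \<Rightarrow> real \<Rightarrow> complex ^ 'k ^ 'k"
  assumes A': "\<And>z x i j. ((\<lambda>z. A z x $ i $ j) has_field_derivative A' z x $ i $ j) (at z)"
    and cont_A': "continuous_on UNIV (\<lambda>(z, x). A' z x)"
  shows "(\<lambda>z. propagator A z x $ i $ j) holomorphic_on UNIV"
proof (rule holomorphic_uniform_sequence)
  have *: "(\<lambda>z. picard A n z x $ i $ j) holomorphic_on UNIV" for n x i j
    using picard_has_field_derivative[OF assms, of n] by (fastforce simp: holomorphic_on_def field_differentiable_def)
  then show "(\<lambda>z. (\<Sum>j<n. picard A j z x) $ i $ j) holomorphic_on UNIV" for n
    by (auto intro!: holomorphic_intros)
  fix z :: complex
  have "uniform_limit (cball z 1) (\<lambda>n z. (\<Sum>j<n. picard A j z x)) (\<lambda>z. propagator A z x) sequentially"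
  proof (rule uniform_limitI)
    fix e :: real assume "e > 0"
    show "\<forall>\<^sub>F n in sequentially. \<forall>w\<in>cball z 1. dist (\<Sum>j<n. picard A j w x) (propagator A w x) < e"
      using uniform_limitD[OF uniform_limit_propagator[of "norm z + 1" "\<bar>x\<bar>"] \<open>e > 0\<close>]
    proof eventually_elim
      case (elim n)
      have "norm w \<le> norm z + 1" if "w \<in> cball z 1" for w
        using that norm_triangle_sub[of w z] by (simp add: dist_norm norm_minus_commute)
      moreover have "x \<in> {-\<bar>x\<bar>..\<bar>x\<bar>}" by (cases "x \<ge> 0") auto
      ultimately show ?case using elim by auto
    qed
  qed
  then have "uniform_limit (cball z 1) (\<lambda>n z. (\<Sum>j<n. picard A j z x) $ i $ j) (\<lambda>z. propagator A z x $ i $ j) sequentially"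
    by (intro bounded_linear.uniform_limit[OF bounded_linear_vec_nth])
  then show "\<exists>d>0. cball z d \<subseteq> UNIV \<and> uniform_limit (cball z d) (\<lambda>n z. (\<Sum>j<n. picard A j z x) $ i $ j) (\<lambda>z. propagator A z x $ i $ j) sequentially"
    by (intro exI[of _ 1]) auto
qed simp

end

section \<open>Powers of matrices without expanding eigenvalues\<close>

text \<open>A linear factor A - r of a polynomial in A, applied to a vector. A list of roots folded
  with \<open>mshift\<close> stands for a polynomial in factored form; since the factors commute, a
  single root can be moved to the end or left out.\<close>

definition mshift :: "complex ^ 'k ^ 'k \<Rightarrow> complex \<Rightarrow> complex ^ 'k \<Rightarrow> complex ^ 'k" where
  "mshift A r v = A *v v - r *s v"

abbreviation mpow :: "complex ^ 'k ^ 'k \<Rightarrow> nat \<Rightarrow> complex ^ 'k \<Rightarrow> complex ^ 'k" where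
  "mpow A n \<equiv> ((*v) A) ^^ n"

lemma mpow_add: "mpow A n (u + v) = mpow A n u + mpow A n v"
  by (induction n) (simp_all add: matrix_vector_right_distrib)

lemma mpow_scale: "mpow A n (r *s v) = r *s mpow A n v"
  by (induction n) (simp_all add: vec.scale)

lemma mpow_zero [simp]: "mpow A n 0 = 0"
  by (induction n) simp_all

lemma mpow_diff: "mpow A n (u - v) = mpow A n u - mpow A n v"
  by (induction n) (simp_all add: matrix_vector_mult_diff_distrib)

lemma norm_scale_vec: "norm (r *s (v :: complex ^ 'k)) = norm r * norm v"
  by (simp add: norm_vec_def norm_mult L2_set_right_distrib)

text \<open>With w = (A - r) c one has A^(n+1) c = r A^n c + A^n w. As |r| <= 1, summation over
  \<open>n\<close> costs one power of 1 + n for each root, and forming w costs one factor 1 + norm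
  A.\<close>

lemma norm_mpow_le:
  assumes "\<And>r. r \<in> set rs \<Longrightarrow> norm r \<le> 1" "fold (mshift A) rs c = 0"
  shows "norm (mpow A n c) \<le> (1 + real n) ^ length rs * (1 + norm A) ^ length rs * norm c"
  using assms
proof (induction rs arbitrary: c n)
  case (Cons r rs)
  let ?d = "length rs"
  let ?w = "mshift A r c"
  let ?K = "(1 + norm A) ^ Suc ?d * norm c"
  have w: "norm ?w \<le> (1 + norm A) * norm c"
  proof -
    have "norm ?w \<le> norm (A *v c) + norm (r *s c)"
      unfolding mshift_def by (rule norm_triangle_ineq4)
    also have "\<dots> \<le> norm A * norm c + 1 * norm c"
      unfolding norm_scale_vec using Cons.prems(1)[of r]
      by (intro add_mono norm_matrix_vector_le mult_right_mono) auto
    finally show ?thesis by (simp add: algebra_simps)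
  qed
  have step: "norm (mpow A (Suc n) c) \<le> norm (mpow A n c) + (1 + real n) ^ ?d * ?K" for n
  proof -
    have "mpow A (Suc n) c = mpow A n (A *v c)" by (simp add: funpow_swap1)
    also have "A *v c = r *s c + ?w" by (simp add: mshift_def)
    finally have "norm (mpow A (Suc n) c) \<le> norm (r *s mpow A n c) + norm (mpow A n ?w)"
      by (simp add: mpow_add mpow_scale norm_triangle_ineq)
    also have "\<dots> \<le> 1 * norm (mpow A n c) + (1 + real n) ^ ?d * (1 + norm A) ^ ?d * norm ?w"
      unfolding norm_scale_vec using Cons.prems
      by (intro add_mono mult_right_mono Cons.IH) auto
    also have "\<dots> \<le> 1 * norm (mpow A n c) + (1 + real n) ^ ?d * (1 + norm A) ^ ?d * ((1 + norm A) * norm c)"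
      by (intro add_mono mult_left_mono w) auto
    finally show ?thesis by (simp add: algebra_simps)
  qed
  have "norm (mpow A n c) \<le> (1 + real n) ^ Suc ?d * ?K"
  proof (induction n)
    case 0
    have "1 * norm c \<le> (1 + norm A) ^ Suc ?d * norm c"
      by (intro mult_right_mono one_le_power) auto
    then show ?case by simp
  next
    case (Suc n)
    have "norm (mpow A (Suc n) c) \<le> (1 + real n) ^ Suc ?d * ?K + (1 + real n) ^ ?d * ?K"
      using step[of n] Suc by linarith
    also have "\<dots> = ((2 + real n) * (1 + real n) ^ ?d) * ?K" by (simp add: algebra_simps)
    also have "\<dots> \<le> ((2 + real n) * (2 + real n) ^ ?d) * ?K"
      by (intro mult_right_mono mult_left_mono power_mono) auto
    finally show ?case by (simp add: algebra_simps)
  qed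
  then show ?case by (simp add: algebra_simps)
qed simp

lemma mshift_commute: "mshift A r (mshift A s v) = mshift A s (mshift A r v)"
  by (simp add: mshift_def vec.scale matrix_vector_mult_diff_distrib vec.scale_right_diff_distrib algebra_simps)

lemma fold_mshift_commute: "fold (mshift A) rs (mshift A r v) = mshift A r (fold (mshift A) rs v)"
  by (induction rs arbitrary: v) (simp_all add: mshift_commute[of A _ r])

text \<open>The fundamental theorem of algebra splits off one root at a time. \<open>N\<close> is
  only an upper bound for the degree, so that it can serve as the induction variable.\<close>

lemma mshift_annihilating_list:
  assumes "p \<noteq> 0" "degree p \<le> N" "(\<Sum>i\<le>N. coeff p i *s mpow A i c) = 0"
  shows "\<exists>rs. length rs \<le> N \<and> fold (mshift A) rs c = 0"
  using assms
proof (induction N arbitrary: p c)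
  case 0
  then show ?case
    by (intro exI[of _ "[]"]) (auto simp: leading_coeff_neq_0[of p, unfolded] vec.scale_eq_0_iff dest: leading_coeff_neq_0)
next
  case (Suc N)
  show ?case
  proof (cases "degree p = 0")
    case True
    then obtain a where "p = [:a:]" using degree_eq_zeroE by blast
    with Suc.prems have "a \<noteq> 0" "(\<Sum>i\<le>Suc N. coeff [:a:] i *s mpow A i c) = 0" by auto
    moreover have "(\<Sum>i\<le>Suc N. coeff [:a:] i *s mpow A i c) = a *s c"
      by (subst sum.atMost_Suc_shift) simp
    ultimately show ?thesis by (intro exI[of _ "[]"]) simp
  next
    case False
    then have "\<exists>i\<in>{1..degree p}. coeff p i \<noteq> 0"
      by (intro bexI[of _ "degree p"]) auto
    then obtain r where "(\<Sum>i\<le>degree p. coeff p i * r ^ i) = 0"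
      using fundamental_theorem_of_algebra[of "coeff p" "degree p"] by blast
    then have "poly p r = 0" by (simp add: poly_altdef)
    then obtain q where q: "p = [:-r, 1:] * q" by (auto simp: poly_eq_0_iff_dvd)
    have "q \<noteq> 0" using q Suc.prems by auto
    have "degree p = degree [:-r, 1:] + degree q"
      unfolding q using \<open>q \<noteq> 0\<close> by (intro degree_mult_eq) auto
    then have dq: "degree q \<le> N" using Suc.prems by simp
    \<comment> \<open>Applying q to (A - r) c amounts to applying p = (X - r) q to c; the two sums
      are brought to a common range and compared coefficient by coefficient.\<close>
    have "(\<Sum>i\<le>N. coeff q i *s mpow A i (mshift A r c))
        = (\<Sum>i\<le>N. coeff q i *s mpow A (Suc i) c) - (\<Sum>i\<le>N. (r * coeff q i) *s mpow A i c)"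
      by (simp add: mshift_def mpow_diff mpow_scale funpow_swap1 vec.scale_right_diff_distrib sum_subtractf mult.commute)
    also have "(\<Sum>i\<le>N. (r * coeff q i) *s mpow A i c) = (\<Sum>i\<le>Suc N. (r * coeff q i) *s mpow A i c)"
      using dq by (simp add: coeff_eq_0)
    also have "(\<Sum>i\<le>N. coeff q i *s mpow A (Suc i) c) = (\<Sum>i\<le>Suc N. coeff (pCons 0 q) i *s mpow A i c)"
      by (subst sum.atMost_Suc_shift) simp
    also have "\<dots> - (\<Sum>i\<le>Suc N. (r * coeff q i) *s mpow A i c) = (\<Sum>i\<le>Suc N. coeff p i *s mpow A i c)"
      unfolding sum_subtractf[symmetric] vec.scale_left_diff_distrib[symmetric] by (simp add: q)
    finally have "(\<Sum>i\<le>N. coeff q i *s mpow A i (mshift A r c)) = 0" using Suc.prems by simp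
    from Suc.IH[OF \<open>q \<noteq> 0\<close> dq this] obtain rs where "length rs \<le> N" "fold (mshift A) rs (mshift A r c) = 0" by blast
    then show ?thesis by (intro exI[of _ "r # rs"]) simp
  qed
qed

text \<open>More than \<open>DIM(complex ^ 'k)\<close> vectors A^i c are linearly dependent over the
  reals. A repetition among them is treated apart, since their set is then too small for the
  dimension argument; a difference of two monomials settles it.\<close>

lemma exists_annihilating_poly:
  fixes A :: "complex ^ 'k ^ 'k"
  shows "\<exists>p. p \<noteq> 0 \<and> degree p \<le> DIM(complex ^ 'k) \<and> (\<Sum>i\<le>DIM(complex ^ 'k). coeff p i *s mpow A i c) = 0"
proof -
  let ?N = "DIM(complex ^ 'k)" and ?f = "\<lambda>i. mpow A i c"
  show ?thesis
  proof (cases "inj_on ?f {..?N}")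
    case True
    then have "card (?f ` {..?N}) = Suc ?N" by (simp add: card_image)
    then have "dependent (?f ` {..?N})" by (intro dependent_biggerset) auto
    then obtain u v where u: "v \<in> ?f ` {..?N}" "u v \<noteq> 0" "(\<Sum>v\<in>?f ` {..?N}. u v *\<^sub>R v) = 0"
      by (auto simp: dependent_finite)
    define p where "p = (\<Sum>i\<le>?N. monom (of_real (u (?f i))) i :: complex poly)"
    have co: "coeff p i = (if i \<le> ?N then of_real (u (?f i)) else 0)" for i
      by (simp add: p_def coeff_sum)
    have "(\<Sum>i\<le>?N. coeff p i *s ?f i) = (\<Sum>i\<le>?N. u (?f i) *\<^sub>R ?f i)"
      by (intro sum.cong) (auto simp: co vec_eq_iff scaleR_conv_of_real[where 'a=complex])
    also have "\<dots> = 0" using u(3) True by (simp add: sum.reindex)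
    finally have "(\<Sum>i\<le>?N. coeff p i *s ?f i) = 0" .
    moreover have "p \<noteq> 0"
    proof -
      obtain i where "i \<le> ?N" "v = ?f i" using u(1) by auto
      then have "coeff p i \<noteq> 0" using u(2) by (simp add: co)
      then show ?thesis by auto
    qed
    moreover have "degree p \<le> ?N" by (rule degree_le) (simp add: co)
    ultimately show ?thesis by blast
  next
    case False
    then obtain i j where ij: "i \<le> ?N" "j \<le> ?N" "i \<noteq> j" "?f i = ?f j" by (auto simp: inj_on_def)
    define p where "p = (monom 1 i - monom 1 j :: complex poly)"
    have "(\<Sum>k\<le>?N. coeff p k *s ?f k) = (\<Sum>k\<le>?N. (if i = k then ?f k else 0) - (if j = k then ?f k else 0))"
      by (intro sum.cong) (auto simp: p_def)
    also have "\<dots> = 0" using ij by (simp add: sum_subtractf)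
    finally have "(\<Sum>k\<le>?N. coeff p k *s ?f k) = 0" .
    moreover have "coeff p i \<noteq> 0" using ij by (simp add: p_def)
    then have "p \<noteq> 0" by auto
    moreover have "degree p \<le> ?N" using ij by (intro degree_le) (auto simp: p_def)
    ultimately show ?thesis by blast
  qed
qed

text \<open>A qualitative hypothesis, with an unspecified constant for each vector, becomes an
  explicit bound in \<open>norm A\<close>. In a shortest list annihilating \<open>c\<close> every
  root is an eigenvalue, and an eigenvalue outside the unit disc contradicts linear growth.\<close>

lemma norm_mpow_uniform:
  fixes A :: "complex ^ 'k ^ 'k"
  assumes bd: "\<And>w. \<exists>C. \<forall>n. norm (mpow A n w) \<le> C * (1 + real n)"
  shows "norm (mpow A n c) \<le> (1 + real n) ^ DIM(complex ^ 'k) * (1 + norm A) ^ DIM(complex ^ 'k) * norm c"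
proof -
  define P where "P = (\<lambda>rs. fold (mshift A) rs c = 0)"
  obtain rs0 where rs0: "length rs0 \<le> DIM(complex ^ 'k)" "P rs0"
    using exists_annihilating_poly[of A c] mshift_annihilating_list[of _ _ A c] unfolding P_def by blast
  obtain rs where rs: "P rs" and min: "\<And>ys. P ys \<Longrightarrow> length rs \<le> length ys"
    using ex_has_least_nat[of P rs0 length] rs0 by blast
  have "norm r \<le> 1" if r: "r \<in> set rs" for r
  proof (rule ccontr)
    assume r1: "\<not> norm r \<le> 1"
    obtain xs ys where xy: "rs = xs @ r # ys" using r by (meson split_list)
    \<comment> \<open>The list without \<open>r\<close> is shorter and hence does not annihilate
      \<open>c\<close>; so \<open>w\<close> is an eigenvector for \<open>r\<close>.\<close>
    define w where "w = fold (mshift A) (xs @ ys) c"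
    have "\<not> P (xs @ ys)" using min[of "xs @ ys"] by (auto simp: xy)
    then have w0: "w \<noteq> 0" by (simp add: P_def w_def)
    have "mshift A r w = 0" using rs by (simp add: P_def xy w_def fold_mshift_commute)
    then have "A *v w = r *s w" by (simp add: mshift_def)
    then have pw: "mpow A n w = r ^ n *s w" for n
      by (induction n) (simp_all add: vec.scale mult.commute)
    obtain C where C: "\<And>n. norm (mpow A n w) \<le> C * (1 + real n)" using bd by blast
    have "(\<lambda>n. (1 + real n) / a ^ n) \<longlonglongrightarrow> 0" if "a > 1" for a :: real
    proof -
      have "(\<lambda>n. (1 / a) ^ n + real n * (1 / a) ^ n) \<longlonglongrightarrow> 0 + 0"
        using that by (intro tendsto_add LIMSEQ_realpow_zero powser_times_n_limit_0) auto
      then show ?thesis by (simp add: power_one_over field_simps add_divide_distrib)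
    qed
    from tendsto_mult_right_zero[OF this, of "norm r" C] have "(\<lambda>n. C * (1 + real n) / norm r ^ n) \<longlonglongrightarrow> 0"
      using r1 by simp
    then have "\<forall>\<^sub>F n in sequentially. C * (1 + real n) / norm r ^ n < norm w"
      using w0 by (intro order_tendstoD) auto
    then obtain n where "C * (1 + real n) / norm r ^ n < norm w"
      using eventually_happens by fastforce
    moreover have "norm r ^ n > 0" using r1 by (intro zero_less_power) linarith
    ultimately have "C * (1 + real n) < norm (mpow A n w)"
      by (simp add: pw norm_scale_vec norm_power divide_simps mult.commute split: if_splits)
    with C[of n] show False by simp
  qed
  then have "norm (mpow A n c) \<le> (1 + real n) ^ length rs * (1 + norm A) ^ length rs * norm c"
    using rs by (intro norm_mpow_le) (auto simp: P_def)
  also have "\<dots> \<le> (1 + real n) ^ DIM(complex ^ 'k) * (1 + norm A) ^ DIM(complex ^ 'k) * norm c"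
    using min[OF rs0(2)] rs0(1) by (intro mult_right_mono mult_mono power_increasing) auto
  finally show ?thesis .
qed

section \<open>A Phragmen--Lindeloef principle\<close>

text \<open>In the upper half-plane the denominator 1 - i \<epsilon> z has modulus at least 1 and at
  least \<epsilon> |z|. The quotient is thus small on large half-circles, where only the bound
  \<open>B\<close> is known, and the maximum principle on a half-disc leaves
  \<open>b + \<epsilon>\<close>. Finally \<epsilon> tends to 0.\<close>

lemma half_plane_maximum_principle:
  assumes hol: "g holomorphic_on {z. Im z > 0}" and cont: "continuous_on {z. Im z \<ge> 0} g"
    and B: "\<And>z. Im z \<ge> 0 \<Longrightarrow> norm (g z) \<le> B"
    and b: "\<And>z. Im z = 0 \<Longrightarrow> norm (g z) \<le> b" and z0: "Im z0 \<ge> 0"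
  shows "norm (g z0) \<le> b"
proof -
  have b0: "b \<ge> 0" using b[of 0] norm_ge_zero[of "g 0"] by (simp del: norm_ge_zero)
  have B0: "B \<ge> 0" using B[of 0] norm_ge_zero[of "g 0"] by (simp del: norm_ge_zero)
  have main: "norm (g z0) \<le> (b + \<epsilon>) * norm (1 - \<i> * of_real \<epsilon> * z0)" if e: "\<epsilon> > 0" for \<epsilon> :: real
  proof -
    define d where "d = (\<lambda>z. 1 - \<i> * of_real \<epsilon> * z)"
    have d1: "norm (d z) \<ge> 1" if "Im z \<ge> 0" for z
    proof -
      have "1 \<le> Re (d z)" using that e by (simp add: d_def)
      also have "\<dots> \<le> norm (d z)" by (rule complex_Re_le_cmod)
      finally show ?thesis .
    qed
    have d2: "norm (d z) \<ge> \<epsilon> * norm z" if "Im z \<ge> 0" for z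
    proof -
      have "(\<epsilon> * norm z)\<^sup>2 \<le> (norm (d z))\<^sup>2"
        unfolding power_mult_distrib cmod_power2 using that e by (simp add: d_def power2_eq_square algebra_simps)
      then show ?thesis by (rule power2_le_imp_le) simp
    qed
    \<comment> \<open>The radius makes \<open>B / (\<epsilon> * R)\<close> at most
      \<open>b + \<epsilon>\<close>. Adding \<epsilon> to \<open>b\<close> keeps the denominator
      positive even for \<open>b = 0\<close>, and the final 1 makes \<open>R\<close>
      positive.\<close>
    define R where "R = max (norm z0) (B / (\<epsilon> * (b + \<epsilon>))) + 1"
    define S where "S = cball 0 R \<inter> {z. Im z \<ge> 0}"
    have cl: "closed S" unfolding S_def by (intro closed_Int closed_cball closed_halfspace_Im_ge)
    have int: "interior S \<subseteq> {z. Im z > 0}"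
    proof -
      have "interior S \<subseteq> interior {z. Im z \<ge> 0}" by (intro interior_mono) (auto simp: S_def)
      also have "{z. Im z \<ge> 0} = {z. \<i> \<bullet> z \<ge> 0}" by (simp add: inner_complex_def)
      also have "interior \<dots> = {z. \<i> \<bullet> z > 0}" by (rule interior_halfspace_ge) simp
      finally show ?thesis by (simp add: inner_complex_def)
    qed
    have nz: "d z \<noteq> 0" if "Im z \<ge> 0" for z using d1[OF that] by auto
    have "norm (g z0 / d z0) \<le> b + \<epsilon>"
    proof (rule maximum_modulus_frontier[where S=S and f="\<lambda>z. g z / d z" and \<xi>=z0])
      show "(\<lambda>z. g z / d z) holomorphic_on interior S"
      proof (rule holomorphic_on_divide)
        show "g holomorphic_on interior S" by (rule holomorphic_on_subset[OF hol int])
        show "d holomorphic_on interior S" unfolding d_def by (intro holomorphic_intros)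
        show "d z \<noteq> 0" if "z \<in> interior S" for z using that int nz[of z] by fastforce
      qed
      show "continuous_on (closure S) (\<lambda>z. g z / d z)"
        unfolding closure_closed[OF cl]
      proof (rule continuous_on_divide)
        show "continuous_on S g" by (rule continuous_on_subset[OF cont]) (auto simp: S_def)
        show "continuous_on S d" unfolding d_def by (intro continuous_intros)
        show "\<forall>z\<in>S. d z \<noteq> 0" using nz by (auto simp: S_def)
      qed
      show "bounded S" by (auto simp: S_def)
      show "z0 \<in> S" using z0 by (auto simp: S_def R_def)
      fix z assume "z \<in> frontier S"
      then have z: "z \<in> S" "z \<notin> interior S" using cl by (auto simp: frontier_def)
      have "ball 0 R \<inter> {z. Im z > 0} \<subseteq> interior S"
        by (intro interior_maximal open_Int open_ball open_halfspace_Im_gt) (auto simp: S_def)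
      then consider "Im z = 0" | "norm z = R" using z by (force simp: S_def)
      then show "norm (g z / d z) \<le> b + \<epsilon>"
      proof cases
        case 1
        then have "norm (g z) / norm (d z) \<le> b / 1"
          using b[of z] d1[of z] b0 by (intro frac_le) auto
        then show ?thesis using e by (simp add: norm_divide)
      next
        case 2
        have "R > 0" unfolding R_def using norm_ge_zero[of z0] by linarith
        have Im: "Im z \<ge> 0" using z by (simp add: S_def)
        have "norm (g z) / norm (d z) \<le> B / (\<epsilon> * R)"
          using B[OF Im] d2[OF Im] e \<open>R > 0\<close> 2 B0 by (intro frac_le) auto
        also have "\<dots> \<le> b + \<epsilon>"
        proof -
          have "B / (\<epsilon> * (b + \<epsilon>)) \<le> R" unfolding R_def by linarith
          then show ?thesis using e b0 \<open>R > 0\<close> by (simp add: divide_simps mult_ac split: if_splits)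
        qed
        finally show ?thesis by (simp add: norm_divide)
      qed
    qed
    then show ?thesis using nz[OF z0] by (simp add: norm_divide d_def divide_simps split: if_splits)
  qed
  have "((\<lambda>\<epsilon>. (b + \<epsilon>) * norm (1 - \<i> * of_real \<epsilon> * z0)) \<longlongrightarrow> (b + 0) * norm (1 - \<i> * of_real 0 * z0)) (at_right 0)"
    by (intro tendsto_intros)
  then have lim: "((\<lambda>\<epsilon>. (b + \<epsilon>) * norm (1 - \<i> * of_real \<epsilon> * z0)) \<longlongrightarrow> b) (at_right 0)" by simp
  have "\<forall>\<^sub>F \<epsilon> in at_right 0. norm (g z0) \<le> (b + \<epsilon>) * norm (1 - \<i> * of_real \<epsilon> * z0)"
    using main by (intro eventually_at_rightI[of 0 1]) auto
  then show ?thesis by (rule tendsto_lowerbound[OF lim]) simp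
qed

section \<open>Schroedinger systems\<close>

text \<open>Vectors indexed by \<open>'m + 'm\<close> are Cauchy data: \<open>lo\<close> is the value and \<open>hi\<close> the derivative.\<close>

definition lo :: "'a ^ ('m + 'm) \<Rightarrow> 'a ^ 'm" where "lo v = (\<chi> i. v $ Inl i)"
definition hi :: "'a ^ ('m + 'm) \<Rightarrow> 'a ^ 'm" where "hi v = (\<chi> i. v $ Inr i)"
definition join :: "'a ^ 'm \<Rightarrow> 'a ^ 'm \<Rightarrow> 'a ^ ('m + 'm)" where
  "join u v = (\<chi> i. case i of Inl a \<Rightarrow> u $ a | Inr b \<Rightarrow> v $ b)"

lemma lo_join [simp]: "lo (join u v) = u" and hi_join [simp]: "hi (join u v) = v"
  by (simp_all add: lo_def hi_def join_def vec_eq_iff)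

lemma join_lo_hi [simp]: "join (lo v) (hi v) = v"
  by (simp add: lo_def hi_def join_def vec_eq_iff split: sum.splits)

lemma sum_UNIV_sum:
  fixes f :: "'a::finite + 'b::finite \<Rightarrow> 'c::comm_monoid_add"
  shows "(\<Sum>i\<in>UNIV. f i) = (\<Sum>a\<in>UNIV. f (Inl a)) + (\<Sum>b\<in>UNIV. f (Inr b))"
  using sum.Plus[of "UNIV :: 'a set" "UNIV :: 'b set" f] by (simp add: comp_def)

lemma norm_lo_hi: "(norm (v :: complex ^ ('m::finite + 'm)))\<^sup>2 = (norm (lo v))\<^sup>2 + (norm (hi v))\<^sup>2"
  by (simp add: norm_vec_def L2_set_def sum_nonneg sum_UNIV_sum lo_def hi_def)

lemma norm_lo_le: "norm (lo v) \<le> norm (v :: complex ^ ('m::finite + 'm))"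
  and norm_hi_le: "norm (hi v) \<le> norm (v :: complex ^ ('m::finite + 'm))"
  by (rule power2_le_imp_le; simp add: norm_lo_hi)+

lemma bounded_linear_lo: "bounded_linear (lo :: complex ^ ('m::finite + 'm) \<Rightarrow> complex ^ 'm)"
  by (rule bounded_linear_intro[of _ 1]) (auto simp: norm_lo_le, auto simp: lo_def vec_eq_iff)

lemma bounded_linear_hi: "bounded_linear (hi :: complex ^ ('m::finite + 'm) \<Rightarrow> complex ^ 'm)"
  by (rule bounded_linear_intro[of _ 1]) (auto simp: norm_hi_le, auto simp: hi_def vec_eq_iff)

text \<open>The equation -y'' + Q y = z y as a first-order system for (y, y').\<close>

definition sysmat :: "(real \<Rightarrow> complex ^ 'm ^ 'm) \<Rightarrow> complex \<Rightarrow> real \<Rightarrow> complex ^ ('m::finite + 'm) ^ ('m + 'm)" where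
  "sysmat Q z x = (\<chi> i j. case i of
       Inl a \<Rightarrow> (case j of Inl b \<Rightarrow> 0 | Inr b \<Rightarrow> if a = b then 1 else 0)
     | Inr a \<Rightarrow> (case j of Inl b \<Rightarrow> Q x $ a $ b - (if a = b then z else 0) | Inr b \<Rightarrow> 0))"

lemma lo_sysmat: "lo (sysmat Q z x *v v) = hi v"
  by (simp add: vec_eq_iff lo_def hi_def sysmat_def matrix_vector_mult_def sum_UNIV_sum if_distrib[of "\<lambda>x. x * _"] cong: if_cong)

lemma hi_sysmat: "hi (sysmat Q z x *v v) = Q x *v lo v - z *s lo v"
  by (simp add: vec_eq_iff lo_def hi_def sysmat_def matrix_vector_mult_def sum_UNIV_sum left_diff_distrib sum_subtractf
     if_distrib[of "\<lambda>x. x * _"] cong: if_cong)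

lemma continuous_on_vec: "(\<And>i. continuous_on S (\<lambda>x. f x $ i)) \<Longrightarrow> continuous_on S (f :: _ \<Rightarrow> 'a::real_normed_vector ^ 'n)"
  by (simp add: continuous_on_def vec_tendstoI)

lemma continuous_sysmat:
  assumes "continuous_on UNIV Q"
  shows "continuous_on UNIV (\<lambda>(z, x). sysmat Q z x)"
proof -
  have "continuous_on UNIV (\<lambda>p. Q (snd p))"
    by (rule continuous_on_compose2[OF assms]) (auto intro!: continuous_intros)
  moreover have "continuous_on UNIV (\<lambda>p::complex \<times> real. if P then fst p else 0)" for P
    by (cases P) (auto intro!: continuous_intros)
  ultimately have "continuous_on UNIV (\<lambda>p. sysmat Q (fst p) (snd p) $ i $ j)" for i j
    by (cases i; cases j) (auto simp: sysmat_def intro!: continuous_intros)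
  then have "continuous_on UNIV (\<lambda>p. sysmat Q (fst p) (snd p))" by (intro continuous_on_vec)
  then show ?thesis by (simp add: split_beta)
qed

abbreviation schr_prop :: "(real \<Rightarrow> complex ^ 'm ^ 'm) \<Rightarrow> complex \<Rightarrow> real \<Rightarrow> complex ^ ('m::finite + 'm) ^ ('m + 'm)" where
  "schr_prop Q \<equiv> propagator (sysmat Q)"

lemma holomorphic_schr_prop:
  assumes "continuous_on UNIV Q"
  shows "(\<lambda>z. schr_prop Q z x $ i $ j) holomorphic_on UNIV"
proof (rule holomorphic_propagator[OF continuous_sysmat[OF assms]])
  let ?A' = "\<lambda>(z::complex) (x::real). \<chi> i j. case i of Inl a \<Rightarrow> 0 | Inr a \<Rightarrow> (case j of Inl b \<Rightarrow> (if a = b then - 1 else 0) | Inr b \<Rightarrow> 0)"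
  show "((\<lambda>z. sysmat Q z x $ i $ j) has_field_derivative ?A' z x $ i $ j) (at z)" for z x i j
    by (auto simp: sysmat_def split: sum.splits intro!: derivative_eq_intros)
  show "continuous_on UNIV (\<lambda>(z, x). ?A' z x)" by (simp add: split_beta)
qed

lemma has_vector_derivative_schr_prop:
  assumes "continuous_on UNIV Q"
  shows "((\<lambda>x. schr_prop Q z x *v c) has_vector_derivative sysmat Q z x *v (schr_prop Q z x *v c)) (at x)"
proof -
  have "((\<lambda>x. schr_prop Q z x *v c) has_vector_derivative
      (schr_prop Q z x *v 0 + (sysmat Q z x ** schr_prop Q z x) *v c)) (at x)"
    by (intro derivative_intros propagator_has_vector_derivative continuous_sysmat assms)
  then show ?thesis by (simp add: matrix_vector_mul_assoc)
qed

lemma has_vector_derivative_lo_hi_schr_prop: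
  assumes "continuous_on UNIV Q"
  shows "((\<lambda>x. lo (schr_prop Q z x *v c)) has_vector_derivative hi (schr_prop Q z x *v c)) (at x)"
    and "((\<lambda>x. hi (schr_prop Q z x *v c)) has_vector_derivative
       Q x *v lo (schr_prop Q z x *v c) - z *s lo (schr_prop Q z x *v c)) (at x)"
  using bounded_linear.has_vector_derivative[OF bounded_linear_lo has_vector_derivative_schr_prop[OF assms]]
    bounded_linear.has_vector_derivative[OF bounded_linear_hi has_vector_derivative_schr_prop[OF assms]]
  by (simp_all add: lo_sysmat hi_sysmat)

section \<open>Growth and uniqueness for linear systems\<close>

lemma gronwall:
  fixes N :: "real \<Rightarrow> real"
  assumes "\<And>x. 0 \<le> x \<Longrightarrow> x \<le> X \<Longrightarrow> (N has_real_derivative N' x) (at x)"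
    and "\<And>x. 0 \<le> x \<Longrightarrow> x \<le> X \<Longrightarrow> N' x \<le> c * N x" and "0 \<le> X"
  shows "N X \<le> exp (c * X) * N 0"
proof -
  have "N X * exp (- c * X) \<le> N 0 * exp (- c * 0)"
  proof (rule DERIV_nonpos_imp_nonincreasing[OF \<open>0 \<le> X\<close>])
    fix x assume x: "0 \<le> x" "x \<le> X"
    have "((\<lambda>x. N x * exp (- c * x)) has_real_derivative (N' x - c * N x) * exp (- c * x)) (at x)"
      using assms(1)[OF x] by (auto intro!: derivative_eq_intros simp: algebra_simps)
    moreover have "(N' x - c * N x) * exp (- c * x) \<le> 0"
      using assms(2)[OF x] by (simp add: mult_nonpos_nonneg)
    ultimately show "\<exists>y. ((\<lambda>x. N x * exp (- c * x)) has_real_derivative y) (at x) \<and> y \<le> 0" by blast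
  qed
  then have "N X * exp (- c * X) * exp (c * X) \<le> N 0 * exp (c * X)"
    by (intro mult_right_mono) auto
  then have "N X * (exp (- c * X) * exp (c * X)) \<le> N 0 * exp (c * X)" by (simp only: mult.assoc)
  also have "exp (- c * X) * exp (c * X) = 1" by (simp flip: exp_add)
  finally show ?thesis by (simp add: mult.commute)
qed

lemma norm_sq_has_real_derivative:
  fixes u :: "real \<Rightarrow> 'a::real_inner"
  assumes "(u has_vector_derivative u') (at x)"
  shows "((\<lambda>x. (norm (u x))\<^sup>2) has_real_derivative 2 * (u x \<bullet> u')) (at x)"
proof -
  have "((\<lambda>x. u x \<bullet> u x) has_vector_derivative (u x \<bullet> u' + u' \<bullet> u x)) (at x)"
    by (rule bounded_bilinear.has_vector_derivative[OF bounded_bilinear_inner assms assms])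
  then show ?thesis
    by (simp add: power2_norm_eq_inner has_real_derivative_iff_has_vector_derivative inner_commute)
qed

lemma parallelogram_law:
  "(norm (a + b))\<^sup>2 + (norm (a - b))\<^sup>2 = 2 * ((norm a)\<^sup>2 + (norm (b :: 'a::real_inner))\<^sup>2)"
  by (simp add: power2_norm_eq_inner inner_add_left inner_add_right inner_diff_left inner_diff_right inner_commute)

lemma linear_ode_norm_bound:
  fixes y :: "real \<Rightarrow> complex ^ 'k"
  assumes "\<And>x. 0 \<le> x \<Longrightarrow> x \<le> X \<Longrightarrow> (y has_vector_derivative A x *v y x) (at x)"
    and "\<And>x. 0 \<le> x \<Longrightarrow> x \<le> X \<Longrightarrow> norm (A x) \<le> K" and "0 \<le> X"
  shows "norm (y X) \<le> exp (K * X) * norm (y 0)"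
proof -
  have "(norm (y X))\<^sup>2 \<le> exp (2 * K * X) * (norm (y 0))\<^sup>2"
  proof (rule gronwall[where N'="\<lambda>x. 2 * (y x \<bullet> (A x *v y x))"])
    fix x assume x: "0 \<le> x" "x \<le> X"
    then show "((\<lambda>x. (norm (y x))\<^sup>2) has_real_derivative 2 * (y x \<bullet> (A x *v y x))) (at x)"
      by (intro norm_sq_has_real_derivative assms)
    have "y x \<bullet> (A x *v y x) \<le> norm (y x) * norm (A x *v y x)" by (rule norm_cauchy_schwarz)
    also have "\<dots> \<le> norm (y x) * (K * norm (y x))"
      using assms(2)[OF x] by (intro mult_left_mono order_trans[OF norm_matrix_vector_le] mult_right_mono) auto
    finally show "2 * (y x \<bullet> (A x *v y x)) \<le> 2 * K * (norm (y x))\<^sup>2" by (simp add: power2_eq_square algebra_simps)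
  qed (use assms in auto)
  also have "\<dots> = (exp (K * X) * norm (y 0))\<^sup>2"
    by (simp add: power_mult_distrib exp_double[symmetric] mult.assoc)
  finally show ?thesis by (rule power2_le_imp_le) simp
qed

lemma linear_ode_unique:
  fixes y :: "real \<Rightarrow> complex ^ 'k"
  assumes "\<And>x. 0 \<le> x \<Longrightarrow> x \<le> X \<Longrightarrow> (y has_vector_derivative A x *v y x) (at x)"
    and "continuous_on UNIV A" "0 \<le> X" "y 0 = 0"
  shows "y X = 0"
proof -
  have "bounded (A ` {0..X})"
    by (intro compact_imp_bounded compact_continuous_image continuous_on_subset[OF assms(2)]) auto
  then obtain K where "\<And>x. 0 \<le> x \<Longrightarrow> x \<le> X \<Longrightarrow> norm (A x) \<le> K" unfolding bounded_iff by force
  from linear_ode_norm_bound[OF assms(1) this assms(3)] show ?thesis using assms(4) by simp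
qed

text \<open>By periodicity both sides solve the same system, and they agree at 0.\<close>

lemma schr_prop_add_period:
  assumes Q: "continuous_on UNIV Q" and per: "\<And>x. Q (x + \<omega>) = Q x" and x: "x \<ge> 0"
  shows "schr_prop Q z (x + \<omega>) *v c = schr_prop Q z x *v (schr_prop Q z \<omega> *v c)"
proof -
  define d where "d = (\<lambda>x. schr_prop Q z (x + \<omega>) *v c - schr_prop Q z x *v (schr_prop Q z \<omega> *v c))"
  have per': "sysmat Q z (t + \<omega>) = sysmat Q z t" for t
    by (auto simp: sysmat_def per vec_eq_iff split: sum.splits)
  have "d x = 0"
  proof (rule linear_ode_unique[where A="sysmat Q z"])
    fix t :: real
    have "((\<lambda>x. schr_prop Q z (x + \<omega>) *v c) has_vector_derivative sysmat Q z t *v (schr_prop Q z (t + \<omega>) *v c)) (at t)"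
      using vector_diff_chain_at[of "\<lambda>x. x + \<omega>" 1 t, OF _ has_vector_derivative_schr_prop[OF Q, of z c "t + \<omega>"]]
      by (simp add: o_def per' has_vector_derivative_add_const)
    then show "(d has_vector_derivative sysmat Q z t *v d t) (at t)"
      unfolding d_def matrix_vector_mult_diff_distrib
      by (intro has_vector_derivative_diff has_vector_derivative_schr_prop Q)
    show "continuous_on UNIV (sysmat Q z)" by (rule continuous_on_slice[OF continuous_sysmat[OF Q]])
  qed (use x continuous_sysmat[OF Q] in \<open>auto simp: d_def\<close>)
  then show ?thesis by (simp add: d_def)
qed

text \<open>\<open>schr_prop Q z \<omega>\<close> is the monodromy matrix; growth of solutions along
  the half-line becomes growth of its powers.\<close>

lemma schr_prop_mult_period:
  assumes "continuous_on UNIV Q" "\<And>x. Q (x + \<omega>) = Q x" "\<omega> > 0"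
  shows "schr_prop Q z (real n * \<omega>) *v c = mpow (schr_prop Q z \<omega>) n c"
proof (induction n arbitrary: c)
  case (Suc n)
  have "schr_prop Q z (real (Suc n) * \<omega>) *v c = schr_prop Q z (real n * \<omega> + \<omega>) *v c"
    by (simp add: algebra_simps)
  also have "\<dots> = schr_prop Q z (real n * \<omega>) *v (schr_prop Q z \<omega> *v c)"
    using assms by (intro schr_prop_add_period) auto
  finally show ?case by (simp add: Suc funpow_swap1)
qed (simp add: continuous_sysmat[OF assms(1)])

lemma inner_scale_self: "u \<bullet> (r *s u) = Re r * (norm (u :: complex ^ 'k))\<^sup>2"
  by (simp add: Re_cinner[symmetric] cinner_scale_right cinner_self)

text \<open>The energy \<open>|y' + i k y|\<^sup>2 + |y' - i k y|\<^sup>2 = 2 (|y'|\<^sup>2 + |k y|\<^sup>2)\<close> grows at rate at most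
  \<open>2 (|Im k| + 2 B)\<close>.\<close>

lemma schr_energy_bound:
  fixes Q :: "real \<Rightarrow> complex ^ 'm ^ 'm" and E :: real and k :: complex
  assumes Q: "continuous_on UNIV Q"
    and B: "\<And>x v. norm (Q x *v v - of_real E *s v) \<le> B * norm v"
    and B0: "B \<ge> 0" and k: "norm k \<ge> 1" and x: "x \<ge> 0"
  shows "norm (schr_prop Q (of_real E + k\<^sup>2) x *v c) \<le> norm k * exp ((\<bar>Im k\<bar> + 2 * B) * x) * norm c"
proof -
  let ?z = "of_real E + k\<^sup>2"
  define y where "y = (\<lambda>x. lo (schr_prop Q ?z x *v c))"
  define y' where "y' = (\<lambda>x. hi (schr_prop Q ?z x *v c))"
  define q where "q = (\<lambda>x. Q x *v y x - of_real E *s y x)"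
  have dy: "(y has_vector_derivative y' x) (at x)" for x
    unfolding y_def y'_def by (rule has_vector_derivative_lo_hi_schr_prop[OF Q])
  have dy': "(y' has_vector_derivative q x - k\<^sup>2 *s y x) (at x)" for x
    using has_vector_derivative_lo_hi_schr_prop(2)[OF Q, of ?z c x]
    unfolding y_def y'_def q_def by (simp add: vec.scale_left_distrib algebra_simps)
  \<comment> \<open>Each of the two combinations satisfies u' = s i k u + q, so the free motion
    changes its norm at most at the rate |Im k|. This gives the sharp exponential type on which the
    Phragmen--Lindeloef argument relies.\<close>
  define u where "u = (\<lambda>s x. y' x + (s * \<i> * k) *s y x)"
  have bl: "bounded_linear (\<lambda>v::complex ^ 'm. r *s v)" for r
    by (rule bounded_linear_intro[of _ "norm r"])
       (auto simp: vec.scale_right_distrib norm_scale_vec mult.commute, auto simp: vec_eq_iff)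
  have du: "(u s has_vector_derivative ((s * \<i> * k) *s u s x + q x)) (at x)" if s: "s = 1 \<or> s = -1" for s x
  proof -
    have "(u s has_vector_derivative ((q x - k\<^sup>2 *s y x) + (s * \<i> * k) *s y' x)) (at x)"
      unfolding u_def by (intro has_vector_derivative_add dy' bounded_linear.has_vector_derivative[OF bl] dy)
    also have "(q x - k\<^sup>2 *s y x) + (s * \<i> * k) *s y' x = (s * \<i> * k) *s u s x + q x"
      using s by (auto simp: u_def vec_eq_iff algebra_simps power2_eq_square)
    finally show ?thesis .
  qed
  have energy: "(norm (u 1 x))\<^sup>2 + (norm (u (-1) x))\<^sup>2 = 2 * ((norm (y' x))\<^sup>2 + (norm k * norm (y x))\<^sup>2)" for x
  proof -
    have "u (-1) x = y' x - (\<i> * k) *s y x" by (simp add: u_def vec_eq_iff)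
    then show ?thesis
      by (simp add: u_def parallelogram_law norm_scale_vec norm_mult)
  qed
  have qb: "norm (q x) * norm (u s x) \<le> B * ((norm (u 1 x))\<^sup>2 + (norm (u (-1) x))\<^sup>2)" if s: "s = 1 \<or> s = -1" for s x
  proof -
    have "norm (q x) \<le> B * norm (y x)" unfolding q_def by (rule B)
    also have "\<dots> \<le> B * (norm k * norm (y x))" 
      using mult_right_mono[OF k, of "norm (y x)"] B0 by (intro mult_left_mono) auto
    finally have "norm (q x) * norm (u s x) \<le> B * (norm k * norm (y x)) * norm (u s x)"
      by (intro mult_right_mono) auto
    also have "\<dots> = B * ((norm k * norm (y x)) * norm (u s x))" by simp
    also have "\<dots> \<le> B * ((norm (u 1 x))\<^sup>2 + (norm (u (-1) x))\<^sup>2)"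
    proof (rule mult_left_mono[OF _ B0])
      have "2 * ((norm k * norm (y x)) * norm (u s x)) \<le> (norm k * norm (y x))\<^sup>2 + (norm (u s x))\<^sup>2"
        using sum_squares_bound[of "norm k * norm (y x)" "norm (u s x)"] by (simp add: mult.assoc)
      moreover have "(norm (u s x))\<^sup>2 \<le> (norm (u 1 x))\<^sup>2 + (norm (u (-1) x))\<^sup>2" using s by auto
      moreover have "(norm k * norm (y x))\<^sup>2 \<le> (norm (u 1 x))\<^sup>2 + (norm (u (-1) x))\<^sup>2"
        unfolding energy by simp
      ultimately show "norm k * norm (y x) * norm (u s x) \<le> (norm (u 1 x))\<^sup>2 + (norm (u (-1) x))\<^sup>2" by linarith
    qed
    finally show ?thesis .
  qed
  have "(norm (u 1 x))\<^sup>2 + (norm (u (-1) x))\<^sup>2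
      \<le> exp (2 * (\<bar>Im k\<bar> + 2 * B) * x) * ((norm (u 1 0))\<^sup>2 + (norm (u (-1) 0))\<^sup>2)"
  proof (rule gronwall[OF _ _ x])
    fix t
    show "((\<lambda>x. (norm (u 1 x))\<^sup>2 + (norm (u (-1) x))\<^sup>2) has_real_derivative
       2 * (u 1 t \<bullet> ((1 * \<i> * k) *s u 1 t + q t)) + 2 * (u (-1) t \<bullet> ((- 1 * \<i> * k) *s u (-1) t + q t))) (at t)"
      by (intro DERIV_add norm_sq_has_real_derivative du) auto
    have "2 * (u s t \<bullet> ((s * \<i> * k) *s u s t + q t)) \<le> 2 * \<bar>Im k\<bar> * (norm (u s t))\<^sup>2 + 2 * B * ((norm (u 1 t))\<^sup>2 + (norm (u (-1) t))\<^sup>2)"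
      if s: "s = 1 \<or> s = -1" for s
    proof -
      have "u s t \<bullet> ((s * \<i> * k) *s u s t) \<le> \<bar>Im k\<bar> * (norm (u s t))\<^sup>2"
        using s by (auto simp: inner_scale_self intro!: mult_right_mono)
      moreover have "u s t \<bullet> q t \<le> B * ((norm (u 1 t))\<^sup>2 + (norm (u (-1) t))\<^sup>2)"
        using norm_cauchy_schwarz[of "u s t" "q t"] qb[OF s, of t] by (simp add: mult.commute)
      ultimately show ?thesis by (simp add: inner_add_right)
    qed
    from this[of 1] this[of "-1"]
    show "2 * (u 1 t \<bullet> ((1 * \<i> * k) *s u 1 t + q t)) + 2 * (u (-1) t \<bullet> ((- 1 * \<i> * k) *s u (-1) t + q t))
        \<le> 2 * (\<bar>Im k\<bar> + 2 * B) * ((norm (u 1 t))\<^sup>2 + (norm (u (-1) t))\<^sup>2)"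
      by (simp add: algebra_simps)
  qed
  then have "(norm (y' x))\<^sup>2 + (norm k * norm (y x))\<^sup>2
      \<le> exp (2 * (\<bar>Im k\<bar> + 2 * B) * x) * ((norm (y' 0))\<^sup>2 + (norm k * norm (y 0))\<^sup>2)"
    unfolding energy mult.left_commute[of "exp _" 2] by (simp only: mult_le_cancel_left_pos zero_less_numeral)
  moreover have "1 * (norm (y x))\<^sup>2 \<le> (norm k)\<^sup>2 * (norm (y x))\<^sup>2"
    using k by (intro mult_right_mono one_le_power) auto
  moreover have "1 * (norm (y' 0))\<^sup>2 \<le> (norm k)\<^sup>2 * (norm (y' 0))\<^sup>2"
    using k by (intro mult_right_mono one_le_power) auto
  then have "exp (2 * (\<bar>Im k\<bar> + 2 * B) * x) * ((norm (y' 0))\<^sup>2 + (norm k * norm (y 0))\<^sup>2)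
      \<le> exp (2 * (\<bar>Im k\<bar> + 2 * B) * x) * ((norm k)\<^sup>2 * ((norm (y 0))\<^sup>2 + (norm (y' 0))\<^sup>2))"
    by (intro mult_left_mono) (auto simp: algebra_simps)
  ultimately have "(norm (y x))\<^sup>2 + (norm (y' x))\<^sup>2
     \<le> exp (2 * (\<bar>Im k\<bar> + 2 * B) * x) * ((norm k)\<^sup>2 * ((norm (y 0))\<^sup>2 + (norm (y' 0))\<^sup>2))"
    unfolding power_mult_distrib by linarith
  then have "(norm (schr_prop Q ?z x *v c))\<^sup>2 \<le> (norm k * exp ((\<bar>Im k\<bar> + 2 * B) * x) * norm c)\<^sup>2"
    using norm_lo_hi[of "schr_prop Q ?z x *v c"] norm_lo_hi[of c]
    by (simp add: y_def y'_def continuous_sysmat[OF Q] power_mult_distrib exp_double[symmetric] mult_ac)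
  then show ?thesis by (rule power2_le_imp_le) simp
qed

lemma norm_matrix_le_columns:
  fixes A :: "complex ^ 'k ^ 'k"
  assumes "\<And>j. norm (A *v axis j 1) \<le> b"
  shows "norm A \<le> (real CARD('k))\<^sup>2 * b"
proof -
  have 1: "norm (A $ i $ j) \<le> b" for i j
  proof -
    have "norm (A $ i $ j) = norm ((A *v axis j 1) $ i)"
      by (simp add: matrix_vector_mult_def axis_def if_distrib cong: if_cong)
    also have "\<dots> \<le> b" using Finite_Cartesian_Product.norm_nth_le assms order_trans by blast
    finally show ?thesis .
  qed
  have "norm (A $ i) \<le> real CARD('k) * b" for i
  proof -
    have "norm (A $ i) \<le> (\<Sum>j\<in>UNIV. norm (A $ i $ j))" unfolding norm_vec_def by (rule L2_set_le_sum) auto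
    also have "\<dots> \<le> of_nat CARD('k) * b" by (rule sum_bounded_above) (rule 1)
    finally show ?thesis .
  qed
  then have "(\<Sum>i\<in>UNIV. norm (A $ i)) \<le> of_nat CARD('k) * (real CARD('k) * b)" by (intro sum_bounded_above)
  moreover have "norm A \<le> (\<Sum>i\<in>UNIV. norm (A $ i))" unfolding norm_vec_def by (rule L2_set_le_sum) auto
  ultimately show ?thesis by (simp add: power2_eq_square mult.assoc)
qed

lemma continuous_on_schr_prop_z:
  assumes "continuous_on UNIV Q"
  shows "continuous_on S (\<lambda>z. schr_prop Q z x)"
  by (intro continuous_on_vec holomorphic_on_imp_continuous_on holomorphic_on_subset[OF holomorphic_schr_prop[OF assms]]) auto

text \<open>The energy estimate needs \<open>norm k \<ge> 1\<close>; the unit disc is covered by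
  compactness. What matters is the exact type \<open>L\<close> in Im k, with only a linear factor in
  k beside it.\<close>

lemma norm_schr_prop_le:
  fixes Q :: "real \<Rightarrow> complex ^ 'm ^ 'm" and E :: real
  assumes Q: "continuous_on UNIV Q"
    and B: "\<And>x v. norm (Q x *v v - of_real E *s v) \<le> B * norm v" and "B \<ge> 0" "L \<ge> 0"
  shows "\<exists>K\<ge>0. \<forall>k. norm (schr_prop Q (of_real E + k\<^sup>2) L) \<le> K * (1 + norm k) * exp (\<bar>Im k\<bar> * L)"
proof -
  let ?P = "\<lambda>k. schr_prop Q (of_real E + k\<^sup>2) L"
  let ?N = "(real CARD('m + 'm))\<^sup>2"
  have "continuous_on (cball 0 1) ?P"
    by (rule continuous_on_compose2[OF continuous_on_schr_prop_z[OF Q, of UNIV]]) (auto intro!: continuous_intros)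
  then have "bounded (?P ` cball 0 1)" by (intro compact_imp_bounded compact_continuous_image) auto
  then obtain K1 where "\<forall>k\<in>cball 0 1. norm (?P k) \<le> K1" by (auto simp: bounded_iff)
  then have K1: "norm (?P k) \<le> K1" if "norm k \<le> 1" for k using that by auto
  define K where "K = \<bar>K1\<bar> + ?N * exp (2 * B * L)"
  have "norm (?P k) \<le> K * (1 + norm k) * exp (\<bar>Im k\<bar> * L)" for k
  proof (cases "norm k \<le> 1")
    case True
    have "1 \<le> exp (\<bar>Im k\<bar> * L)" using \<open>L \<ge> 0\<close> by simp
    have "norm (?P k) \<le> \<bar>K1\<bar> * 1 * 1" using K1[OF True] by simp
    also have "\<dots> \<le> K * (1 + norm k) * exp (\<bar>Im k\<bar> * L)"
      using \<open>L \<ge> 0\<close> by (intro mult_mono) (auto simp: K_def)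
    finally show ?thesis .
  next
    case False
    have "norm (?P k) \<le> ?N * (norm k * exp ((\<bar>Im k\<bar> + 2 * B) * L))"
    proof (rule norm_matrix_le_columns)
      fix j
      have "norm (?P k *v axis j 1) \<le> norm k * exp ((\<bar>Im k\<bar> + 2 * B) * L) * norm (axis j 1 :: complex ^ ('m + 'm))"
        using False assms by (intro schr_energy_bound) auto
      then show "norm (?P k *v axis j 1) \<le> norm k * exp ((\<bar>Im k\<bar> + 2 * B) * L)" by simp
    qed
    also have "\<dots> = (?N * exp (2 * B * L)) * norm k * exp (\<bar>Im k\<bar> * L)"
      by (simp add: algebra_simps exp_add)
    also have "\<dots> \<le> K * (1 + norm k) * exp (\<bar>Im k\<bar> * L)"
      by (intro mult_right_mono mult_mono) (auto simp: K_def)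
    finally show ?thesis .
  qed
  moreover have "K \<ge> 0" by (auto simp: K_def)
  ultimately show ?thesis by blast
qed

text \<open>k + i is a weight comparable to 1 + |k| without zeros in the closed upper half-plane, so
  that division by its powers preserves holomorphy.\<close>

lemma norm_k_plus_i:
  assumes "Im k \<ge> 0"
  shows "norm (k + \<i>) \<ge> 1" "1 + norm k \<le> 2 * norm (k + \<i>)"
proof -
  have "1 \<le> \<bar>Im (k + \<i>)\<bar>" using assms by simp
  then show 1: "norm (k + \<i>) \<ge> 1" using abs_Im_le_cmod[of "k + \<i>"] by linarith
  have "(norm k)\<^sup>2 \<le> (norm (k + \<i>))\<^sup>2"
    unfolding cmod_power2 using assms by (simp add: power2_eq_square algebra_simps)
  then have "norm k \<le> norm (k + \<i>)" by (rule power2_le_imp_le) simp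
  with 1 show "1 + norm k \<le> 2 * norm (k + \<i>)" by linarith
qed

text \<open>Phragmen--Lindeloef in \<open>k\<close> with energy \<open>E + k\<^sup>2\<close>: real \<open>k\<close> correspond to energies above \<open>E\<close>, and
  \<open>k = \<i> \<kappa>\<close> to the energy \<open>E - \<kappa>\<^sup>2\<close>.\<close>

lemma mpow_schr_prop_below_spectrum:
  fixes Q :: "real \<Rightarrow> complex ^ 'm ^ 'm" and E \<omega> :: real
  assumes Q: "continuous_on UNIV Q" and per: "\<And>x. Q (x + \<omega>) = Q x" and w: "\<omega> > 0"
    and B: "\<And>x v. norm (Q x *v v - of_real E *s v) \<le> B * norm v" and "B \<ge> 0"
    and pow: "\<And>t n c. t \<ge> E \<Longrightarrow> norm (mpow (schr_prop Q (of_real t) \<omega>) n c)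
        \<le> (1 + real n) ^ N * (1 + norm (schr_prop Q (of_real t) \<omega>)) ^ N * norm c"
  shows "\<exists>K. \<forall>n \<kappa> c. \<kappa> > 0 \<longrightarrow> norm (mpow (schr_prop Q (of_real (E - \<kappa>\<^sup>2)) \<omega>) n c)
      \<le> K * (1 + real n) ^ N * (1 + \<kappa>) ^ Suc N * exp (real n * \<omega> * \<kappa>) * norm c"
proof -
  obtain K1 where K1: "K1 \<ge> 0" "\<And>k. norm (schr_prop Q (of_real E + k\<^sup>2) \<omega>) \<le> K1 * (1 + norm k) * exp (\<bar>Im k\<bar> * \<omega>)"
    using norm_schr_prop_le[OF Q B \<open>B \<ge> 0\<close>, of \<omega>] w by auto
  define K2 where "K2 = 2 * (1 + K1)"
  have entry: "norm ((mpow (schr_prop Q (of_real (E - \<kappa>\<^sup>2)) \<omega>) n c) $ j)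
      \<le> K2 ^ N * (1 + real n) ^ N * (1 + \<kappa>) ^ Suc N * exp (real n * \<omega> * \<kappa>) * norm c" if \<kappa>: "\<kappa> > 0" for n \<kappa> c j
  proof -
    define L where "L = real n * \<omega>"
    have L: "L \<ge> 0" using w by (simp add: L_def)
    define f where "f = (\<lambda>k. (schr_prop Q (of_real E + k\<^sup>2) L *v c) $ j)"
    \<comment> \<open>The exponential cancels the growth in the upper half-plane and has modulus 1
      on the real line. Of the powers of k + i, \<open>N\<close> absorb the norm of the monodromy
      matrix on the real line; one more makes the exponent at least 1, as boundedness in the
      half-plane requires.\<close>
    define g where "g = (\<lambda>k. f k * exp (\<i> * k * of_real L) / (k + \<i>) ^ Suc N)"
    have feq: "f k = (mpow (schr_prop Q (of_real E + k\<^sup>2) \<omega>) n c) $ j" for k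
      unfolding f_def L_def using schr_prop_mult_period[OF Q per w] by simp
    \<comment> \<open>\<open>K3\<close> depends on \<open>L\<close> and hence on \<open>n\<close>.
      It serves only as the a priori bound in the maximum principle; the conclusion inherits the
      bound from the real line.\<close>
    obtain K3 where K3: "K3 \<ge> 0" "\<And>k. norm (schr_prop Q (of_real E + k\<^sup>2) L) \<le> K3 * (1 + norm k) * exp (\<bar>Im k\<bar> * L)"
      using norm_schr_prop_le[OF Q B \<open>B \<ge> 0\<close> L] by auto
    have holf: "f holomorphic_on UNIV"
    proof -
      have "(\<lambda>k. schr_prop Q (of_real E + k\<^sup>2) L $ i $ j) holomorphic_on UNIV" for i j
        using holomorphic_on_compose_gen[of "\<lambda>k. of_real E + k\<^sup>2" UNIV, OF _ holomorphic_schr_prop[OF Q]]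
        by (simp add: o_def holomorphic_intros)
      then show ?thesis unfolding f_def matrix_vector_mult_def by (auto intro!: holomorphic_intros)
    qed
    have nz: "k + \<i> \<noteq> 0" if "Im k \<ge> 0" for k using norm_k_plus_i(1)[OF that] by auto
    have holg: "g holomorphic_on {k. Im k > - 1}"
    proof -
      have "k + \<i> \<noteq> 0" if "Im k > - 1" for k using that by (auto simp: complex_eq_iff)
      then show ?thesis
        unfolding g_def by (intro holomorphic_intros holomorphic_on_subset[OF holf] power_not_zero) auto
    qed
    have gn: "norm (g k) = norm (f k) * exp (- Im k * L) / norm (k + \<i>) ^ Suc N" for k
      by (simp add: g_def norm_mult norm_divide norm_power)
    have "norm (g (\<i> * of_real \<kappa>)) \<le> (1 + real n) ^ N * K2 ^ N * norm c"
    proof (rule half_plane_maximum_principle[where g=g and ?z0.0="\<i> * of_real \<kappa>" and B="K3 * norm c * 2"])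
      show "g holomorphic_on {z. 0 < Im z}" by (rule holomorphic_on_subset[OF holg]) auto
      show "continuous_on {z. 0 \<le> Im z} g"
        by (rule holomorphic_on_imp_continuous_on, rule holomorphic_on_subset[OF holg]) auto
      show "0 \<le> Im (\<i> * of_real \<kappa>)" using \<kappa> by simp
    next
      fix k assume k: "0 \<le> Im k"
      have "norm (f k) \<le> norm (schr_prop Q (of_real E + k\<^sup>2) L *v c)"
        unfolding f_def by (rule Finite_Cartesian_Product.norm_nth_le)
      also have "\<dots> \<le> K3 * (1 + norm k) * exp (\<bar>Im k\<bar> * L) * norm c"
        by (intro order_trans[OF norm_matrix_vector_le] mult_right_mono K3) auto
      finally have "norm (f k) * exp (- Im k * L) \<le> K3 * (1 + norm k) * exp (\<bar>Im k\<bar> * L) * norm c * exp (- Im k * L)"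
        by (intro mult_right_mono) auto
      also have "\<dots> = K3 * (1 + norm k) * norm c * (exp (Im k * L) * exp (- Im k * L))"
        using k by simp
      also have "exp (Im k * L) * exp (- Im k * L) = 1" by (simp flip: exp_add)
      finally have "norm (f k) * exp (- Im k * L) \<le> K3 * norm c * (1 + norm k)" by (simp add: algebra_simps)
      also have "\<dots> \<le> K3 * norm c * (2 * norm (k + \<i>))"
        using norm_k_plus_i[OF k] K3 by (intro mult_left_mono) auto
      finally have 1: "norm (f k) * exp (- Im k * L) \<le> (K3 * norm c * 2) * norm (k + \<i>)" by simp
      have "norm (g k) \<le> (K3 * norm c * 2) * norm (k + \<i>) / norm (k + \<i>) ^ Suc N"
        unfolding gn by (intro divide_right_mono 1) auto
      also have "\<dots> = (K3 * norm c * 2) / norm (k + \<i>) ^ N" using nz[OF k] by simp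
      also have "\<dots> \<le> (K3 * norm c * 2) / 1"
        using norm_k_plus_i(1)[OF k] K3(1) nz[OF k] by (intro divide_left_mono one_le_power) auto
      finally show "norm (g k) \<le> K3 * norm c * 2" by simp
    next
      fix k assume k: "Im k = 0"
      then obtain r where r: "k = of_real r" by (metis complex_is_Real_iff Reals_cases)
      have z: "of_real E + k\<^sup>2 = of_real (E + r\<^sup>2)" by (simp add: r)
      have k0: "Im k \<ge> 0" using k by simp
      have "norm (f k) \<le> norm (mpow (schr_prop Q (of_real (E + r\<^sup>2)) \<omega>) n c)"
        unfolding feq z by (rule Finite_Cartesian_Product.norm_nth_le)
      also have "\<dots> \<le> (1 + real n) ^ N * (1 + norm (schr_prop Q (of_real (E + r\<^sup>2)) \<omega>)) ^ N * norm c"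
        by (rule pow) simp
      also have "\<dots> \<le> (1 + real n) ^ N * (K2 * norm (k + \<i>)) ^ N * norm c"
      proof (intro mult_right_mono mult_left_mono power_mono)
        have "norm (schr_prop Q (of_real (E + r\<^sup>2)) \<omega>) \<le> K1 * (1 + norm k)"
          using K1(2)[of k] unfolding z by (simp only: k) simp
        then have "1 + norm (schr_prop Q (of_real (E + r\<^sup>2)) \<omega>) \<le> 1 * (1 + norm k) + K1 * (1 + norm k)"
          by (intro add_mono) auto
        also have "\<dots> = (1 + K1) * (1 + norm k)" by (simp add: algebra_simps)
        also have "\<dots> \<le> (1 + K1) * (2 * norm (k + \<i>))"
          using norm_k_plus_i[OF k0] K1(1) by (intro mult_left_mono) auto
        finally show "1 + norm (schr_prop Q (of_real (E + r\<^sup>2)) \<omega>) \<le> K2 * norm (k + \<i>)" by (simp only: K2_def mult_ac)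
      qed auto
      finally have 1: "norm (f k) \<le> ((1 + real n) ^ N * K2 ^ N * norm c) * norm (k + \<i>) ^ N"
        by (simp add: power_mult_distrib algebra_simps)
      have "norm (g k) \<le> ((1 + real n) ^ N * K2 ^ N * norm c) * norm (k + \<i>) ^ N / norm (k + \<i>) ^ Suc N"
        unfolding gn using 1 by (intro divide_right_mono) (auto simp: k)
      also have "\<dots> = ((1 + real n) ^ N * K2 ^ N * norm c) / norm (k + \<i>)" using nz[OF k0] by simp
      also have "\<dots> \<le> ((1 + real n) ^ N * K2 ^ N * norm c) / 1"
        using norm_k_plus_i(1)[OF k0] K1 by (intro divide_left_mono) (auto simp: K2_def)
      finally show "norm (g k) \<le> (1 + real n) ^ N * K2 ^ N * norm c" by simp
    qed
    moreover have "norm (g (\<i> * of_real \<kappa>)) = norm (f (\<i> * of_real \<kappa>)) * exp (- \<kappa> * L) / (1 + \<kappa>) ^ Suc N"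
    proof -
      have "\<i> * of_real \<kappa> + \<i> = \<i> * of_real (1 + \<kappa>)" by (simp add: algebra_simps)
      then have "norm (\<i> * of_real \<kappa> + \<i>) = 1 + \<kappa>" using \<kappa> by (simp only: norm_mult norm_of_real) simp
      then show ?thesis unfolding gn by simp
    qed
    ultimately have "norm (f (\<i> * of_real \<kappa>)) * exp (- \<kappa> * L) \<le> (1 + real n) ^ N * K2 ^ N * norm c * (1 + \<kappa>) ^ Suc N"
      using \<kappa> by (simp add: divide_le_eq)
    then have "norm (f (\<i> * of_real \<kappa>)) * exp (- \<kappa> * L) * exp (\<kappa> * L) \<le> (1 + real n) ^ N * K2 ^ N * norm c * (1 + \<kappa>) ^ Suc N * exp (\<kappa> * L)"
      by (intro mult_right_mono) auto
    moreover have "exp (- \<kappa> * L) * exp (\<kappa> * L) = 1" by (simp flip: exp_add)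
    ultimately have "norm (f (\<i> * of_real \<kappa>)) \<le> (1 + real n) ^ N * K2 ^ N * norm c * (1 + \<kappa>) ^ Suc N * exp (\<kappa> * L)"
      by (simp only: mult.assoc mult_1_right)
    moreover have "of_real E + (\<i> * of_real \<kappa>)\<^sup>2 = complex_of_real (E - \<kappa>\<^sup>2)" by (simp add: power_mult_distrib)
    ultimately show ?thesis unfolding feq by (simp add: L_def mult_ac)
  qed
  let ?C = "real CARD('m + 'm) * K2 ^ N"
  have "norm (mpow (schr_prop Q (of_real (E - \<kappa>\<^sup>2)) \<omega>) n c)
      \<le> ?C * (1 + real n) ^ N * (1 + \<kappa>) ^ Suc N * exp (real n * \<omega> * \<kappa>) * norm c" if "\<kappa> > 0" for n \<kappa> c
  proof -
    let ?v = "mpow (schr_prop Q (of_real (E - \<kappa>\<^sup>2)) \<omega>) n c"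
    have "norm ?v \<le> (\<Sum>j\<in>UNIV. norm (?v $ j))" unfolding norm_vec_def by (rule L2_set_le_sum) auto
    also have "\<dots> \<le> of_nat CARD('m + 'm) * (K2 ^ N * (1 + real n) ^ N * (1 + \<kappa>) ^ Suc N * exp (real n * \<omega> * \<kappa>) * norm c)"
      by (rule sum_bounded_above) (rule entry[OF that])
    finally show ?thesis by (simp add: mult_ac)
  qed
  then show ?thesis by blast
qed

section \<open>Growth of solutions below the spectrum\<close>

lemma matrix_inner_le: "u \<bullet> (A *v (v :: complex ^ 'm)) \<le> norm u * norm A * norm v"
  using norm_cauchy_schwarz[of u "A *v v"] mult_left_mono[OF norm_matrix_vector_le[of A v], of "norm u"]
  by (simp add: mult.assoc)

lemma hermitian_inner:
  fixes T :: "complex ^ 'm ^ 'm"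
  assumes "conj_transpose T = T"
  shows "(T *v u) \<bullet> v = u \<bullet> (T *v v)"
  using cinner_conj_transpose[of T u v] by (simp add: assms flip: Re_cinner)

text \<open>For a solution of \<open>y'' = (q + \<kappa>\<^sup>2) y\<close> put \<open>U = exp (- \<kappa> x) (y' + \<kappa> y)\<close> and \<open>W = exp (- \<kappa> x) (y' - \<kappa> y)\<close>. The
  growing component \<open>U\<close> is multiplied over one period by \<open>1 + integral q / (2 \<kappa>) + O(1 / \<kappa>\<^sup>2)\<close>, and \<open>T\<close> is
  positive on the eigenspaces of the mean of \<open>q\<close> for eigenvalues above \<open>\<eta>\<close>. Hence the indefinite form
  increases for large \<open>\<kappa>\<close>.\<close>

lemma cone_step:
  fixes q :: "real \<Rightarrow> complex ^ 'm ^ 'm" and T :: "complex ^ 'm ^ 'm" and \<omega> \<eta> c B :: real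
  assumes q: "continuous_on UNIV q" and B: "\<And>x. norm (q x) \<le> B" and w: "\<omega> > 0"
    and T: "T = (1 / \<omega>) *\<^sub>R integral {0..\<omega>} q - \<eta> *\<^sub>R mat 1"
    and herm: "conj_transpose T = T" and \<eta>: "\<eta> > 0"
    and c: "c > 0" "\<And>v. c * norm v \<le> norm (T *v v)"
  shows "\<exists>\<kappa>>0. \<forall>U W.
    (\<forall>x\<in>{0..\<omega>}. (U has_vector_derivative (1 / (2 * \<kappa>)) *\<^sub>R (q x *v (U x - W x))) (at x)) \<longrightarrow>
    (\<forall>x\<in>{0..\<omega>}. (W has_vector_derivative (1 / (2 * \<kappa>)) *\<^sub>R (q x *v (U x - W x)) - (2 * \<kappa>) *\<^sub>R W x) (at x)) \<longrightarrow>
    (1 + \<omega> * \<eta> / (2 * \<kappa>))\<^sup>2 * ((T *v U 0) \<bullet> U 0 - (norm (W 0))\<^sup>2) \<le> (T *v U \<omega>) \<bullet> U \<omega> - (norm (W \<omega>))\<^sup>2"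
proof -
  have B0: "B \<ge> 0" using B[of 0] norm_ge_zero order_trans by blast
  define t where "t = norm T"
  \<comment> \<open>\<open>C1\<close> bounds the error in the first-order expansion of U over one
    period, in units of 1 / \<kappa>^2. Its terms stem from the drift of U away from U(0), from the
    decaying initial value of W, and from the part of W driven by q.\<close>
  define C1 where "C1 = B / 2 * (2 * \<omega>\<^sup>2 * B + 1 / 2 + B * \<omega>)"
  define C2 where "C2 = 1 + \<omega> * \<eta> + \<omega> * t"
  \<comment> \<open>\<open>C2\<close> bounds the expansion itself. \<open>C3\<close> collects all
    errors of order 1 / \<kappa>^2: the remainder inside the form of T, the second-order term of the
    expansion, and the driven part of W.\<close>
  define C3 where "C3 = t * (2 * C2 * C1 + C1\<^sup>2) + \<omega>\<^sup>2 * t ^ 3 + 2 * B\<^sup>2"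
  \<comment> \<open>Each summand has one purpose: \<kappa> >= 1; Gronwall growth by at most a factor
    e over the period; \<open>exp (- 2 * \<kappa> * \<omega>) \<le> 1 / 2\<close>; and absorption of
    \<open>C3 / \<kappa>\<^sup>2\<close> by the gain in |U(0)|^2 and by the loss of
    |W(0)|^2.\<close>
  define \<kappa> where "\<kappa> = 1 + 2 * B * \<omega> + 1 / \<omega> + C3 / (\<omega> * c\<^sup>2) + 2 * C3"
  have t0: "t \<ge> 0" by (simp add: t_def)
  have C10: "C1 \<ge> 0" using B0 w by (simp add: C1_def)
  have C20: "C2 \<ge> 0" using t0 w \<eta> by (simp add: C2_def)
  have C30: "C3 \<ge> 0" using t0 C10 C20 B0 by (simp add: C3_def)
  have "\<kappa> \<ge> 1" using B0 w C30 c by (simp add: \<kappa>_def)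
  show ?thesis
  proof (intro exI[of _ \<kappa>] conjI allI impI)
    show "\<kappa> > 0" using \<open>\<kappa> \<ge> 1\<close> by simp
    fix U W
    assume dU': "\<forall>x\<in>{0..\<omega>}. (U has_vector_derivative (1 / (2 * \<kappa>)) *\<^sub>R (q x *v (U x - W x))) (at x)"
      and dW': "\<forall>x\<in>{0..\<omega>}. (W has_vector_derivative (1 / (2 * \<kappa>)) *\<^sub>R (q x *v (U x - W x)) - (2 * \<kappa>) *\<^sub>R W x) (at x)"
    have dU: "(U has_vector_derivative (1 / (2 * \<kappa>)) *\<^sub>R (q x *v (U x - W x))) (at x)"
      and dW: "(W has_vector_derivative (1 / (2 * \<kappa>)) *\<^sub>R (q x *v (U x - W x)) - (2 * \<kappa>) *\<^sub>R W x) (at x)"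
      if "0 \<le> x" "x \<le> \<omega>" for x using dU' dW' that by auto
    have pos: "C3 / (\<omega> * c\<^sup>2) \<ge> 0" "2 * B * \<omega> \<ge> 0" "1 / \<omega> \<ge> 0" using C30 w c B0 by auto
    have \<kappa>1: "\<kappa> \<ge> 1" and k2: "2 * B * \<omega> \<le> \<kappa>" and k3: "1 / \<omega> \<le> \<kappa>" and k4: "C3 / (\<omega> * c\<^sup>2) \<le> \<kappa>" and k5: "2 * C3 \<le> \<kappa>"
      using pos C30 unfolding \<kappa>_def by linarith+
    define N where "N = (\<lambda>x. (norm (U x))\<^sup>2 + (norm (W x))\<^sup>2)"
    define s where "s = sqrt (N 0)"
    have s0: "s \<ge> 0" by (simp add: s_def N_def)
    have s2: "s\<^sup>2 = (norm (U 0))\<^sup>2 + (norm (W 0))\<^sup>2" by (simp add: s_def N_def)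
    have qle: "norm (q x *v v) \<le> B * norm v" for x v
      using order_trans[OF norm_matrix_vector_le mult_right_mono[OF B]] by simp
    have Nb: "N X \<le> 4 * N 0" if X: "0 \<le> X" "X \<le> \<omega>" for X
    proof -
      let ?r = "\<lambda>x. (1 / (2 * \<kappa>)) *\<^sub>R (q x *v (U x - W x))"
      have "N X \<le> exp (2 * B / \<kappa> * X) * N 0"
      proof (rule gronwall[where N'="\<lambda>x. 2 * (U x \<bullet> ?r x) + 2 * (W x \<bullet> (?r x - (2 * \<kappa>) *\<^sub>R W x))"])
        fix x assume x: "0 \<le> x" "x \<le> X"
        then have x': "0 \<le> x" "x \<le> \<omega>" using X by auto
        show "(N has_real_derivative 2 * (U x \<bullet> ?r x) + 2 * (W x \<bullet> (?r x - (2 * \<kappa>) *\<^sub>R W x))) (at x)"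
          unfolding N_def by (intro DERIV_add norm_sq_has_real_derivative dU[OF x'] dW[OF x'])
        have r: "norm (?r x) \<le> B / (2 * \<kappa>) * (norm (U x) + norm (W x))"
        proof -
          have "norm (q x *v (U x - W x)) \<le> B * (norm (U x) + norm (W x))"
            using B0 by (intro order_trans[OF qle] mult_left_mono norm_triangle_ineq4)
          then show ?thesis using \<kappa>1 by (simp add: divide_right_mono)
        qed
        have sq: "(norm (U x) + norm (W x))\<^sup>2 \<le> 2 * N x"
          using sum_squares_bound[of "norm (U x)" "norm (W x)"] by (simp add: N_def power2_sum)
        have "U x \<bullet> ?r x + W x \<bullet> ?r x \<le> (norm (U x) + norm (W x)) * norm (?r x)"
          using norm_cauchy_schwarz[of "U x" "?r x"] norm_cauchy_schwarz[of "W x" "?r x"] by (simp add: algebra_simps)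
        also have "\<dots> \<le> (norm (U x) + norm (W x)) * (B / (2 * \<kappa>) * (norm (U x) + norm (W x)))"
          by (intro mult_left_mono r) auto
        also have "\<dots> = B / (2 * \<kappa>) * (norm (U x) + norm (W x))\<^sup>2" by (simp add: power2_eq_square)
        also have "\<dots> \<le> B / (2 * \<kappa>) * (2 * N x)" using B0 \<kappa>1 by (intro mult_left_mono sq) auto
        finally have "2 * (U x \<bullet> ?r x + W x \<bullet> ?r x) \<le> 2 * B / \<kappa> * N x" using \<kappa>1 by (simp add: field_simps)
        moreover have "W x \<bullet> ((2 * \<kappa>) *\<^sub>R W x) \<ge> 0" using \<kappa>1 by simp
        ultimately show "2 * (U x \<bullet> ?r x) + 2 * (W x \<bullet> (?r x - (2 * \<kappa>) *\<^sub>R W x)) \<le> 2 * B / \<kappa> * N x"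
          by (simp add: inner_diff_right ring_distribs)
      qed (use X in auto)
      also have "\<dots> \<le> 4 * N 0"
      proof (rule mult_right_mono)
        have "2 * B / \<kappa> * X \<le> 2 * B / \<kappa> * \<omega>" using X B0 \<kappa>1 by (intro mult_left_mono) auto
        also have "\<dots> \<le> 1" using k2 \<kappa>1 by (simp add: field_simps)
        finally have "exp (2 * B / \<kappa> * X) \<le> exp 1" by simp
        then show "exp (2 * B / \<kappa> * X) \<le> 4" using exp_le by linarith
      qed (simp add: N_def)
      finally show ?thesis .
    qed
    have Ub: "norm (U x) \<le> 2 * s" and Wb: "norm (W x) \<le> 2 * s" if x: "0 \<le> x" "x \<le> \<omega>" for x
    proof -
      have "(norm (U x))\<^sup>2 \<le> (2 * s)\<^sup>2" "(norm (W x))\<^sup>2 \<le> (2 * s)\<^sup>2"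
        using Nb[OF x] s2 by (simp_all add: N_def power_mult_distrib) (smt (verit) zero_le_power2)+
      then show "norm (U x) \<le> 2 * s" "norm (W x) \<le> 2 * s" using s0 by (auto intro: power2_le_imp_le)
    qed
    have rb: "norm ((1 / (2 * \<kappa>)) *\<^sub>R (q x *v (U x - W x))) \<le> 2 * B / \<kappa> * s" if x: "0 \<le> x" "x \<le> \<omega>" for x
    proof -
      have "norm (q x *v (U x - W x)) \<le> B * (2 * s + 2 * s)"
        using B0 Ub[OF x] Wb[OF x]
        by (intro order_trans[OF qle] mult_left_mono order_trans[OF norm_triangle_ineq4]) auto
      then have "norm (q x *v (U x - W x)) / (2 * \<kappa>) \<le> B * (2 * s + 2 * s) / (2 * \<kappa>)"
        using \<kappa>1 by (intro divide_right_mono) auto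
      then show ?thesis using \<kappa>1 by (simp add: field_simps)
    qed
    have cU: "continuous_on {0..x} U" and cW: "continuous_on {0..x} W" if "x \<le> \<omega>" for x
      using that has_vector_derivative_continuous[OF dU] has_vector_derivative_continuous[OF dW]
      by (auto intro!: continuous_at_imp_continuous_on)
    have Udiff: "norm (U x - U 0) \<le> 2 * \<omega> * B / \<kappa> * s" if x: "0 \<le> x" "x \<le> \<omega>" for x
    proof (cases "x = 0")
      case True
      then show ?thesis using w B0 \<kappa>1 s0 by simp
    next
      case False
      have "norm (U x - U 0) \<le> (2 * B / \<kappa> * s) * x - (2 * B / \<kappa> * s) * 0"
      proof (rule differentiable_bound_general[of 0 x])
        fix y assume y: "0 < y" "y < x"
        show "(U has_vector_derivative (1 / (2 * \<kappa>)) *\<^sub>R (q y *v (U y - W y))) (at y)" using y x by (intro dU) auto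
        show "((\<lambda>x. (2 * B / \<kappa> * s) * x) has_vector_derivative (2 * B / \<kappa> * s)) (at y)"
          using \<kappa>1 by (auto intro!: derivative_eq_intros simp flip: has_real_derivative_iff_has_vector_derivative)
        show "norm ((1 / (2 * \<kappa>)) *\<^sub>R (q y *v (U y - W y))) \<le> 2 * B / \<kappa> * s" using y x by (intro rb) auto
      qed (use x False cU \<kappa>1 in \<open>auto intro!: continuous_intros\<close>)
      also have "\<dots> \<le> (2 * B / \<kappa> * s) * \<omega>" using x B0 \<kappa>1 s0
        by (simp only: mult_zero_right diff_zero) (intro mult_left_mono, auto)
      finally show ?thesis by (simp add: mult_ac)
    qed
    have Wx: "norm (W x) \<le> exp (- 2 * \<kappa> * x) * norm (W 0) + B / \<kappa>\<^sup>2 * s" if x: "0 \<le> x" "x \<le> \<omega>" for x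
    proof (cases "x = 0")
      case True
      then show ?thesis using B0 s0 by simp
    next
      case False
      \<comment> \<open>The integrating factor removes the damping of W and leaves only the forcing
        by q.\<close>
      let ?V = "\<lambda>x. exp (2 * \<kappa> * x) *\<^sub>R W x"
      have "norm (?V x - ?V 0) \<le> exp (2 * \<kappa> * x) * (B / \<kappa>\<^sup>2 * s) - exp (2 * \<kappa> * 0) * (B / \<kappa>\<^sup>2 * s)"
      proof (rule differentiable_bound_general[of 0 x])
        fix y assume y: "0 < y" "y < x"
        let ?r = "(1 / (2 * \<kappa>)) *\<^sub>R (q y *v (U y - W y))"
        have "((\<lambda>x. exp (2 * \<kappa> * x)) has_real_derivative 2 * \<kappa> * exp (2 * \<kappa> * y)) (at y)"
          by (auto intro!: derivative_eq_intros)
        moreover have "(W has_vector_derivative ?r - (2 * \<kappa>) *\<^sub>R W y) (at y)" using y x by (intro dW) auto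
        ultimately have "(?V has_vector_derivative (exp (2 * \<kappa> * y) *\<^sub>R (?r - (2 * \<kappa>) *\<^sub>R W y) + (2 * \<kappa> * exp (2 * \<kappa> * y)) *\<^sub>R W y)) (at y)"
          by (rule has_vector_derivative_scaleR)
        then show "(?V has_vector_derivative exp (2 * \<kappa> * y) *\<^sub>R ?r) (at y)"
          by (simp add: scaleR_right_diff_distrib mult.commute)
        show "((\<lambda>x. exp (2 * \<kappa> * x) * (B / \<kappa>\<^sup>2 * s)) has_vector_derivative exp (2 * \<kappa> * y) * (2 * B / \<kappa> * s)) (at y)"
          using \<kappa>1 by (auto intro!: derivative_eq_intros simp flip: has_real_derivative_iff_has_vector_derivative
            simp: field_simps power2_eq_square)
        show "norm (exp (2 * \<kappa> * y) *\<^sub>R ?r) \<le> exp (2 * \<kappa> * y) * (2 * B / \<kappa> * s)"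
          using rb[of y] y x by (simp only: norm_scaleR abs_exp_cancel) (intro mult_left_mono, auto)
      qed (use x False cW \<kappa>1 in \<open>auto intro!: continuous_intros\<close>)
      then have "norm (?V x) \<le> norm (W 0) + exp (2 * \<kappa> * x) * (B / \<kappa>\<^sup>2 * s)"
        using norm_triangle_sub[of "?V x" "?V 0"] B0 s0 by simp (smt (verit) divide_nonneg_nonneg mult_nonneg_nonneg zero_le_power2)
      then have h1: "exp (- 2 * \<kappa> * x) * norm (?V x) \<le> exp (- 2 * \<kappa> * x) * (norm (W 0) + exp (2 * \<kappa> * x) * (B / \<kappa>\<^sup>2 * s))"
        by (intro mult_left_mono) auto
      have "exp (- 2 * \<kappa> * x) * exp (2 * \<kappa> * x) = 1" by (simp flip: exp_add)
      then have "exp (- 2 * \<kappa> * x) * norm (?V x) = norm (W x)"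
         "exp (- 2 * \<kappa> * x) * (norm (W 0) + exp (2 * \<kappa> * x) * (B / \<kappa>\<^sup>2 * s)) = exp (- 2 * \<kappa> * x) * norm (W 0) + B / \<kappa>\<^sup>2 * s"
        by (simp_all only: norm_scaleR abs_exp_cancel ring_distribs mult.assoc[symmetric] mult_1_left)
      then show ?thesis using h1 by (simp only:)
    qed
    define \<alpha> where "\<alpha> = 1 + \<omega> * \<eta> / (2 * \<kappa>)"
    define \<beta> where "\<beta> = \<omega> / (2 * \<kappa>)"
    define Er where "Er = U \<omega> - \<alpha> *\<^sub>R U 0 - \<beta> *\<^sub>R (T *v U 0)"
    have \<alpha>1: "\<alpha> \<ge> 1" and \<beta>0: "\<beta> \<ge> 0" using w \<eta> \<kappa>1 by (simp_all add: \<alpha>_def \<beta>_def)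
    have kk: "1 / \<kappa> \<le> 1" using \<kappa>1 by simp
    have Er: "norm Er \<le> C1 / \<kappa>\<^sup>2 * s"
    proof -
      define J where "J = (\<lambda>x. integral {0..x} q)"
      have J0: "J 0 = 0" by (simp add: J_def)
      have dJ: "(J has_vector_derivative q x) (at x)" if x: "0 < x" "x < \<omega>" for x
      proof -
        have "(J has_vector_derivative q x) (at x within {0..\<omega>})"
          unfolding J_def by (rule integral_has_vector_derivative) (use x continuous_on_subset[OF q] in auto)
        moreover have "at x within {0..\<omega>} = at x" by (rule at_within_interior) (use x in auto)
        ultimately show ?thesis by simp
      qed
      have cJ: "continuous_on {0..\<omega>} J"
        unfolding J_def by (intro indefinite_integral_continuous_1 integrable_continuous_real continuous_on_subset[OF q]) auto
      \<comment> \<open>As \<open>J\<close> is the antiderivative of q, \<open>D\<close> compares U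
        with its first-order expansion U(0) + J U(0) / (2 \<kappa>). The function \<phi> below is an
        antiderivative of the bound for D', and its three terms become those of
        \<open>C1\<close>.\<close>
      define D where "D = (\<lambda>x. U x - U 0 - (1 / (2 * \<kappa>)) *\<^sub>R (J x *v U 0))"
      define \<phi> where "\<phi> = (\<lambda>x. B / (2 * \<kappa>) * ((2 * \<omega> * B / \<kappa> * s) * x - exp (- 2 * \<kappa> * x) * (s / (2 * \<kappa>)) + (B / \<kappa>\<^sup>2 * s) * x))"
      have "norm (D \<omega> - D 0) \<le> \<phi> \<omega> - \<phi> 0"
      proof (rule differentiable_bound_general[OF w])
        show "continuous_on {0..\<omega>} D" unfolding D_def by (intro continuous_intros cU cJ) auto
        show "continuous_on {0..\<omega>} \<phi>" unfolding \<phi>_def using \<kappa>1 by (intro continuous_intros) auto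
        fix x assume x: "0 < x" "x < \<omega>"
        have "(D has_vector_derivative (1 / (2 * \<kappa>)) *\<^sub>R (q x *v (U x - W x)) - 0 - (1 / (2 * \<kappa>)) *\<^sub>R (J x *v 0 + q x *v U 0)) (at x)"
          unfolding D_def
          by (intro has_vector_derivative_diff dU has_vector_derivative_const
              bounded_linear.has_vector_derivative[OF bounded_linear_scaleR_right] matrix_vector_has_vector_derivative dJ)
            (use x in auto)
        then show "(D has_vector_derivative (1 / (2 * \<kappa>)) *\<^sub>R (q x *v (U x - U 0 - W x))) (at x)"
          by (simp add: matrix_vector_mult_diff_distrib scaleR_right_diff_distrib algebra_simps)
        show "(\<phi> has_vector_derivative B / (2 * \<kappa>) * ((2 * \<omega> * B / \<kappa> * s) + exp (- 2 * \<kappa> * x) * s + B / \<kappa>\<^sup>2 * s)) (at x)"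
        proof -
          have "((\<lambda>x. a0 * (a1 * x - exp (- 2 * \<kappa> * x) * a2 + a3 * x)) has_real_derivative
              a0 * (a1 + exp (- 2 * \<kappa> * x) * (2 * \<kappa> * a2) + a3)) (at x)" for a0 a1 a2 a3
            by (auto intro!: derivative_eq_intros simp: algebra_simps)
          from this[of "B / (2 * \<kappa>)" "2 * \<omega> * B / \<kappa> * s" "s / (2 * \<kappa>)" "B / \<kappa>\<^sup>2 * s"] show ?thesis
            unfolding \<phi>_def has_real_derivative_iff_has_vector_derivative using \<kappa>1 by simp
        qed
        have "norm (q x *v (U x - U 0 - W x)) \<le> B * ((2 * \<omega> * B / \<kappa> * s) + (exp (- 2 * \<kappa> * x) * s + B / \<kappa>\<^sup>2 * s))"
        proof (rule order_trans[OF qle mult_left_mono[OF order_trans[OF norm_triangle_ineq4 add_mono] B0]])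
          show "norm (U x - U 0) \<le> 2 * \<omega> * B / \<kappa> * s" using x by (intro Udiff) auto
          have "norm (W 0) \<le> s" using s2 s0 by (auto intro: power2_le_imp_le)
          then have "exp (- 2 * \<kappa> * x) * norm (W 0) \<le> exp (- 2 * \<kappa> * x) * s" by (intro mult_left_mono) auto
          moreover have "norm (W x) \<le> exp (- 2 * \<kappa> * x) * norm (W 0) + B / \<kappa>\<^sup>2 * s" using x by (intro Wx) auto
          ultimately show "norm (W x) \<le> exp (- 2 * \<kappa> * x) * s + B / \<kappa>\<^sup>2 * s" by linarith
        qed
        then have "norm (q x *v (U x - U 0 - W x)) / (2 * \<kappa>) \<le> B * ((2 * \<omega> * B / \<kappa> * s) + (exp (- 2 * \<kappa> * x) * s + B / \<kappa>\<^sup>2 * s)) / (2 * \<kappa>)"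
          using \<kappa>1 by (intro divide_right_mono) auto
        moreover have "norm ((1 / (2 * \<kappa>)) *\<^sub>R v) = norm v / (2 * \<kappa>)" for v :: "complex ^ 'm" using \<kappa>1 by simp
        ultimately show "norm ((1 / (2 * \<kappa>)) *\<^sub>R (q x *v (U x - U 0 - W x))) \<le> B / (2 * \<kappa>) * ((2 * \<omega> * B / \<kappa> * s) + exp (- 2 * \<kappa> * x) * s + B / \<kappa>\<^sup>2 * s)"
          by (simp only: add.assoc times_divide_eq_left)
      qed
      also have "\<phi> \<omega> - \<phi> 0 \<le> B / (2 * \<kappa>) * ((2 * \<omega> * B / \<kappa> * s) * \<omega> + s / (2 * \<kappa>) + (B / \<kappa> * s) * \<omega>)"
      proof -
        have "0 \<le> exp (- 2 * \<kappa> * \<omega>) * (s / (2 * \<kappa>))" using s0 \<kappa>1 by simp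
        moreover have "B / \<kappa>\<^sup>2 * s * \<omega> \<le> B / \<kappa> * s * \<omega>"
          using \<kappa>1 B0 s0 w by (intro mult_right_mono divide_left_mono) (auto simp: power2_eq_square)
        ultimately have "(2 * \<omega> * B / \<kappa> * s) * \<omega> - exp (- 2 * \<kappa> * \<omega>) * (s / (2 * \<kappa>)) + (B / \<kappa>\<^sup>2 * s) * \<omega> + s / (2 * \<kappa>)
           \<le> (2 * \<omega> * B / \<kappa> * s) * \<omega> + s / (2 * \<kappa>) + (B / \<kappa> * s) * \<omega>" by linarith
        then have "B / (2 * \<kappa>) * ((2 * \<omega> * B / \<kappa> * s) * \<omega> - exp (- 2 * \<kappa> * \<omega>) * (s / (2 * \<kappa>)) + (B / \<kappa>\<^sup>2 * s) * \<omega> + s / (2 * \<kappa>))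
           \<le> B / (2 * \<kappa>) * ((2 * \<omega> * B / \<kappa> * s) * \<omega> + s / (2 * \<kappa>) + (B / \<kappa> * s) * \<omega>)"
          using B0 \<kappa>1 by (intro mult_left_mono) auto
        moreover have "\<phi> \<omega> - \<phi> 0 = B / (2 * \<kappa>) * ((2 * \<omega> * B / \<kappa> * s) * \<omega> - exp (- 2 * \<kappa> * \<omega>) * (s / (2 * \<kappa>)) + (B / \<kappa>\<^sup>2 * s) * \<omega> + s / (2 * \<kappa>))"
          unfolding \<phi>_def by (simp add: algebra_simps)
        ultimately show ?thesis by simp
      qed
      also have "\<dots> = C1 / \<kappa>\<^sup>2 * s"
        using \<kappa>1 by (simp add: C1_def power2_eq_square field_simps)
      finally have "norm (D \<omega>) \<le> C1 / \<kappa>\<^sup>2 * s" by (simp add: D_def J0)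
      \<comment> \<open>The mean of q is T + \<eta>: the part \<eta> produces the factor \<alpha>,
        the part T the correction \<beta> T.\<close>
      moreover have "J \<omega> = \<omega> *\<^sub>R T + (\<omega> * \<eta>) *\<^sub>R mat 1"
        using w by (simp add: J_def T scaleR_right_diff_distrib)
      then have "D \<omega> = Er"
        by (simp add: D_def Er_def \<alpha>_def \<beta>_def matrix_vector_mult_add_rdistrib scaleR_matrix_vector_complex
            scaleR_right_distrib scaleR_left_distrib algebra_simps)
      ultimately show ?thesis by simp
    qed
    define X where "X = \<alpha> *\<^sub>R U 0 + \<beta> *\<^sub>R (T *v U 0)"
    have UX: "U \<omega> = X + Er" by (simp add: X_def Er_def)
    have U0s: "norm (U 0) \<le> s" using s2 s0 by (auto intro: power2_le_imp_le)
    have Xb: "norm X \<le> C2 * s"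
    proof -
      have "norm X \<le> \<alpha> * norm (U 0) + \<beta> * norm (T *v U 0)"
        unfolding X_def using \<alpha>1 \<beta>0 by (intro order_trans[OF norm_triangle_ineq]) simp
      also have "\<dots> \<le> \<alpha> * s + \<beta> * (t * s)"
        using \<alpha>1 \<beta>0 U0s t0 unfolding t_def
        by (intro add_mono mult_left_mono order_trans[OF norm_matrix_vector_le]) auto
      also have "\<dots> = (\<alpha> + \<beta> * t) * s" by (simp add: algebra_simps)
      also have "\<dots> \<le> C2 * s"
      proof (rule mult_right_mono[OF _ s0])
        have "\<omega> * \<eta> / (2 * \<kappa>) \<le> \<omega> * \<eta> / 1" using w \<eta> \<kappa>1 by (intro divide_left_mono) auto
        moreover have "\<beta> \<le> \<omega> / 1" unfolding \<beta>_def using w \<kappa>1 by (intro divide_left_mono) auto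
        then have "\<beta> * t \<le> \<omega> * t" using t0 by (intro mult_right_mono) auto
        ultimately show "\<alpha> + \<beta> * t \<le> C2" by (simp add: \<alpha>_def C2_def)
      qed
      finally show ?thesis .
    qed
    have a: "\<alpha>\<^sup>2 * ((T *v U 0) \<bullet> U 0) + \<omega> * c\<^sup>2 / \<kappa> * (norm (U 0))\<^sup>2 - \<omega>\<^sup>2 * t ^ 3 / \<kappa>\<^sup>2 * s\<^sup>2 \<le> (T *v X) \<bullet> X"
    proof -
      define p where "p = U 0"
      define r where "r = T *v p"
      have "(T *v X) \<bullet> X = \<alpha>\<^sup>2 * (r \<bullet> p) + \<alpha> * \<beta> * (r \<bullet> r) + \<alpha> * \<beta> * ((T *v r) \<bullet> p) + \<beta>\<^sup>2 * ((T *v r) \<bullet> r)"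
        by (simp add: X_def p_def[symmetric] r_def matrix_vector_right_distrib matrix_vector_mult_scaleR_complex
            inner_add_left inner_add_right power2_eq_square algebra_simps)
      also have "(T *v r) \<bullet> p = r \<bullet> r" using hermitian_inner[OF herm, of r p] by (simp add: r_def)
      finally have eq: "(T *v X) \<bullet> X = \<alpha>\<^sup>2 * (r \<bullet> p) + 2 * \<alpha> * \<beta> * (norm r)\<^sup>2 + \<beta>\<^sup>2 * ((T *v r) \<bullet> r)"
        by (simp add: power2_norm_eq_inner)
      have rp: "norm r \<le> t * norm p" unfolding r_def t_def by (rule norm_matrix_vector_le)
      have "norm r \<le> t * s" using rp U0s t0 unfolding p_def by (meson mult_left_mono order_trans)
      then have r2: "(norm r)\<^sup>2 \<le> (t * s)\<^sup>2" by (intro power_mono) auto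
      have "- ((T *v r) \<bullet> r) \<le> norm (T *v r) * norm r" using norm_cauchy_schwarz[of "- (T *v r)" r] by simp
      also have "\<dots> \<le> t * norm r * norm r" unfolding t_def by (intro mult_right_mono norm_matrix_vector_le) auto
      also have "\<dots> \<le> t * (t * s)\<^sup>2" using r2 t0 by (simp add: mult.assoc mult_left_mono flip: power2_eq_square)
      also have "\<dots> = t ^ 3 * s\<^sup>2" by (simp add: power3_eq_cube power2_eq_square)
      finally have "\<beta>\<^sup>2 * (- ((T *v r) \<bullet> r)) \<le> \<beta>\<^sup>2 * (t ^ 3 * s\<^sup>2)" by (intro mult_left_mono) auto
      also have "\<dots> \<le> (\<omega> / \<kappa>)\<^sup>2 * (t ^ 3 * s\<^sup>2)"
        using t0 w \<kappa>1 by (intro mult_right_mono power_mono) (auto simp: \<beta>_def intro!: divide_left_mono)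
      finally have 1: "- (\<beta>\<^sup>2 * ((T *v r) \<bullet> r)) \<le> \<omega>\<^sup>2 * t ^ 3 / \<kappa>\<^sup>2 * s\<^sup>2" by (simp add: power_divide)
      \<comment> \<open>The gain: the cross term 2 \<alpha> \<beta> |T U(0)|^2 is of first order in
        1 / \<kappa> and bounded below through the lower bound \<open>c\<close> for T, so it
        dominates the errors of second order.\<close>
      have "(c * norm p)\<^sup>2 \<le> (norm r)\<^sup>2" unfolding r_def using c by (intro power_mono) auto
      then have "2 * 1 * \<beta> * (c * norm p)\<^sup>2 \<le> 2 * \<alpha> * \<beta> * (norm r)\<^sup>2"
        using \<alpha>1 \<beta>0 by (intro mult_mono) auto
      then have "\<omega> * c\<^sup>2 / \<kappa> * (norm p)\<^sup>2 \<le> 2 * \<alpha> * \<beta> * (norm r)\<^sup>2"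
        by (simp add: \<beta>_def power_mult_distrib)
      with 1 eq show ?thesis unfolding r_def p_def by linarith
    qed
    have b: "(T *v X) \<bullet> X - t * (2 * C2 * C1 + C1\<^sup>2) / \<kappa>\<^sup>2 * s\<^sup>2 \<le> (T *v U \<omega>) \<bullet> U \<omega>"
    proof -
      have eq: "(T *v U \<omega>) \<bullet> U \<omega> = (T *v X) \<bullet> X + 2 * (X \<bullet> (T *v Er)) + Er \<bullet> (T *v Er)"
        using hermitian_inner[OF herm, of X Er] hermitian_inner[OF herm, of Er X]
        by (simp add: UX matrix_vector_right_distrib inner_add_left inner_add_right inner_commute)
      have k2: "C1 / \<kappa>\<^sup>2 * s \<ge> 0" using C10 s0 by simp
      have "- (X \<bullet> (T *v Er)) \<le> norm X * t * norm Er"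
        using matrix_inner_le[of "- X" T Er] by (simp add: t_def)
      also have "\<dots> \<le> (C2 * s) * t * (C1 / \<kappa>\<^sup>2 * s)"
        using Xb Er t0 C20 s0 by (intro mult_mono) auto
      finally have 1: "- (X \<bullet> (T *v Er)) \<le> t * (C2 * C1) / \<kappa>\<^sup>2 * s\<^sup>2" by (simp add: power2_eq_square mult_ac)
      have "C1 / \<kappa>\<^sup>2 \<le> C1 / \<kappa>"
        using \<kappa>1 C10 by (intro divide_left_mono) (auto simp: power2_eq_square)
      then have Er': "norm Er \<le> C1 / \<kappa> * s" using Er s0 by (meson mult_right_mono order_trans)
      have "- (Er \<bullet> (T *v Er)) \<le> norm Er * t * norm Er"
        using matrix_inner_le[of "- Er" T Er] by (simp add: t_def)
      also have "\<dots> \<le> (C1 / \<kappa> * s) * t * (C1 / \<kappa> * s)"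
        using Er' t0 s0 C10 \<kappa>1 by (intro mult_mono) auto
      also have "\<dots> = t * C1\<^sup>2 / \<kappa>\<^sup>2 * s\<^sup>2" by (simp add: power2_eq_square)
      finally have 2: "- (Er \<bullet> (T *v Er)) \<le> t * C1\<^sup>2 / \<kappa>\<^sup>2 * s\<^sup>2" .
      have "t * (2 * C2 * C1 + C1\<^sup>2) / \<kappa>\<^sup>2 * s\<^sup>2 = 2 * (t * (C2 * C1) / \<kappa>\<^sup>2 * s\<^sup>2) + t * C1\<^sup>2 / \<kappa>\<^sup>2 * s\<^sup>2"
        by (simp add: add_divide_distrib algebra_simps)
      moreover have "x - (2 * a + b) \<le> y" if "- u \<le> a" "- v \<le> b" "y = x + 2 * u + v" for x y a b u v :: real
        using that by linarith
      ultimately show ?thesis using 1 2 eq by metis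
    qed
    have d: "(norm (W \<omega>))\<^sup>2 \<le> 1 / 2 * (norm (W 0))\<^sup>2 + 2 * B\<^sup>2 / \<kappa>\<^sup>2 * s\<^sup>2"
    proof -
      let ?a = "exp (- 2 * \<kappa> * \<omega>) * norm (W 0)" and ?b = "B / \<kappa>\<^sup>2 * s"
      have "1 \<le> \<omega> * \<kappa>" using k3 w by (simp add: field_simps)
      moreover have "1 + 2 * (\<omega> * \<kappa>) \<le> exp (2 * \<kappa> * \<omega>)"
        using exp_ge_add_one_self[of "2 * \<kappa> * \<omega>"] by (simp only: mult_ac)
      ultimately have "2 \<le> exp (2 * \<kappa> * \<omega>)" by linarith
      then have "exp (- 2 * \<kappa> * \<omega>) \<le> 1 / 2" by (simp add: exp_minus field_simps)
      then have "?a\<^sup>2 \<le> (1 / 2 * norm (W 0))\<^sup>2" by (intro power_mono mult_right_mono) auto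
      then have a: "?a\<^sup>2 \<le> 1 / 4 * (norm (W 0))\<^sup>2" by (simp add: power_mult_distrib power_divide)
      have "?b \<le> B / \<kappa> * s"
        using \<kappa>1 B0 s0 by (intro mult_right_mono divide_left_mono) (auto simp: power2_eq_square)
      then have "?b\<^sup>2 \<le> (B / \<kappa> * s)\<^sup>2" using B0 s0 by (intro power_mono) auto
      then have b: "?b\<^sup>2 \<le> B\<^sup>2 / \<kappa>\<^sup>2 * s\<^sup>2" by (simp add: power_mult_distrib power_divide)
      have "(norm (W \<omega>))\<^sup>2 \<le> (?a + ?b)\<^sup>2" using Wx[of \<omega>] w by (intro power_mono) auto
      also have "\<dots> \<le> 2 * ?a\<^sup>2 + 2 * ?b\<^sup>2" using sum_squares_bound[of ?a ?b] by (simp add: power2_sum)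
      finally show ?thesis using a b by linarith
    qed
    have e: "C3 / \<kappa>\<^sup>2 \<le> \<omega> * c\<^sup>2 / \<kappa>" "C3 / \<kappa>\<^sup>2 \<le> 1 / 2"
    proof -
      have "C3 \<le> \<omega> * c\<^sup>2 * \<kappa>" using k4 w c by (simp add: field_simps)
      then show "C3 / \<kappa>\<^sup>2 \<le> \<omega> * c\<^sup>2 / \<kappa>" using \<kappa>1 by (simp add: power2_eq_square field_simps)
      have "2 * C3 \<le> 1 * \<kappa>" using k5 by simp
      also have "\<dots> \<le> \<kappa> * \<kappa>" using \<kappa>1 by (intro mult_right_mono) auto
      finally show "C3 / \<kappa>\<^sup>2 \<le> 1 / 2" using \<kappa>1 by (simp add: power2_eq_square field_simps)
    qed
    have C3s: "C3 / \<kappa>\<^sup>2 * s\<^sup>2 = t * (2 * C2 * C1 + C1\<^sup>2) / \<kappa>\<^sup>2 * s\<^sup>2 + \<omega>\<^sup>2 * t ^ 3 / \<kappa>\<^sup>2 * s\<^sup>2 + 2 * B\<^sup>2 / \<kappa>\<^sup>2 * s\<^sup>2"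
      by (simp add: C3_def add_divide_distrib algebra_simps)
    have "C3 / \<kappa>\<^sup>2 * s\<^sup>2 \<le> \<omega> * c\<^sup>2 / \<kappa> * (norm (U 0))\<^sup>2 + 1 / 2 * (norm (W 0))\<^sup>2"
      unfolding s2 ring_distribs by (intro add_mono mult_right_mono e) auto
    moreover have "(norm (W 0))\<^sup>2 \<le> \<alpha>\<^sup>2 * (norm (W 0))\<^sup>2"
      using w \<eta> \<kappa>1 by (simp add: \<alpha>_def mult_le_cancel_right1)
    ultimately have "\<alpha>\<^sup>2 * ((T *v U 0) \<bullet> U 0) - \<alpha>\<^sup>2 * (norm (W 0))\<^sup>2 \<le> (T *v U \<omega>) \<bullet> U \<omega> - (norm (W \<omega>))\<^sup>2"
      using a b d C3s by linarith
    then show "(1 + \<omega> * \<eta> / (2 * \<kappa>))\<^sup>2 * ((T *v U 0) \<bullet> U 0 - (norm (W 0))\<^sup>2) \<le> (T *v U \<omega>) \<bullet> U \<omega> - (norm (W \<omega>))\<^sup>2"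
      by (simp only: \<alpha>_def right_diff_distrib)
  qed
qed

lemma poly_less_exp:
  fixes a d K :: real
  assumes "a > 1" "d > 0"
  shows "\<exists>n. K * (1 + real n) ^ M < d * a ^ n"
proof -
  define b where "b = ln a"
  have b: "b > 0" using assms by (simp add: b_def)
  have "filterlim (\<lambda>n. b * (1 + real n)) at_top sequentially"
    using b by (intro filterlim_tendsto_pos_mult_at_top[OF tendsto_const] filterlim_tendsto_add_at_top[OF tendsto_const] filterlim_real_sequentially) auto
  from filterlim_compose[OF tendsto_power_div_exp_0 this]
  have "(\<lambda>n. (b * (1 + real n)) ^ M / exp (b * (1 + real n))) \<longlonglongrightarrow> 0" .
  then have "(\<lambda>n. (\<bar>K\<bar> * a / b ^ M) * ((b * (1 + real n)) ^ M / exp (b * (1 + real n)))) \<longlonglongrightarrow> 0"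
    by (intro tendsto_mult_right_zero)
  then have "\<forall>\<^sub>F n in sequentially. (\<bar>K\<bar> * a / b ^ M) * ((b * (1 + real n)) ^ M / exp (b * (1 + real n))) < d"
    using assms by (intro order_tendstoD)
  then obtain n where n: "(\<bar>K\<bar> * a / b ^ M) * ((b * (1 + real n)) ^ M / exp (b * (1 + real n))) < d"
    using eventually_happens by fastforce
  have e: "exp (b * (1 + real n)) = a * a ^ n"
    using assms by (simp add: b_def ring_distribs exp_add) (simp add: mult.commute exp_of_nat_mult)
  have "\<bar>K\<bar> * (1 + real n) ^ M / a ^ n < d"
    using n b assms by (simp add: e power_mult_distrib)
  then have "\<bar>K\<bar> * (1 + real n) ^ M < d * a ^ n"
    using assms by (simp add: pos_divide_less_eq)
  moreover have "K * (1 + real n) ^ M \<le> \<bar>K\<bar> * (1 + real n) ^ M" by (intro mult_right_mono) auto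
  ultimately have "K * (1 + real n) ^ M < d * a ^ n" by linarith
  then show ?thesis ..
qed

section \<open>Periodic functions and Hermitian matrices\<close>

lemma periodic_shift_int:
  fixes Q :: "real \<Rightarrow> 'a"
  assumes per: "\<And>x. Q (x + \<omega>) = Q x"
  shows "Q (x + of_int k * \<omega>) = Q x"
proof -
  have nat: "Q (x + real n * \<omega>) = Q x" for n x
  proof (induction n)
    case (Suc n)
    have "Q (x + real (Suc n) * \<omega>) = Q (x + real n * \<omega> + \<omega>)" by (simp add: algebra_simps)
    then show ?case using per Suc by simp
  qed simp
  show ?thesis
  proof (cases "k \<ge> 0")
    case True
    then show ?thesis using nat[of x "nat k"] by simp
  next
    case False
    then show ?thesis using nat[of "x + of_int k * \<omega>" "nat (- k)"] by (simp add: algebra_simps)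
  qed
qed

lemma periodic_continuous_bounded:
  fixes Q :: "real \<Rightarrow> 'a::real_normed_vector"
  assumes "continuous_on UNIV Q" and per: "\<And>x. Q (x + \<omega>) = Q x" and w: "\<omega> > 0"
  shows "\<exists>B\<ge>0. \<forall>x. norm (Q x) \<le> B"
proof -
  have "bounded (Q ` {0..\<omega>})"
    by (intro compact_imp_bounded compact_continuous_image continuous_on_subset[OF assms(1)]) auto
  then obtain B where "\<forall>x\<in>{0..\<omega>}. norm (Q x) \<le> B" by (auto simp: bounded_iff)
  then have B: "norm (Q x) \<le> B" if "x \<in> {0..\<omega>}" for x using that by blast
  have "norm (Q x) \<le> B" for x
  proof -
    let ?k = "- \<lfloor>x / \<omega>\<rfloor>"
    have "of_int \<lfloor>x / \<omega>\<rfloor> \<le> x / \<omega>" "x / \<omega> \<le> of_int \<lfloor>x / \<omega>\<rfloor> + 1" by linarith+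
    then have "of_int \<lfloor>x / \<omega>\<rfloor> * \<omega> \<le> x" "x \<le> (of_int \<lfloor>x / \<omega>\<rfloor> + 1) * \<omega>"
      by (simp_all only: pos_le_divide_eq[OF w] pos_divide_le_eq[OF w])
    then have "x + of_int ?k * \<omega> \<in> {0..\<omega>}" by (simp add: algebra_simps)
    then have "norm (Q (x + of_int ?k * \<omega>)) \<le> B" by (rule B)
    then show ?thesis by (simp only: periodic_shift_int[of Q \<omega>, OF per])
  qed
  moreover have "B \<ge> 0" using B[of 0] w norm_ge_zero[of "Q 0"] by (simp del: norm_ge_zero)
  ultimately show ?thesis by blast
qed

lemma conj_transpose_diff: "conj_transpose (A - B) = conj_transpose A - conj_transpose B"
  and conj_transpose_add: "conj_transpose (A + B) = conj_transpose A + conj_transpose B"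
  and conj_transpose_scaleR: "conj_transpose (r *\<^sub>R A) = r *\<^sub>R conj_transpose A"
  and conj_transpose_mat_1: "conj_transpose (mat 1) = mat 1"
  by (simp_all add: conj_transpose_def transpose_def map_matrix_def vec_eq_iff mat_def)

lemma bounded_linear_conj_transpose: "bounded_linear (conj_transpose :: complex ^ 'n ^ 'm \<Rightarrow> _)"
  unfolding linear_conv_bounded_linear[symmetric]
  by (rule linearI) (simp_all add: conj_transpose_add conj_transpose_scaleR)

text \<open>Eigenvectors for different eigenvalues are orthogonal, hence independent. This allows a
  level \<eta> to be chosen that avoids the eigenvalues of the mean of q.\<close>

lemma finite_real_eigenvalues:
  fixes A :: "complex ^ 'm ^ 'm"
  assumes herm: "conj_transpose A = A"
  shows "finite {\<eta>::real. \<exists>u. u \<noteq> 0 \<and> A *v u = \<eta> *\<^sub>R u}"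
proof -
  let ?S = "{\<eta>::real. \<exists>u. u \<noteq> 0 \<and> A *v u = \<eta> *\<^sub>R u}"
  obtain e where e: "\<And>\<eta>. \<eta> \<in> ?S \<Longrightarrow> e \<eta> \<noteq> 0 \<and> A *v e \<eta> = \<eta> *\<^sub>R e \<eta>" 
    using bchoice[of ?S "\<lambda>\<eta> u. u \<noteq> 0 \<and> A *v u = \<eta> *\<^sub>R u"] by auto
  have orth: "e \<eta> \<bullet> e \<theta> = 0" if "\<eta> \<in> ?S" "\<theta> \<in> ?S" "\<eta> \<noteq> \<theta>" for \<eta> \<theta>
  proof -
    have "\<eta> * (e \<eta> \<bullet> e \<theta>) = \<theta> * (e \<eta> \<bullet> e \<theta>)"
      using hermitian_inner[OF herm, of "e \<eta>" "e \<theta>"] e[OF that(1)] e[OF that(2)] by simp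
    then show ?thesis using that by simp
  qed
  have inj: "inj_on e ?S"
  proof (rule inj_onI, rule ccontr)
    fix \<eta> \<theta> assume *: "\<eta> \<in> ?S" "\<theta> \<in> ?S" "e \<eta> = e \<theta>" "\<eta> \<noteq> \<theta>"
    then have "e \<eta> \<bullet> e \<eta> = 0" using orth[of \<eta> \<theta>] by simp
    then show False using e[OF *(1)] by simp
  qed
  have "pairwise orthogonal (e ` ?S)"
    using orth by (auto simp: pairwise_def orthogonal_def)
  moreover have "0 \<notin> e ` ?S"
  proof
    assume "0 \<in> e ` ?S"
    then obtain \<eta> where "\<eta> \<in> ?S" "e \<eta> = 0" by force
    then show False using e[of \<eta>] by blast
  qed
  ultimately have "independent (e ` ?S)" by (rule pairwise_orthogonal_independent)
  then have "finite (e ` ?S)" using independent_bound by blast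
  then show ?thesis using inj finite_imageD by blast
qed

lemma scaleR_eq_scale: "r *\<^sub>R (v :: complex ^ 'm) = of_real r *s v"
  by (simp add: vec_eq_iff scaleR_conv_of_real[where 'a=complex])

text \<open>If the mean of q were positive in the direction v, the cone form would start at a
  positive value and gain a fixed factor above 1 in every period, whereas the growth bound keeps exp
  (- \<kappa> x) (y' + \<kappa> y) polynomial.\<close>

lemma mean_potential_nonpos:
  fixes Q :: "real \<Rightarrow> complex ^ 'm ^ 'm" and E \<omega> :: real
  assumes Q: "continuous_on UNIV Q" and per: "\<And>x. Q (x + \<omega>) = Q x" and w: "\<omega> > 0"
    and herm: "\<And>x. conj_transpose (Q x) = Q x"
    and pow: "\<And>n \<kappa> c. \<kappa> > 0 \<Longrightarrow> norm (mpow (schr_prop Q (of_real (E - \<kappa>\<^sup>2)) \<omega>) n c)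
      \<le> K * (1 + real n) ^ N * (1 + \<kappa>) ^ Suc N * exp (real n * \<omega> * \<kappa>) * norm c"
  shows "(integral {0..\<omega>} (\<lambda>x. Q x - E *\<^sub>R mat 1) *v v) \<bullet> v \<le> 0"
proof (rule ccontr)
  assume neg: "\<not> ?thesis"
  define q where "q = (\<lambda>x. Q x - E *\<^sub>R mat 1)"
  have cq: "continuous_on UNIV q" unfolding q_def by (intro continuous_intros Q)
  have perq: "q (x + \<omega>) = q x" for x by (simp add: q_def per)
  obtain B where B: "\<And>x. norm (q x) \<le> B" using periodic_continuous_bounded[OF cq perq w] by blast
  define A where "A = (1 / \<omega>) *\<^sub>R integral {0..\<omega>} q"
  have v: "(A *v v) \<bullet> v > 0" using neg w by (simp add: A_def q_def scaleR_matrix_vector_complex)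
  then have v0: "v \<noteq> 0" by auto
  have hermA: "conj_transpose A = A"
  proof -
    have "conj_transpose (integral {0..\<omega>} q) = integral {0..\<omega>} (conj_transpose \<circ> q)"
      by (rule integral_linear[symmetric, OF integrable_continuous_real[OF continuous_on_subset[OF cq]] bounded_linear_conj_transpose]) auto
    also have "conj_transpose \<circ> q = q"
      by (simp add: fun_eq_iff q_def conj_transpose_diff conj_transpose_scaleR conj_transpose_mat_1 herm)
    finally show ?thesis by (simp add: A_def conj_transpose_scaleR)
  qed
  \<comment> \<open>\<eta> is taken below the Rayleigh quotient of v, so that the form of T is
    positive at v, and off the finitely many eigenvalues, so that T is invertible.\<close>
  have "infinite {0<..<(A *v v) \<bullet> v / (norm v)\<^sup>2}" using v v0 by (intro infinite_Ioo) simp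
  then have "\<not> {0<..<(A *v v) \<bullet> v / (norm v)\<^sup>2} \<subseteq> {\<eta>::real. \<exists>u. u \<noteq> 0 \<and> A *v u = \<eta> *\<^sub>R u}"
    using finite_real_eigenvalues[OF hermA] finite_subset by blast
  then obtain \<eta> where "\<eta> \<in> {0<..<(A *v v) \<bullet> v / (norm v)\<^sup>2}" "\<eta> \<notin> {\<eta>::real. \<exists>u. u \<noteq> 0 \<and> A *v u = \<eta> *\<^sub>R u}"
    by blast
  then have \<eta>: "0 < \<eta>" "\<eta> < (A *v v) \<bullet> v / (norm v)\<^sup>2" and ne: "\<And>u. A *v u = \<eta> *\<^sub>R u \<Longrightarrow> u = 0"
    by auto
  define T where "T = A - \<eta> *\<^sub>R mat 1"
  have T_eq: "T = (1 / \<omega>) *\<^sub>R integral {0..\<omega>} q - \<eta> *\<^sub>R mat 1" by (simp add: T_def A_def)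
  have Tv: "T *v u = A *v u - \<eta> *\<^sub>R u" for u
    by (simp add: T_def matrix_vector_mult_diff_rdistrib scaleR_matrix_vector_complex)
  have hermT: "conj_transpose T = T" by (simp add: T_def conj_transpose_diff conj_transpose_scaleR conj_transpose_mat_1 hermA)
  have linT: "linear ((*v) T)"
    by (rule linearI) (simp_all add: matrix_vector_right_distrib matrix_vector_mult_scaleR_complex)
  have "inj ((*v) T)"
    unfolding linear_injective_0[OF linT] using ne by (auto simp: Tv)
  then obtain c where c: "c > 0" "\<And>u. c * norm u \<le> norm (T *v u)"
    using linear_inj_bounded_below_pos[OF linT] by blast
  have Tv0: "(T *v v) \<bullet> v > 0"
    using \<eta>(2) v0 by (simp add: Tv inner_diff_left power2_norm_eq_inner field_simps)
  obtain \<kappa> where \<kappa>: "\<kappa> > 0" and step: "\<forall>U W.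
    (\<forall>x\<in>{0..\<omega>}. (U has_vector_derivative (1 / (2 * \<kappa>)) *\<^sub>R (q x *v (U x - W x))) (at x)) \<longrightarrow>
    (\<forall>x\<in>{0..\<omega>}. (W has_vector_derivative (1 / (2 * \<kappa>)) *\<^sub>R (q x *v (U x - W x)) - (2 * \<kappa>) *\<^sub>R W x) (at x)) \<longrightarrow>
    (1 + \<omega> * \<eta> / (2 * \<kappa>))\<^sup>2 * ((T *v U 0) \<bullet> U 0 - (norm (W 0))\<^sup>2) \<le> (T *v U \<omega>) \<bullet> U \<omega> - (norm (W \<omega>))\<^sup>2"
    using cone_step[OF cq B w T_eq hermT \<eta>(1) c] by (elim exE conjE) (rule that; assumption)
  define z where "z = complex_of_real (E - \<kappa>\<^sup>2)"
  \<comment> \<open>The data y = v / (2 \<kappa>), y' = v / 2 select the growing component: U(0) = v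
    and W(0) = 0.\<close>
  define c0 where "c0 = join ((1 / (2 * \<kappa>)) *\<^sub>R v) ((1 / 2) *\<^sub>R v)"
  define y where "y = (\<lambda>x. lo (schr_prop Q z x *v c0))"
  define y' where "y' = (\<lambda>x. hi (schr_prop Q z x *v c0))"
  define U where "U = (\<lambda>x. exp (- \<kappa> * x) *\<^sub>R (y' x + \<kappa> *\<^sub>R y x))"
  define W where "W = (\<lambda>x. exp (- \<kappa> * x) *\<^sub>R (y' x - \<kappa> *\<^sub>R y x))"
  have dy: "(y has_vector_derivative y' x) (at x)" for x
    unfolding y_def y'_def by (rule has_vector_derivative_lo_hi_schr_prop[OF Q])
  have dy': "(y' has_vector_derivative q x *v y x + \<kappa>\<^sup>2 *\<^sub>R y x) (at x)" for x
  proof -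
    have "Q x *v y x - z *s y x = q x *v y x + \<kappa>\<^sup>2 *\<^sub>R y x"
      by (simp add: q_def z_def matrix_vector_mult_diff_rdistrib scaleR_matrix_vector_complex scaleR_eq_scale
          vec.scale_left_diff_distrib)
    then show ?thesis
      using has_vector_derivative_lo_hi_schr_prop(2)[OF Q, of z c0 x] unfolding y_def y'_def by simp
  qed
  have de: "((\<lambda>x. exp (- \<kappa> * x)) has_real_derivative - \<kappa> * exp (- \<kappa> * x)) (at x)" for x
    by (auto intro!: derivative_eq_intros)
  have UW: "U x - W x = (2 * \<kappa> * exp (- \<kappa> * x)) *\<^sub>R y x" for x
    by (simp add: U_def W_def algebra_simps scaleR_2[symmetric])
  have qUW: "(1 / (2 * \<kappa>)) *\<^sub>R (q x *v (U x - W x)) = exp (- \<kappa> * x) *\<^sub>R (q x *v y x)" for x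
    using \<kappa> by (simp only: UW matrix_vector_mult_scaleR_complex) simp
  have id1: "e *\<^sub>R ((g + \<kappa>\<^sup>2 *\<^sub>R u) + \<kappa> *\<^sub>R u') + (- \<kappa> * e) *\<^sub>R (u' + \<kappa> *\<^sub>R u) = e *\<^sub>R g"
    and id2: "e *\<^sub>R ((g + \<kappa>\<^sup>2 *\<^sub>R u) - \<kappa> *\<^sub>R u') + (- \<kappa> * e) *\<^sub>R (u' - \<kappa> *\<^sub>R u)
      = e *\<^sub>R g - (2 * \<kappa>) *\<^sub>R (e *\<^sub>R (u' - \<kappa> *\<^sub>R u))" for e and g u u' :: "complex ^ 'm"
    by (simp_all add: vec_eq_iff scaleR_conv_of_real[where 'a=complex] algebra_simps power2_eq_square)
  have dU: "(U has_vector_derivative (1 / (2 * \<kappa>)) *\<^sub>R (q x *v (U x - W x))) (at x)" for x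
  proof -
    have "(U has_vector_derivative exp (- \<kappa> * x) *\<^sub>R ((q x *v y x + \<kappa>\<^sup>2 *\<^sub>R y x) + \<kappa> *\<^sub>R y' x)
        + (- \<kappa> * exp (- \<kappa> * x)) *\<^sub>R (y' x + \<kappa> *\<^sub>R y x)) (at x)"
      unfolding U_def
      by (intro has_vector_derivative_scaleR de has_vector_derivative_add dy'
          bounded_linear.has_vector_derivative[OF bounded_linear_scaleR_right] dy)
    also have "exp (- \<kappa> * x) *\<^sub>R ((q x *v y x + \<kappa>\<^sup>2 *\<^sub>R y x) + \<kappa> *\<^sub>R y' x)
        + (- \<kappa> * exp (- \<kappa> * x)) *\<^sub>R (y' x + \<kappa> *\<^sub>R y x) = (1 / (2 * \<kappa>)) *\<^sub>R (q x *v (U x - W x))"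
      by (simp only: id1 qUW)
    finally show ?thesis .
  qed
  have dW: "(W has_vector_derivative (1 / (2 * \<kappa>)) *\<^sub>R (q x *v (U x - W x)) - (2 * \<kappa>) *\<^sub>R W x) (at x)" for x
  proof -
    have "(W has_vector_derivative exp (- \<kappa> * x) *\<^sub>R ((q x *v y x + \<kappa>\<^sup>2 *\<^sub>R y x) - \<kappa> *\<^sub>R y' x)
        + (- \<kappa> * exp (- \<kappa> * x)) *\<^sub>R (y' x - \<kappa> *\<^sub>R y x)) (at x)"
      unfolding W_def
      by (intro has_vector_derivative_scaleR de has_vector_derivative_diff dy'
          bounded_linear.has_vector_derivative[OF bounded_linear_scaleR_right] dy)
    also have "exp (- \<kappa> * x) *\<^sub>R ((q x *v y x + \<kappa>\<^sup>2 *\<^sub>R y x) - \<kappa> *\<^sub>R y' x)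
        + (- \<kappa> * exp (- \<kappa> * x)) *\<^sub>R (y' x - \<kappa> *\<^sub>R y x) = (1 / (2 * \<kappa>)) *\<^sub>R (q x *v (U x - W x)) - (2 * \<kappa>) *\<^sub>R W x"
      by (simp only: id2 qUW) (simp add: W_def)
    finally show ?thesis .
  qed
  define \<Phi> where "\<Phi> = (\<lambda>x. (T *v U x) \<bullet> U x - (norm (W x))\<^sup>2)"
  define a where "a = (1 + \<omega> * \<eta> / (2 * \<kappa>))\<^sup>2"
  have \<Phi>_step: "a * \<Phi> (real n * \<omega>) \<le> \<Phi> (real (Suc n) * \<omega>)" for n
  proof -
    have q_per: "q (x + real n * \<omega>) = q x" for x
      using periodic_shift_int[of q \<omega> x "int n", OF perq] by simp
    have shift: "((\<lambda>x. F (x + real n * \<omega>)) has_vector_derivative F') (at x)"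
      if "(F has_vector_derivative F') (at (x + real n * \<omega>))" for F :: "real \<Rightarrow> complex ^ 'm" and F' x
      using vector_diff_chain_at[of "\<lambda>x. x + real n * \<omega>" 1 x, OF _ that] by (simp add: o_def has_vector_derivative_add_const)
    have "a * ((T *v U (0 + real n * \<omega>)) \<bullet> U (0 + real n * \<omega>) - (norm (W (0 + real n * \<omega>)))\<^sup>2)
        \<le> (T *v U (\<omega> + real n * \<omega>)) \<bullet> U (\<omega> + real n * \<omega>) - (norm (W (\<omega> + real n * \<omega>)))\<^sup>2"
      unfolding a_def
    proof (rule step[rule_format])
      fix x
      show "((\<lambda>x. U (x + real n * \<omega>)) has_vector_derivative (1 / (2 * \<kappa>)) *\<^sub>R (q x *v (U (x + real n * \<omega>) - W (x + real n * \<omega>)))) (at x)"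
        using shift[OF dU[of "x + real n * \<omega>"]] by (simp add: q_per)
      show "((\<lambda>x. W (x + real n * \<omega>)) has_vector_derivative (1 / (2 * \<kappa>)) *\<^sub>R (q x *v (U (x + real n * \<omega>) - W (x + real n * \<omega>))) - (2 * \<kappa>) *\<^sub>R W (x + real n * \<omega>)) (at x)"
        using shift[OF dW[of "x + real n * \<omega>"]] by (simp add: q_per)
    qed
    then show ?thesis by (simp add: \<Phi>_def algebra_simps)
  qed
  have a1: "a > 1" unfolding a_def using w \<eta>(1) \<kappa> by (intro one_less_power) auto
  have low: "\<Phi> 0 * a ^ n \<le> \<Phi> (real n * \<omega>)" for n
  proof (induction n)
    case (Suc n)
    have "\<Phi> 0 * a ^ Suc n \<le> a * \<Phi> (real n * \<omega>)" using Suc a1 by simp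
    also have "\<dots> \<le> \<Phi> (real (Suc n) * \<omega>)" by (rule \<Phi>_step)
    finally show ?case .
  qed simp
  have "y 0 = (1 / (2 * \<kappa>)) *\<^sub>R v" "y' 0 = (1 / 2) *\<^sub>R v"
    by (simp_all add: y_def y'_def c0_def continuous_sysmat[OF Q])
  then have "U 0 = v" "W 0 = 0"
    using \<kappa> by (simp_all add: U_def W_def flip: scaleR_left_distrib)
  then have \<Phi>0: "\<Phi> 0 > 0" using Tv0 by (simp add: \<Phi>_def)
  define K' where "K' = (1 + \<kappa>) * (\<bar>K\<bar> * (1 + \<kappa>) ^ Suc N * norm c0)"
  have up: "\<Phi> (real n * \<omega>) \<le> norm T * K'\<^sup>2 * (1 + real n) ^ (N * 2)" for n
  proof -
    let ?Y = "schr_prop Q z (real n * \<omega>) *v c0"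
    have "norm ?Y \<le> K * (1 + real n) ^ N * (1 + \<kappa>) ^ Suc N * exp (real n * \<omega> * \<kappa>) * norm c0"
      using pow[OF \<kappa>, of n c0] by (simp add: schr_prop_mult_period[OF Q per w] z_def)
    also have "\<dots> \<le> \<bar>K\<bar> * (1 + real n) ^ N * (1 + \<kappa>) ^ Suc N * exp (real n * \<omega> * \<kappa>) * norm c0"
      using \<kappa> by (intro mult_right_mono) auto
    finally have Y: "norm ?Y \<le> \<bar>K\<bar> * (1 + real n) ^ N * (1 + \<kappa>) ^ Suc N * exp (real n * \<omega> * \<kappa>) * norm c0" .
    have "norm (hi ?Y + \<kappa> *\<^sub>R lo ?Y) \<le> norm ?Y + \<kappa> * norm ?Y"
      using \<kappa> by (intro order_trans[OF norm_triangle_ineq] add_mono) (auto simp: norm_hi_le norm_lo_le)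
    also have "\<dots> = (1 + \<kappa>) * norm ?Y" by (simp add: algebra_simps)
    finally have "norm (U (real n * \<omega>)) \<le> exp (- \<kappa> * (real n * \<omega>)) * ((1 + \<kappa>) * norm ?Y)"
      unfolding U_def y_def y'_def norm_scaleR abs_exp_cancel by (intro mult_left_mono) auto
    also have "\<dots> \<le> exp (- \<kappa> * (real n * \<omega>)) * ((1 + \<kappa>) * (\<bar>K\<bar> * (1 + real n) ^ N * (1 + \<kappa>) ^ Suc N * exp (real n * \<omega> * \<kappa>) * norm c0))"
      using \<kappa> by (intro mult_left_mono Y) auto
    also have "\<dots> = (exp (- \<kappa> * (real n * \<omega>)) * exp (real n * \<omega> * \<kappa>)) * (K' * (1 + real n) ^ N)"
      by (simp add: K'_def mult_ac)
    also have "exp (- \<kappa> * (real n * \<omega>)) * exp (real n * \<omega> * \<kappa>) = 1" by (simp add: mult_ac flip: exp_add)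
    finally have Ub: "norm (U (real n * \<omega>)) \<le> K' * (1 + real n) ^ N" by simp
    \<comment> \<open>The subtracted |W|^2 only lowers the form, so an estimate for U is
      enough.\<close>
    have "\<Phi> (real n * \<omega>) \<le> norm (U (real n * \<omega>)) * norm T * norm (U (real n * \<omega>))"
      using matrix_inner_le[of "U (real n * \<omega>)" T "U (real n * \<omega>)"] by (simp add: \<Phi>_def inner_commute) (smt (verit) zero_le_power2)
    also have "\<dots> = norm T * (norm (U (real n * \<omega>)))\<^sup>2" by (simp add: power2_eq_square)
    also have "\<dots> \<le> norm T * (K' * (1 + real n) ^ N)\<^sup>2" by (intro mult_left_mono power_mono Ub) auto
    finally show ?thesis by (simp add: power_mult_distrib power_mult mult.assoc)
  qed
  obtain n where "norm T * K'\<^sup>2 * (1 + real n) ^ (N * 2) < \<Phi> 0 * a ^ n"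
    using poly_less_exp[OF a1 \<Phi>0] by blast
  with low[of n] up[of n] show False by linarith
qed

section \<open>Square integrable functions\<close>

lemma bounded_linear_scale: "bounded_linear (\<lambda>v::complex ^ 'n. r *s v)"
  by (rule bounded_linear_intro[of _ "norm r"])
     (auto simp: vec.scale_right_distrib norm_scale_vec mult.commute, auto simp: vec_eq_iff)

lemma measurable_scale [measurable]:
  "f \<in> borel_measurable M \<Longrightarrow> (\<lambda>x. r *s (f x :: complex ^ 'n)) \<in> borel_measurable M"
  by (rule measurable_compose[OF _ borel_measurable_continuous_onI])
     (auto intro: linear_continuous_on bounded_linear_scale)

lemma measurable_vec_nth_complex [measurable]:
  "f \<in> borel_measurable M \<Longrightarrow> (\<lambda>x. (f x :: complex ^ 'n) $ i) \<in> borel_measurable M"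
  by (rule measurable_compose[OF _ borel_measurable_continuous_onI])
     (auto intro: continuous_intros)

lemma measurable_cinner [measurable]:
  fixes f g :: "'a \<Rightarrow> complex ^ 'n"
  assumes [measurable]: "f \<in> borel_measurable M" "g \<in> borel_measurable M"
  shows "(\<lambda>x. cinner (f x) (g x)) \<in> borel_measurable M"
proof -
  have "(\<lambda>x. cnj (g x $ i)) \<in> borel_measurable M" for i
    by (rule measurable_compose[OF measurable_vec_nth_complex[OF assms(2)] borel_measurable_continuous_onI])
       (auto intro: continuous_intros)
  then show ?thesis unfolding cinner_def by measurable
qed

lemma L2D: "f \<in> L2 M \<Longrightarrow> f \<in> borel_measurable M" "f \<in> L2 M \<Longrightarrow> integrable M (\<lambda>x. (norm (f x))\<^sup>2)"
  by (auto simp: L2_def)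

lemma L2_bound:
  assumes g: "g \<in> L2 M" and f: "f \<in> borel_measurable M" and "AE x in M. norm (f x) \<le> C * norm (g x)"
  shows "f \<in> L2 M"
proof -
  have "integrable M (\<lambda>x. C\<^sup>2 * (norm (g x))\<^sup>2)" using L2D(2)[OF g] by simp
  moreover have "(\<lambda>x. (norm (f x))\<^sup>2) \<in> borel_measurable M" using f by measurable
  moreover have "AE x in M. norm ((norm (f x))\<^sup>2) \<le> norm (C\<^sup>2 * (norm (g x))\<^sup>2)"
    using assms(3)
  proof eventually_elim
    case (elim x)
    then have "(norm (f x))\<^sup>2 \<le> (C * norm (g x))\<^sup>2" by (intro power_mono) auto
    then show ?case by (simp add: power_mult_distrib)
  qed
  ultimately have "integrable M (\<lambda>x. (norm (f x))\<^sup>2)" by (rule Bochner_Integration.integrable_bound)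
  with f show ?thesis by (simp add: L2_def)
qed

lemma L2_add:
  assumes f: "f \<in> L2 M" and g: "g \<in> L2 M"
  shows "(\<lambda>x. f x + g x) \<in> L2 M"
proof -
  have [measurable]: "f \<in> borel_measurable M" "g \<in> borel_measurable M" using L2D assms by auto
  have "integrable M (\<lambda>x. 2 * (norm (f x))\<^sup>2 + 2 * (norm (g x))\<^sup>2)" using L2D(2)[OF f] L2D(2)[OF g] by simp
  moreover have "(\<lambda>x. (norm (f x + g x))\<^sup>2) \<in> borel_measurable M" by measurable
  moreover have "norm ((norm (f x + g x))\<^sup>2) \<le> norm (2 * (norm (f x))\<^sup>2 + 2 * (norm (g x))\<^sup>2)" for x
  proof -
    have "(norm (f x + g x))\<^sup>2 \<le> (norm (f x) + norm (g x))\<^sup>2" by (intro power_mono norm_triangle_ineq) auto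
    also have "\<dots> \<le> 2 * (norm (f x))\<^sup>2 + 2 * (norm (g x))\<^sup>2"
      using sum_squares_bound[of "norm (f x)" "norm (g x)"] by (simp add: power2_sum)
    finally show ?thesis by simp
  qed
  ultimately have "integrable M (\<lambda>x. (norm (f x + g x))\<^sup>2)" by (auto intro: Bochner_Integration.integrable_bound)
  then show ?thesis by (simp add: L2_def)
qed

lemma L2_scale:
  assumes f: "f \<in> L2 M" shows "(\<lambda>x. a *s f x) \<in> L2 M"
  by (rule L2_bound[OF f]) (use L2D[OF f] in \<open>auto simp: norm_scale_vec\<close>)

lemma L2_lincomb: "f \<in> L2 M \<Longrightarrow> g \<in> L2 M \<Longrightarrow> (\<lambda>x. a *s f x + b *s g x) \<in> L2 M"
  by (intro L2_add L2_scale)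

lemma L2_diff: "f \<in> L2 M \<Longrightarrow> g \<in> L2 M \<Longrightarrow> (\<lambda>x. f x - g x) \<in> L2 M"
  using L2_lincomb[of f M g 1 "-1"] by simp

lemma L2_diff_scale: "f \<in> L2 M \<Longrightarrow> g \<in> L2 M \<Longrightarrow> (\<lambda>x. f x - z *s g x) \<in> L2 M"
  using L2_lincomb[of f M g 1 "-z"] by simp

lemma L2_sum: "(\<And>i. i \<in> I \<Longrightarrow> f i \<in> L2 M) \<Longrightarrow> (\<lambda>x. \<Sum>i\<in>I. f i x) \<in> L2 M"
  by (induction I rule: infinite_finite_induct) (auto simp: L2_add, auto simp: L2_def)

lemma L2_norm_nonneg [simp]: "L2_norm M f \<ge> 0"
  by (simp add: L2_norm_def)

lemma L2_norm_sq: "(L2_norm M f)\<^sup>2 = (\<integral>x. (norm (f x))\<^sup>2 \<partial>M)"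
  by (simp add: L2_norm_def)

lemma L2_inner_eq: "L2_inner M f g = (\<integral>x. cinner (f x) (g x) \<partial>M)"
  by (simp add: L2_inner_def cinner_def)

lemma L2_inner_self: "L2_inner M f f = of_real ((L2_norm M f)\<^sup>2)"
  unfolding L2_inner_eq cinner_self L2_norm_sq by (rule integral_complex_of_real)

lemma integrable_cinner:
  assumes f: "f \<in> L2 M" and g: "g \<in> L2 M"
  shows "integrable M (\<lambda>x. cinner (f x) (g x))" "integrable M (\<lambda>x. norm (f x) * norm (g x))"
proof -
  have [measurable]: "f \<in> borel_measurable M" "g \<in> borel_measurable M" using L2D assms by auto
  have i: "integrable M (\<lambda>x. (norm (f x))\<^sup>2 + (norm (g x))\<^sup>2)" using L2D(2)[OF f] L2D(2)[OF g] by simp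
  have n: "norm (f x) * norm (g x) \<le> (norm (f x))\<^sup>2 + (norm (g x))\<^sup>2" for x
  proof -
    have "2 * (norm (f x) * norm (g x)) \<le> (norm (f x))\<^sup>2 + (norm (g x))\<^sup>2"
      using sum_squares_bound[of "norm (f x)" "norm (g x)"] by (simp only: mult.assoc)
    moreover have "0 \<le> norm (f x) * norm (g x)" by simp
    ultimately show ?thesis by linarith
  qed
  show "integrable M (\<lambda>x. cinner (f x) (g x))"
    by (rule Bochner_Integration.integrable_bound[OF i]) (auto intro!: order_trans[OF norm_cinner_le n])
  show "integrable M (\<lambda>x. norm (f x) * norm (g x))"
    by (rule Bochner_Integration.integrable_bound[OF i]) (auto intro!: n)
qed

lemma L2_norm_zero_AE:
  assumes "f \<in> L2 M" "L2_norm M f = 0"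
  shows "AE x in M. f x = 0"
proof -
  have "(\<integral>x. (norm (f x))\<^sup>2 \<partial>M) = 0" using assms(2) L2_norm_sq[of M f] by simp
  then have "AE x in M. (norm (f x))\<^sup>2 = 0"
    using integral_nonneg_eq_0_iff_AE[OF L2D(2)[OF assms(1)]] by simp
  then show ?thesis by eventually_elim simp
qed

lemma L2_inner_cong_AE:
  assumes "AE x in M. f x = f' x" "AE x in M. g x = g' x"
    and "f \<in> L2 M" "f' \<in> L2 M" "g \<in> L2 M" "g' \<in> L2 M"
  shows "L2_inner M f g = L2_inner M f' g'"
  unfolding L2_inner_eq
proof (rule integral_cong_AE)
  show "(\<lambda>x. cinner (f x) (g x)) \<in> borel_measurable M" using assms(3,5)[THEN L2D(1)] by measurable
  show "(\<lambda>x. cinner (f' x) (g' x)) \<in> borel_measurable M" using assms(4,6)[THEN L2D(1)] by measurable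
  show "AE x in M. cinner (f x) (g x) = cinner (f' x) (g' x)"
    using assms(1,2) by eventually_elim simp
qed

lemma L2_norm_cong_AE:
  assumes "AE x in M. f x = g x" "f \<in> L2 M" "g \<in> L2 M"
  shows "L2_norm M f = L2_norm M g"
proof -
  have "complex_of_real ((L2_norm M f)\<^sup>2) = of_real ((L2_norm M g)\<^sup>2)"
    unfolding L2_inner_self[symmetric] by (rule L2_inner_cong_AE) (use assms in auto)
  then have "(L2_norm M f)\<^sup>2 = (L2_norm M g)\<^sup>2" by (simp only: of_real_eq_iff)
  then show ?thesis by (simp add: power2_eq_iff_nonneg)
qed

text \<open>A pointwise inequality of arithmetic and geometric means, with the weights b / (2 a) and
  a / (2 b) that are optimal for norms a and b; vanishing norms are treated apart.\<close>

lemma L2_Cauchy_Schwarz: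
  assumes f: "f \<in> L2 M" and g: "g \<in> L2 M"
  shows "norm (L2_inner M f g) \<le> L2_norm M f * L2_norm M g"
proof (cases "L2_norm M f = 0 \<or> L2_norm M g = 0")
  case True
  then have "AE x in M. cinner (f x) (g x) = 0"
    using L2_norm_zero_AE[OF f] L2_norm_zero_AE[OF g] by (auto elim!: eventually_mono)
  then have "L2_inner M f g = 0" unfolding L2_inner_eq by (rule integral_eq_zero_AE)
  then show ?thesis by simp
next
  case False
  define a where "a = L2_norm M f"
  define b where "b = L2_norm M g"
  have ab: "a > 0" "b > 0" using False by (auto simp: a_def b_def less_le)
  have "norm (L2_inner M f g) \<le> (\<integral>x. norm (f x) * norm (g x) \<partial>M)"
    unfolding L2_inner_eq
    by (rule order_trans[OF integral_norm_bound integral_mono])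
       (auto intro!: integrable_cinner integrable_norm f g norm_cinner_le)
  also have "\<dots> \<le> (\<integral>x. (b / (2 * a)) * (norm (f x))\<^sup>2 + (a / (2 * b)) * (norm (g x))\<^sup>2 \<partial>M)"
  proof (rule integral_mono)
    show "integrable M (\<lambda>x. norm (f x) * norm (g x))" by (rule integrable_cinner[OF f g])
    show "integrable M (\<lambda>x. (b / (2 * a)) * (norm (f x))\<^sup>2 + (a / (2 * b)) * (norm (g x))\<^sup>2)"
      using L2D(2)[OF f] L2D(2)[OF g] by simp
    fix x
    have "0 \<le> (b * norm (f x) - a * norm (g x))\<^sup>2" by simp
    then show "norm (f x) * norm (g x) \<le> (b / (2 * a)) * (norm (f x))\<^sup>2 + (a / (2 * b)) * (norm (g x))\<^sup>2"
      using ab by (simp add: field_simps power2_eq_square)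
  qed
  also have "\<dots> = (b / (2 * a)) * a\<^sup>2 + (a / (2 * b)) * b\<^sup>2"
    using L2D(2)[OF f] L2D(2)[OF g] by (simp add: a_def b_def L2_norm_sq)
  also have "\<dots> = a * b" using ab by (simp add: field_simps power2_eq_square)
  finally show ?thesis by (simp add: a_def b_def)
qed

lemma L2_inner_diff_scale_left:
  assumes "f \<in> L2 M" "g \<in> L2 M" "h \<in> L2 M"
  shows "L2_inner M (\<lambda>x. f x - z *s g x) h = L2_inner M f h - z * L2_inner M g h"
  unfolding L2_inner_eq using assms
  by (simp add: cinner_diff_left cinner_scale_left integrable_cinner)

lemma L2_inner_diff_right:
  assumes "f \<in> L2 M" "g \<in> L2 M" "h \<in> L2 M"
  shows "L2_inner M h (\<lambda>x. f x - g x) = L2_inner M h f - L2_inner M h g"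
  unfolding L2_inner_eq using assms
  by (simp add: cinner_diff_right integrable_cinner)

text \<open>The level sets where |\<phi>|^2 is at least 1 / (n + 1) have finite measure by
  Chebyshev. Since \<mu> is not assumed \<sigma>-finite, J may have infinite measure without any
  subset of finite positive measure; square integrable functions do not see such a set.\<close>

lemma L2_AE_zero_on:
  assumes \<phi>: "\<phi> \<in> L2 M" and J: "J \<in> sets M"
    and null: "\<And>S. S \<in> sets M \<Longrightarrow> S \<subseteq> J \<Longrightarrow> emeasure M S < \<infinity> \<Longrightarrow> emeasure M S = 0"
  shows "AE x in M. x \<in> J \<longrightarrow> \<phi> x = 0"
proof -
  have [measurable]: "\<phi> \<in> borel_measurable M" "J \<in> sets M" using \<phi> J by (auto dest: L2D)
  define S where "S = (\<lambda>n::nat. {x \<in> space M. x \<in> J \<and> 1 / real (Suc n) \<le> (norm (\<phi> x))\<^sup>2})"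
  have S [measurable]: "S n \<in> sets M" for n unfolding S_def by measurable
  have fin: "emeasure M (S n) < \<infinity>" for n
  proof -
    have "emeasure M (S n) = (\<integral>\<^sup>+x. indicator (S n) x \<partial>M)" by simp
    also have "\<dots> \<le> (\<integral>\<^sup>+x. ennreal (real (Suc n) * (norm (\<phi> x))\<^sup>2) \<partial>M)"
    proof (rule nn_integral_mono)
      fix x assume "x \<in> space M"
      show "indicator (S n) x \<le> ennreal (real (Suc n) * (norm (\<phi> x))\<^sup>2)"
      proof (cases "x \<in> S n")
        case True
        then have "1 \<le> real (Suc n) * (norm (\<phi> x))\<^sup>2" by (simp add: S_def field_simps)
        then have "ennreal 1 \<le> ennreal (real (Suc n) * (norm (\<phi> x))\<^sup>2)" by (rule ennreal_leI)
        with True show ?thesis by simp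
      qed simp
    qed
    also have "\<dots> < \<infinity>"
    proof -
      have "integrable M (\<lambda>x. real (Suc n) * (norm (\<phi> x))\<^sup>2)" using L2D(2)[OF \<phi>] by simp
      then show ?thesis by (subst nn_integral_eq_integral) auto
    qed
    finally show ?thesis .
  qed
  have "S n \<in> null_sets M" for n
    using null[OF S _ fin] by (auto simp: S_def null_sets_def intro: S[unfolded S_def])
  then have "AE x in M. \<forall>n. x \<notin> S n" by (simp add: AE_all_countable AE_not_in)
  with AE_space show ?thesis
  proof eventually_elim
    case (elim x)
    show ?case
    proof (rule impI, rule ccontr)
      assume "x \<in> J" "\<phi> x \<noteq> 0"
      then have "(norm (\<phi> x))\<^sup>2 > 0" by simp
      then obtain n where "inverse (real (Suc n)) < (norm (\<phi> x))\<^sup>2" using reals_Archimedean by blast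
      then have "x \<in> S n" using \<open>x \<in> J\<close> elim(1) by (simp add: S_def inverse_eq_divide)
      with elim(2) show False by blast
    qed
  qed
qed

section \<open>The spectral representation\<close>

text \<open>Only the unitary equivalence and the spectrum enter at this stage, so the fibre index
  \<open>'k\<close> is still arbitrary.\<close>

locale spectral_schroedinger =
  fixes Q :: "real \<Rightarrow> complex ^ 'm ^ 'm" and E0 :: real and \<mu> :: "real measure"
    and U :: "(real \<Rightarrow> complex ^ 'm) \<Rightarrow> real \<Rightarrow> complex ^ 'k"
  assumes sets_mu [measurable_cong]: "sets \<mu> = sets borel"
    and unitary: "unitary_map lebesgue \<mu> U"
    and dom_iff: "\<And>f. f \<in> L2 lebesgue \<Longrightarrow>
      (\<exists>g\<in>schroedinger_dom Q. AE x in lebesgue. f x = g x) \<longleftrightarrow> (\<exists>h\<in>mult_dom \<mu>. AE y in \<mu>. U f y = h y)"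
    and intertwine: "\<And>g h. g \<in> schroedinger_dom Q \<Longrightarrow> h \<in> mult_dom \<mu> \<Longrightarrow> (AE y in \<mu>. U g y = h y) \<Longrightarrow>
      (AE y in \<mu>. U (schroedinger Q g) y = mult_op h y)"
    and spec: "spectrum lebesgue (schroedinger_dom Q) (schroedinger Q) = complex_of_real ` {E0..}"
begin

abbreviation "D \<equiv> schroedinger_dom Q"
abbreviation "H \<equiv> schroedinger Q"

lemma D_L2: "f \<in> D \<Longrightarrow> f \<in> L2 lebesgue" and H_L2: "f \<in> D \<Longrightarrow> H f \<in> L2 lebesgue"
  by (auto simp: schroedinger_dom_def)

section \<open>Transfer between \<open>H\<close> and multiplication by the variable\<close>

lemma space_mu [simp]: "space \<mu> = UNIV"
  using sets_eq_imp_space_eq[OF sets_mu] by simp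

lemma U_L2: "f \<in> L2 lebesgue \<Longrightarrow> U f \<in> L2 \<mu>"
  and U_lin: "f \<in> L2 lebesgue \<Longrightarrow> g \<in> L2 lebesgue \<Longrightarrow> AE y in \<mu>. U (\<lambda>x. a *s f x + b *s g x) y = a *s U f y + b *s U g y"
  and U_inner: "f \<in> L2 lebesgue \<Longrightarrow> g \<in> L2 lebesgue \<Longrightarrow> L2_inner \<mu> (U f) (U g) = L2_inner lebesgue f g"
  and U_surj: "h \<in> L2 \<mu> \<Longrightarrow> \<exists>f\<in>L2 lebesgue. AE y in \<mu>. U f y = h y"
  using unitary by (auto simp: unitary_map_def)

lemma U_diff_scale:
  assumes "f \<in> L2 lebesgue" "g \<in> L2 lebesgue"
  shows "AE y in \<mu>. U (\<lambda>x. f x - z *s g x) y = U f y - z *s U g y"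
  using U_lin[OF assms, of 1 "-z"] by simp

lemma U_norm: "f \<in> L2 lebesgue \<Longrightarrow> L2_norm \<mu> (U f) = L2_norm lebesgue f"
proof -
  assume f: "f \<in> L2 lebesgue"
  have "complex_of_real ((L2_norm \<mu> (U f))\<^sup>2) = of_real ((L2_norm lebesgue f)\<^sup>2)"
    unfolding L2_inner_self[symmetric] by (rule U_inner[OF f f])
  then have "(L2_norm \<mu> (U f))\<^sup>2 = (L2_norm lebesgue f)\<^sup>2" by (simp only: of_real_eq_iff)
  then show ?thesis by (simp add: power2_eq_iff_nonneg)
qed

text \<open>\<open>U\<close> acts on functions instead of classes; linearity and isometry make it
  respect almost everywhere equality in both directions.\<close>

lemma U_eq_iff:
  assumes f: "f \<in> L2 lebesgue" and g: "g \<in> L2 lebesgue"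
  shows "(AE y in \<mu>. U f y = U g y) \<longleftrightarrow> (AE x in lebesgue. f x = g x)"
proof -
  let ?d = "\<lambda>x. f x - 1 *s g x"
  have d: "?d \<in> L2 lebesgue" by (rule L2_diff_scale[OF f g])
  have Ud: "AE y in \<mu>. U ?d y = U f y - U g y" using U_diff_scale[OF f g, of 1] by simp
  show ?thesis
  proof
    assume "AE y in \<mu>. U f y = U g y"
    with Ud have "AE y in \<mu>. U ?d y = 0" by eventually_elim simp
    then have "L2_norm \<mu> (U ?d) = L2_norm \<mu> (\<lambda>_. 0 :: complex ^ 'k)"
      by (intro L2_norm_cong_AE U_L2 d) (auto simp: L2_def)
    then have "L2_norm lebesgue ?d = 0" using U_norm[OF d] by (simp add: L2_norm_def)
    from L2_norm_zero_AE[OF d this] show "AE x in lebesgue. f x = g x" by eventually_elim simp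
  next
    assume "AE x in lebesgue. f x = g x"
    then have "AE x in lebesgue. ?d x = 0" by eventually_elim simp
    then have "L2_norm lebesgue ?d = L2_norm lebesgue (\<lambda>_::real. 0 :: complex ^ 'm)"
      by (intro L2_norm_cong_AE d) (auto simp: L2_def)
    then have "L2_norm \<mu> (U ?d) = 0" using U_norm[OF d] by (simp add: L2_norm_def)
    from L2_norm_zero_AE[OF U_L2[OF d] this] Ud show "AE y in \<mu>. U f y = U g y" by eventually_elim simp
  qed
qed

lemma U_D:
  assumes f: "f \<in> D"
  shows "mult_op (U f) \<in> L2 \<mu>" "AE y in \<mu>. U (H f) y = mult_op (U f) y"
proof -
  have "\<exists>h\<in>mult_dom \<mu>. AE y in \<mu>. U f y = h y"
    using dom_iff[OF D_L2[OF f]] f by (auto intro: bexI[of _ f])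
  then obtain h where h: "h \<in> mult_dom \<mu>" "AE y in \<mu>. U f y = h y" by blast
  have "AE y in \<mu>. U (H f) y = mult_op h y" by (rule intertwine[OF f h])
  with h(2) show 1: "AE y in \<mu>. U (H f) y = mult_op (U f) y"
    by eventually_elim (simp add: mult_op_def)
  have [measurable]: "U f \<in> borel_measurable \<mu>" by (rule L2D(1)[OF U_L2[OF D_L2[OF f]]])
  show "mult_op (U f) \<in> L2 \<mu>"
  proof (rule L2_bound[OF U_L2[OF H_L2[OF f]], where C=1])
    show "mult_op (U f) \<in> borel_measurable \<mu>" unfolding mult_op_def by measurable
    show "AE y in \<mu>. norm (mult_op (U f) y) \<le> 1 * norm (U (H f) y)"
      using 1 by eventually_elim simp
  qed
qed

lemma U_preimage:
  assumes "\<phi> \<in> mult_dom \<mu>"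
  shows "\<exists>f\<in>D. AE y in \<mu>. U f y = \<phi> y"
proof -
  have "\<phi> \<in> L2 \<mu>" using assms by (simp add: mult_dom_def)
  then obtain f where f: "f \<in> L2 lebesgue" "AE y in \<mu>. U f y = \<phi> y" using U_surj by blast
  then obtain g where g: "g \<in> D" "AE x in lebesgue. f x = g x" using dom_iff[OF f(1)] assms by blast
  have "AE y in \<mu>. U f y = U g y" using U_eq_iff[OF f(1) D_L2[OF g(1)]] g(2) by blast
  with f(2) have "AE y in \<mu>. U g y = \<phi> y" by eventually_elim simp
  with g(1) show ?thesis by blast
qed

lemma H_inner:
  assumes f: "f \<in> D" and g: "g \<in> L2 lebesgue"
  shows "L2_inner lebesgue (H f) g = L2_inner \<mu> (mult_op (U f)) (U g)"
  unfolding U_inner[OF H_L2[OF f] g, symmetric]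
  by (rule L2_inner_cong_AE) (use U_D[OF f] U_L2 H_L2[OF f] g in auto)

text \<open>Multiplication by a real variable is symmetric. Reading the symmetry off the spectral
  side avoids any discussion of boundary terms at infinity.\<close>

lemma H_symmetric:
  assumes f: "f \<in> D" and g: "g \<in> D"
  shows "L2_inner lebesgue (H f) g = L2_inner lebesgue f (H g)"
proof -
  have "L2_inner lebesgue (H f) g = L2_inner \<mu> (U f) (mult_op (U g))"
    unfolding H_inner[OF f D_L2[OF g]] by (simp add: L2_inner_eq mult_op_def cinner_scaleR_left cinner_scaleR_right)
  also have "\<dots> = L2_inner \<mu> (U f) (U (H g))"
    by (rule L2_inner_cong_AE) (use U_D[OF g] U_L2 H_L2[OF g] D_L2[OF f] in auto)
  also have "\<dots> = L2_inner lebesgue f (H g)" by (rule U_inner[OF D_L2[OF f] H_L2[OF g]])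
  finally show ?thesis .
qed

lemma U_D_shift:
  assumes f: "f \<in> D"
  shows "AE y in \<mu>. U (\<lambda>x. H f x - of_real t *s f x) y = (y - t) *\<^sub>R U f y"
  using U_diff_scale[OF H_L2[OF f] D_L2[OF f], of "of_real t"] U_D(2)[OF f]
  by eventually_elim (simp add: mult_op_def scaleR_left_diff_distrib scaleR_eq_scale)

lemma norm_H_shift:
  assumes f: "f \<in> D"
  shows "L2_norm lebesgue (\<lambda>x. H f x - of_real t *s f x) = L2_norm \<mu> (\<lambda>y. (y - t) *\<^sub>R U f y)"
proof -
  let ?h = "\<lambda>x. H f x - of_real t *s f x"
  have h: "?h \<in> L2 lebesgue" by (rule L2_diff_scale[OF H_L2[OF f] D_L2[OF f]])
  have [measurable]: "U f \<in> borel_measurable \<mu>" by (rule L2D(1)[OF U_L2[OF D_L2[OF f]]])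
  have "L2_norm lebesgue ?h = L2_norm \<mu> (U ?h)" by (rule U_norm[OF h, symmetric])
  also have "\<dots> = L2_norm \<mu> (\<lambda>y. (y - t) *\<^sub>R U f y)"
  proof (rule L2_norm_cong_AE[OF U_D_shift[OF f] U_L2[OF h]])
    show "(\<lambda>y. (y - t) *\<^sub>R U f y) \<in> L2 \<mu>"
    proof (rule L2_bound[OF U_L2[OF h], where C=1])
      show "AE y in \<mu>. norm ((y - t) *\<^sub>R U f y) \<le> 1 * norm (U ?h y)"
        using U_D_shift[OF f, of t] by eventually_elim simp
    qed measurable
  qed
  finally show ?thesis .
qed

lemma bounded_support_mult_dom:
  fixes \<phi> :: "real \<Rightarrow> complex ^ 'k"
  assumes \<phi>: "\<phi> \<in> L2 \<mu>" and supp: "\<And>y. R < \<bar>y\<bar> \<Longrightarrow> \<phi> y = 0"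
  shows "\<phi> \<in> mult_dom \<mu>"
proof -
  have [measurable]: "\<phi> \<in> borel_measurable \<mu>" by (rule L2D(1)[OF \<phi>])
  have "mult_op \<phi> \<in> L2 \<mu>"
  proof (rule L2_bound[OF \<phi>, where C="\<bar>R\<bar>"])
    show "mult_op \<phi> \<in> borel_measurable \<mu>" unfolding mult_op_def by measurable
    have "norm (mult_op \<phi> y) \<le> \<bar>R\<bar> * norm (\<phi> y)" for y
      using supp[of y] by (cases "R < \<bar>y\<bar>") (auto simp: mult_op_def intro!: mult_right_mono)
    then show "AE y in \<mu>. norm (mult_op \<phi> y) \<le> \<bar>R\<bar> * norm (\<phi> y)" by simp
  qed
  with \<phi> show ?thesis by (simp add: mult_dom_def)
qed

lemma indicator_L2:
  assumes "S \<in> sets borel" "emeasure \<mu> S < \<infinity>" "g \<in> borel_measurable borel" "\<And>y. y \<in> S \<Longrightarrow> norm (g y) \<le> C"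
  shows "(\<lambda>y. indicat_real S y *\<^sub>R (g y :: complex ^ 'k)) \<in> L2 \<mu>"
proof -
  have S: "S \<in> sets \<mu>" using assms(1) sets_mu by simp
  have [measurable]: "g \<in> borel_measurable \<mu>" using assms(3) measurable_cong_sets[OF sets_mu refl] by blast
  have m: "(\<lambda>y. indicat_real S y *\<^sub>R g y) \<in> borel_measurable \<mu>" using S by measurable
  have "integrable \<mu> (\<lambda>y. indicat_real S y *\<^sub>R (norm (g y))\<^sup>2)"
  proof (rule integrableI_bounded_set_indicator[OF S])
    show "AE y in \<mu>. y \<in> S \<longrightarrow> norm ((norm (g y))\<^sup>2) \<le> C\<^sup>2"
      using assms(4) by (auto intro!: power_mono)
  qed (use assms(2) in \<open>auto\<close>)
  moreover have "(norm (indicat_real S y *\<^sub>R g y))\<^sup>2 = indicat_real S y *\<^sub>R (norm (g y))\<^sup>2" for y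
    by (simp add: indicator_def)
  ultimately show ?thesis using m by (simp add: L2_def)
qed

text \<open>Otherwise square integrable functions on the spectral side would vanish near
  \<open>t\<close>, division by y - t would be bounded by 1 / e, and \<open>t\<close> would lie in
  the resolvent set. Finite measure is demanded so that indicators of the set are square
  integrable.\<close>

lemma spectral_support:
  assumes t: "t \<ge> E0" and e: "e > 0"
  shows "\<exists>S\<in>sets borel. S \<subseteq> {t - e<..<t + e} \<and> 0 < emeasure \<mu> S \<and> emeasure \<mu> S < \<infinity>"
proof (rule ccontr)
  assume neg: "\<not> ?thesis"
  let ?J = "{t - e<..<t + e}"
  have null: "AE y in \<mu>. y \<in> ?J \<longrightarrow> \<phi> y = 0" if "\<phi> \<in> L2 \<mu>" for \<phi> :: "real \<Rightarrow> complex ^ 'k"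
  proof (rule L2_AE_zero_on[OF that])
    show "?J \<in> sets \<mu>" by (simp add: sets_mu)
    fix S assume "S \<in> sets \<mu>" "S \<subseteq> ?J" "emeasure \<mu> S < \<infinity>"
    then show "emeasure \<mu> S = 0" using neg by (auto simp: sets_mu zero_less_iff_neq_zero)
  qed
  have away: "\<bar>y - t\<bar> \<ge> e" if "y \<notin> ?J" for y using that by auto
  have "complex_of_real t \<in> resolvent_set lebesgue D H"
    unfolding resolvent_set_def
  proof (intro CollectI conjI ballI exI[of _ "1 / e"])
    fix h :: "real \<Rightarrow> complex ^ 'm" assume h: "h \<in> L2 lebesgue"
    \<comment> \<open>The transform of the resolvent at \<open>t\<close> applied to
      \<open>h\<close>, cut off where the transform of \<open>h\<close> vanishes almost
      everywhere.\<close>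
    define \<phi> where "\<phi> = (\<lambda>y. indicat_real (- ?J) y *\<^sub>R ((1 / (y - t)) *\<^sub>R U h y))"
    have [measurable]: "U h \<in> borel_measurable \<mu>" by (rule L2D(1)[OF U_L2[OF h]])
    have [measurable]: "\<phi> \<in> borel_measurable \<mu>" unfolding \<phi>_def by measurable
    have n1: "norm (\<phi> y) \<le> 1 / e * norm (U h y)" for y
    proof (cases "y \<in> ?J")
      case False
      then have "1 / \<bar>y - t\<bar> \<le> 1 / e" using away e by (intro divide_left_mono) auto
      then have "1 / \<bar>y - t\<bar> * norm (U h y) \<le> 1 / e * norm (U h y)" by (intro mult_right_mono) auto
      with False show ?thesis by (simp add: \<phi>_def)
    qed (use e in \<open>simp add: \<phi>_def\<close>)
    have \<phi>: "\<phi> \<in> L2 \<mu>" by (rule L2_bound[OF U_L2[OF h], where C="1 / e"]) (use n1 in auto)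
    have eq: "(y - t) *\<^sub>R \<phi> y = indicat_real (- ?J) y *\<^sub>R U h y" for y
      using away[of y] e by (auto simp: \<phi>_def indicator_def)
    have "mult_op \<phi> \<in> L2 \<mu>"
    proof (rule L2_bound[OF U_L2[OF h], where C="1 + \<bar>t\<bar> * (1 / e)"])
      show "mult_op \<phi> \<in> borel_measurable \<mu>" unfolding mult_op_def by measurable
      have "norm (mult_op \<phi> y) \<le> (1 + \<bar>t\<bar> * (1 / e)) * norm (U h y)" for y
      proof -
        have "mult_op \<phi> y = (y - t) *\<^sub>R \<phi> y + t *\<^sub>R \<phi> y" by (simp add: mult_op_def algebra_simps)
        then have "norm (mult_op \<phi> y) \<le> norm (U h y) + \<bar>t\<bar> * norm (\<phi> y)"
          using norm_triangle_ineq[of "(y - t) *\<^sub>R \<phi> y" "t *\<^sub>R \<phi> y"] unfolding eq by (auto simp: indicator_def split: if_splits)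
        also have "\<dots> \<le> norm (U h y) + \<bar>t\<bar> * (1 / e * norm (U h y))"
          by (intro add_left_mono mult_left_mono n1) auto
        finally show ?thesis by (simp add: algebra_simps)
      qed
      then show "AE y in \<mu>. norm (mult_op \<phi> y) \<le> (1 + \<bar>t\<bar> * (1 / e)) * norm (U h y)" by simp
    qed
    then have "\<phi> \<in> mult_dom \<mu>" using \<phi> by (simp add: mult_dom_def)
    then obtain f where f: "f \<in> D" "AE y in \<mu>. U f y = \<phi> y" using U_preimage by blast
    let ?g = "\<lambda>x. H f x - of_real t *s f x"
    have g: "?g \<in> L2 lebesgue" by (rule L2_diff_scale[OF H_L2[OF f(1)] D_L2[OF f(1)]])
    have "AE y in \<mu>. U ?g y = U h y"
      using U_D_shift[OF f(1), of t] f(2) null[OF U_L2[OF h]]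
    proof eventually_elim
      case (elim y)
      then show ?case using eq[of y] by (auto simp: indicator_def split: if_splits)
    qed
    then have "AE x in lebesgue. ?g x = h x" using U_eq_iff[OF g h] by blast
    with f(1) show "\<exists>f\<in>D. AE x in lebesgue. H f x - of_real t *s f x = h x" by blast
  next
    fix f assume f: "f \<in> D"
    let ?g = "\<lambda>x. H f x - of_real t *s f x"
    have g: "?g \<in> L2 lebesgue" by (rule L2_diff_scale[OF H_L2[OF f] D_L2[OF f]])
    have Uf: "U f \<in> L2 \<mu>" by (rule U_L2[OF D_L2[OF f]])
    have "(L2_norm \<mu> (U f))\<^sup>2 \<le> (1 / e * L2_norm \<mu> (U ?g))\<^sup>2"
      unfolding power_mult_distrib L2_norm_sq integral_mult_right_zero[symmetric]
    proof (rule integral_mono_AE)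
      show "integrable \<mu> (\<lambda>y. (norm (U f y))\<^sup>2)" by (rule L2D(2)[OF Uf])
      show "integrable \<mu> (\<lambda>y. (1 / e)\<^sup>2 * (norm (U ?g y))\<^sup>2)" using L2D(2)[OF U_L2[OF g]] by simp
      show "AE y in \<mu>. (norm (U f y))\<^sup>2 \<le> (1 / e)\<^sup>2 * (norm (U ?g y))\<^sup>2"
        using U_D_shift[OF f, of t] null[OF Uf]
      proof eventually_elim
        case (elim y)
        show ?case
        proof (cases "y \<in> ?J")
          case False
          have "e * norm (U f y) \<le> \<bar>y - t\<bar> * norm (U f y)" by (intro mult_right_mono away False) auto
          also have "\<dots> = norm (U ?g y)" using elim(1) by simp
          finally have "norm (U f y) \<le> 1 / e * norm (U ?g y)" using e by (simp add: field_simps)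
          then have "(norm (U f y))\<^sup>2 \<le> (1 / e * norm (U ?g y))\<^sup>2" by (intro power_mono) auto
          then show ?thesis by (simp only: power_mult_distrib)
        qed (use elim in simp)
      qed
    qed
    then have "L2_norm \<mu> (U f) \<le> 1 / e * L2_norm \<mu> (U ?g)" by (rule power2_le_imp_le) (use e in simp)
    then show "L2_norm lebesgue f \<le> 1 / e * L2_norm lebesgue ?g"
      by (simp only: U_norm[OF g] U_norm[OF D_L2[OF f]])
  qed
  moreover have "complex_of_real t \<in> spectrum lebesgue D H" unfolding spec using t by simp
  ultimately show False by (simp add: spectrum_def)
qed

text \<open>For \<open>t\<close> below the spectrum the resolvent estimate excludes transforms
  concentrated within a small distance of \<open>t\<close>. By Lindeloef countably many such balls
  cover the half-line, as an almost everywhere statement requires.\<close>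

lemma no_measure_below:
  fixes \<phi> :: "real \<Rightarrow> complex ^ 'k"
  assumes \<phi>: "\<phi> \<in> L2 \<mu>"
  shows "AE y in \<mu>. y < E0 \<longrightarrow> \<phi> y = 0"
proof -
  have local: "\<exists>d>0. \<forall>\<psi>\<in>L2 \<mu>. AE y in \<mu>. y \<in> ball t d \<longrightarrow> (\<psi> y :: complex ^ 'k) = 0" if t: "t < E0" for t
  proof -
    have "complex_of_real t \<notin> spectrum lebesgue D H" unfolding spec using t by auto
    then have "complex_of_real t \<in> resolvent_set lebesgue D H" by (simp add: spectrum_def)
    then obtain C where C: "\<And>f. f \<in> D \<Longrightarrow> L2_norm lebesgue f \<le> C * L2_norm lebesgue (\<lambda>x. H f x - of_real t *s f x)"
      unfolding resolvent_set_def by blast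
    \<comment> \<open>With |C| d <= 1 / 2 the resolvent estimate bounds a norm by half of itself;
      the summand 2 covers \<open>C = 0\<close>.\<close>
    define d where "d = 1 / (2 * \<bar>C\<bar> + 2)"
    have d: "d > 0" "\<bar>C\<bar> * d \<le> 1 / 2" by (auto simp: d_def field_simps)
    have "AE y in \<mu>. y \<in> ball t d \<longrightarrow> \<psi> y = 0" if "\<psi> \<in> L2 \<mu>" for \<psi> :: "real \<Rightarrow> complex ^ 'k"
    proof (rule L2_AE_zero_on[OF that])
      show "ball t d \<in> sets \<mu>" by (simp add: sets_mu)
      fix S assume S: "S \<in> sets \<mu>" "S \<subseteq> ball t d" "emeasure \<mu> S < \<infinity>"
      \<comment> \<open>The index is arbitrary: any fixed unit vector of the fibre will do.\<close>
      define \<xi> where "\<xi> = (\<lambda>y. indicat_real S y *\<^sub>R (axis undefined 1 :: complex ^ 'k))"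
      have \<xi>: "\<xi> \<in> L2 \<mu>"
        unfolding \<xi>_def by (rule indicator_L2[where C=1]) (use S in \<open>auto simp: sets_mu\<close>)
      have "\<xi> \<in> mult_dom \<mu>"
      proof (rule bounded_support_mult_dom[OF \<xi>, where R="\<bar>t\<bar> + d"])
        fix y :: real assume "\<bar>t\<bar> + d < \<bar>y\<bar>"
        then have "y \<notin> ball t d" by (auto simp: dist_real_def)
        then have "y \<notin> S" using S(2) by blast
        then show "\<xi> y = 0" by (simp add: \<xi>_def)
      qed
      then obtain f where f: "f \<in> D" "AE y in \<mu>. U f y = \<xi> y" using U_preimage by blast
      have Uf: "U f \<in> L2 \<mu>" by (rule U_L2[OF D_L2[OF f(1)]])
      have [measurable]: "\<xi> \<in> borel_measurable \<mu>" "U f \<in> borel_measurable \<mu>" using \<xi> Uf by (auto dest: L2D)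
      have b: "norm ((y - t) *\<^sub>R \<xi> y) \<le> d * norm (\<xi> y)" for y
      proof (cases "y \<in> S")
        case True
        then have "\<bar>y - t\<bar> < d" using S(2) by (auto simp: dist_real_def)
        then show ?thesis by (auto intro!: mult_right_mono)
      qed (simp add: \<xi>_def)
      have "L2_norm \<mu> \<xi> = L2_norm lebesgue f"
        using U_norm[OF D_L2[OF f(1)]] L2_norm_cong_AE[OF f(2) Uf \<xi>] by simp
      also have "\<dots> \<le> C * L2_norm lebesgue (\<lambda>x. H f x - of_real t *s f x)" by (rule C[OF f(1)])
      also have "\<dots> \<le> \<bar>C\<bar> * L2_norm \<mu> (\<lambda>y. (y - t) *\<^sub>R U f y)"
        unfolding norm_H_shift[OF f(1)] by (intro mult_right_mono) auto
      also have "L2_norm \<mu> (\<lambda>y. (y - t) *\<^sub>R U f y) \<le> d * L2_norm \<mu> \<xi>"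
      proof (rule power2_le_imp_le)
        have "(L2_norm \<mu> (\<lambda>y. (y - t) *\<^sub>R U f y))\<^sup>2 \<le> (\<integral>y. d\<^sup>2 * (norm (\<xi> y))\<^sup>2 \<partial>\<mu>)"
          unfolding L2_norm_sq
        proof (rule integral_mono_AE)
          show i: "integrable \<mu> (\<lambda>y. d\<^sup>2 * (norm (\<xi> y))\<^sup>2)" using L2D(2)[OF \<xi>] by simp
          show ae: "AE y in \<mu>. (norm ((y - t) *\<^sub>R U f y))\<^sup>2 \<le> d\<^sup>2 * (norm (\<xi> y))\<^sup>2"
            using f(2)
          proof eventually_elim
            case (elim y)
            show ?case unfolding elim power_mult_distrib[symmetric] by (intro power_mono b) auto
          qed
          show "integrable \<mu> (\<lambda>y. (norm ((y - t) *\<^sub>R U f y))\<^sup>2)"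
            by (rule Bochner_Integration.integrable_bound[OF i]) (measurable, use ae in \<open>auto elim: eventually_mono\<close>)
        qed
        then show "(L2_norm \<mu> (\<lambda>y. (y - t) *\<^sub>R U f y))\<^sup>2 \<le> (d * L2_norm \<mu> \<xi>)\<^sup>2"
          by (simp add: power_mult_distrib L2_norm_sq)
      qed (use d in simp)
      finally have "L2_norm \<mu> \<xi> \<le> (\<bar>C\<bar> * d) * L2_norm \<mu> \<xi>" by (simp add: mult_left_mono mult.assoc)
      also have "\<dots> \<le> 1 / 2 * L2_norm \<mu> \<xi>" by (intro mult_right_mono d) auto
      finally have "L2_norm \<mu> \<xi> = 0" using L2_norm_nonneg[of \<mu> \<xi>] by linarith
      from L2_norm_zero_AE[OF \<xi> this] have "AE y in \<mu>. y \<notin> S"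
        by eventually_elim (auto simp: \<xi>_def indicator_def axis_eq_0_iff split: if_splits)
      then have "S \<in> null_sets \<mu>" by (simp add: AE_iff_null_sets[OF S(1)])
      then show "emeasure \<mu> S = 0" by auto
    qed
    with d(1) show ?thesis by blast
  qed
  then obtain d where d: "\<And>t. t < E0 \<Longrightarrow> d t > 0 \<and> (AE y in \<mu>. y \<in> ball t (d t) \<longrightarrow> \<phi> y = 0)"
    using \<phi> by metis
  obtain F' where F': "F' \<subseteq> (\<lambda>t. ball t (d t)) ` {..<E0}" "countable F'" "\<Union>F' = \<Union>((\<lambda>t. ball t (d t)) ` {..<E0})"
    using Lindelof[of "(\<lambda>t. ball t (d t)) ` {..<E0}"] by (metis (no_types, lifting) imageE open_ball)
  have "AE y in \<mu>. \<forall>B\<in>F'. y \<in> B \<longrightarrow> \<phi> y = 0"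
    unfolding AE_ball_countable[OF F'(2)] using F'(1) d by (auto simp: image_iff)
  then show ?thesis
  proof eventually_elim
    case (elim y)
    show ?case
    proof
      assume "y < E0"
      then have "y \<in> \<Union>F'" unfolding F'(3) using d[of y] by (auto intro!: bexI[of _ y])
      with elim show "\<phi> y = 0" by blast
    qed
  qed
qed

text \<open>The transform of \<open>f\<close> vanishes almost everywhere below \<open>E0\<close>, so
  y may be replaced by \<open>E0\<close> under the integral.\<close>

lemma form_lower_bound:
  assumes f: "f \<in> D"
  shows "E0 * (L2_norm lebesgue f)\<^sup>2 \<le> Re (L2_inner lebesgue (H f) f)"
proof -
  have Uf: "U f \<in> L2 \<mu>" by (rule U_L2[OF D_L2[OF f]])
  have eq: "cinner (mult_op (U f) y) (U f y) = of_real (y * (norm (U f y))\<^sup>2)" for y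
    by (simp add: mult_op_def cinner_scaleR_left cinner_self)
  have int: "integrable \<mu> (\<lambda>y. y * (norm (U f y))\<^sup>2)"
    using integrable_Re[OF integrable_cinner(1)[OF U_D(1)[OF f] Uf]] unfolding eq by simp
  have "E0 * (L2_norm lebesgue f)\<^sup>2 = (\<integral>y. E0 * (norm (U f y))\<^sup>2 \<partial>\<mu>)"
    using U_norm[OF D_L2[OF f]] L2_norm_sq[of \<mu> "U f"] by simp
  also have "\<dots> \<le> (\<integral>y. y * (norm (U f y))\<^sup>2 \<partial>\<mu>)"
  proof (rule integral_mono_AE[OF _ int])
    show "integrable \<mu> (\<lambda>y. E0 * (norm (U f y))\<^sup>2)" using L2D(2)[OF Uf] by simp
    show "AE y in \<mu>. E0 * (norm (U f y))\<^sup>2 \<le> y * (norm (U f y))\<^sup>2"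
      using no_measure_below[OF Uf]
    proof eventually_elim
      case (elim y)
      then show ?case by (cases "y < E0") (auto intro!: mult_right_mono)
    qed
  qed
  also have "\<dots> = Re (L2_inner lebesgue (H f) f)"
  proof -
    have "L2_inner lebesgue (H f) f = of_real (\<integral>y. y * (norm (U f y))\<^sup>2 \<partial>\<mu>)"
      unfolding H_inner[OF f D_L2[OF f]] by (simp only: L2_inner_eq eq integral_complex_of_real)
    then show ?thesis by simp
  qed
  finally show ?thesis .
qed

lemma resolvent_exists:
  assumes "h \<in> L2 lebesgue"
  shows "\<exists>f\<in>D. AE x in lebesgue. H f x - of_real (E0 - 1) *s f x = h x"
proof -
  have "complex_of_real (E0 - 1) \<notin> spectrum lebesgue D H" unfolding spec by (auto simp del: of_real_diff)
  then show ?thesis using assms by (auto simp: spectrum_def resolvent_set_def)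
qed

end

section \<open>Test functions\<close>

lemma AC_loc_C1:
  fixes f :: "real \<Rightarrow> complex"
  assumes f: "\<And>x. (f has_vector_derivative f' x) (at x)" and f': "continuous_on UNIV f'"
  shows "f \<in> AC_loc"
  unfolding AC_loc_def absolutely_continuous_between_def
proof (intro CollectI allI impI)
  fix a b \<epsilon> :: real assume \<epsilon>: "\<epsilon> > 0"
  have "bounded (f' ` {a..b})"
    by (intro compact_imp_bounded compact_continuous_image continuous_on_subset[OF f']) auto
  then obtain K where K: "\<forall>x\<in>{a..b}. norm (f' x) \<le> K" by (auto simp: bounded_iff)
  have lip: "norm (f t - f s) \<le> \<bar>K\<bar> * (t - s)" if "a \<le> s" "s \<le> t" "t \<le> b" for s t
  proof (cases "s = t")
    case False
    have "norm (f t - f s) \<le> \<bar>K\<bar> * t - \<bar>K\<bar> * s"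
    proof (rule differentiable_bound_general[of s t])
      show "continuous_on {s..t} f"
        using f by (auto intro!: continuous_at_imp_continuous_on has_vector_derivative_continuous)
      show "(f has_vector_derivative f' x) (at x)" for x by (rule f)
      show "((\<lambda>x. \<bar>K\<bar> * x) has_vector_derivative \<bar>K\<bar>) (at x)" for x
        by (auto intro!: derivative_eq_intros simp flip: has_real_derivative_iff_has_vector_derivative)
      show "norm (f' x) \<le> \<bar>K\<bar>" if "s < x" "x < t" for x
        using K \<open>a \<le> s\<close> \<open>t \<le> b\<close> that by (meson abs_ge_self atLeastAtMost_iff less_imp_le order_trans)
    qed (use that False in \<open>auto intro!: continuous_intros\<close>)
    then show ?thesis by (simp add: algebra_simps)
  qed simp
  show "\<exists>\<delta>>0. \<forall>(n::nat) (s::nat \<Rightarrow> real) t. (\<forall>i<n. a \<le> s i \<and> s i \<le> t i \<and> t i \<le> b) \<and>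
      disjoint_family_on (\<lambda>i. {s i<..<t i}) {..<n} \<and> (\<Sum>i<n. t i - s i) < \<delta>
      \<longrightarrow> (\<Sum>i<n. cmod (f (t i) - f (s i))) < \<epsilon>"
  proof (intro exI[of _ "\<epsilon> / (\<bar>K\<bar> + 1)"] conjI allI impI)
    fix n :: nat and s t :: "nat \<Rightarrow> real"
    assume *: "(\<forall>i<n. a \<le> s i \<and> s i \<le> t i \<and> t i \<le> b) \<and>
      disjoint_family_on (\<lambda>i. {s i<..<t i}) {..<n} \<and> (\<Sum>i<n. t i - s i) < \<epsilon> / (\<bar>K\<bar> + 1)"
    have nn: "0 \<le> (\<Sum>i<n. t i - s i)" using * by (intro sum_nonneg) auto
    have "(\<Sum>i<n. cmod (f (t i) - f (s i))) \<le> (\<Sum>i<n. \<bar>K\<bar> * (t i - s i))"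
      using * by (intro sum_mono lip) auto
    also have "\<dots> = \<bar>K\<bar> * (\<Sum>i<n. t i - s i)" by (simp add: sum_distrib_left)
    also have "\<dots> \<le> (\<bar>K\<bar> + 1) * (\<Sum>i<n. t i - s i)" using nn by (intro mult_right_mono) auto
    also have "\<dots> < \<epsilon>" using * by (simp add: pos_less_divide_eq mult.commute)
    finally show "(\<Sum>i<n. cmod (f (t i) - f (s i))) < \<epsilon>" .
  qed (use \<epsilon> in simp)
qed

lemma AC_loc_continuous:
  assumes "f \<in> AC_loc"
  shows "continuous_on UNIV f"
  unfolding continuous_on_iff
proof (intro ballI allI impI)
  fix x \<epsilon> :: real assume "\<epsilon> > 0"
  have ac: "absolutely_continuous_between (x - 1) (x + 1) f" using assms by (simp add: AC_loc_def)
  then obtain \<delta> where \<delta>: "\<delta> > 0" and P: "\<forall>n (s::nat \<Rightarrow> real) t.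
        (\<forall>i<n. x - 1 \<le> s i \<and> s i \<le> t i \<and> t i \<le> x + 1) \<and>
        disjoint_family_on (\<lambda>i. {s i<..<t i}) {..<n} \<and> (\<Sum>i<n. t i - s i) < \<delta>
        \<longrightarrow> (\<Sum>i<n. cmod (f (t i) - f (s i))) < \<epsilon>"
    unfolding absolutely_continuous_between_def using \<open>\<epsilon> > 0\<close> by blast
  have "dist (f y) (f x) < \<epsilon>" if "dist y x < min \<delta> 1" for y
  proof -
    have "cmod (f (max x y) - f (min x y)) < \<epsilon>"
      using P[rule_format, of 1 "\<lambda>_. min x y" "\<lambda>_. max x y"] that
      by (auto simp: disjoint_family_on_def dist_real_def max_def min_def split: if_splits)
    then show ?thesis by (auto simp: max_def min_def dist_norm norm_minus_commute split: if_splits)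
  qed
  then show "\<exists>d>0. \<forall>x'\<in>UNIV. dist x' x < d \<longrightarrow> dist (f x') (f x) < \<epsilon>"
    using \<delta> by (intro exI[of _ "min \<delta> 1"]) auto
qed

lemma has_vector_derivative_vec_nth:
  "(g has_vector_derivative g') (at x) \<Longrightarrow> ((\<lambda>x. (g x :: complex ^ 'n) $ i) has_vector_derivative g' $ i) (at x)"
  by (rule bounded_linear.has_vector_derivative[OF bounded_linear_vec_nth])

lemma continuous_vec_nth: "continuous_on S g \<Longrightarrow> continuous_on S (\<lambda>x. (g x :: complex ^ 'n) $ i)"
  by (intro continuous_intros)

lemma deriv_zero_outside:
  fixes g :: "real \<Rightarrow> 'a::real_normed_vector"
  assumes "\<And>x. (g has_vector_derivative g' x) (at x)" "\<And>x. R < \<bar>x\<bar> \<Longrightarrow> g x = 0" "R < \<bar>x\<bar>"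
  shows "g' x = 0"
proof -
  have "open {x. R < \<bar>x\<bar>}" by (intro open_Collect_less continuous_intros)
  then have "(g has_vector_derivative 0) (at x)"
    by (rule has_vector_derivative_transform_within_open[rotated]) (use assms in \<open>auto simp: has_vector_derivative_const\<close>)
  then show ?thesis using assms(1) vector_derivative_unique_at by blast
qed

lemma L2_bounded_interval:
  fixes f :: "real \<Rightarrow> complex ^ 'n"
  assumes f: "continuous_on {a..b} f" and K: "\<And>x. x \<in> {a..b} \<Longrightarrow> norm (f x) \<le> K" and "a \<le> b"
  shows "(\<lambda>x. indicat_real {a..b} x *\<^sub>R f x) \<in> L2 lebesgue"
    "L2_norm lebesgue (\<lambda>x. indicat_real {a..b} x *\<^sub>R f x) \<le> \<bar>K\<bar> * sqrt (b - a)"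
proof -
  have "(\<lambda>x. indicat_real {a..b} x *\<^sub>R f x) \<in> borel_measurable lborel"
    using borel_measurable_continuous_on_indicator[OF _ f] by simp
  then have m: "(\<lambda>x. indicat_real {a..b} x *\<^sub>R f x) \<in> borel_measurable lebesgue"
    by (rule measurable_completion)
  have i1: "integrable lebesgue (\<lambda>x. indicat_real {a..b} x *\<^sub>R K\<^sup>2)"
    by (rule integrableI_bounded_set_indicator[where B="K\<^sup>2"]) (use \<open>a \<le> b\<close> in auto)
  have le: "(norm (indicat_real {a..b} x *\<^sub>R f x))\<^sup>2 \<le> indicat_real {a..b} x *\<^sub>R K\<^sup>2" for x
    using K by (auto simp: indicator_def intro!: power_mono)
  have int: "integrable lebesgue (\<lambda>x. (norm (indicat_real {a..b} x *\<^sub>R f x))\<^sup>2)"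
  proof (rule Bochner_Integration.integrable_bound[OF i1])
    show "(\<lambda>x. (norm (indicat_real {a..b} x *\<^sub>R f x))\<^sup>2) \<in> borel_measurable lebesgue"
      by (intro borel_measurable_power measurable_compose[OF m borel_measurable_norm])
  qed (use le in auto)
  with m show "(\<lambda>x. indicat_real {a..b} x *\<^sub>R f x) \<in> L2 lebesgue" by (simp add: L2_def)
  have "(L2_norm lebesgue (\<lambda>x. indicat_real {a..b} x *\<^sub>R f x))\<^sup>2 \<le> (\<integral>x. indicat_real {a..b} x *\<^sub>R K\<^sup>2 \<partial>lebesgue)"
    unfolding L2_norm_sq by (rule integral_mono[OF int i1 le])
  also have "\<dots> = K\<^sup>2 * (b - a)" using \<open>a \<le> b\<close> by simp
  also have "\<dots> = (\<bar>K\<bar> * sqrt (b - a))\<^sup>2" using \<open>a \<le> b\<close> by (simp add: power_mult_distrib)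
  finally show "L2_norm lebesgue (\<lambda>x. indicat_real {a..b} x *\<^sub>R f x) \<le> \<bar>K\<bar> * sqrt (b - a)"
    by (rule power2_le_imp_le) (use \<open>a \<le> b\<close> in simp)
qed

lemma L2_continuous_interval:
  fixes f :: "real \<Rightarrow> complex ^ 'n"
  assumes f: "continuous_on {a..b} f" and "a \<le> b"
  shows "(\<lambda>x. indicat_real {a..b} x *\<^sub>R f x) \<in> L2 lebesgue"
proof -
  have "bounded (f ` {a..b})" by (intro compact_imp_bounded compact_continuous_image f) auto
  then obtain K where "\<forall>x\<in>{a..b}. norm (f x) \<le> K" by (auto simp: bounded_iff)
  then show ?thesis by (intro L2_bounded_interval[OF f, where K=K] \<open>a \<le> b\<close>) auto
qed

lemma L2_compact_support:
  fixes f :: "real \<Rightarrow> complex ^ 'n"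
  assumes f: "continuous_on UNIV f" and "\<And>x. R < \<bar>x\<bar> \<Longrightarrow> f x = 0"
  shows "f \<in> L2 lebesgue"
proof -
  have "f = (\<lambda>x. indicat_real {-\<bar>R\<bar>..\<bar>R\<bar>} x *\<^sub>R f x)"
    using assms(2) by (auto simp: fun_eq_iff indicator_def abs_le_iff not_le)
  also have "\<dots> \<in> L2 lebesgue"
    by (rule L2_continuous_interval) (auto intro: continuous_on_subset[OF f])
  finally show ?thesis .
qed

lemma test_function_in_dom:
  fixes Q :: "real \<Rightarrow> complex ^ 'm ^ 'm" and g :: "real \<Rightarrow> complex ^ 'm"
  assumes Q: "continuous_on UNIV Q"
    and g: "\<And>x. (g has_vector_derivative g' x) (at x)" and g': "\<And>x. (g' has_vector_derivative g'' x) (at x)"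
    and g'': "continuous_on UNIV g''" and supp: "\<And>x. R < \<bar>x\<bar> \<Longrightarrow> g x = 0"
  shows "g \<in> schroedinger_dom Q" "schroedinger Q g = (\<lambda>x. - g'' x + Q x *v g x)"
proof -
  have cg: "continuous_on UNIV g" and cg': "continuous_on UNIV g'"
    using g g' by (auto intro!: continuous_at_imp_continuous_on has_vector_derivative_continuous)
  have v1: "vector_derivative g (at x) = g' x" and v2: "vector_derivative g' (at x) = g'' x" for x
    using g g' by (auto intro: vector_derivative_at)
  show H: "schroedinger Q g = (\<lambda>x. - g'' x + Q x *v g x)"
    by (simp add: schroedinger_def v1 v2)
  have z1: "g' x = 0" if "R < \<bar>x\<bar>" for x by (rule deriv_zero_outside[OF g supp that])
  have z2: "g'' x = 0" if "R < \<bar>x\<bar>" for x by (rule deriv_zero_outside[OF g' z1 that])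
  have "g \<in> L2 lebesgue" by (rule L2_compact_support[OF cg supp])
  moreover have "schroedinger Q g \<in> L2 lebesgue"
    unfolding H by (rule L2_compact_support[where R=R]) (auto intro!: continuous_intros g'' Q cg simp: z2 supp)
  moreover have "(\<lambda>x. g x $ i) \<in> AC_loc" for i
    by (rule AC_loc_C1[OF has_vector_derivative_vec_nth[OF g] continuous_vec_nth[OF cg']])
  moreover have "(\<lambda>x. vderiv g x $ i) \<in> AC_loc" for i
    unfolding v1 by (rule AC_loc_C1[OF has_vector_derivative_vec_nth[OF g'] continuous_vec_nth[OF g'']])
  moreover have "g differentiable (at x)" for x using g by (auto intro: differentiableI_vector)
  ultimately show "g \<in> schroedinger_dom Q" by (simp add: schroedinger_dom_def)
qed

section \<open>Twice continuously differentiable cutoffs\<close>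

definition clamp :: "real \<Rightarrow> real" where "clamp t = max 0 (min 1 t)"

text \<open>One-sided derivatives are computed and glued. At the two kinks of \<open>clamp\<close>
  the derivative of \<open>p\<close> vanishes, which matches the constant pieces.\<close>

lemma clamp_has_real_derivative:
  fixes p :: "real \<Rightarrow> real"
  assumes p: "\<And>t. (p has_real_derivative p' t) (at t)" and "p' 0 = 0" "p' 1 = 0"
  shows "((\<lambda>t. p (clamp t)) has_real_derivative p' (clamp t)) (at t)"
proof -
  have left: "((\<lambda>t. p (clamp t)) has_real_derivative p' (clamp t)) (at t within {..t})"
  proof -
    consider "t \<le> 0" | "0 < t" "t \<le> 1" | "1 < t" by linarith
    then show ?thesis
    proof cases
      case 1
      have "((\<lambda>_. p 0) has_real_derivative 0) (at t within {..t})" by simp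
      then have "((\<lambda>t. p (clamp t)) has_real_derivative 0) (at t within {..t})"
        by (rule has_field_derivative_transform_within[where d=1]) (use 1 in \<open>auto simp: clamp_def\<close>)
      then show ?thesis using 1 assms by (simp add: clamp_def)
    next
      case 2
      have "(p has_real_derivative p' t) (at t within {..t})" using p by (rule has_field_derivative_at_within)
      then have "((\<lambda>t. p (clamp t)) has_real_derivative p' t) (at t within {..t})"
        by (rule has_field_derivative_transform_within[where d=t]) (use 2 in \<open>auto simp: clamp_def dist_real_def\<close>)
      then show ?thesis using 2 by (simp add: clamp_def)
    next
      case 3
      have "((\<lambda>_. p 1) has_real_derivative 0) (at t within {..t})" by simp
      then have "((\<lambda>t. p (clamp t)) has_real_derivative 0) (at t within {..t})"
        by (rule has_field_derivative_transform_within[where d="t - 1"]) (use 3 in \<open>auto simp: clamp_def dist_real_def\<close>)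
      then show ?thesis using 3 assms by (simp add: clamp_def)
    qed
  qed
  have right: "((\<lambda>t. p (clamp t)) has_real_derivative p' (clamp t)) (at t within {t..})"
  proof -
    consider "t < 0" | "0 \<le> t" "t < 1" | "1 \<le> t" by linarith
    then show ?thesis
    proof cases
      case 1
      have "((\<lambda>_. p 0) has_real_derivative 0) (at t within {t..})" by simp
      then have "((\<lambda>t. p (clamp t)) has_real_derivative 0) (at t within {t..})"
        by (rule has_field_derivative_transform_within[where d="-t"]) (use 1 in \<open>auto simp: clamp_def dist_real_def\<close>)
      then show ?thesis using 1 assms by (simp add: clamp_def)
    next
      case 2
      have "(p has_real_derivative p' t) (at t within {t..})" using p by (rule has_field_derivative_at_within)
      then have "((\<lambda>t. p (clamp t)) has_real_derivative p' t) (at t within {t..})"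
        by (rule has_field_derivative_transform_within[where d="1 - t"]) (use 2 in \<open>auto simp: clamp_def dist_real_def\<close>)
      then show ?thesis using 2 by (simp add: clamp_def)
    next
      case 3
      have "((\<lambda>_. p 1) has_real_derivative 0) (at t within {t..})" by simp
      then have "((\<lambda>t. p (clamp t)) has_real_derivative 0) (at t within {t..})"
        by (rule has_field_derivative_transform_within[where d=1]) (use 3 in \<open>auto simp: clamp_def\<close>)
      then show ?thesis using 3 assms by (simp add: clamp_def)
    qed
  qed
  have "((\<lambda>y. (p (clamp y) - p (clamp t)) / (y - t)) \<longlongrightarrow> p' (clamp t)) (sup (at t within {..t}) (at t within {t..}))"
    using left right unfolding has_field_derivative_iff by (rule filterlim_sup)
  then have "((\<lambda>t. p (clamp t)) has_real_derivative p' (clamp t)) (at t within {..t} \<union> {t..})"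
    unfolding has_field_derivative_iff by (simp add: at_within_union)
  moreover have "{..t} \<union> {t..} = UNIV" by auto
  ultimately show ?thesis by simp
qed

text \<open>The quintic smoothstep: it rises from 0 to 1 with vanishing first and second derivatives
  at both ends, so that its clamped version is twice continuously differentiable.\<close>

definition step_poly :: "real \<Rightarrow> real" where "step_poly t = t ^ 3 * (10 - 15 * t + 6 * t\<^sup>2)"
definition step :: "real \<Rightarrow> real" where "step t = step_poly (clamp t)"
definition step' :: "real \<Rightarrow> real" where "step' t = 30 * (clamp t)\<^sup>2 * (1 - clamp t)\<^sup>2"
definition step'' :: "real \<Rightarrow> real" where "step'' t = 60 * clamp t * (1 - clamp t) * (1 - 2 * clamp t)"

lemma step_has_real_derivative:
  "(step has_real_derivative step' t) (at t)" "(step' has_real_derivative step'' t) (at t)"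
proof -
  have "(step_poly has_real_derivative 30 * t\<^sup>2 * (1 - t)\<^sup>2) (at t)" for t
    unfolding step_poly_def by (auto intro!: derivative_eq_intros simp: algebra_simps power2_eq_square power3_eq_cube)
  from clamp_has_real_derivative[OF this]
  show "(step has_real_derivative step' t) (at t)" by (simp add: step_def[abs_def] step'_def)
  have "((\<lambda>t. 30 * t\<^sup>2 * (1 - t)\<^sup>2) has_real_derivative 60 * t * (1 - t) * (1 - 2 * t)) (at t)" for t :: real
    by (auto intro!: derivative_eq_intros simp: algebra_simps power2_eq_square)
  from clamp_has_real_derivative[OF this]
  show "(step' has_real_derivative step'' t) (at t)" by (simp add: step'_def[abs_def] step''_def)
qed

lemma continuous_step'': "continuous_on UNIV step''"
  unfolding step''_def[abs_def] clamp_def by (intro continuous_intros)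

lemma step_le_0: "t \<le> 0 \<Longrightarrow> step t = 0" "t \<le> 0 \<Longrightarrow> step' t = 0" "t \<le> 0 \<Longrightarrow> step'' t = 0"
  and step_ge_1: "t \<ge> 1 \<Longrightarrow> step t = 1" "t \<ge> 1 \<Longrightarrow> step' t = 0"
  and step'_nonneg: "step' t \<ge> 0"
  by (auto simp: step_def step'_def step''_def step_poly_def clamp_def)

lemma step_bounds: "0 \<le> step t" "step t \<le> 1"
proof -
  have mono: "step s \<le> step t" if "s \<le> t" for s t
    by (rule DERIV_nonneg_imp_nondecreasing[OF that]) (use step_has_real_derivative step'_nonneg in blast)
  show "0 \<le> step t" using mono[of "min t 0" t] by (simp add: step_le_0)
  show "step t \<le> 1" using mono[of t "max t 1"] by (simp add: step_ge_1)
qed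

text \<open>A product of a rising and a falling smoothstep. The signs of \<xi>' on the two ramps
  make it a positive and a negative weight concentrated at the ends; the slope bound uses
  \<open>step'\<close> at most 30 and ramps of width \<epsilon>.\<close>

lemma exists_cutoff:
  fixes a b \<epsilon> :: real
  assumes \<epsilon>: "\<epsilon> > 0" "2 * \<epsilon> \<le> b - a"
  obtains \<xi> \<xi>' \<xi>'' where
    "\<And>x. (\<xi> has_real_derivative \<xi>' x) (at x)" "\<And>x. (\<xi>' has_real_derivative \<xi>'' x) (at x)" "continuous_on UNIV \<xi>''"
    "\<And>x. 0 \<le> \<xi> x \<and> \<xi> x \<le> 1" "\<And>x. x \<le> a \<or> b \<le> x \<Longrightarrow> \<xi> x = 0 \<and> \<xi>' x = 0 \<and> \<xi>'' x = 0"
    "\<And>x. a + \<epsilon> \<le> x \<Longrightarrow> x \<le> b - \<epsilon> \<Longrightarrow> \<xi> x = 1 \<and> \<xi>' x = 0"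
    "\<And>x. x \<le> a + \<epsilon> \<Longrightarrow> \<xi>' x \<ge> 0" "\<And>x. b - \<epsilon> \<le> x \<Longrightarrow> \<xi>' x \<le> 0"
    "\<And>x. \<bar>\<xi>' x\<bar> \<le> 30 / \<epsilon>"
proof -
  define l where "l = (\<lambda>x. (x - a) / \<epsilon>)"
  define r where "r = (\<lambda>x. (b - x) / \<epsilon>)"
  have dl: "(l has_real_derivative 1 / \<epsilon>) (at x)" and dr: "(r has_real_derivative - 1 / \<epsilon>) (at x)" for x
    unfolding l_def r_def using \<epsilon> by (auto intro!: derivative_eq_intros)
  define \<xi> where "\<xi> = (\<lambda>x. step (l x) * step (r x))"
  define \<xi>' where "\<xi>' = (\<lambda>x. (step' (l x) * step (r x) - step (l x) * step' (r x)) / \<epsilon>)"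
  define \<xi>'' where "\<xi>'' = (\<lambda>x. (step'' (l x) * step (r x) - 2 * (step' (l x) * step' (r x)) + step (l x) * step'' (r x)) / \<epsilon>\<^sup>2)"
  have chain: "((\<lambda>x. f (l x)) has_real_derivative f' (l x) * (1 / \<epsilon>)) (at x)"
    "((\<lambda>x. f (r x)) has_real_derivative f' (r x) * (- 1 / \<epsilon>)) (at x)"
    if "\<And>t. (f has_real_derivative f' t) (at t)" for f f' x
    using DERIV_chain2[OF that dl] DERIV_chain2[OF that dr] by auto
  note s1 = chain[of step step', OF step_has_real_derivative(1)] and s2 = chain[of step' step'', OF step_has_real_derivative(2)]
  have cl: "continuous_on UNIV (\<lambda>x. f (l x))" "continuous_on UNIV (\<lambda>x. f (r x))" if "continuous_on UNIV f" for f :: "real \<Rightarrow> real"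
    unfolding l_def r_def by (rule continuous_on_compose2[OF that]; use \<epsilon> in \<open>auto intro!: continuous_intros\<close>)+
  have cs: "continuous_on UNIV step" "continuous_on UNIV step'"
    using step_has_real_derivative by (auto intro!: continuous_at_imp_continuous_on DERIV_isCont)
  show ?thesis
  proof (rule that[of \<xi> \<xi>' \<xi>''])
    show "(\<xi> has_real_derivative \<xi>' x) (at x)" for x
      unfolding \<xi>_def \<xi>'_def using DERIV_mult[OF s1(1)[of x] s1(2)[of x]]
      by (rule DERIV_cong) (simp add: diff_divide_distrib mult.commute)
    show "(\<xi>' has_real_derivative \<xi>'' x) (at x)" for x
      unfolding \<xi>'_def \<xi>''_def
      by (rule DERIV_cong[OF DERIV_cdivide[OF DERIV_diff[OF DERIV_mult[OF s2(1)[of x] s1(2)[of x]]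
            DERIV_mult[OF s1(1)[of x] s2(2)[of x]]], of \<epsilon>]]) (use \<epsilon> in \<open>simp add: field_simps power2_eq_square\<close>)
    show "continuous_on UNIV \<xi>''"
      unfolding \<xi>''_def using \<epsilon> by (intro continuous_intros cl cs continuous_step'') auto
    show "0 \<le> \<xi> x \<and> \<xi> x \<le> 1" for x
      unfolding \<xi>_def using step_bounds by (auto intro: mult_le_one)
    show "\<xi> x = 0 \<and> \<xi>' x = 0 \<and> \<xi>'' x = 0" if "x \<le> a \<or> b \<le> x" for x
    proof -
      have "l x \<le> 0 \<or> r x \<le> 0" using that \<epsilon> by (auto simp: l_def r_def divide_nonpos_pos)
      then show ?thesis by (auto simp: \<xi>_def \<xi>'_def \<xi>''_def step_le_0)
    qed
    show "\<xi> x = 1 \<and> \<xi>' x = 0" if "a + \<epsilon> \<le> x" "x \<le> b - \<epsilon>" for x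
    proof -
      have "1 \<le> l x" "1 \<le> r x" using that \<epsilon> by (auto simp: l_def r_def field_simps)
      then show ?thesis by (simp add: \<xi>_def \<xi>'_def step_ge_1)
    qed
    show "\<xi>' x \<ge> 0" if "x \<le> a + \<epsilon>" for x
    proof -
      have "1 \<le> r x" using that \<epsilon> by (auto simp: r_def field_simps)
      then show ?thesis using \<epsilon> step'_nonneg[of "l x"] by (simp add: \<xi>'_def step_ge_1)
    qed
    show "\<xi>' x \<le> 0" if "b - \<epsilon> \<le> x" for x
    proof -
      have "1 \<le> l x" using that \<epsilon> by (auto simp: l_def field_simps)
      then show ?thesis using \<epsilon> step'_nonneg[of "r x"] by (simp add: \<xi>'_def step_ge_1 divide_nonpos_pos)
    qed
    show "\<bar>\<xi>' x\<bar> \<le> 30 / \<epsilon>" for x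
    proof -
      have c: "0 \<le> clamp t" "clamp t \<le> 1" for t by (auto simp: clamp_def)
      have "step' t \<le> 30 * 1\<^sup>2 * 1\<^sup>2" for t
        unfolding step'_def using c[of t] by (intro mult_mono power_mono) auto
      then have s: "0 \<le> step' t" "step' t \<le> 30" "0 \<le> step t" "step t \<le> 1" for t
        using step'_nonneg step_bounds by auto
      have "0 \<le> step' u * step v" "step' u * step v \<le> 30 * 1" for u v
        using s by (auto intro!: mult_nonneg_nonneg mult_mono simp del: mult_1_right)
      then have p: "0 \<le> step' u * step v" "step' u * step v \<le> 30" for u v by auto
      have "\<bar>step' (l x) * step (r x) - step (l x) * step' (r x)\<bar> \<le> 30"
        using p[of "l x" "r x"] p[of "r x" "l x"] unfolding abs_le_iff by (simp add: mult.commute)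
      then show ?thesis using \<epsilon> by (simp add: \<xi>'_def abs_divide divide_right_mono)
    qed
  qed
qed

text \<open>On the left ramp \<xi>' is a nonnegative weight of mass 1, on the right ramp a
  nonpositive one of mass -1. Integration therefore yields w a - w b up to the oscillation of w on
  the ramps.\<close>

lemma cutoff_boundary_values:
  fixes w :: "real \<Rightarrow> complex"
  assumes ab: "\<epsilon> > 0" "2 * \<epsilon> \<le> b - a" and w: "continuous_on {a..b} w"
    and d\<xi>: "\<And>x. (\<xi> has_real_derivative \<xi>' x) (at x)" and c\<xi>': "continuous_on UNIV \<xi>'"
    and out: "\<xi> a = 0" "\<xi> b = 0" and one: "\<And>x. a + \<epsilon> \<le> x \<Longrightarrow> x \<le> b - \<epsilon> \<Longrightarrow> \<xi> x = 1 \<and> \<xi>' x = 0"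
    and pos: "\<And>x. x \<le> a + \<epsilon> \<Longrightarrow> \<xi>' x \<ge> 0" and neg: "\<And>x. b - \<epsilon> \<le> x \<Longrightarrow> \<xi>' x \<le> 0"
    and osc: "\<And>x. a \<le> x \<Longrightarrow> x \<le> a + \<epsilon> \<Longrightarrow> norm (w x - w a) \<le> \<delta>" "\<And>x. b - \<epsilon> \<le> x \<Longrightarrow> x \<le> b \<Longrightarrow> norm (w x - w b) \<le> \<delta>"
  shows "norm (integral {a..b} (\<lambda>x. \<xi>' x *\<^sub>R w x) - (w a - w b)) \<le> 2 * \<delta>"
proof -
  have int: "(\<lambda>x. \<xi>' x *\<^sub>R (w x - k)) integrable_on {c..d}" if "a \<le> c" "d \<le> b" for c d k
    by (rule integrable_continuous_real)
       (use that in \<open>auto intro!: continuous_intros continuous_on_subset[OF w] continuous_on_subset[OF c\<xi>']\<close>)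
  have FTC: "(\<xi>' has_integral \<xi> d - \<xi> c) {c..d}" if "c \<le> d" for c d
    by (rule fundamental_theorem_of_calculus[OF that])
       (use d\<xi> in \<open>auto simp: has_real_derivative_iff_has_vector_derivative[symmetric] intro: has_field_derivative_at_within\<close>)
  have shift: "integral {c..d} (\<lambda>x. \<xi>' x *\<^sub>R w x) = integral {c..d} (\<lambda>x. \<xi>' x *\<^sub>R (w x - k)) + (\<xi> d - \<xi> c) *\<^sub>R k"
    if "a \<le> c" "c \<le> d" "d \<le> b" for c d k
  proof -
    have "((\<lambda>x. \<xi>' x *\<^sub>R (w x - k) + \<xi>' x *\<^sub>R k) has_integral (integral {c..d} (\<lambda>x. \<xi>' x *\<^sub>R (w x - k)) + (\<xi> d - \<xi> c) *\<^sub>R k)) {c..d}"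
      using that by (intro has_integral_add integrable_integral int has_integral_scaleR_left FTC) auto
    then show ?thesis by (simp add: algebra_simps integral_unique)
  qed
  \<comment> \<open>\<open>s\<close> is the sign of \<xi>' on the ramp, so that one estimate serves
    both ends.\<close>
  have bound: "norm (integral {c..d} (\<lambda>x. \<xi>' x *\<^sub>R (w x - k))) \<le> \<delta>"
    if cd: "a \<le> c" "c \<le> d" "d \<le> b" and k: "\<And>x. c \<le> x \<Longrightarrow> x \<le> d \<Longrightarrow> norm (w x - k) \<le> \<delta>"
      and s: "\<bar>s\<bar> = 1" "\<And>x. c \<le> x \<Longrightarrow> x \<le> d \<Longrightarrow> \<bar>\<xi>' x\<bar> = s * \<xi>' x" "s * (\<xi> d - \<xi> c) = 1" for c d k s
  proof -
    have "((\<lambda>x. s * \<xi>' x * \<delta>) has_integral s * (\<xi> d - \<xi> c) * \<delta>) {c..d}"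
      by (intro has_integral_mult_left has_integral_mult_right FTC cd)
    then have i: "((\<lambda>x. s * \<xi>' x * \<delta>) has_integral \<delta>) {c..d}" by (simp add: s(3))
    have "norm (integral {c..d} (\<lambda>x. \<xi>' x *\<^sub>R (w x - k))) \<le> integral {c..d} (\<lambda>x. s * \<xi>' x * \<delta>)"
    proof (rule integral_norm_bound_integral)
      show "(\<lambda>x. \<xi>' x *\<^sub>R (w x - k)) integrable_on {c..d}" using cd by (intro int) auto
      show "(\<lambda>x. s * \<xi>' x * \<delta>) integrable_on {c..d}" using i by blast
      show "norm (\<xi>' x *\<^sub>R (w x - k)) \<le> s * \<xi>' x * \<delta>" if "x \<in> {c..d}" for x
        using k[of x] s(2)[of x] that by (auto simp: mult_left_mono simp flip: s(2))
    qed
    also have "\<dots> = \<delta>" using i by (rule integral_unique)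
    finally show ?thesis .
  qed
  have \<xi>1: "\<xi> (a + \<epsilon>) = 1" "\<xi> (b - \<epsilon>) = 1" using one ab by auto
  have "integral {a..b} (\<lambda>x. \<xi>' x *\<^sub>R w x) = integral {a..a + \<epsilon>} (\<lambda>x. \<xi>' x *\<^sub>R w x)
      + (integral {a + \<epsilon>..b - \<epsilon>} (\<lambda>x. \<xi>' x *\<^sub>R w x) + integral {b - \<epsilon>..b} (\<lambda>x. \<xi>' x *\<^sub>R w x))"
  proof -
    have "integral {a + \<epsilon>..b - \<epsilon>} (\<lambda>x. \<xi>' x *\<^sub>R w x) + integral {b - \<epsilon>..b} (\<lambda>x. \<xi>' x *\<^sub>R w x) = integral {a + \<epsilon>..b} (\<lambda>x. \<xi>' x *\<^sub>R w x)"
      using ab int[of "a + \<epsilon>" b 0] by (intro Henstock_Kurzweil_Integration.integral_combine) auto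
    moreover have "integral {a..a + \<epsilon>} (\<lambda>x. \<xi>' x *\<^sub>R w x) + integral {a + \<epsilon>..b} (\<lambda>x. \<xi>' x *\<^sub>R w x) = integral {a..b} (\<lambda>x. \<xi>' x *\<^sub>R w x)"
      using ab int[of a b 0] by (intro Henstock_Kurzweil_Integration.integral_combine) auto
    ultimately show ?thesis by simp
  qed
  also have "integral {a + \<epsilon>..b - \<epsilon>} (\<lambda>x. \<xi>' x *\<^sub>R w x) = 0"
    by (rule integral_unique[OF has_integral_is_0]) (use one in auto)
  also have "integral {a..a + \<epsilon>} (\<lambda>x. \<xi>' x *\<^sub>R w x) = integral {a..a + \<epsilon>} (\<lambda>x. \<xi>' x *\<^sub>R (w x - w a)) + w a"
    using shift[of a "a + \<epsilon>" "w a"] ab by (simp add: \<xi>1 out)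
  also have "integral {b - \<epsilon>..b} (\<lambda>x. \<xi>' x *\<^sub>R w x) = integral {b - \<epsilon>..b} (\<lambda>x. \<xi>' x *\<^sub>R (w x - w b)) - w b"
    using shift[of "b - \<epsilon>" b "w b"] ab by (simp add: \<xi>1 out)
  finally have "integral {a..b} (\<lambda>x. \<xi>' x *\<^sub>R w x) - (w a - w b)
     = integral {a..a + \<epsilon>} (\<lambda>x. \<xi>' x *\<^sub>R (w x - w a)) + integral {b - \<epsilon>..b} (\<lambda>x. \<xi>' x *\<^sub>R (w x - w b))" by simp
  also have "norm \<dots> \<le> \<delta> + \<delta>"
  proof (rule norm_triangle_mono)
    show "norm (integral {a..a + \<epsilon>} (\<lambda>x. \<xi>' x *\<^sub>R (w x - w a))) \<le> \<delta>"
      by (rule bound[where s=1]) (use ab osc pos \<xi>1 out in auto)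
    show "norm (integral {b - \<epsilon>..b} (\<lambda>x. \<xi>' x *\<^sub>R (w x - w b))) \<le> \<delta>"
      by (rule bound[where s="-1"]) (use ab osc neg \<xi>1 out in auto)
  qed
  finally show ?thesis by simp
qed

text \<open>Passage from the Lebesgue integral of the inner product to the gauge integral, in which
  the integration by parts is carried out.\<close>

lemma lebesgue_integral_compact_support:
  fixes T :: "real \<Rightarrow> complex"
  assumes "integrable lebesgue T" "\<And>x. x \<notin> {a..b} \<Longrightarrow> T x = 0"
  shows "(\<integral>x. T x \<partial>lebesgue) = integral {a..b} T"
proof -
  have "(T has_integral (\<integral>x. T x \<partial>lebesgue)) UNIV" by (rule has_integral_integral_lebesgue[OF assms(1)])
  moreover have "T = (\<lambda>x. if x \<in> {a..b} then T x else 0)" using assms(2) by auto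
  ultimately have "((\<lambda>x. if x \<in> {a..b} then T x else 0) has_integral (\<integral>x. T x \<partial>lebesgue)) UNIV" by simp
  then show ?thesis unfolding has_integral_restrict_UNIV by (simp add: integral_unique)
qed

section \<open>The boundary forms and their representation\<close>

text \<open>The Wronskian at \<open>a\<close> of \<open>f\<close> with a function having the Cauchy
  data \<open>c\<close>, conjugate linear in \<open>c\<close>. It combines f(a) and f'(a) into one
  functional.\<close>

definition lform :: "real \<Rightarrow> complex ^ ('m::finite + 'm) \<Rightarrow> (real \<Rightarrow> complex ^ 'm) \<Rightarrow> complex" where
  "lform a c f = cinner (vderiv f a) (lo c) - cinner (f a) (hi c)"

text \<open>From here on the fibre is indexed by \<open>'m + 'm\<close>, as the Cauchy data are, so
  that its dimension is 2 m.\<close>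

locale periodic_schroedinger = spectral_schroedinger Q E0 \<mu> U
  for Q :: "real \<Rightarrow> complex ^ 'm ^ 'm" and E0 :: real and \<mu> :: "real measure"
    and U :: "(real \<Rightarrow> complex ^ 'm) \<Rightarrow> real \<Rightarrow> complex ^ ('m::finite + 'm)" +
  fixes \<omega> :: real
  assumes Q: "continuous_on UNIV Q" and herm: "\<And>x. conj_transpose (Q x) = Q x"
    and per: "\<And>x. Q (x + \<omega>) = Q x" and w: "\<omega> > 0"
begin

section \<open>Lagrange's identity on an interval\<close>

lemma D_derivative:
  assumes "f \<in> D"
  shows "(f has_vector_derivative vderiv f x) (at x)" "continuous_on UNIV f" "continuous_on UNIV (vderiv f)"
proof -
  show d: "(f has_vector_derivative vderiv f x) (at x)" for x
    using assms by (auto simp: schroedinger_dom_def vector_derivative_works)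
  show "continuous_on UNIV f"
    using d by (auto intro!: continuous_at_imp_continuous_on has_vector_derivative_continuous)
  show "continuous_on UNIV (vderiv f)"
    by (rule continuous_on_vec) (use assms AC_loc_continuous in \<open>auto simp: schroedinger_dom_def\<close>)
qed

lemma test_identity:
  assumes f: "f \<in> D" and g: "\<And>x. (g has_vector_derivative g' x) (at x)" "\<And>x. (g' has_vector_derivative g'' x) (at x)"
    "continuous_on UNIV g''" "\<And>x. R < \<bar>x\<bar> \<Longrightarrow> g x = 0"
  shows "L2_inner lebesgue (H f) g = L2_inner lebesgue f (\<lambda>x. - g'' x + Q x *v g x)"
    "g \<in> L2 lebesgue" "(\<lambda>x. - g'' x + Q x *v g x) \<in> L2 lebesgue"
proof -
  have gD: "g \<in> D" by (rule test_function_in_dom(1)[where R=R, OF Q g(1,2,3)]) (use g(4) in auto)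
  have Hg: "H g = (\<lambda>x. - g'' x + Q x *v g x)"
    by (rule test_function_in_dom(2)[where R=R, OF Q g(1,2,3)]) (use g(4) in auto)
  show "L2_inner lebesgue (H f) g = L2_inner lebesgue f (\<lambda>x. - g'' x + Q x *v g x)"
    "g \<in> L2 lebesgue" "(\<lambda>x. - g'' x + Q x *v g x) \<in> L2 lebesgue"
    using H_symmetric[OF f gD] H_L2[OF gD] D_L2[OF gD] unfolding Hg by auto
qed

text \<open>Integration by parts against f'' is avoided. The symmetry of \<open>H\<close> is applied
  to the test function \<xi> \<psi>, and the terms in which a derivative falls on \<xi> can be
  rewritten with f and f' alone.\<close>

lemma cutoff_identity:
  fixes \<psi> \<psi>' \<psi>'' :: "real \<Rightarrow> complex ^ 'm"
  assumes f: "f \<in> D" and "a < b"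
    and d\<psi>: "\<And>x. (\<psi> has_vector_derivative \<psi>' x) (at x)" "\<And>x. (\<psi>' has_vector_derivative \<psi>'' x) (at x)"
    and c\<psi>'': "continuous_on UNIV \<psi>''"
    and d\<xi>: "\<And>x. (\<xi> has_real_derivative \<xi>' x) (at x)" "\<And>x. (\<xi>' has_real_derivative \<xi>'' x) (at x)"
    and c\<xi>'': "continuous_on UNIV \<xi>''" and out: "\<And>x. x \<le> a \<or> b \<le> x \<Longrightarrow> \<xi> x = 0 \<and> \<xi>' x = 0 \<and> \<xi>'' x = 0"
  shows "(\<integral>x. \<xi> x *\<^sub>R (cinner (H f x) (\<psi> x) - cinner (f x) (- \<psi>'' x + Q x *v \<psi> x)) \<partial>lebesgue)
    = integral {a..b} (\<lambda>x. \<xi>' x *\<^sub>R (cinner (vderiv f x) (\<psi> x) - cinner (f x) (\<psi>' x)))"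
proof -
  have c\<psi>: "continuous_on UNIV \<psi>" "continuous_on UNIV \<psi>'"
    using d\<psi> by (auto intro!: continuous_at_imp_continuous_on has_vector_derivative_continuous)
  have c\<xi>: "continuous_on UNIV \<xi>" "continuous_on UNIV \<xi>'"
    using d\<xi> by (auto intro!: continuous_at_imp_continuous_on DERIV_isCont)
  define g where "g = (\<lambda>x. \<xi> x *\<^sub>R \<psi> x)"
  define g' where "g' = (\<lambda>x. \<xi> x *\<^sub>R \<psi>' x + \<xi>' x *\<^sub>R \<psi> x)"
  define g'' where "g'' = (\<lambda>x. (\<xi> x *\<^sub>R \<psi>'' x + \<xi>' x *\<^sub>R \<psi>' x) + (\<xi>' x *\<^sub>R \<psi>' x + \<xi>'' x *\<^sub>R \<psi> x))"
  have dg: "(g has_vector_derivative g' x) (at x)" for x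
    unfolding g_def g'_def by (intro has_vector_derivative_scaleR d\<xi> d\<psi>)
  have dg': "(g' has_vector_derivative g'' x) (at x)" for x
    unfolding g'_def g''_def by (intro has_vector_derivative_add has_vector_derivative_scaleR d\<xi> d\<psi>)
  have cg'': "continuous_on UNIV g''" unfolding g''_def by (intro continuous_intros c\<xi> c\<psi> c\<xi>'' c\<psi>'')
  have supp: "g x = 0" if "max \<bar>a\<bar> \<bar>b\<bar> < \<bar>x\<bar>" for x
  proof -
    have "x \<le> a \<or> b \<le> x" using that by (auto simp: abs_if split: if_splits)
    then show ?thesis using out by (simp add: g_def)
  qed
  have ti: "L2_inner lebesgue (H f) g = L2_inner lebesgue f (\<lambda>x. - g'' x + Q x *v g x)"
    "g \<in> L2 lebesgue" "(\<lambda>x. - g'' x + Q x *v g x) \<in> L2 lebesgue"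
    using test_identity[where R="max \<bar>a\<bar> \<bar>b\<bar>", OF f dg dg' cg''] supp by blast+
  \<comment> \<open>The commutator of the second derivative with \<xi>, applied to \<psi> and paired
    with f.\<close>
  define T where "T = (\<lambda>x. (2 * \<xi>' x) *\<^sub>R cinner (f x) (\<psi>' x) + \<xi>'' x *\<^sub>R cinner (f x) (\<psi> x))"
  have eq: "\<xi> x *\<^sub>R (cinner (H f x) (\<psi> x) - cinner (f x) (- \<psi>'' x + Q x *v \<psi> x))
      = (cinner (H f x) (g x) - cinner (f x) (- g'' x + Q x *v g x)) - T x" for x
    by (simp only: g_def g''_def T_def cinner_scaleR_right cinner_add_right cinner_minus_right matrix_vector_mult_scaleR_complex
        scaleR_conv_of_real[where 'a=complex]) (simp add: algebra_simps)
  have Tout: "T x = 0" if "x \<notin> {a..b}" for x using out[of x] that by (auto simp: T_def)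
  have cT: "continuous_on UNIV T"
    unfolding T_def by (intro continuous_intros D_derivative[OF f] c\<xi> c\<psi> c\<xi>'')
  have intT: "integrable lebesgue T"
  proof -
    have 1: "(\<lambda>x. indicat_real {a..b} x *\<^sub>R f x) \<in> L2 lebesgue"
      using \<open>a < b\<close> by (intro L2_continuous_interval continuous_on_subset[OF D_derivative(2)[OF f]]) auto
    have 2: "(\<lambda>x. indicat_real {a..b} x *\<^sub>R ((2 * \<xi>' x) *\<^sub>R \<psi>' x + \<xi>'' x *\<^sub>R \<psi> x)) \<in> L2 lebesgue"
      using \<open>a < b\<close> by (intro L2_continuous_interval continuous_on_subset[of UNIV _ "{a..b}"] continuous_intros c\<xi> c\<psi> c\<xi>'') auto
    have "T = (\<lambda>x. cinner (indicat_real {a..b} x *\<^sub>R f x) (indicat_real {a..b} x *\<^sub>R ((2 * \<xi>' x) *\<^sub>R \<psi>' x + \<xi>'' x *\<^sub>R \<psi> x)))"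
      using Tout by (auto simp: fun_eq_iff indicator_def T_def cinner_add_right cinner_scaleR_right scaleR_conv_of_real[where 'a=complex])
    then show ?thesis using integrable_cinner(1)[OF 1 2] by simp
  qed
  have "(\<integral>x. \<xi> x *\<^sub>R (cinner (H f x) (\<psi> x) - cinner (f x) (- \<psi>'' x + Q x *v \<psi> x)) \<partial>lebesgue)
      = (\<integral>x. cinner (H f x) (g x) - cinner (f x) (- g'' x + Q x *v g x) \<partial>lebesgue) - (\<integral>x. T x \<partial>lebesgue)"
    unfolding eq
    by (intro Bochner_Integration.integral_diff Bochner_Integration.integrable_diff integrable_cinner intT H_L2[OF f] D_L2[OF f] ti(2,3))
  also have "(\<integral>x. cinner (H f x) (g x) - cinner (f x) (- g'' x + Q x *v g x) \<partial>lebesgue) = 0"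
    using ti(1) Bochner_Integration.integral_diff[OF integrable_cinner(1)[OF H_L2[OF f] ti(2)] integrable_cinner(1)[OF D_L2[OF f] ti(3)]]
    by (simp only: L2_inner_eq) simp
  also have "(\<integral>x. T x \<partial>lebesgue) = integral {a..b} T"
    by (rule lebesgue_integral_compact_support[OF intT Tout])
  also have "0 - integral {a..b} T = integral {a..b} (\<lambda>x. \<xi>' x *\<^sub>R (cinner (vderiv f x) (\<psi> x) - cinner (f x) (\<psi>' x)))"
  proof -
    let ?w = "\<lambda>x. \<xi>' x *\<^sub>R (cinner (vderiv f x) (\<psi> x) - cinner (f x) (\<psi>' x))"
    \<comment> \<open>The integrand is the derivative of \<xi>' times the pairing of f with \<psi>,
      and \<xi>' vanishes at both ends.\<close>
    have "((\<lambda>x. T x + ?w x) has_integral (\<xi>' b *\<^sub>R cinner (f b) (\<psi> b) - \<xi>' a *\<^sub>R cinner (f a) (\<psi> a))) {a..b}"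
    proof (rule fundamental_theorem_of_calculus)
      fix x
      have "((\<lambda>x. \<xi>' x *\<^sub>R cinner (f x) (\<psi> x)) has_vector_derivative
         (\<xi>' x *\<^sub>R (cinner (f x) (\<psi>' x) + cinner (vderiv f x) (\<psi> x)) + \<xi>'' x *\<^sub>R cinner (f x) (\<psi> x))) (at x)"
        by (intro has_vector_derivative_scaleR d\<xi> cinner_has_vector_derivative D_derivative[OF f] d\<psi>)
      moreover have "(\<xi>' x *\<^sub>R (cinner (f x) (\<psi>' x) + cinner (vderiv f x) (\<psi> x)) + \<xi>'' x *\<^sub>R cinner (f x) (\<psi> x)) = T x + ?w x"
        by (simp add: T_def algebra_simps scaleR_conv_of_real)
      ultimately show "((\<lambda>x. \<xi>' x *\<^sub>R cinner (f x) (\<psi> x)) has_vector_derivative T x + ?w x) (at x within {a..b})"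
        by (simp add: has_vector_derivative_at_within)
    qed (use \<open>a < b\<close> in simp)
    then have "((\<lambda>x. T x + ?w x) has_integral 0) {a..b}" using out[of a] out[of b] by simp
    moreover have "T integrable_on {a..b}" by (intro integrable_continuous_real continuous_on_subset[OF cT]) auto
    ultimately have "((\<lambda>x. (T x + ?w x) - T x) has_integral 0 - integral {a..b} T) {a..b}"
      by (intro has_integral_diff integrable_integral)
    then show ?thesis by (simp add: integral_unique)
  qed
  finally show ?thesis .
qed

text \<open>As the ramps of the cutoffs shrink, the cutoffs tend to the indicator of [a, b]:
  dominated convergence handles the side with \<open>H\<close>, concentration of \<xi>' at the
  endpoints the boundary terms.\<close>

lemma Lagrange_identity:
  fixes \<psi> \<psi>' \<psi>'' :: "real \<Rightarrow> complex ^ 'm"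
  assumes f: "f \<in> D" and ab: "a < b"
    and d\<psi>: "\<And>x. (\<psi> has_vector_derivative \<psi>' x) (at x)" "\<And>x. (\<psi>' has_vector_derivative \<psi>'' x) (at x)"
    and c\<psi>'': "continuous_on UNIV \<psi>''"
  shows "L2_inner lebesgue (H f) (\<lambda>x. indicat_real {a..b} x *\<^sub>R \<psi> x)
      - L2_inner lebesgue f (\<lambda>x. indicat_real {a..b} x *\<^sub>R (- \<psi>'' x + Q x *v \<psi> x))
    = lform a (join (\<psi> a) (\<psi>' a)) f - lform b (join (\<psi> b) (\<psi>' b)) f"
proof -
  have c\<psi>: "continuous_on UNIV \<psi>" "continuous_on UNIV \<psi>'"
    using d\<psi> by (auto intro!: continuous_at_imp_continuous_on has_vector_derivative_continuous)
  define R where "R = (\<lambda>x. cinner (H f x) (\<psi> x) - cinner (f x) (- \<psi>'' x + Q x *v \<psi> x))"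
  define w where "w = (\<lambda>x. cinner (vderiv f x) (\<psi> x) - cinner (f x) (\<psi>' x))"
  have cw: "continuous_on UNIV w" unfolding w_def by (intro continuous_intros D_derivative[OF f] c\<psi>)
  have L1: "(\<lambda>x. indicat_real {a..b} x *\<^sub>R \<psi> x) \<in> L2 lebesgue"
    using ab by (intro L2_continuous_interval continuous_on_subset[OF c\<psi>(1)]) auto
  have L2: "(\<lambda>x. indicat_real {a..b} x *\<^sub>R (- \<psi>'' x + Q x *v \<psi> x)) \<in> L2 lebesgue"
    using ab by (intro L2_continuous_interval continuous_on_subset[of UNIV _ "{a..b}"] continuous_intros c\<psi>'' Q c\<psi>) auto
  have Req: "indicat_real {a..b} x *\<^sub>R R x = cinner (H f x) (indicat_real {a..b} x *\<^sub>R \<psi> x)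
      - cinner (f x) (indicat_real {a..b} x *\<^sub>R (- \<psi>'' x + Q x *v \<psi> x))" for x
    by (simp add: R_def indicator_def)
  have intR: "integrable lebesgue (\<lambda>x. indicat_real {a..b} x *\<^sub>R R x)"
    unfolding Req by (intro Bochner_Integration.integrable_diff integrable_cinner H_L2[OF f] D_L2[OF f] L1 L2)
  \<comment> \<open>The properties of the n-th cutoff, with ramps of width (b - a) / (2 (n + 1)),
    form one predicate, so that a sequence of cutoffs and derivatives can be chosen at once.\<close>
  define P where "P = (\<lambda>(n::nat) \<xi> \<xi>'. (\<forall>x. 0 \<le> \<xi> x \<and> \<xi> x \<le> 1) \<and> (\<forall>x. x \<le> a \<or> b \<le> x \<longrightarrow> \<xi> x = 0) \<and> continuous_on UNIV \<xi> \<and>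
      (\<forall>x. a + (b - a) / (2 * real (Suc n)) \<le> x \<longrightarrow> x \<le> b - (b - a) / (2 * real (Suc n)) \<longrightarrow> \<xi> x = (1::real)) \<and>
      (\<integral>x. \<xi> x *\<^sub>R R x \<partial>lebesgue) = integral {a..b} (\<lambda>x. \<xi>' x *\<^sub>R w x) \<and>
      (\<forall>\<delta>. (\<forall>x\<in>{a..a + (b - a) / (2 * real (Suc n))}. norm (w x - w a) \<le> \<delta>) \<longrightarrow>
           (\<forall>x\<in>{b - (b - a) / (2 * real (Suc n))..b}. norm (w x - w b) \<le> \<delta>) \<longrightarrow>
           norm (integral {a..b} (\<lambda>x. \<xi>' x *\<^sub>R w x) - (w a - w b)) \<le> 2 * \<delta>))"
  have "\<forall>n. \<exists>\<xi> \<xi>'. P n \<xi> \<xi>'"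
  proof
    fix n :: nat
    define e where "e = (b - a) / (2 * real (Suc n))"
    have "(b - a) / real (Suc n) \<le> (b - a) / 1" using ab by (intro divide_left_mono) auto
    moreover have "2 * e = (b - a) / real (Suc n)" 
      using mult_divide_mult_cancel_left[of "2::real" "b - a" "real (Suc n)"] by (simp add: e_def del: of_nat_Suc)
    ultimately have e: "e > 0" "2 * e \<le> b - a" using ab by (auto simp: e_def)
    obtain \<xi> \<xi>' \<xi>'' where \<xi>: "\<And>x. (\<xi> has_real_derivative \<xi>' x) (at x)" "\<And>x. (\<xi>' has_real_derivative \<xi>'' x) (at x)" "continuous_on UNIV \<xi>''"
      and b01: "\<And>x. 0 \<le> \<xi> x \<and> \<xi> x \<le> 1" and out: "\<And>x. x \<le> a \<or> b \<le> x \<Longrightarrow> \<xi> x = 0 \<and> \<xi>' x = 0 \<and> \<xi>'' x = 0"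
      and one: "\<And>x. a + e \<le> x \<Longrightarrow> x \<le> b - e \<Longrightarrow> \<xi> x = 1 \<and> \<xi>' x = 0"
      and pn: "\<And>x. x \<le> a + e \<Longrightarrow> \<xi>' x \<ge> 0" "\<And>x. b - e \<le> x \<Longrightarrow> \<xi>' x \<le> 0"
      by (rule exists_cutoff[OF e]) (rule that)
    have c\<xi>: "continuous_on UNIV \<xi>" "continuous_on UNIV \<xi>'"
      using \<xi> by (auto intro!: continuous_at_imp_continuous_on DERIV_isCont)
    have "P n \<xi> \<xi>'"
      unfolding P_def e_def[symmetric]
    proof (intro conjI allI impI)
      show "0 \<le> \<xi> x" "\<xi> x \<le> 1" for x using b01 by auto
      show "\<xi> x = 0" if "x \<le> a \<or> b \<le> x" for x using out[OF that] by simp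
      show "continuous_on UNIV \<xi>" by (rule c\<xi>)
      show "\<xi> x = 1" if "a + e \<le> x" "x \<le> b - e" for x using one[OF that] by simp
      show "(\<integral>x. \<xi> x *\<^sub>R R x \<partial>lebesgue) = integral {a..b} (\<lambda>x. \<xi>' x *\<^sub>R w x)"
        unfolding R_def w_def by (rule cutoff_identity[OF f ab d\<psi> c\<psi>'' \<xi> out])
      show "norm (integral {a..b} (\<lambda>x. \<xi>' x *\<^sub>R w x) - (w a - w b)) \<le> 2 * \<delta>"
        if "\<forall>x\<in>{a..a + e}. norm (w x - w a) \<le> \<delta>" "\<forall>x\<in>{b - e..b}. norm (w x - w b) \<le> \<delta>" for \<delta>
      proof (rule cutoff_boundary_values[OF e continuous_on_subset[OF cw] \<xi>(1) c\<xi>(2)])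
        show "\<xi> a = 0" using out[of a] by blast
        show "\<xi> b = 0" using out[of b] by blast
        show "\<xi> x = 1 \<and> \<xi>' x = 0" if "a + e \<le> x" "x \<le> b - e" for x by (rule one[OF that])
        show "0 \<le> \<xi>' x" if "x \<le> a + e" for x by (rule pn(1)[OF that])
        show "\<xi>' x \<le> 0" if "b - e \<le> x" for x by (rule pn(2)[OF that])
        show "norm (w x - w a) \<le> \<delta>" if "a \<le> x" "x \<le> a + e" for x
          by (rule bspec[OF \<open>\<forall>x\<in>{a..a + e}. norm (w x - w a) \<le> \<delta>\<close>]) (use that in simp)
        show "norm (w x - w b) \<le> \<delta>" if "b - e \<le> x" "x \<le> b" for x
          by (rule bspec[OF \<open>\<forall>x\<in>{b - e..b}. norm (w x - w b) \<le> \<delta>\<close>]) (use that in simp)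
      qed simp
    qed
    then show "\<exists>\<xi> \<xi>'. P n \<xi> \<xi>'" by blast
  qed
  then obtain \<xi> \<xi>' where P: "\<And>n. P n (\<xi> n) (\<xi>' n)" by metis
  note P' = P[unfolded P_def]
  have b01: "0 \<le> \<xi> n x \<and> \<xi> n x \<le> 1" for n x by (rule P'[of n, THEN conjunct1, THEN HOL.spec])
  have out: "\<xi> n x = 0" if "x \<le> a \<or> b \<le> x" for n x
    by (rule P'[of n, THEN conjunct2, THEN conjunct1, THEN HOL.spec, THEN mp, OF that])
  have c\<xi>: "continuous_on UNIV (\<xi> n)" for n using P'[of n, THEN conjunct2, THEN conjunct2, THEN conjunct1] .
  have one: "\<xi> n x = 1" if "a + (b - a) / (2 * real (Suc n)) \<le> x" "x \<le> b - (b - a) / (2 * real (Suc n))" for n x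
    by (rule P'[of n, THEN conjunct2, THEN conjunct2, THEN conjunct2, THEN conjunct1, THEN HOL.spec, THEN mp, THEN mp, OF that])
  have id: "(\<integral>x. \<xi> n x *\<^sub>R R x \<partial>lebesgue) = integral {a..b} (\<lambda>x. \<xi>' n x *\<^sub>R w x)" for n
    using P'[of n, THEN conjunct2, THEN conjunct2, THEN conjunct2, THEN conjunct2, THEN conjunct1] .
  note lim = P'[THEN conjunct2, THEN conjunct2, THEN conjunct2, THEN conjunct2, THEN conjunct2, THEN HOL.spec, THEN mp, THEN mp]
  have e0: "(\<lambda>n. (b - a) / (2 * real (Suc n))) \<longlonglongrightarrow> 0"
  proof -
    have "(\<lambda>n. (b - a) / 2 / real (Suc n)) \<longlonglongrightarrow> 0"
      by (rule LIMSEQ_Suc[OF lim_const_over_n])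
    then show ?thesis by (simp only: divide_divide_eq_left)
  qed
  have lim1: "(\<lambda>n. \<integral>x. \<xi> n x *\<^sub>R R x \<partial>lebesgue) \<longlonglongrightarrow> w a - w b"
    unfolding id
  proof (rule LIMSEQ_I)
    fix r :: real assume r: "r > 0"
    have "r / 3 > 0" using r by simp
    have cont: "\<exists>d>0. \<forall>x. dist x p < d \<longrightarrow> norm (w x - w p) < r / 3" for p
      using cw[unfolded continuous_on_iff, THEN bspec, of p, THEN HOL.spec, THEN mp, OF UNIV_I \<open>r / 3 > 0\<close>]
      by (simp add: dist_norm[of "w _"] del: less_divide_eq_numeral1)
    from cont[of a] obtain d1 where d1: "d1 > 0" "\<forall>x. dist x a < d1 \<longrightarrow> norm (w x - w a) < r / 3" by blast
    from cont[of b] obtain d2 where d2: "d2 > 0" "\<forall>x. dist x b < d2 \<longrightarrow> norm (w x - w b) < r / 3" by blast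
    have "\<forall>\<^sub>F n in sequentially. (b - a) / (2 * real (Suc n)) < min d1 d2"
      using e0 d1(1) d2(1) by (intro order_tendstoD(2)) auto
    then obtain N where N: "\<And>n. n \<ge> N \<Longrightarrow> (b - a) / (2 * real (Suc n)) < min d1 d2"
      by (auto simp: eventually_sequentially)
    have "norm (integral {a..b} (\<lambda>x. \<xi>' n x *\<^sub>R w x) - (w a - w b)) < r" if n: "n \<ge> N" for n
    proof -
      have "norm (integral {a..b} (\<lambda>x. \<xi>' n x *\<^sub>R w x) - (w a - w b)) \<le> 2 * (r / 3)"
      proof (rule lim; intro ballI less_imp_le)
        show "norm (w x - w a) < r / 3" if "x \<in> {a..a + (b - a) / (2 * real (Suc n))}" for x
          using that N[OF n] by (intro d1(2)[rule_format]) (auto simp: dist_real_def)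
        show "norm (w x - w b) < r / 3" if "x \<in> {b - (b - a) / (2 * real (Suc n))..b}" for x
          using that N[OF n] by (intro d2(2)[rule_format]) (auto simp: dist_real_def)
      qed
      then show ?thesis using r by simp
    qed
    then show "\<exists>no. \<forall>n\<ge>no. norm (integral {a..b} (\<lambda>x. \<xi>' n x *\<^sub>R w x) - (w a - w b)) < r" by blast
  qed
  have "(\<lambda>n. \<integral>x. \<xi> n x *\<^sub>R R x \<partial>lebesgue) \<longlonglongrightarrow> (\<integral>x. indicat_real {a..b} x *\<^sub>R R x \<partial>lebesgue)"
  proof (rule integral_dominated_convergence[where w="\<lambda>x. norm (indicat_real {a..b} x *\<^sub>R R x)"])
    \<comment> \<open>The endpoints are set aside because every cutoff vanishes there while the
      indicator is 1.\<close>
    have "{a, b} \<in> null_sets lebesgue" by (simp add: negligible_iff_null_sets[symmetric])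
    then have "AE x in lebesgue. x \<notin> {a, b}" by (rule AE_not_in)
    then show "AE x in lebesgue. (\<lambda>n. \<xi> n x *\<^sub>R R x) \<longlonglongrightarrow> indicat_real {a..b} x *\<^sub>R R x"
    proof eventually_elim
      case (elim x)
      show ?case
      proof (cases "x \<in> {a<..<b}")
        case True
        have "\<forall>\<^sub>F n in sequentially. (b - a) / (2 * real (Suc n)) < min (x - a) (b - x)"
          using e0 True by (intro order_tendstoD(2)) auto
        then have "\<forall>\<^sub>F n in sequentially. \<xi> n x *\<^sub>R R x = indicat_real {a..b} x *\<^sub>R R x"
        proof eventually_elim
          case (elim n)
          then have "\<xi> n x = 1" by (intro one) auto
          with True show ?case by simp
        qed
        then show ?thesis by (rule tendsto_eventually)
      next
        case False
        then have "\<xi> n x = 0" for n using elim by (intro out) auto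
        moreover have "x \<notin> {a..b}" using False elim by auto
        ultimately show ?thesis by simp
      qed
    qed
    have eq: "\<xi> n x *\<^sub>R R x = \<xi> n x *\<^sub>R (indicat_real {a..b} x *\<^sub>R R x)" for n x
    proof (cases "x \<in> {a..b}")
      case False
      then have "x \<le> a \<or> b \<le> x" by auto
      from out[OF this] show ?thesis by simp
    qed simp
    show "(\<lambda>x. \<xi> n x *\<^sub>R R x) \<in> borel_measurable lebesgue" for n
    proof -
      have "\<xi> n \<in> borel_measurable lborel" using borel_measurable_continuous_onI[OF c\<xi>] by simp
      then have "\<xi> n \<in> borel_measurable lebesgue" by (rule measurable_completion)
      then show ?thesis unfolding eq by (rule borel_measurable_scaleR[OF _ borel_measurable_integrable[OF intR]])
    qed
    show "AE x in lebesgue. norm (\<xi> n x *\<^sub>R R x) \<le> norm (indicat_real {a..b} x *\<^sub>R R x)" for n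
    proof (rule AE_I2)
      fix x
      have "norm (\<xi> n x *\<^sub>R R x) = \<xi> n x * norm (indicat_real {a..b} x *\<^sub>R R x)"
        unfolding eq[of n x] using b01[of n x] by simp
      also have "\<dots> \<le> 1 * norm (indicat_real {a..b} x *\<^sub>R R x)" using b01[of n x] by (intro mult_right_mono) auto
      finally show "norm (\<xi> n x *\<^sub>R R x) \<le> norm (indicat_real {a..b} x *\<^sub>R R x)" by simp
    qed
    show "integrable lebesgue (\<lambda>x. norm (indicat_real {a..b} x *\<^sub>R R x))" by (rule integrable_norm[OF intR])
    show "(\<lambda>x. indicat_real {a..b} x *\<^sub>R R x) \<in> borel_measurable lebesgue" by (rule borel_measurable_integrable[OF intR])
  qed
  then have "(\<integral>x. indicat_real {a..b} x *\<^sub>R R x \<partial>lebesgue) = w a - w b"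
    using lim1 LIMSEQ_unique by blast
  moreover have "(\<integral>x. indicat_real {a..b} x *\<^sub>R R x \<partial>lebesgue) = L2_inner lebesgue (H f) (\<lambda>x. indicat_real {a..b} x *\<^sub>R \<psi> x)
      - L2_inner lebesgue f (\<lambda>x. indicat_real {a..b} x *\<^sub>R (- \<psi>'' x + Q x *v \<psi> x))"
    unfolding Req L2_inner_eq
    by (intro Bochner_Integration.integral_diff integrable_cinner H_L2[OF f] D_L2[OF f] L1 L2)
  ultimately show ?thesis by (simp add: lform_def w_def)
qed

end

lemma cnj_L2_inner: "cnj (L2_inner M u v) = L2_inner M v u"
  unfolding L2_inner_eq Bochner_Integration.integral_cnj[symmetric] cnj_cinner ..

lemma measurable_scale2 [measurable]:
  fixes k :: "'a \<Rightarrow> complex ^ 'k"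
  assumes "g \<in> borel_measurable M" "k \<in> borel_measurable M"
  shows "(\<lambda>y. g y *s k y) \<in> borel_measurable M"
proof -
  have "bounded_bilinear (\<lambda>c (v::complex ^ 'k). c *s v)"
    by (rule bounded_bilinear.intro)
       (auto simp: vec.scale_right_distrib vec.scale_left_distrib norm_scale_vec intro!: exI[of _ 1],
        auto simp: vec_eq_iff)
  then have "continuous_on UNIV (\<lambda>p::complex \<times> (complex ^ 'k). fst p *s snd p)"
    by (rule bounded_bilinear.continuous_on) (auto intro!: continuous_intros)
  then have "(\<lambda>p::complex \<times> (complex ^ 'k). fst p *s snd p) \<in> borel_measurable borel"
    by (rule borel_measurable_continuous_onI)
  then show ?thesis
    using measurable_compose[of "\<lambda>y. (g y, k y)" M "borel \<Otimes>\<^sub>M borel" "\<lambda>p. fst p *s snd p" borel] assms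
    by (simp add: borel_prod)
qed

context periodic_schroedinger
begin

section \<open>Bumps and Green functions at an energy below the spectrum\<close>

abbreviation "t0 \<equiv> E0 - 1"

lemma lform_zero [simp]: "lform a (join 0 0) f = 0"
  by (simp add: lform_def)

text \<open>Lagrange's identity on [a, a + 1] for a function with Cauchy data \<open>c\<close> at
  the left end and zero data at the right end. As Q is bounded, the norms of \<open>b\<close> and
  \<open>h\<close> are bounded independently of \<open>a\<close>.\<close>

lemma lform_bump:
  "\<exists>K\<ge>0. \<forall>a c. \<exists>b h. b \<in> L2 lebesgue \<and> h \<in> L2 lebesgue \<and>
    L2_norm lebesgue b \<le> K * norm c \<and> L2_norm lebesgue h \<le> K * norm c \<and>
    (\<forall>f\<in>D. lform a c f = L2_inner lebesgue (\<lambda>x. H f x - of_real t0 *s f x) b - L2_inner lebesgue f h)"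
proof -
  obtain B where B: "B \<ge> 0" "\<And>x. norm (Q x) \<le> B"
    using periodic_continuous_bounded[OF Q per w] by blast
  \<comment> \<open>From |\<psi>| <= 2 |c| and |\<psi>''| <= 16 |c| on the unit interval.\<close>
  define K where "K = 16 + 2 * B + 2 * \<bar>t0\<bar>"
  show ?thesis
  proof (intro exI[of _ K] conjI allI)
    show "K \<ge> 0" using B by (simp add: K_def)
    fix a :: real and c :: "complex ^ ('m + 'm)"
    \<comment> \<open>Cubic Hermite interpolation in x - a, with value and slope 0 at the right
      end.\<close>
    define \<psi> where "\<psi> = (\<lambda>x. (1 - 3 * (x - a)\<^sup>2 + 2 * (x - a) ^ 3) *\<^sub>R lo c + ((x - a) - 2 * (x - a)\<^sup>2 + (x - a) ^ 3) *\<^sub>R hi c)"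
    define \<psi>' where "\<psi>' = (\<lambda>x. (6 * (x - a)\<^sup>2 - 6 * (x - a)) *\<^sub>R lo c + (1 - 4 * (x - a) + 3 * (x - a)\<^sup>2) *\<^sub>R hi c)"
    define \<psi>'' where "\<psi>'' = (\<lambda>x. (12 * (x - a) - 6) *\<^sub>R lo c + (6 * (x - a) - 4) *\<^sub>R hi c)"
    have d1: "(\<psi> has_vector_derivative \<psi>' x) (at x)" for x
    proof -
      have "((\<lambda>x. 1 - 3 * (x - a)\<^sup>2 + 2 * (x - a) ^ 3) has_real_derivative 6 * (x - a)\<^sup>2 - 6 * (x - a)) (at x)"
        "((\<lambda>x. (x - a) - 2 * (x - a)\<^sup>2 + (x - a) ^ 3) has_real_derivative 1 - 4 * (x - a) + 3 * (x - a)\<^sup>2) (at x)"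
        by (auto intro!: derivative_eq_intros)
      then have "(\<psi> has_vector_derivative (((1 - 3 * (x - a)\<^sup>2 + 2 * (x - a) ^ 3) *\<^sub>R 0 + (6 * (x - a)\<^sup>2 - 6 * (x - a)) *\<^sub>R lo c)
          + (((x - a) - 2 * (x - a)\<^sup>2 + (x - a) ^ 3) *\<^sub>R 0 + (1 - 4 * (x - a) + 3 * (x - a)\<^sup>2) *\<^sub>R hi c))) (at x)"
        unfolding \<psi>_def by (intro has_vector_derivative_add has_vector_derivative_scaleR has_vector_derivative_const)
      then show ?thesis by (simp add: \<psi>'_def)
    qed
    have d2: "(\<psi>' has_vector_derivative \<psi>'' x) (at x)" for x
    proof -
      have "((\<lambda>x. 6 * (x - a)\<^sup>2 - 6 * (x - a)) has_real_derivative 12 * (x - a) - 6) (at x)"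
        "((\<lambda>x. 1 - 4 * (x - a) + 3 * (x - a)\<^sup>2) has_real_derivative 6 * (x - a) - 4) (at x)"
        by (auto intro!: derivative_eq_intros)
      then have "(\<psi>' has_vector_derivative (((6 * (x - a)\<^sup>2 - 6 * (x - a)) *\<^sub>R 0 + (12 * (x - a) - 6) *\<^sub>R lo c)
          + ((1 - 4 * (x - a) + 3 * (x - a)\<^sup>2) *\<^sub>R 0 + (6 * (x - a) - 4) *\<^sub>R hi c))) (at x)"
        unfolding \<psi>'_def by (intro has_vector_derivative_add has_vector_derivative_scaleR has_vector_derivative_const)
      then show ?thesis by (simp add: \<psi>''_def)
    qed
    have c\<psi>: "continuous_on UNIV \<psi>" "continuous_on UNIV \<psi>''"
      unfolding \<psi>_def \<psi>''_def by (intro continuous_intros)+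
    let ?I = "\<lambda>x. indicat_real {a..a + 1} x"
    define b where "b = (\<lambda>x. ?I x *\<^sub>R \<psi> x)"
    define g where "g = (\<lambda>x. ?I x *\<^sub>R (- \<psi>'' x + Q x *v \<psi> x))"
    define h where "h = (\<lambda>x. ?I x *\<^sub>R (- \<psi>'' x + Q x *v \<psi> x - t0 *\<^sub>R \<psi> x))"
    have c01: "norm (r *\<^sub>R lo c) \<le> k * norm c" "norm (r *\<^sub>R hi c) \<le> k * norm c" if "\<bar>r\<bar> \<le> k" for r k
      using that by (auto intro!: mult_mono norm_lo_le norm_hi_le)
    have b\<psi>: "norm (\<psi> x) \<le> 2 * norm c" "norm (\<psi>'' x) \<le> 16 * norm c" if x: "x \<in> {a..a + 1}" for x
    proof -
      define t where "t = x - a"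
      have t: "0 \<le> t" "t \<le> 1" using x by (auto simp: t_def)
      have "1 - 3 * t\<^sup>2 + 2 * t ^ 3 = (1 - t)\<^sup>2 * (1 + 2 * t)" "1 - (1 - 3 * t\<^sup>2 + 2 * t ^ 3) = t\<^sup>2 * (3 - 2 * t)"
        "t - 2 * t\<^sup>2 + t ^ 3 = t * (1 - t)\<^sup>2" by (auto simp: power2_eq_square power3_eq_cube algebra_simps)
      moreover have "0 \<le> (1 - t)\<^sup>2 * (1 + 2 * t)" "0 \<le> t\<^sup>2 * (3 - 2 * t)" "0 \<le> t * (1 - t)\<^sup>2" using t by auto
      moreover have "t * (1 - t)\<^sup>2 \<le> 1 * 1\<^sup>2" using t by (intro mult_mono power_mono) auto
      ultimately have 1: "\<bar>1 - 3 * t\<^sup>2 + 2 * t ^ 3\<bar> \<le> 1" "\<bar>t - 2 * t\<^sup>2 + t ^ 3\<bar> \<le> 1" by (auto simp: abs_le_iff)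
      have 2: "\<bar>12 * t - 6\<bar> \<le> 8" "\<bar>6 * t - 4\<bar> \<le> 8" using t by (auto simp: abs_le_iff)
      show "norm (\<psi> x) \<le> 2 * norm c"
        using norm_triangle_mono[OF c01(1)[OF 1(1)] c01(2)[OF 1(2)]] by (simp add: \<psi>_def t_def)
      show "norm (\<psi>'' x) \<le> 16 * norm c"
        using norm_triangle_mono[OF c01(1)[OF 2(1)] c01(2)[OF 2(2)]] by (simp add: \<psi>''_def t_def)
    qed
    have bh: "norm (- \<psi>'' x + Q x *v \<psi> x - t0 *\<^sub>R \<psi> x) \<le> K * norm c" if x: "x \<in> {a..a + 1}" for x
    proof -
      have "norm (Q x *v \<psi> x) \<le> B * (2 * norm c)"
        by (rule order_trans[OF norm_matrix_vector_le]) (intro mult_mono B b\<psi>(1)[OF x], auto intro: B)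
      moreover have "norm (t0 *\<^sub>R \<psi> x) \<le> \<bar>t0\<bar> * (2 * norm c)"
        using b\<psi>(1)[OF x] by (simp add: mult_left_mono)
      moreover have "norm (- \<psi>'' x + Q x *v \<psi> x - t0 *\<^sub>R \<psi> x) \<le> norm (\<psi>'' x) + norm (Q x *v \<psi> x) + norm (t0 *\<^sub>R \<psi> x)"
        using norm_triangle_ineq4[of "- \<psi>'' x + Q x *v \<psi> x" "t0 *\<^sub>R \<psi> x"] norm_triangle_ineq[of "- \<psi>'' x" "Q x *v \<psi> x"] by simp
      ultimately show ?thesis using b\<psi>(2)[OF x] by (simp add: K_def algebra_simps)
    qed
    have ch: "continuous_on {a..a + 1} (\<lambda>x. - \<psi>'' x + Q x *v \<psi> x - t0 *\<^sub>R \<psi> x)"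
      by (intro continuous_on_subset[of UNIV _ "{a..a + 1}"] continuous_intros c\<psi> Q) auto
    have cg: "continuous_on {a..a + 1} (\<lambda>x. - \<psi>'' x + Q x *v \<psi> x)"
      by (intro continuous_on_subset[of UNIV _ "{a..a + 1}"] continuous_intros c\<psi> Q) auto
    have bL: "b \<in> L2 lebesgue" "L2_norm lebesgue b \<le> \<bar>2 * norm c\<bar> * sqrt (a + 1 - a)"
      unfolding b_def using L2_bounded_interval[OF continuous_on_subset[OF c\<psi>(1)] b\<psi>(1), where a=a and b="a + 1"] by auto
    have hL: "h \<in> L2 lebesgue" "L2_norm lebesgue h \<le> \<bar>K * norm c\<bar> * sqrt (a + 1 - a)"
      unfolding h_def using L2_bounded_interval[OF ch bh] by auto
    have gL: "g \<in> L2 lebesgue" unfolding g_def by (rule L2_continuous_interval[OF cg]) simp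
    have h_eq: "h = (\<lambda>x. g x - of_real t0 *s b x)"
      by (auto simp: h_def g_def b_def indicator_def scaleR_eq_scale)
    have "lform a c f = L2_inner lebesgue (\<lambda>x. H f x - of_real t0 *s f x) b - L2_inner lebesgue f h" if f: "f \<in> D" for f
    proof -
      have "L2_inner lebesgue (H f) b - L2_inner lebesgue f g = lform a (join (\<psi> a) (\<psi>' a)) f - lform (a + 1) (join (\<psi> (a + 1)) (\<psi>' (a + 1))) f"
        unfolding b_def g_def by (rule Lagrange_identity[OF f _ d1 d2 c\<psi>(2)]) simp
      moreover have "\<psi> a = lo c" "\<psi>' a = hi c" "\<psi> (a + 1) = 0" "\<psi>' (a + 1) = 0" by (simp_all add: \<psi>_def \<psi>'_def)
      ultimately have 1: "lform a c f = L2_inner lebesgue (H f) b - L2_inner lebesgue f g" by (simp add: join_lo_hi)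
      have "L2_inner lebesgue f h = cnj (L2_inner lebesgue h f)"
        by (simp add: cnj_L2_inner)
      also have "\<dots> = cnj (L2_inner lebesgue g f) - of_real t0 * cnj (L2_inner lebesgue b f)"
        unfolding h_eq using L2_inner_diff_scale_left[OF gL bL(1) D_L2[OF f], of "of_real t0"] by simp
      also have "\<dots> = L2_inner lebesgue f g - of_real t0 * L2_inner lebesgue f b"
        by (simp add: cnj_L2_inner)
      finally show ?thesis
        using 1 L2_inner_diff_scale_left[OF H_L2[OF f] D_L2[OF f] bL(1), of "of_real t0"] by simp
    qed
    moreover have "L2_norm lebesgue b \<le> K * norm c"
    proof -
      have "2 * norm c \<le> K * norm c" using B by (intro mult_right_mono) (auto simp: K_def)
      then show ?thesis using bL(2) by simp
    qed
    moreover have "L2_norm lebesgue h \<le> K * norm c" using hL(2) B by (simp add: K_def)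
    ultimately show "\<exists>b h. b \<in> L2 lebesgue \<and> h \<in> L2 lebesgue \<and>
      L2_norm lebesgue b \<le> K * norm c \<and> L2_norm lebesgue h \<le> K * norm c \<and>
      (\<forall>f\<in>D. lform a c f = L2_inner lebesgue (\<lambda>x. H f x - of_real t0 *s f x) b - L2_inner lebesgue f h)"
      using bL(1) hL(1) by blast
  qed
qed

text \<open>Cauchy--Schwarz for the bump representation: boundary values are controlled by the graph
  norm, uniformly in the position \<open>a\<close>. This uniformity is what bounds the kernels far
  away from 0.\<close>

lemma lform_bound:
  "\<exists>K\<ge>0. \<forall>a c. \<forall>f\<in>D. norm (lform a c f)
    \<le> K * norm c * (L2_norm lebesgue (\<lambda>x. H f x - of_real t0 *s f x) + L2_norm lebesgue f)"
proof -
  obtain K where K: "K \<ge> 0" and P: "\<And>a c. \<exists>b h. b \<in> L2 lebesgue \<and> h \<in> L2 lebesgue \<and>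
    L2_norm lebesgue b \<le> K * norm c \<and> L2_norm lebesgue h \<le> K * norm c \<and>
    (\<forall>f\<in>D. lform a c f = L2_inner lebesgue (\<lambda>x. H f x - of_real t0 *s f x) b - L2_inner lebesgue f h)"
    using lform_bump by blast
  have "norm (lform a c f) \<le> K * norm c * (L2_norm lebesgue (\<lambda>x. H f x - of_real t0 *s f x) + L2_norm lebesgue f)"
    if f: "f \<in> D" for a c f
  proof -
    let ?g = "\<lambda>x. H f x - of_real t0 *s f x"
    obtain b h where bh: "b \<in> L2 lebesgue" "h \<in> L2 lebesgue" "L2_norm lebesgue b \<le> K * norm c" "L2_norm lebesgue h \<le> K * norm c"
      and eq: "lform a c f = L2_inner lebesgue ?g b - L2_inner lebesgue f h"
      using P[of c a] f by blast
    have g: "?g \<in> L2 lebesgue" by (rule L2_diff_scale[OF H_L2[OF f] D_L2[OF f]])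
    have "norm (lform a c f) \<le> norm (L2_inner lebesgue ?g b) + norm (L2_inner lebesgue f h)"
      unfolding eq by (rule norm_triangle_ineq4)
    also have "\<dots> \<le> L2_norm lebesgue ?g * L2_norm lebesgue b + L2_norm lebesgue f * L2_norm lebesgue h"
      by (intro add_mono L2_Cauchy_Schwarz g bh(1,2) D_L2[OF f])
    also have "\<dots> \<le> L2_norm lebesgue ?g * (K * norm c) + L2_norm lebesgue f * (K * norm c)"
      by (intro add_mono mult_left_mono bh(3,4)) auto
    finally show ?thesis by (simp add: algebra_simps)
  qed
  with K show ?thesis by blast
qed

text \<open>The Green function at \<open>a\<close> below the spectrum is a bump corrected by a resolvent.\<close>

lemma green_exists:
  "\<exists>G\<in>L2 lebesgue. \<forall>f\<in>D. lform a c f = L2_inner lebesgue (\<lambda>x. H f x - of_real t0 *s f x) G"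
proof -
  obtain b h where bh: "b \<in> L2 lebesgue" "h \<in> L2 lebesgue"
    and eq: "\<And>f. f \<in> D \<Longrightarrow> lform a c f = L2_inner lebesgue (\<lambda>x. H f x - of_real t0 *s f x) b - L2_inner lebesgue f h"
    using lform_bump by blast
  obtain r where r: "r \<in> D" "AE x in lebesgue. H r x - of_real t0 *s r x = h x"
    using resolvent_exists[OF bh(2)] by blast
  have "lform a c f = L2_inner lebesgue (\<lambda>x. H f x - of_real t0 *s f x) (\<lambda>x. b x - r x)" if f: "f \<in> D" for f
  proof -
    let ?g = "\<lambda>x. H f x - of_real t0 *s f x" and ?k = "\<lambda>x. H r x - of_real t0 *s r x"
    have g: "?g \<in> L2 lebesgue" by (rule L2_diff_scale[OF H_L2[OF f] D_L2[OF f]])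
    have k: "?k \<in> L2 lebesgue" by (rule L2_diff_scale[OF H_L2[OF r(1)] D_L2[OF r(1)]])
    have "L2_inner lebesgue f h = L2_inner lebesgue f ?k"
      by (rule L2_inner_cong_AE) (use r(2) D_L2[OF f] bh(2) k in \<open>auto elim: eventually_mono\<close>)
    also have "\<dots> = cnj (L2_inner lebesgue (H r) f - of_real t0 * L2_inner lebesgue r f)"
      unfolding cnj_L2_inner[of _ ?k f, symmetric] using L2_inner_diff_scale_left[OF H_L2[OF r(1)] D_L2[OF r(1)] D_L2[OF f], of "of_real t0"] by simp
    also have "\<dots> = L2_inner lebesgue f (H r) - of_real t0 * L2_inner lebesgue f r"
      by (simp add: cnj_L2_inner)
    also have "\<dots> = L2_inner lebesgue ?g r"
      using L2_inner_diff_scale_left[OF H_L2[OF f] D_L2[OF f] D_L2[OF r(1)], of "of_real t0"] H_symmetric[OF f r(1)] by simp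
    finally show ?thesis
      using eq[OF f] L2_inner_diff_right[OF bh(1) D_L2[OF r(1)] g] by simp
  qed
  moreover have "(\<lambda>x. b x - r x) \<in> L2 lebesgue" by (rule L2_diff[OF bh(1) D_L2[OF r(1)]])
  ultimately show ?thesis by blast
qed

definition green :: "real \<Rightarrow> complex ^ ('m + 'm) \<Rightarrow> real \<Rightarrow> complex ^ 'm" where
  "green a c = (SOME G. G \<in> L2 lebesgue \<and> (\<forall>f\<in>D. lform a c f = L2_inner lebesgue (\<lambda>x. H f x - of_real t0 *s f x) G))"

lemma green: "green a c \<in> L2 lebesgue"
  "f \<in> D \<Longrightarrow> lform a c f = L2_inner lebesgue (\<lambda>x. H f x - of_real t0 *s f x) (green a c)"
proof -
  have "green a c \<in> L2 lebesgue \<and> (\<forall>f\<in>D. lform a c f = L2_inner lebesgue (\<lambda>x. H f x - of_real t0 *s f x) (green a c))"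
    unfolding green_def using green_exists[of a c] unfolding Bex_def by (rule someI_ex)
  then show "green a c \<in> L2 lebesgue"
    "f \<in> D \<Longrightarrow> lform a c f = L2_inner lebesgue (\<lambda>x. H f x - of_real t0 *s f x) (green a c)" by auto
qed

text \<open>\<open>kernel a c\<close> is the density representing the form \<open>lform a c\<close> in the spectral representation.\<close>

definition kern :: "real \<Rightarrow> 'm + 'm \<Rightarrow> real \<Rightarrow> complex ^ ('m + 'm)" where
  "kern a j y = (y - t0) *\<^sub>R U (green a (axis j 1)) y"

text \<open>Extended linearly from the basis instead of being taken from \<open>green a c\<close>,
  which is a choice and known only up to null sets. The extension is linear at every y, so that the
  coefficient \<open>c\<close> may itself depend on y.\<close>

definition kernel :: "real \<Rightarrow> complex ^ ('m + 'm) \<Rightarrow> real \<Rightarrow> complex ^ ('m + 'm)" where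
  "kernel a c y = (\<Sum>j\<in>UNIV. c $ j *s kern a j y)"

lemma measurable_mu_iff: "f \<in> borel_measurable \<mu> \<longleftrightarrow> f \<in> borel_measurable borel"
  using measurable_cong_sets[OF sets_mu refl] by blast

lemma measurable_kern [measurable]: "kern a j \<in> borel_measurable borel"
proof -
  have [measurable]: "U (green a (axis j 1)) \<in> borel_measurable \<mu>" by (rule L2D(1)[OF U_L2[OF green(1)]])
  have "kern a j \<in> borel_measurable \<mu>" unfolding kern_def[abs_def] by measurable
  then show ?thesis by (simp only: measurable_mu_iff)
qed

lemma measurable_kernel_fun:
  assumes "continuous_on UNIV d"
  shows "(\<lambda>y. kernel a (d y) y) \<in> borel_measurable borel"
proof -
  have "(\<lambda>y. d y $ j) \<in> borel_measurable borel" for j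
    by (intro borel_measurable_continuous_onI continuous_intros assms)
  then show ?thesis
    unfolding kernel_def by (intro borel_measurable_sum measurable_scale2 measurable_kern)
qed

lemma kernel_add: "kernel a (c + d) y = kernel a c y + kernel a d y"
  and kernel_diff: "kernel a (c - d) y = kernel a c y - kernel a d y"
  and kernel_scaleR: "kernel a (r *\<^sub>R c) y = r *\<^sub>R kernel a c y"
  by (simp_all add: kernel_def vec.scale_left_distrib vec.scale_left_diff_distrib sum.distrib sum_subtractf scaleR_sum_right
      vec_eq_iff scaleR_conv_of_real[where 'a=complex] mult.assoc)

lemma kernel_axis: "kernel a (axis j 1) y = kern a j y"
proof -
  have "kernel a (axis j 1) y = (\<Sum>i\<in>UNIV. if i = j then kern a i y else 0)"
    unfolding kernel_def by (rule sum.cong) (auto simp: axis_def)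
  then show ?thesis by simp
qed

lemma lform_expand:
  fixes f :: "real \<Rightarrow> complex ^ 'm"
  shows "lform a c f = (\<Sum>j\<in>UNIV. cnj (c $ j) * lform a (axis j 1) f)"
proof -
  have ax: "lo (axis (Inl i) 1) = axis i 1" "hi (axis (Inl i) 1) = 0" "lo (axis (Inr i) 1) = 0" "hi (axis (Inr i) 1) = axis i 1"
    for i :: 'm by (auto simp: lo_def hi_def axis_def vec_eq_iff)
  have "lform a (axis (Inl i) 1) f = vderiv f a $ i" "lform a (axis (Inr i) 1) f = - (f a $ i)" for i :: 'm
    by (simp_all add: lform_def ax cinner_axis)
  then show ?thesis
    by (simp add: sum_UNIV_sum lform_def cinner_def lo_def hi_def mult.commute sum_negf)
qed

text \<open>The factor y - t0 in \<open>kern\<close> is moved over to U f, where the product is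
  square integrable because f lies in the domain. Integrability is part of the claim, as the kernel
  itself is not known to be in \<open>L2\<close>.\<close>

lemma lform_kernel:
  assumes f: "f \<in> D"
  shows "integrable \<mu> (\<lambda>y. cinner (U f y) (kernel a c y))"
    "lform a c f = (\<integral>y. cinner (U f y) (kernel a c y) \<partial>\<mu>)"
proof -
  let ?g = "\<lambda>x. H f x - of_real t0 *s f x"
  have g: "?g \<in> L2 lebesgue" by (rule L2_diff_scale[OF H_L2[OF f] D_L2[OF f]])
  have gL: "(\<lambda>y. (y - t0) *\<^sub>R U f y) \<in> L2 \<mu>"
  proof (rule L2_bound[OF U_L2[OF g], where C=1])
    have [measurable]: "U f \<in> borel_measurable \<mu>" by (rule L2D(1)[OF U_L2[OF D_L2[OF f]]])
    show "(\<lambda>y. (y - t0) *\<^sub>R U f y) \<in> borel_measurable \<mu>" by measurable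
    show "AE y in \<mu>. norm ((y - t0) *\<^sub>R U f y) \<le> 1 * norm (U ?g y)"
      using U_D_shift[OF f, of t0] by eventually_elim simp
  qed
  have eq: "cinner (U f y) (kern a j y) = cinner ((y - t0) *\<^sub>R U f y) (U (green a (axis j 1)) y)" for j y
    by (simp add: kern_def cinner_scaleR_left cinner_scaleR_right)
  have i: "integrable \<mu> (\<lambda>y. cinner (U f y) (kern a j y))" for j
    unfolding eq by (rule integrable_cinner(1)[OF gL U_L2[OF green(1)]])
  have l: "lform a (axis j 1) f = (\<integral>y. cinner (U f y) (kern a j y) \<partial>\<mu>)" for j
  proof -
    have "lform a (axis j 1) f = L2_inner \<mu> (U ?g) (U (green a (axis j 1)))"
      unfolding green(2)[OF f] by (rule U_inner[OF g green(1), symmetric])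
    also have "\<dots> = L2_inner \<mu> (\<lambda>y. (y - t0) *\<^sub>R U f y) (U (green a (axis j 1)))"
      by (rule L2_inner_cong_AE) (use U_D_shift[OF f, of t0] U_L2[OF g] gL U_L2[OF green(1)] in auto)
    finally show ?thesis by (simp add: L2_inner_eq eq)
  qed
  have k: "cinner (U f y) (kernel a c y) = (\<Sum>j\<in>UNIV. cnj (c $ j) * cinner (U f y) (kern a j y))" for y
    by (simp add: kernel_def cinner_sum_right cinner_scale_right)
  show "integrable \<mu> (\<lambda>y. cinner (U f y) (kernel a c y))" unfolding k using i by simp
  have "lform a c f = (\<Sum>j\<in>UNIV. cnj (c $ j) * (\<integral>y. cinner (U f y) (kern a j y) \<partial>\<mu>))"
    unfolding lform_expand[of a c] l ..
  also have "\<dots> = (\<integral>y. cinner (U f y) (kernel a c y) \<partial>\<mu>)" unfolding k using i by simp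
  finally show "lform a c f = (\<integral>y. cinner (U f y) (kernel a c y) \<partial>\<mu>)" .
qed

end

section \<open>Transport of the kernels\<close>

context periodic_schroedinger
begin

text \<open>Supplies domain functions with a prescribed transform of bounded support. When the
  transform lives near \<open>t\<close>, the function is an approximate eigenfunction at the energy
  \<open>t\<close>.\<close>

lemma preimage_bounded_support:
  assumes \<phi>: "\<phi> \<in> L2 \<mu>" and supp: "\<And>y. R < \<bar>y\<bar> \<Longrightarrow> \<phi> y = 0"
  obtains f where "f \<in> D" "AE y in \<mu>. U f y = \<phi> y" "L2_norm lebesgue f = L2_norm \<mu> \<phi>"
    "\<And>t e. 0 \<le> e \<Longrightarrow> (\<And>y. \<phi> y \<noteq> 0 \<Longrightarrow> \<bar>y - t\<bar> \<le> e) \<Longrightarrow>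
      L2_norm lebesgue (\<lambda>x. H f x - of_real t *s f x) \<le> e * L2_norm \<mu> \<phi>"
proof -
  obtain f where f: "f \<in> D" "AE y in \<mu>. U f y = \<phi> y"
    using U_preimage[OF bounded_support_mult_dom[OF \<phi> supp]] by blast
  have n: "L2_norm lebesgue f = L2_norm \<mu> \<phi>"
    using L2_norm_cong_AE[OF f(2) U_L2[OF D_L2[OF f(1)]] \<phi>] U_norm[OF D_L2[OF f(1)]] by simp
  have [measurable]: "U f \<in> borel_measurable \<mu>" "\<phi> \<in> borel_measurable \<mu>"
    using U_L2[OF D_L2[OF f(1)]] \<phi> by (auto dest: L2D)
  have "L2_norm lebesgue (\<lambda>x. H f x - of_real t *s f x) \<le> e * L2_norm \<mu> \<phi>"
    if e: "0 \<le> e" "\<And>y. \<phi> y \<noteq> 0 \<Longrightarrow> \<bar>y - t\<bar> \<le> e" for t e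
  proof (rule power2_le_imp_le)
    have "(L2_norm lebesgue (\<lambda>x. H f x - of_real t *s f x))\<^sup>2 = (\<integral>y. (norm ((y - t) *\<^sub>R U f y))\<^sup>2 \<partial>\<mu>)"
      by (simp add: norm_H_shift[OF f(1)] L2_norm_sq)
    also have "\<dots> \<le> (\<integral>y. e\<^sup>2 * (norm (\<phi> y))\<^sup>2 \<partial>\<mu>)"
    proof (rule integral_mono_AE')
      show "integrable \<mu> (\<lambda>y. e\<^sup>2 * (norm (\<phi> y))\<^sup>2)" using L2D(2)[OF \<phi>] by simp
      show "AE y in \<mu>. (norm ((y - t) *\<^sub>R U f y))\<^sup>2 \<le> e\<^sup>2 * (norm (\<phi> y))\<^sup>2"
        using f(2)
      proof eventually_elim
        case (elim y)
        then show ?case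
          using power_mono[OF e(2), of y 2] by (cases "\<phi> y = 0") (auto simp: power_mult_distrib intro!: mult_right_mono)
      qed
    qed simp
    also have "\<dots> = (e * L2_norm \<mu> \<phi>)\<^sup>2" by (simp add: L2_norm_sq power_mult_distrib)
    finally show "(L2_norm lebesgue (\<lambda>x. H f x - of_real t *s f x))\<^sup>2 \<le> (e * L2_norm \<mu> \<phi>)\<^sup>2" .
    show "0 \<le> e * L2_norm \<mu> \<phi>" using e(1) by (simp add: L2_norm_def)
  qed
  from that[OF f n this] show ?thesis by blast
qed

lemma kern_L2:
  assumes J: "J \<in> sets borel" "J \<subseteq> {-R..R}"
  shows "(\<lambda>y. indicat_real J y *\<^sub>R kern a j y) \<in> L2 \<mu>"
proof (rule L2_bound[OF U_L2[OF green(1)]])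
  have [measurable]: "J \<in> sets \<mu>" "kern a j \<in> borel_measurable \<mu>" using J by (auto simp: sets_mu measurable_mu_iff)
  show "(\<lambda>y. indicat_real J y *\<^sub>R kern a j y) \<in> borel_measurable \<mu>" by measurable
  have "norm (indicat_real J y *\<^sub>R kern a j y) \<le> (\<bar>R\<bar> + \<bar>t0\<bar>) * norm (U (green a (axis j 1)) y)" for y
  proof (cases "y \<in> J")
    case True
    then have "y \<in> {-R..R}" using J(2) by blast
    then have "\<bar>y - t0\<bar> \<le> \<bar>R\<bar> + \<bar>t0\<bar>" by auto
    then show ?thesis using True by (auto simp: kern_def intro!: mult_right_mono)
  qed auto
  then show "AE y in \<mu>. norm (indicat_real J y *\<^sub>R kern a j y) \<le> (\<bar>R\<bar> + \<bar>t0\<bar>) * norm (U (green a (axis j 1)) y)" by simp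
qed

lemma kernel_L2:
  assumes J: "J \<in> sets borel" "J \<subseteq> {-R..R}"
  shows "(\<lambda>y. indicat_real J y *\<^sub>R kernel a c y) \<in> L2 \<mu>"
proof -
  have "(\<lambda>y. indicat_real J y *\<^sub>R kernel a c y) = (\<lambda>y. \<Sum>j\<in>UNIV. c $ j *s (indicat_real J y *\<^sub>R kern a j y))"
    by (auto simp: kernel_def indicator_def)
  moreover have "\<dots> \<in> L2 \<mu>" by (rule L2_sum) (rule L2_scale[OF kern_L2[OF J]])
  ultimately show ?thesis by simp
qed

text \<open>Duality: when f has the truncated difference of kernels as its transform, the boundary
  forms of f return the square of the norm of that difference.\<close>

lemma L2_norm_kernel_combination:
  assumes J: "J \<in> sets borel" "J \<subseteq> {-R..R}"
    and \<phi>: "\<phi> = (\<lambda>y. indicat_real J y *\<^sub>R (kernel a c y - kernel b d y))"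
    and f: "f \<in> D" "AE y in \<mu>. U f y = \<phi> y"
  shows "\<phi> \<in> L2 \<mu>" "lform a c f - lform b d f = of_real ((L2_norm \<mu> \<phi>)\<^sup>2)"
proof -
  have "\<phi> = (\<lambda>y. indicat_real J y *\<^sub>R kernel a c y - indicat_real J y *\<^sub>R kernel b d y)"
    by (simp add: \<phi> scaleR_diff_right)
  then show L: "\<phi> \<in> L2 \<mu>" using L2_diff[OF kernel_L2[OF J] kernel_L2[OF J]] by simp
  have [measurable]: "U f \<in> borel_measurable \<mu>" "\<phi> \<in> borel_measurable \<mu>"
    using U_L2[OF D_L2[OF f(1)]] L by (auto dest: L2D)
  have [measurable]: "(\<lambda>y. kernel a' c' y) \<in> borel_measurable \<mu>" for a' c'
    using measurable_kernel_fun[of "\<lambda>_. c'"] by (simp add: measurable_mu_iff)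
  have "lform a c f - lform b d f = (\<integral>y. cinner (U f y) (kernel a c y) - cinner (U f y) (kernel b d y) \<partial>\<mu>)"
    using lform_kernel[OF f(1)] by simp
  also have "\<dots> = (\<integral>y. cinner (\<phi> y) (\<phi> y) \<partial>\<mu>)"
  proof (rule integral_cong_AE)
    show "AE y in \<mu>. cinner (U f y) (kernel a c y) - cinner (U f y) (kernel b d y) = cinner (\<phi> y) (\<phi> y)"
      using f(2) by eventually_elim (auto simp: \<phi> indicator_def cinner_diff_right)
  qed measurable
  finally show "lform a c f - lform b d f = of_real ((L2_norm \<mu> \<phi>)\<^sup>2)"
    using L2_inner_self[of \<mu> \<phi>] by (simp add: L2_inner_eq)
qed

text \<open>For the function whose transform is the truncated kernel, \<open>lform_bound\<close>
  bounds the square of its norm by a constant times |c| times the norm. Cancelling one factor leaves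
  a bound independent of \<open>a\<close>.\<close>

lemma kernel_L2_bound:
  "\<exists>C\<ge>0. \<forall>a c. \<forall>J\<in>sets borel. J \<subseteq> {-R..R} \<longrightarrow> L2_norm \<mu> (\<lambda>y. indicat_real J y *\<^sub>R kernel a c y) \<le> C * norm c"
proof -
  obtain K where K: "K \<ge> 0" "\<And>a c f. f \<in> D \<Longrightarrow> norm (lform a c f)
    \<le> K * norm c * (L2_norm lebesgue (\<lambda>x. H f x - of_real t0 *s f x) + L2_norm lebesgue f)"
    using lform_bound by blast
  define M where "M = \<bar>R\<bar> + \<bar>t0\<bar> + 1"
  have "L2_norm \<mu> (\<lambda>y. indicat_real J y *\<^sub>R kernel a c y) \<le> (K * M) * norm c"
    if J: "J \<in> sets borel" "J \<subseteq> {-R..R}" for a c J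
  proof -
    define \<phi> where "\<phi> = (\<lambda>y. indicat_real J y *\<^sub>R kernel a c y)"
    have L: "\<phi> \<in> L2 \<mu>" unfolding \<phi>_def by (rule kernel_L2[OF J])
    have nz: "y \<in> {-R..R}" if "\<phi> y \<noteq> 0" for y using that J(2) by (auto simp: \<phi>_def indicator_def split: if_splits)
    obtain f where f: "f \<in> D" "AE y in \<mu>. U f y = \<phi> y" "L2_norm lebesgue f = L2_norm \<mu> \<phi>"
      and fs: "\<And>t e. 0 \<le> e \<Longrightarrow> (\<And>y. \<phi> y \<noteq> 0 \<Longrightarrow> \<bar>y - t\<bar> \<le> e) \<Longrightarrow>
      L2_norm lebesgue (\<lambda>x. H f x - of_real t *s f x) \<le> e * L2_norm \<mu> \<phi>"
      by (rule preimage_bounded_support[OF L, of "\<bar>R\<bar>"]) (use nz in force)+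
    have s: "L2_norm lebesgue (\<lambda>x. H f x - of_real t0 *s f x) \<le> (\<bar>R\<bar> + \<bar>t0\<bar>) * L2_norm \<mu> \<phi>"
    proof (rule fs)
      show "\<bar>y - t0\<bar> \<le> \<bar>R\<bar> + \<bar>t0\<bar>" if "\<phi> y \<noteq> 0" for y using nz[OF that] by auto
    qed simp
    have "lform a c f - lform a 0 f = of_real ((L2_norm \<mu> \<phi>)\<^sup>2)"
      by (rule L2_norm_kernel_combination(2)[OF J _ f(1,2)]) (simp add: \<phi>_def kernel_def)
    moreover have "lform a 0 f = 0" by (subst lform_expand) simp
    ultimately have "norm (lform a c f) = (L2_norm \<mu> \<phi>)\<^sup>2" by (simp add: norm_power)
    then have "(L2_norm \<mu> \<phi>)\<^sup>2 \<le> K * norm c * (L2_norm lebesgue (\<lambda>x. H f x - of_real t0 *s f x) + L2_norm lebesgue f)"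
      using K(2)[OF f(1), of a c] by simp
    also have "\<dots> \<le> K * norm c * (M * L2_norm \<mu> \<phi>)"
      using s K(1) f(3) by (intro mult_left_mono) (auto simp: M_def algebra_simps)
    finally have "L2_norm \<mu> \<phi> * L2_norm \<mu> \<phi> \<le> (K * M * norm c) * L2_norm \<mu> \<phi>"
      by (simp add: power2_eq_square mult_ac)
    moreover have "0 \<le> L2_norm \<mu> \<phi>" "0 \<le> K * M * norm c" using K(1) by (auto simp: M_def L2_norm_def)
    ultimately show ?thesis unfolding \<phi>_def[symmetric] by (metis mult_right_le_imp_le less_le)
  qed
  moreover have "0 \<le> K * M" using K(1) by (simp add: M_def)
  ultimately show ?thesis by blast
qed

text \<open>The Cauchy data at \<open>b\<close> of the solution at energy \<open>t\<close> with data
  \<open>c\<close> at \<open>a\<close>. Shifting Q by \<open>a\<close> reduces this to the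
  propagator started at 0; \<open>b < a\<close> is allowed.\<close>

definition transport :: "real \<Rightarrow> real \<Rightarrow> complex ^ ('m + 'm) \<Rightarrow> real \<Rightarrow> complex ^ ('m + 'm)" where
  "transport a b c t = schr_prop (\<lambda>x. Q (x + a)) (of_real t) (b - a) *v c"

lemma continuous_shift: "continuous_on UNIV (\<lambda>x. Q (x + a))"
  by (rule continuous_on_compose2[OF Q]) (auto intro!: continuous_intros)

lemma continuous_transport: "continuous_on UNIV (\<lambda>(t, x). transport a x c t)"
proof -
  have "continuous_on UNIV (\<lambda>p::real \<times> real. (\<lambda>(z, x). schr_prop (\<lambda>x. Q (x + a)) z x) (of_real (fst p), snd p - a))"
    by (rule continuous_on_compose2[OF continuous_propagator[OF continuous_sysmat[OF continuous_shift]]])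
       (auto intro!: continuous_intros)
  then have "continuous_on UNIV (\<lambda>p::real \<times> real. schr_prop (\<lambda>x. Q (x + a)) (of_real (fst p)) (snd p - a) *v c)"
    by (intro continuous_intros) simp
  then show ?thesis by (simp add: transport_def split_beta)
qed

lemma continuous_transport_energy: "continuous_on S (transport a b c)"
proof -
  have "continuous_on UNIV (\<lambda>t. (\<lambda>(t, x). transport a x c t) (t, b))"
    by (rule continuous_on_compose2[OF continuous_transport]) (auto intro!: continuous_intros)
  then show ?thesis by (auto intro: continuous_on_subset)
qed

lemma transport_same: "transport a a c t = c"
  by (simp add: transport_def propagator_0[OF continuous_sysmat[OF continuous_shift]])

text \<open>Lagrange's identity between \<open>a\<close> and \<open>b\<close> with the solution
  itself: only the pairing of (H - t) f with a piece of the solution remains. Compactness makes the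
  constant uniform in the energy.\<close>

lemma lform_transport_bound:
  "\<exists>K\<ge>0. \<forall>t\<in>{-R..R}. \<forall>f\<in>D. norm (lform a c f - lform b (transport a b c t) f)
    \<le> K * L2_norm lebesgue (\<lambda>x. H f x - of_real t *s f x)"
proof -
  define p q where "p = min a b" and "q = max a b"
  have "compact ((\<lambda>(t, x). transport a x c t) ` ({-R..R} \<times> {p..q}))"
    by (intro compact_continuous_image continuous_on_subset[OF continuous_transport] compact_Times) auto
  then have "bounded ((\<lambda>(t, x). transport a x c t) ` ({-R..R} \<times> {p..q}))" by (rule compact_imp_bounded)
  then obtain M0 where M1: "\<And>v. v \<in> (\<lambda>(t, x). transport a x c t) ` ({-R..R} \<times> {p..q}) \<Longrightarrow> norm v \<le> M0"
    unfolding bounded_iff by blast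
  have M0: "norm (transport a x c t) \<le> M0" if "t \<in> {-R..R}" "x \<in> {p..q}" for t x
    by (rule M1) (use that in \<open>auto intro!: image_eqI[of _ _ "(t, x)"]\<close>)
  define K where "K = \<bar>M0\<bar> * sqrt (q - p)"
  have K: "K \<ge> 0" by (simp add: K_def p_def q_def)
  have "norm (lform a c f - lform b (transport a b c t) f) \<le> K * L2_norm lebesgue (\<lambda>x. H f x - of_real t *s f x)"
    if t: "t \<in> {-R..R}" and f: "f \<in> D" for t f
  proof (cases "a = b")
    case True
    then show ?thesis using K by (simp add: transport_same L2_norm_def)
  next
    case False
    then have pq: "p < q" by (auto simp: p_def q_def)
    let ?g = "\<lambda>x. H f x - of_real t *s f x"
    have g: "?g \<in> L2 lebesgue" by (rule L2_diff_scale[OF H_L2[OF f] D_L2[OF f]])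
    define Y where "Y = (\<lambda>x. transport a x c t)"
    have shift: "((\<lambda>x::real. x - a) has_real_derivative 1) (at x)" for x by (auto intro!: derivative_eq_intros)
    have d1: "((\<lambda>x. lo (Y x)) has_vector_derivative hi (Y x)) (at x)" for x
      using vector_diff_chain_at[OF shift[unfolded has_real_derivative_iff_has_vector_derivative]
          has_vector_derivative_lo_hi_schr_prop(1)[OF continuous_shift[of a], of "of_real t" c "x - a"]]
      by (simp add: Y_def transport_def o_def)
    have d2: "((\<lambda>x. hi (Y x)) has_vector_derivative (Q x *v lo (Y x) - of_real t *s lo (Y x))) (at x)" for x
      using vector_diff_chain_at[OF shift[unfolded has_real_derivative_iff_has_vector_derivative]
          has_vector_derivative_lo_hi_schr_prop(2)[OF continuous_shift[of a], of "of_real t" c "x - a"]]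
      by (simp add: Y_def transport_def o_def)
    have cY: "continuous_on UNIV (\<lambda>x. lo (Y x))"
      using d1 by (auto intro!: continuous_at_imp_continuous_on has_vector_derivative_continuous)
    have cY2: "continuous_on UNIV (\<lambda>x. Q x *v lo (Y x) - of_real t *s lo (Y x))"
      unfolding scaleR_eq_scale[symmetric] by (intro continuous_intros Q cY)
    define b' where "b' = (\<lambda>x. indicat_real {p..q} x *\<^sub>R lo (Y x))"
    have b': "b' \<in> L2 lebesgue" "L2_norm lebesgue b' \<le> K"
    proof -
      have "norm (lo (Y x)) \<le> M0" if "x \<in> {p..q}" for x
        using order_trans[OF norm_lo_le M0[OF t that]] by (simp add: Y_def)
      from L2_bounded_interval[OF continuous_on_subset[OF cY] this] pq
      show "b' \<in> L2 lebesgue" "L2_norm lebesgue b' \<le> K" by (auto simp: b'_def K_def)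
    qed
    have "L2_inner lebesgue (H f) b' - L2_inner lebesgue f (\<lambda>x. of_real t *s b' x) = lform p (Y p) f - lform q (Y q) f"
    proof -
      have e: "(\<lambda>x. of_real t *s b' x) = (\<lambda>x. indicat_real {p..q} x *\<^sub>R (- (Q x *v lo (Y x) - of_real t *s lo (Y x)) + Q x *v lo (Y x)))"
        by (auto simp: b'_def indicator_def)
      show ?thesis
        using Lagrange_identity[OF f pq d1 d2 cY2] unfolding e by (simp add: b'_def)
    qed
    also have "L2_inner lebesgue f (\<lambda>x. of_real t *s b' x) = of_real t * L2_inner lebesgue f b'"
      by (simp add: L2_inner_eq cinner_scale_right)
    also have "L2_inner lebesgue (H f) b' - of_real t * L2_inner lebesgue f b' = L2_inner lebesgue ?g b'"
      by (rule L2_inner_diff_scale_left[OF H_L2[OF f] D_L2[OF f] b'(1), symmetric])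
    finally have "norm (lform p (Y p) f - lform q (Y q) f) \<le> L2_norm lebesgue ?g * L2_norm lebesgue b'"
      using L2_Cauchy_Schwarz[OF g b'(1)] by simp
    also have "\<dots> \<le> L2_norm lebesgue ?g * K" using b'(2) by (intro mult_left_mono) (auto simp: L2_norm_def)
    finally have 1: "norm (lform p (Y p) f - lform q (Y q) f) \<le> K * L2_norm lebesgue ?g" by (simp add: mult.commute)
    have Ya: "Y a = c" "Y b = transport a b c t" by (simp_all add: Y_def transport_same)
    show ?thesis
    proof (cases "a < b")
      case True
      then show ?thesis using 1 Ya by (simp add: p_def q_def)
    next
      case False
      then have "p = b" "q = a" by (auto simp: p_def q_def)
      then show ?thesis using 1 Ya by (simp add: norm_minus_commute)
    qed
  qed
  with K show ?thesis by blast
qed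

text \<open>Duality again, now with a transform supported within \<open>h\<close> of
  \<open>t\<close>: the operator H - t then costs a factor \<open>h\<close>, which becomes the size
  of the error.\<close>

lemma kernel_transport_bound:
  "\<exists>K\<ge>0. \<forall>t\<in>{-R..R}. \<forall>h\<ge>0. \<forall>J\<in>sets borel. J \<subseteq> {-R..R} \<inter> {t - h..t + h} \<longrightarrow>
    L2_norm \<mu> (\<lambda>y. indicat_real J y *\<^sub>R (kernel a c y - kernel b (transport a b c t) y)) \<le> K * h"
proof -
  obtain K where K: "K \<ge> 0" "\<And>t f. t \<in> {-R..R} \<Longrightarrow> f \<in> D \<Longrightarrow> norm (lform a c f - lform b (transport a b c t) f)
    \<le> K * L2_norm lebesgue (\<lambda>x. H f x - of_real t *s f x)"
    using lform_transport_bound[of R a c b] by blast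
  have "L2_norm \<mu> (\<lambda>y. indicat_real J y *\<^sub>R (kernel a c y - kernel b (transport a b c t) y)) \<le> K * h"
    if t: "t \<in> {-R..R}" and h: "h \<ge> 0" and J: "J \<in> sets borel" "J \<subseteq> {-R..R} \<inter> {t - h..t + h}" for t h J
  proof -
    define \<phi> where "\<phi> = (\<lambda>y. indicat_real J y *\<^sub>R (kernel a c y - kernel b (transport a b c t) y))"
    have J': "J \<subseteq> {-R..R}" using J(2) by auto
    have nz: "y \<in> {-R..R}" "\<bar>y - t\<bar> \<le> h" if "\<phi> y \<noteq> 0" for y
    proof -
      have "y \<in> J" using that by (auto simp: \<phi>_def indicator_def split: if_splits)
      then have "y \<in> {-R..R} \<inter> {t - h..t + h}" using J(2) by blast
      then show "y \<in> {-R..R}" "\<bar>y - t\<bar> \<le> h" by auto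
    qed
    have "(\<lambda>y. indicat_real J y *\<^sub>R kernel a c y - indicat_real J y *\<^sub>R kernel b (transport a b c t) y) \<in> L2 \<mu>"
      by (rule L2_diff[OF kernel_L2[OF J(1) J'] kernel_L2[OF J(1) J']])
    then have L: "\<phi> \<in> L2 \<mu>" by (simp add: \<phi>_def scaleR_diff_right)
    obtain f where f: "f \<in> D" "AE y in \<mu>. U f y = \<phi> y"
      and fs: "\<And>t e. 0 \<le> e \<Longrightarrow> (\<And>y. \<phi> y \<noteq> 0 \<Longrightarrow> \<bar>y - t\<bar> \<le> e) \<Longrightarrow>
      L2_norm lebesgue (\<lambda>x. H f x - of_real t *s f x) \<le> e * L2_norm \<mu> \<phi>"
      by (rule preimage_bounded_support[OF L, of "\<bar>R\<bar>"]) (use nz(1) in force)+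
    have "(L2_norm \<mu> \<phi>)\<^sup>2 = norm (lform a c f - lform b (transport a b c t) f)"
      by (simp add: L2_norm_kernel_combination(2)[OF J(1) J' \<phi>_def f] norm_power)
    also have "\<dots> \<le> K * L2_norm lebesgue (\<lambda>x. H f x - of_real t *s f x)" by (rule K(2)[OF t f(1)])
    also have "\<dots> \<le> K * (h * L2_norm \<mu> \<phi>)" by (rule mult_left_mono[OF fs[OF h nz(2)] K(1)])
    finally have "L2_norm \<mu> \<phi> * L2_norm \<mu> \<phi> \<le> (K * h) * L2_norm \<mu> \<phi>"
      by (simp add: power2_eq_square mult_ac)
    moreover have "0 \<le> L2_norm \<mu> \<phi>" "0 \<le> K * h" using K(1) h by (auto simp: L2_norm_def)
    ultimately show ?thesis unfolding \<phi>_def[symmetric] by (metis mult_right_le_imp_le less_le)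
  qed
  with K(1) show ?thesis by blast
qed

text \<open>The squared Frobenius norm of the linear map taking c to
  \<open>kernel b c y\<close>.\<close>

definition kern_sq :: "real \<Rightarrow> real \<Rightarrow> real" where
  "kern_sq b y = (\<Sum>j\<in>UNIV. (norm (kern b j y))\<^sup>2)"

lemma kern_sq_nonneg: "0 \<le> kern_sq b y"
  by (simp add: kern_sq_def sum_nonneg)

lemma norm_kernel_sq_le: "(norm (kernel b v y))\<^sup>2 \<le> (norm v)\<^sup>2 * kern_sq b y"
proof -
  have "norm (kernel b v y) \<le> (\<Sum>j\<in>UNIV. norm (v $ j *s kern b j y))"
    unfolding kernel_def by (rule norm_sum)
  also have "\<dots> = (\<Sum>j\<in>UNIV. \<bar>norm (v $ j)\<bar> * \<bar>norm (kern b j y)\<bar>)" by (simp add: norm_scale_vec)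
  also have "\<dots> \<le> L2_set (\<lambda>j. norm (v $ j)) UNIV * L2_set (\<lambda>j. norm (kern b j y)) UNIV"
    by (rule L2_set_mult_ineq)
  also have "\<dots> = norm v * sqrt (kern_sq b y)" by (simp add: norm_vec_def L2_set_def kern_sq_def)
  finally have "(norm (kernel b v y))\<^sup>2 \<le> (norm v * sqrt (kern_sq b y))\<^sup>2" by (intro power_mono) auto
  then show ?thesis by (simp add: power_mult_distrib kern_sq_nonneg)
qed

lemma integrable_kern_sq:
  assumes J: "J \<in> sets borel" "J \<subseteq> {-R..R}"
  shows "integrable \<mu> (\<lambda>y. indicat_real J y * kern_sq b y)"
proof -
  have "(\<lambda>y. indicat_real J y * kern_sq b y) = (\<lambda>y. \<Sum>j\<in>UNIV. (norm (indicat_real J y *\<^sub>R kern b j y))\<^sup>2)"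
    by (auto simp: kern_sq_def indicator_def)
  then show ?thesis using L2D(2)[OF kern_L2[OF J]] by simp
qed

lemma sum_indicator_cells:
  assumes "0 \<le> h"
  shows "(\<Sum>k<n. indicat_real {a + real k * h..<a + real (Suc k) * h} y) = indicat_real {a..<a + real n * h} y"
proof (induction n)
  case (Suc n)
  have "0 \<le> real n * h" using assms by simp
  then have "a \<le> a + real n * h" "a + real n * h \<le> a + real (Suc n) * h" using assms by (simp_all add: distrib_right)
  then show ?case unfolding sum.lessThan_Suc Suc by (auto simp: indicator_def simp del: of_nat_Suc)
qed simp

text \<open>On a spectral cell of width \<open>h\<close> the energy may be frozen at the price of an error of norm \<open>O(h)\<close>;
  as the squares of these errors are added up over \<open>O(1 / h)\<close> cells, they disappear in the limit.\<close>

lemma kernel_transport_bounded: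
  assumes "R > 0"
  shows "AE y in \<mu>. y \<in> {-R..<R} \<longrightarrow> kernel a c y = kernel b (transport a b c y) y"
proof -
  let ?d = "transport a b c"
  define E where "E = (\<lambda>y. indicat_real {-R..<R} y * (norm (kernel a c y - kernel b (?d y) y))\<^sup>2)"
  have "\<exists>K\<ge>0. \<forall>t h J. t \<in> {-R..R} \<longrightarrow> 0 \<le> h \<longrightarrow> J \<in> sets borel \<longrightarrow> J \<subseteq> {-R..R} \<inter> {t - h..t + h} \<longrightarrow>
    L2_norm \<mu> (\<lambda>y. indicat_real J y *\<^sub>R (kernel a c y - kernel b (?d t) y)) \<le> K * h"
    using kernel_transport_bound[of R a c b] unfolding Ball_def by (elim exE conjE) (intro exI conjI allI impI, assumption, simp)
  then obtain K where K: "K \<ge> 0" "\<And>t h J. t \<in> {-R..R} \<Longrightarrow> 0 \<le> h \<Longrightarrow> J \<in> sets borel \<Longrightarrow> J \<subseteq> {-R..R} \<inter> {t - h..t + h} \<Longrightarrow>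
    L2_norm \<mu> (\<lambda>y. indicat_real J y *\<^sub>R (kernel a c y - kernel b (?d t) y)) \<le> K * h"
    by (elim exE conjE) (rule that, assumption, simp)
  define W where "W = (\<integral>y. indicat_real {-R..<R} y * kern_sq b y \<partial>\<mu>)"
  have W: "W \<ge> 0" unfolding W_def by (intro integral_nonneg_AE) (simp add: kern_sq_nonneg)
  have iW: "integrable \<mu> (\<lambda>y. indicat_real {-R..<R} y * kern_sq b y)"
    by (rule integrable_kern_sq[of _ R]) auto
  have [measurable]: "(\<lambda>y. kernel a c y) \<in> borel_measurable \<mu>" "(\<lambda>y. kernel b (?d y) y) \<in> borel_measurable \<mu>"
    using measurable_kernel_fun[of "\<lambda>_. c"] measurable_kernel_fun[OF continuous_transport_energy] by (simp_all add: measurable_mu_iff)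
  have [measurable]: "{-R..<R} \<in> sets \<mu>" by (simp add: sets_mu)
  have mE: "E \<in> borel_measurable \<mu>" unfolding E_def by measurable
  have E0': "0 \<le> E y" for y by (simp add: E_def)
  \<comment> \<open>The 2 R / h cells contribute at most 2 (K h)^2 each, in total 4 R K^2 h; the
    term with \<open>W\<close> accounts for the change of the transported data within a
    cell.\<close>
  define C where "C = 4 * R * K\<^sup>2 + 2 * W"
  have C: "C \<ge> 0" using assms W by (simp add: C_def)
  \<comment> \<open>\<delta> bounds both the mesh h and the oscillation of the transported data on a
    cell, so that the integral of \<open>E\<close> is at most a constant times \<delta>.\<close>
  have main: "integrable \<mu> E \<and> (\<integral>y. E y \<partial>\<mu>) \<le> C * \<delta>" if \<delta>: "0 < \<delta>" "\<delta> < 1" for \<delta>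
  proof -
    have "uniformly_continuous_on {-R..R} ?d"
      by (intro compact_uniformly_continuous continuous_transport_energy) auto
    then obtain r where r: "r > 0" "\<And>y t. y \<in> {-R..R} \<Longrightarrow> t \<in> {-R..R} \<Longrightarrow> \<bar>y - t\<bar> < r \<Longrightarrow> norm (?d y - ?d t) < \<delta>"
      unfolding uniformly_continuous_on_def dist_norm using \<delta>(1) by (metis real_norm_def)
    obtain N :: nat where N: "2 * R / min r \<delta> < real N" using reals_Archimedean2 by blast
    have N0: "real N > 0" using N r(1) \<delta>(1) assms by (smt (verit) divide_pos_pos)
    define h where "h = 2 * R / real N"
    have rd: "0 < min r \<delta>" using r(1) \<delta>(1) by simp
    have "h < min r \<delta>"
      using N N0 unfolding h_def pos_divide_less_eq[OF rd] pos_divide_less_eq[OF N0] by (simp only: mult.commute)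
    then have h: "0 < h" "h < r" "h < \<delta>" "real N * h = 2 * R"
      using N0 assms by (auto simp: h_def)
    define t where "t = (\<lambda>k. -R + real k * h)"
    define J where "J = (\<lambda>k. {-R + real k * h..<-R + real (Suc k) * h})"
    have Jt: "t k \<in> {-R..R}" "J k \<subseteq> {-R..R} \<inter> {t k - h..t k + h}" "J k \<in> sets borel" if "k < N" for k
    proof -
      have "real (Suc k) * h \<le> real N * h" using that h(1) by (intro mult_right_mono) auto
      then have "real k * h + h \<le> 2 * R" using h(4) by (simp add: algebra_simps)
      moreover have "0 \<le> real k * h" using h(1) by simp
      ultimately have "-R \<le> t k" "t k + h \<le> R" "J k = {t k..<t k + h}" by (auto simp: t_def J_def distrib_right)
      then show "t k \<in> {-R..R}" "J k \<subseteq> {-R..R} \<inter> {t k - h..t k + h}" "J k \<in> sets borel"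
        using h(1) by auto
    qed
    have sumJ: "(\<Sum>k<N. indicat_real (J k) y) = indicat_real {-R..<R} y" for y
      using sum_indicator_cells[where h=h and a="-R" and n=N and y=y] h by (simp add: J_def)
    define F where "F = (\<lambda>k y. indicat_real (J k) y *\<^sub>R (kernel a c y - kernel b (?d (t k)) y))"
    have FL: "F k \<in> L2 \<mu>" if k: "k < N" for k
    proof -
      have "J k \<subseteq> {-R..R}" using Jt(2)[OF k] by auto
      then have "(\<lambda>y. indicat_real (J k) y *\<^sub>R kernel a c y - indicat_real (J k) y *\<^sub>R kernel b (?d (t k)) y) \<in> L2 \<mu>"
        using L2_diff kernel_L2 Jt(3)[OF k] by blast
      then show ?thesis by (simp add: F_def scaleR_diff_right)
    qed
    have Fn: "(\<integral>y. (norm (F k y))\<^sup>2 \<partial>\<mu>) \<le> (K * h)\<^sup>2" if k: "k < N" for k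
    proof -
      have "L2_norm \<mu> (F k) \<le> K * h"
        unfolding F_def by (rule K(2)[OF Jt(1)[OF k] _ Jt(3,2)[OF k]]) (use h in simp)
      then have "(L2_norm \<mu> (F k))\<^sup>2 \<le> (K * h)\<^sup>2" by (intro power_mono) (auto simp: L2_norm_def)
      then show ?thesis by (simp add: L2_norm_sq)
    qed
    let ?G = "\<lambda>y. (\<Sum>k<N. 2 * (norm (F k y))\<^sup>2) + 2 * \<delta>\<^sup>2 * (indicat_real {-R..<R} y * kern_sq b y)"
    have le: "E y \<le> ?G y" for y
    proof -
      have cell: "indicat_real (J k) y * (norm (kernel a c y - kernel b (?d y) y))\<^sup>2
          \<le> 2 * (norm (F k y))\<^sup>2 + 2 * \<delta>\<^sup>2 * (indicat_real (J k) y * kern_sq b y)" if k: "k < N" for k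
      proof (cases "y \<in> J k")
        case True
        then have "y \<in> {-R..R} \<inter> {t k - h..t k + h}" using Jt(2)[OF k] by blast
        then have yJ: "y \<in> {-R..R}" "\<bar>y - t k\<bar> \<le> h" by auto
        have "norm (?d (t k) - ?d y) \<le> \<delta>"
          using r(2)[OF yJ(1) Jt(1)[OF k]] yJ(2) h(2) by (simp add: norm_minus_commute)
        then have "(norm (?d (t k) - ?d y))\<^sup>2 \<le> \<delta>\<^sup>2" by (intro power_mono) auto
        then have 1: "(norm (kernel b (?d (t k) - ?d y) y))\<^sup>2 \<le> \<delta>\<^sup>2 * kern_sq b y"
          by (intro order_trans[OF norm_kernel_sq_le] mult_right_mono kern_sq_nonneg)
        have "kernel a c y - kernel b (?d y) y = F k y + kernel b (?d (t k) - ?d y) y"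
          using True by (simp add: F_def kernel_diff)
        moreover have "(norm (u + v))\<^sup>2 \<le> 2 * (norm u)\<^sup>2 + 2 * (norm v)\<^sup>2" for u v :: "complex ^ ('m + 'm)"
          using parallelogram_law[of u v] zero_le_power2[of "norm (u - v)"] unfolding distrib_left by linarith
        ultimately have "(norm (kernel a c y - kernel b (?d y) y))\<^sup>2 \<le> 2 * (norm (F k y))\<^sup>2 + 2 * (norm (kernel b (?d (t k) - ?d y) y))\<^sup>2"
          by simp
        then show ?thesis using 1 True by simp
      qed simp
      have "E y = (\<Sum>k<N. indicat_real (J k) y * (norm (kernel a c y - kernel b (?d y) y))\<^sup>2)"
        unfolding E_def sumJ[symmetric] sum_distrib_right ..
      also have "\<dots> \<le> (\<Sum>k<N. 2 * (norm (F k y))\<^sup>2 + 2 * \<delta>\<^sup>2 * (indicat_real (J k) y * kern_sq b y))"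
        by (rule sum_mono) (use cell in simp)
      also have "\<dots> = ?G y"
        unfolding sum.distrib sumJ[symmetric] sum_distrib_right sum_distrib_left ..
      finally show ?thesis .
    qed
    have iG: "integrable \<mu> ?G"
      by (intro Bochner_Integration.integrable_add Bochner_Integration.integrable_sum integrable_mult_right iW L2D(2) FL) auto
    have iE: "integrable \<mu> E"
      by (rule Bochner_Integration.integrable_bound[OF iG mE]) (use le E0' in \<open>auto intro!: AE_I2 simp: order_trans[OF le abs_ge_self]\<close>)
    have "(\<integral>y. E y \<partial>\<mu>) \<le> (\<integral>y. ?G y \<partial>\<mu>)" by (rule integral_mono[OF iE iG le])
    also have "\<dots> = (\<Sum>k<N. 2 * (\<integral>y. (norm (F k y))\<^sup>2 \<partial>\<mu>)) + 2 * \<delta>\<^sup>2 * W"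
    proof -
      have iF: "integrable \<mu> (\<lambda>y. 2 * (norm (F k y))\<^sup>2)" if "k \<in> {..<N}" for k
        using L2D(2)[OF FL[of k]] that by simp
      have "(\<integral>y. (\<Sum>k<N. 2 * (norm (F k y))\<^sup>2) \<partial>\<mu>) = (\<Sum>k<N. \<integral>y. 2 * (norm (F k y))\<^sup>2 \<partial>\<mu>)"
        by (rule Bochner_Integration.integral_sum) (rule iF)
      then show ?thesis
        unfolding W_def using iW
        by (subst Bochner_Integration.integral_add[OF Bochner_Integration.integrable_sum[OF iF]])
           simp_all
    qed
    also have "(\<Sum>k<N. 2 * (\<integral>y. (norm (F k y))\<^sup>2 \<partial>\<mu>)) \<le> (\<Sum>k<N. 2 * (K * h)\<^sup>2)"
      by (intro sum_mono mult_left_mono Fn) auto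
    also have "\<dots> = 4 * R * K\<^sup>2 * h"
      using h(4) by (simp add: power2_eq_square) (metis (no_types, opaque_lifting) mult.assoc mult.commute)
    also have "\<dots> \<le> 4 * R * K\<^sup>2 * \<delta>" using h(3) assms by (intro mult_left_mono) auto
    also have "2 * \<delta>\<^sup>2 * W \<le> 2 * \<delta> * W"
      using \<delta> W by (intro mult_right_mono mult_left_mono) (auto simp: power2_eq_square)
    finally show ?thesis using iE by (simp add: C_def algebra_simps)
  qed
  have iE: "integrable \<mu> E" using main[of "1/2"] by simp
  have "(\<integral>y. E y \<partial>\<mu>) \<le> 0"
  proof (rule ccontr)
    assume neg: "\<not> ?thesis"
    define \<delta> where "\<delta> = min (1/2) ((\<integral>y. E y \<partial>\<mu>) / (2 * (C + 1)))"
    have "0 < \<delta>" "\<delta> < 1" using neg C by (auto simp: \<delta>_def)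
    then have "(\<integral>y. E y \<partial>\<mu>) \<le> C * \<delta>" using main by blast
    also have "\<dots> \<le> (C + 1) * ((\<integral>y. E y \<partial>\<mu>) / (2 * (C + 1)))"
      using C neg by (intro mult_mono) (auto simp: \<delta>_def)
    also have "\<dots> = (\<integral>y. E y \<partial>\<mu>) / 2" using C by (simp add: field_simps)
    finally show False using neg by simp
  qed
  moreover have "0 \<le> (\<integral>y. E y \<partial>\<mu>)" using E0' by (intro integral_nonneg_AE) simp
  ultimately have "(\<integral>y. E y \<partial>\<mu>) = 0" by (rule antisym)
  moreover have "AE y in \<mu>. 0 \<le> E y" using E0' by simp
  ultimately have "AE y in \<mu>. E y = 0" using integral_nonneg_eq_0_iff_AE[OF iE] by blast
  then show ?thesis by eventually_elim (auto simp: E_def)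
qed

lemma kernel_transport: "AE y in \<mu>. kernel a c y = kernel b (transport a b c y) y"
proof -
  have "AE y in \<mu>. \<forall>n::nat. y \<in> {- real (Suc n)..<real (Suc n)} \<longrightarrow> kernel a c y = kernel b (transport a b c y) y"
    unfolding AE_all_countable by (intro allI kernel_transport_bounded) simp
  then show ?thesis
  proof eventually_elim
    case (elim y)
    obtain n :: nat where "\<bar>y\<bar> < real n" using reals_Archimedean2 by blast
    then have "y \<in> {- real (Suc n)..<real (Suc n)}" by auto
    then show ?case using elim by blast
  qed
qed

end

section \<open>Polynomial growth on the spectrum\<close>

text \<open>Gram--Schmidt: the component of \<open>v\<close> orthogonal to a list of vectors. Its explicit form makes it
  measurable in the vectors; a division by \<open>0\<close> only occurs together with a vanishing vector.\<close>

fun residual :: "(complex ^ 'k) list \<Rightarrow> complex ^ 'k \<Rightarrow> complex ^ 'k" where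
  "residual [] v = v"
| "residual (k # ks) v = residual ks v - (cinner (residual ks v) (residual ks k) / cinner (residual ks k) (residual ks k)) *s residual ks k"

text \<open>The removed part \<open>v - residual ks v\<close> lies in the span of \<open>ks\<close>;
  with the orthogonality shown next, \<open>residual\<close> is the projection onto the orthogonal
  complement.\<close>

lemma cinner_residual_diff:
  "(\<And>k. k \<in> set ks \<Longrightarrow> cinner x k = 0) \<Longrightarrow> cinner x (v - residual ks v) = 0"
proof (induction ks arbitrary: v)
  case Nil
  then show ?case by (simp add: cinner_def)
next
  case (Cons k ks)
  have IH: "cinner x u = cinner x (residual ks u)" for u
    using Cons by (simp add: cinner_diff_right)
  have "cinner x (residual ks k) = 0" using IH[of k] Cons.prems[of k] by simp
  then show ?case using IH[of v] by (simp add: cinner_diff_right cinner_scale_right)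
qed

lemma residual_orthogonal: "k \<in> set ks \<Longrightarrow> cinner (residual ks v) k = 0"
proof (induction ks arbitrary: v k)
  case (Cons a ks)
  let ?u = "residual ks a" and ?w = "residual ks v"
  have o: "cinner (residual (a # ks) v) k = 0" if "k \<in> set ks" for k
    using Cons.IH[OF that] by (simp add: cinner_diff_left cinner_scale_left)
  have "cinner (residual (a # ks) v) a = cinner (residual (a # ks) v) ?u"
    using cinner_residual_diff[of ks "residual (a # ks) v" a] o by (simp only: cinner_diff_right) simp
  also have "\<dots> = 0"
  proof (cases "?u = 0")
    case True
    then show ?thesis by (simp only: True) (simp add: cinner_def)
  next
    case False
    then have "cinner ?u ?u \<noteq> 0" by (simp add: cinner_self)
    then show ?thesis by (simp add: cinner_diff_left cinner_scale_left)
  qed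
  finally show ?case using Cons.prems o by auto
qed simp

lemma norm_residual_le: "norm (residual ks v) \<le> norm v"
proof -
  have "cinner (residual ks v) v = cinner (residual ks v) (residual ks v)"
    using cinner_residual_diff[of ks "residual ks v" v] residual_orthogonal[of _ ks v] by (simp add: cinner_diff_right)
  then have "(norm (residual ks v))\<^sup>2 = norm (cinner (residual ks v) v)" by (simp add: cinner_self norm_power)
  then have "norm (residual ks v) * norm (residual ks v) \<le> norm v * norm (residual ks v)"
    using norm_cinner_le[of "residual ks v" v] by (simp add: power2_eq_square mult.commute)
  then show ?thesis by (cases "residual ks v = 0") auto
qed

lemma measurable_residual:
  fixes F :: "'b \<Rightarrow> 'a \<Rightarrow> complex ^ 'k"
  assumes F: "\<And>j. F j \<in> borel_measurable M"
  shows "v \<in> borel_measurable M \<Longrightarrow> (\<lambda>y. residual (map (\<lambda>j. F j y) js) (v y)) \<in> borel_measurable M"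
proof (induction js arbitrary: v)
  case (Cons j js)
  note [measurable] = Cons.IH[OF Cons.prems] Cons.IH[OF F[of j]]
  show ?case by (simp, measurable)
qed simp

text \<open>The series of |g_n|^2 / (1 + n)^2 has a finite integral, hence is finite almost
  everywhere, and it dominates each of its terms.\<close>

lemma AE_linear_growth:
  fixes g :: "nat \<Rightarrow> 'a \<Rightarrow> 'b::euclidean_space"
  assumes g: "\<And>n. g n \<in> borel_measurable M" and i: "\<And>n. integrable M (\<lambda>x. (norm (g n x))\<^sup>2)"
    and C: "\<And>n. (\<integral>x. (norm (g n x))\<^sup>2 \<partial>M) \<le> C"
  shows "AE x in M. \<exists>K. \<forall>n. norm (g n x) \<le> K * (1 + real n)"
proof -
  define c where "c = (\<lambda>n. 1 / (1 + real n)\<^sup>2)"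
  define h where "h = (\<lambda>n x. c n * (norm (g n x))\<^sup>2)"
  have c0: "0 < c n" for n by (simp add: c_def)
  have "summable (\<lambda>n. inverse ((of_nat (Suc n) :: real) ^ 2))"
    by (subst summable_Suc_iff[of "\<lambda>n. inverse ((of_nat n :: real) ^ 2)"]) (rule inverse_power_summable, simp)
  then have "summable (\<lambda>n. C * c n)" by (intro summable_mult) (simp add: c_def inverse_eq_divide add.commute)
  moreover have C0: "0 \<le> C" by (rule order_trans[OF _ C[of 0]]) simp
  ultimately have fin: "(\<Sum>n. ennreal (C * c n)) \<noteq> \<infinity>" using c0 by (simp add: suminf_ennreal2 less_imp_le)
  have mh: "(\<lambda>x. ennreal (h n x)) \<in> borel_measurable M" for n
    using g[of n] unfolding h_def by measurable
  have "(\<integral>\<^sup>+x. (\<Sum>n. ennreal (h n x)) \<partial>M) = (\<Sum>n. \<integral>\<^sup>+x. ennreal (h n x) \<partial>M)"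
    by (rule nn_integral_suminf[OF mh])
  also have "\<dots> \<le> (\<Sum>n. ennreal (C * c n))"
  proof (intro suminf_le summableI)
    fix n
    have "(\<integral>\<^sup>+x. ennreal (h n x) \<partial>M) = ennreal (\<integral>x. h n x \<partial>M)"
      by (rule nn_integral_eq_integral) (use i c0[of n] in \<open>auto simp: h_def\<close>)
    also have "(\<integral>x. h n x \<partial>M) = c n * (\<integral>x. (norm (g n x))\<^sup>2 \<partial>M)" by (simp add: h_def)
    also have "\<dots> \<le> C * c n" using C[of n] c0[of n] by (simp add: mult.commute)
    finally show "(\<integral>\<^sup>+x. ennreal (h n x) \<partial>M) \<le> ennreal (C * c n)" by (simp add: ennreal_leI)
  qed
  finally have "(\<integral>\<^sup>+x. (\<Sum>n. ennreal (h n x)) \<partial>M) \<noteq> \<infinity>" using fin by (metis neq_top_trans infinity_ennreal_def)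
  then have "AE x in M. (\<Sum>n. ennreal (h n x)) \<noteq> \<infinity>"
    by (rule nn_integral_PInf_AE[rotated]) (rule borel_measurable_suminf_order, rule mh)
  then show ?thesis
  proof eventually_elim
    case (elim x)
    define S where "S = enn2real (\<Sum>n. ennreal (h n x))"
    have "norm (g n x) \<le> sqrt S * (1 + real n)" for n
    proof -
      have "ennreal (h n x) \<le> (\<Sum>n. ennreal (h n x))"
        using sum_le_suminf[of "\<lambda>n. ennreal (h n x)" "{n}"] by (simp add: summableI)
      also have "\<dots> = ennreal S" using elim by (simp add: S_def ennreal_enn2real_if)
      finally have "h n x \<le> S" by (simp add: S_def)
      then have "(norm (g n x))\<^sup>2 \<le> S * (1 + real n)\<^sup>2" by (simp add: h_def c_def field_simps)
      then have "sqrt ((norm (g n x))\<^sup>2) \<le> sqrt (S * (1 + real n)\<^sup>2)" by (rule real_sqrt_le_mono)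
      then show ?thesis by (simp add: real_sqrt_mult)
    qed
    then show ?case by blast
  qed
qed

lemma mpow_sum: "mpow A n (\<Sum>j\<in>J. c j *s e j) = (\<Sum>j\<in>J. c j *s mpow A n (e j))"
  by (induction J rule: infinite_finite_induct) (simp_all add: mpow_add mpow_scale)

context periodic_schroedinger
begin

section \<open>From the fibre to the monodromy matrix\<close>

lemma kernel_linear: "linear (\<lambda>d. kernel a d y)"
  by (rule linearI) (simp_all add: kernel_add kernel_scaleR)

text \<open>This is where the multiplicity enters: the fibre of the spectral representation has exactly the
  dimension \<open>2 m\<close> of the space of Cauchy data. A function whose spectral transform is orthogonal to the
  kernels at \<open>0\<close> vanishes.\<close>

lemma orthogonal_to_kern_imp_zero:
  assumes S: "S \<in> sets borel" "S \<subseteq> {-R..R}" "emeasure \<mu> S < \<infinity>"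
  shows "AE y in \<mu>. y \<in> S \<longrightarrow> (\<forall>x. (\<forall>j. cinner x (kern 0 j y) = 0) \<longrightarrow> x = 0)"
proof -
  obtain js :: "('m + 'm) list" where js: "set js = UNIV" using finite_list[OF finite] by blast
  \<comment> \<open>The components of the basis vectors orthogonal to all kernels at 0; all of them
    vanish exactly when the kernels span the fibre.\<close>
  define p where "p = (\<lambda>l y. residual (map (\<lambda>j. kern 0 j y) js) (axis l 1))"
  have p: "AE y in \<mu>. y \<in> S \<longrightarrow> p l y = 0" for l
  proof -
    have mp: "p l \<in> borel_measurable borel" unfolding p_def by (rule measurable_residual) (simp_all add: measurable_kern)
    define \<phi> where "\<phi> = (\<lambda>y. indicat_real S y *\<^sub>R p l y)"
    have "norm (p l y) \<le> 1" for y
      using norm_residual_le[of "map (\<lambda>j. kern 0 j y) js" "axis l 1"] by (simp add: p_def)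
    then have L: "\<phi> \<in> L2 \<mu>" unfolding \<phi>_def by (intro indicator_L2[OF S(1,3) mp])
    have supp: "\<phi> y = 0" if "\<bar>R\<bar> < \<bar>y\<bar>" for y
    proof -
      have "y \<notin> {-R..R}" using that by auto
      then have "y \<notin> S" using S(2) by blast
      then show ?thesis by (simp add: \<phi>_def)
    qed
    obtain f where f: "f \<in> D" "AE y in \<mu>. U f y = \<phi> y" "L2_norm lebesgue f = L2_norm \<mu> \<phi>"
      by (rule preimage_bounded_support[OF L supp])
    have orth: "cinner (\<phi> y) (kernel 0 c y) = 0" for c y
    proof -
      have "cinner (p l y) (kern 0 j y) = 0" for j
        unfolding p_def by (rule residual_orthogonal) (simp add: js)
      then show ?thesis by (simp add: kernel_def \<phi>_def cinner_scaleR_left cinner_sum_right cinner_scale_right)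
    qed
    \<comment> \<open>Transport carries the orthogonality from 0 to every point \<open>a\<close>;
      Cauchy data of the form (0, e_i) then read off the components of f(a).\<close>
    have "lform a c f = 0" for a c
    proof -
      have "AE y in \<mu>. cinner (U f y) (kernel a c y) = 0"
        using f(2) kernel_transport[of a c 0] by eventually_elim (simp add: orth)
      then show ?thesis unfolding lform_kernel(2)[OF f(1)] by (rule integral_eq_zero_AE)
    qed
    then have "lform a (join 0 (axis i 1)) f = 0" for a i by blast
    then have "f a $ i = 0" for a i by (simp add: lform_def cinner_axis)
    then have "f = (\<lambda>_. 0)" by (simp add: fun_eq_iff vec_eq_iff)
    then have "L2_norm \<mu> \<phi> = 0" using f(3) by (simp add: L2_norm_def)
    from L2_norm_zero_AE[OF L this] show ?thesis by eventually_elim (auto simp: \<phi>_def)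
  qed
  have "AE y in \<mu>. \<forall>l. y \<in> S \<longrightarrow> p l y = 0" unfolding AE_all_countable using p by blast
  then show ?thesis
  proof eventually_elim
    case (elim y)
    show ?case
    proof (intro impI allI)
      fix x assume y: "y \<in> S" and x: "\<forall>j. cinner x (kern 0 j y) = 0"
      have "x $ l = 0" for l
        using cinner_residual_diff[of "map (\<lambda>j. kern 0 j y) js" x "axis l 1"] x elim y by (auto simp: p_def cinner_axis)
      then show "x = 0" by (simp add: vec_eq_iff)
    qed
  qed
qed

text \<open>The hypothesis says that the kernels span the fibre, so the real adjoint of the map from
  d to \<open>kernel 0 d y\<close> is injective. Fibre and Cauchy data have equal dimension, hence
  the adjoint is onto and the map itself injective.\<close>

lemma kernel_bounded_below:
  assumes "\<And>x. (\<And>j. cinner x (kern 0 j y) = 0) \<Longrightarrow> x = 0"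
  shows "\<exists>B>0. \<forall>d. B * norm d \<le> norm (kernel 0 d y)"
proof -
  let ?L = "\<lambda>d. kernel 0 d y"
  have adj: "x \<bullet> ?L d = adjoint ?L x \<bullet> d" for x d by (metis adjoint_works[OF kernel_linear] inner_commute)
  have "inj (adjoint ?L)"
  proof (rule linear_injective_0[OF adjoint_linear[OF kernel_linear], THEN iffD2], intro allI impI)
    fix x assume "adjoint ?L x = 0"
    then have 0: "x \<bullet> ?L d = 0" for d by (simp add: adj)
    have "cinner x (kern 0 j y) = 0" for j
    proof (rule complex_eqI)
      show "Re (cinner x (kern 0 j y)) = Re 0" using 0[of "axis j 1"] by (simp add: Re_cinner kernel_axis)
      \<comment> \<open>Testing with i times a basis vector recovers the imaginary part, which the
        real inner product does not see.\<close>
      have "kernel 0 (\<i> *s axis j 1) y = \<i> *s kernel 0 (axis j 1) y"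
        by (simp add: kernel_def vec_eq_iff sum_distrib_left mult_ac)
      then have "Re (cinner x (\<i> *s kern 0 j y)) = 0" using 0[of "\<i> *s axis j 1"] by (simp add: Re_cinner kernel_axis)
      then show "Im (cinner x (kern 0 j y)) = Im 0" by (simp add: cinner_scale_right)
    qed
    then show "x = 0" by (rule assms)
  qed
  then have "surj (adjoint ?L)" by (intro linear_injective_imp_surjective adjoint_linear kernel_linear refl)
  then have "inj ?L"
    unfolding linear_injective_0[OF kernel_linear]
  proof (intro allI impI)
    fix d assume "?L d = 0"
    moreover obtain x where "d = adjoint ?L x" using \<open>surj (adjoint ?L)\<close> by (rule surjE)
    ultimately have "d \<bullet> d = 0" using adj[of x d] by simp
    then show "d = 0" by simp
  qed
  from linear_inj_bounded_below_pos[OF kernel_linear this] show ?thesis by (metis mult.commute)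
qed

text \<open>Transport runs from - n \<omega> up to 0, so that positive powers of the monodromy
  matrix appear.\<close>

lemma transport_period: "transport (- real n * \<omega>) 0 c y = mpow (schr_prop Q (of_real y) \<omega>) n c"
proof -
  have "(\<lambda>x. Q (x + - real n * \<omega>)) = Q"
    using periodic_shift_int[where k="- int n" and Q=Q, OF per] by (simp add: fun_eq_iff)
  then show ?thesis
    using schr_prop_mult_period[OF Q per w, of "of_real y" n c] by (simp add: transport_def)
qed

text \<open>The kernels at \<open>- n \<omega>\<close> are bounded in \<open>L\<^sup>2\<close> uniformly in \<open>n\<close>, so that summing their squares against
  \<open>1 / (1 + n)\<^sup>2\<close> bounds them pointwise; the kernel at \<open>0\<close> transfers this to the monodromy matrix.\<close>

lemma mpow_linear_growth:
  assumes S: "S \<in> sets borel" "S \<subseteq> {-R..R}" "emeasure \<mu> S < \<infinity>"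
  shows "AE y in \<mu>. y \<in> S \<longrightarrow> (\<forall>c. \<exists>C. \<forall>n. norm (mpow (schr_prop Q (of_real y) \<omega>) n c) \<le> C * (1 + real n))"
proof -
  obtain C where C: "C \<ge> 0" "\<And>a c. L2_norm \<mu> (\<lambda>y. indicat_real S y *\<^sub>R kernel a c y) \<le> C * norm c"
    using kernel_L2_bound[of R] S(1,2) by blast
  have 1: "AE y in \<mu>. \<exists>K. \<forall>n. norm (indicat_real S y *\<^sub>R kern (- real n * \<omega>) j y) \<le> K * (1 + real n)" for j
  proof (rule AE_linear_growth)
    fix n
    have L: "(\<lambda>y. indicat_real S y *\<^sub>R kern (- real n * \<omega>) j y) \<in> L2 \<mu>" by (rule kern_L2[OF S(1,2)])
    show "(\<lambda>y. indicat_real S y *\<^sub>R kern (- real n * \<omega>) j y) \<in> borel_measurable \<mu>"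
      "integrable \<mu> (\<lambda>y. (norm (indicat_real S y *\<^sub>R kern (- real n * \<omega>) j y))\<^sup>2)"
      by (rule L2D[OF L])+
    have "L2_norm \<mu> (\<lambda>y. indicat_real S y *\<^sub>R kern (- real n * \<omega>) j y) \<le> C"
      using C(2)[of "- real n * \<omega>" "axis j 1"] by (simp add: kernel_axis)
    then have "(L2_norm \<mu> (\<lambda>y. indicat_real S y *\<^sub>R kern (- real n * \<omega>) j y))\<^sup>2 \<le> C\<^sup>2" by (intro power_mono) simp_all
    then show "(\<integral>y. (norm (indicat_real S y *\<^sub>R kern (- real n * \<omega>) j y))\<^sup>2 \<partial>\<mu>) \<le> C\<^sup>2" by (simp only: L2_norm_sq)
  qed
  have 2: "AE y in \<mu>. \<forall>j. \<exists>K. \<forall>n. norm (indicat_real S y *\<^sub>R kern (- real n * \<omega>) j y) \<le> K * (1 + real n)"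
    using 1 by (simp add: AE_all_countable)
  have 3: "AE y in \<mu>. \<forall>j. \<forall>n. kern (- real n * \<omega>) j y = kernel 0 (mpow (schr_prop Q (of_real y) \<omega>) n (axis j 1)) y"
    unfolding AE_all_countable
  proof (intro allI)
    fix j n
    show "AE y in \<mu>. kern (- real n * \<omega>) j y = kernel 0 (mpow (schr_prop Q (of_real y) \<omega>) n (axis j 1)) y"
      using kernel_transport[of "- real n * \<omega>" "axis j 1" 0] unfolding kernel_axis transport_period .
  qed
  show ?thesis
    using 2 3 orthogonal_to_kern_imp_zero[OF S]
  proof eventually_elim
    case (elim y)
    let ?P = "schr_prop Q (of_real y) \<omega>"
    show ?case
    proof (intro impI allI)
      fix c assume y: "y \<in> S"
      obtain K where K: "\<And>j n. norm (kern (- real n * \<omega>) j y) \<le> K j * (1 + real n)"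
        using elim(1) y by simp metis
      obtain B where B: "B > 0" "\<And>d. B * norm d \<le> norm (kernel 0 d y)"
        using kernel_bounded_below[of y] elim(3) y by blast
      have e: "norm (mpow ?P n (axis j 1)) \<le> (K j / B) * (1 + real n)" for n j
      proof -
        have "B * norm (mpow ?P n (axis j 1)) \<le> K j * (1 + real n)"
          using order_trans[OF B(2) K[of n j, unfolded elim(2)[rule_format]]] .
        then show ?thesis using B(1) by (simp add: field_simps)
      qed
      have "norm (mpow ?P n c) \<le> (\<Sum>j\<in>UNIV. norm (c $ j) * (K j / B)) * (1 + real n)" for n
      proof -
        have "mpow ?P n c = (\<Sum>j\<in>UNIV. c $ j *s mpow ?P n (axis j 1))"
          using mpow_sum[where A="?P" and n=n and c="\<lambda>j. c $ j" and e="\<lambda>j. axis j 1" and J=UNIV] by (simp only: basis_expansion)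
        then have "norm (mpow ?P n c) \<le> (\<Sum>j\<in>UNIV. norm (c $ j) * norm (mpow ?P n (axis j 1)))"
          using norm_sum[of "\<lambda>j. c $ j *s mpow ?P n (axis j 1)" UNIV] by (simp add: norm_scale_vec)
        also have "\<dots> \<le> (\<Sum>j\<in>UNIV. norm (c $ j) * ((K j / B) * (1 + real n)))"
          by (intro sum_mono mult_left_mono e) simp
        finally show ?thesis by (simp add: sum_distrib_right mult.assoc)
      qed
      then show "\<exists>C. \<forall>n. norm (mpow ?P n c) \<le> C * (1 + real n)" by blast
    qed
  qed
qed

lemma continuous_mpow: "continuous_on UNIV A \<Longrightarrow> continuous_on UNIV (\<lambda>y. mpow (A y) n c)" for A :: "real \<Rightarrow> complex ^ 'k ^ 'k"
  by (induction n) (auto intro!: continuous_intros)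

text \<open>Both sides are continuous in the energy, so a violation at \<open>t\<close> would
  persist on an interval. That interval contains a set of positive measure on which the powers grow
  linearly almost everywhere, and there \<open>norm_mpow_uniform\<close> enforces the bound.\<close>

lemma mpow_schr_prop_on_spectrum:
  assumes t: "t \<ge> E0"
  defines "N \<equiv> DIM(complex ^ ('m + 'm))"
  shows "norm (mpow (schr_prop Q (of_real t) \<omega>) n c) \<le> (1 + real n) ^ N * (1 + norm (schr_prop Q (of_real t) \<omega>)) ^ N * norm c"
proof (rule ccontr)
  let ?P = "\<lambda>y::real. schr_prop Q (of_real y) \<omega>"
  let ?F = "\<lambda>y. norm (mpow (?P y) n c)" and ?G = "\<lambda>y. (1 + real n) ^ N * (1 + norm (?P y)) ^ N * norm c"
  assume "\<not> ?thesis"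
  then have t': "t \<in> {y. ?G y < ?F y}" by simp
  have cP: "continuous_on UNIV ?P"
    by (rule continuous_on_compose2[OF continuous_on_schr_prop_z[OF Q, of UNIV]]) (auto intro!: continuous_intros)
  have "open {y. ?G y < ?F y}"
    by (intro open_Collect_less continuous_intros cP continuous_mpow)
  then obtain e where e: "e > 0" "\<And>y. \<bar>y - t\<bar> < e \<Longrightarrow> ?G y < ?F y"
    using t' unfolding open_dist dist_real_def by blast
  obtain S where S: "S \<in> sets borel" "S \<subseteq> {t - e<..<t + e}" "0 < emeasure \<mu> S" "emeasure \<mu> S < \<infinity>"
    using spectral_support[OF t e(1)] by blast
  have SR: "S \<subseteq> {- (\<bar>t\<bar> + e)..\<bar>t\<bar> + e}" using S(2) by force
  have "\<exists>y\<in>S. \<forall>w. \<exists>C. \<forall>n. norm (mpow (?P y) n w) \<le> C * (1 + real n)"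
  proof (rule ccontr)
    assume neg: "\<not> ?thesis"
    have "AE y in \<mu>. y \<notin> S" using mpow_linear_growth[OF S(1) SR S(4)] by eventually_elim (use neg in blast)
    then have "emeasure \<mu> S = 0" using S(1) by (subst (asm) AE_iff_null_sets[symmetric]) (auto simp: sets_mu null_sets_def)
    with S(3) show False by simp
  qed
  then obtain y where y: "y \<in> S" "\<And>w. \<exists>C. \<forall>n. norm (mpow (?P y) n w) \<le> C * (1 + real n)" by blast
  have "\<bar>y - t\<bar> < e" using y(1) S(2) by force
  then show False using e(2) norm_mpow_uniform[of "?P y" n c, OF y(2)] unfolding N_def by fastforce
qed

lemma mean_nonpos: "(integral {0..\<omega>} (\<lambda>x. Q x - E0 *\<^sub>R mat 1) *v v) \<bullet> v \<le> 0"
proof -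
  have "continuous_on UNIV (\<lambda>x. Q x - E0 *\<^sub>R mat 1)" by (intro continuous_intros Q)
  moreover have "Q (x + \<omega>) - E0 *\<^sub>R mat 1 = Q x - E0 *\<^sub>R mat 1" for x by (simp add: per)
  ultimately obtain B where B: "B \<ge> 0" "\<And>x. norm (Q x - E0 *\<^sub>R mat 1) \<le> B"
    using periodic_continuous_bounded[OF _ _ w, of "\<lambda>x. Q x - E0 *\<^sub>R mat 1"] by blast
  have B': "norm (Q x *v u - of_real E0 *s u) \<le> B * norm u" for x u
  proof -
    have "Q x *v u - of_real E0 *s u = (Q x - E0 *\<^sub>R mat 1) *v u"
      by (simp add: matrix_vector_mult_diff_rdistrib scaleR_matrix_vector_complex scaleR_eq_scale)
    then show ?thesis using order_trans[OF norm_matrix_vector_le mult_right_mono[OF B(2)]] by simp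
  qed
  obtain K where "\<And>n \<kappa> c. \<kappa> > 0 \<Longrightarrow> norm (mpow (schr_prop Q (of_real (E0 - \<kappa>\<^sup>2)) \<omega>) n c)
      \<le> K * (1 + real n) ^ DIM(complex ^ ('m + 'm)) * (1 + \<kappa>) ^ Suc (DIM(complex ^ ('m + 'm))) * exp (real n * \<omega> * \<kappa>) * norm c"
    using mpow_schr_prop_below_spectrum[OF Q per w B' B(1) mpow_schr_prop_on_spectrum] by blast
  from mean_potential_nonpos[OF Q per w herm this] show ?thesis .
qed

end

section \<open>Rigidity of the potential\<close>

lemma integral_periods:
  fixes F :: "real \<Rightarrow> 'b::euclidean_space"
  assumes F: "continuous_on UNIV F" and per: "\<And>x. F (x + \<omega>) = F x" and w: "\<omega> > 0"
  shows "integral {0..real n * \<omega>} F = real n *\<^sub>R integral {0..\<omega>} F"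
proof (induction n)
  case (Suc n)
  have "F ((+) (real n * \<omega>) x) = F x" for x
    using periodic_shift_int[where k="int n" and Q=F, OF per] by (simp add: add.commute)
  then have "integral {real n * \<omega>..real n * \<omega> + \<omega>} F = integral {0..\<omega>} F"
    using integral_shift_Icc_real[of 0 \<omega> F "real n * \<omega>"] by (simp add: o_def add.commute)
  moreover have "integral {0..real n * \<omega>} F + integral {real n * \<omega>..real n * \<omega> + \<omega>} F = integral {0..real n * \<omega> + \<omega>} F"
    using w by (intro Henstock_Kurzweil_Integration.integral_combine integrable_continuous_real continuous_on_subset[OF F]) auto
  ultimately show ?case using Suc by (simp add: algebra_simps)
qed simp

text \<open>Mean zero makes the antiderivative periodic. Its additive constant is chosen to give
  mean zero again, so that the construction can be repeated.\<close>

lemma periodic_antiderivative: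
  fixes u :: "real \<Rightarrow> 'b::euclidean_space"
  assumes u: "continuous_on UNIV u" and per: "\<And>x. u (x + \<omega>) = u x" and w: "\<omega> > 0" and mean: "integral {0..\<omega>} u = 0"
  obtains p where "\<And>x. (p has_vector_derivative u x) (at x)" "\<And>x. p (x + \<omega>) = p x" "integral {0..\<omega>} p = 0"
proof -
  define p0 where "p0 = (\<lambda>x. x *\<^sub>R integral {0..1} (\<lambda>s. u (s * x)))"
  have d: "(p0 has_vector_derivative u x) (at x)" for x
    unfolding p0_def by (rule antiderivative_scaled_integral[OF u])
  have c: "continuous_on UNIV p0"
    using d by (auto intro!: continuous_at_imp_continuous_on has_vector_derivative_continuous)
  have "((\<lambda>x. p0 (x + \<omega>) - p0 x) has_vector_derivative 0) (at x within UNIV)" for x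
  proof -
    have "((\<lambda>x::real. x + \<omega>) has_vector_derivative 1) (at x)" by (auto intro!: derivative_eq_intros)
    from vector_diff_chain_at[OF this d]
    have "((\<lambda>x. p0 (x + \<omega>)) has_vector_derivative u x) (at x)" by (simp add: o_def per)
    from has_vector_derivative_diff[OF this d[of x]] show ?thesis by simp
  qed
  then obtain k where k: "\<And>x. p0 (x + \<omega>) - p0 x = k"
    using has_vector_derivative_zero_constant[of UNIV "\<lambda>x. p0 (x + \<omega>) - p0 x"] by (metis UNIV_I convex_UNIV)
  have "(u has_integral p0 \<omega> - p0 0) {0..\<omega>}"
    by (rule fundamental_theorem_of_calculus) (use w in simp, rule has_vector_derivative_at_within[OF d])
  then have "k = 0" using mean k[of 0] by (simp add: integral_unique)
  define p where "p = (\<lambda>x. p0 x - (1 / \<omega>) *\<^sub>R integral {0..\<omega>} p0)"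
  show ?thesis
  proof (rule that[of p])
    show "(p has_vector_derivative u x) (at x)" for x
      using has_vector_derivative_diff[OF d has_vector_derivative_const] unfolding p_def by simp
    show "p (x + \<omega>) = p x" for x using k[of x] \<open>k = 0\<close> by (simp add: p_def)
    have "p0 integrable_on {0..\<omega>}" by (intro integrable_continuous_real continuous_on_subset[OF c]) auto
    then show "integral {0..\<omega>} p = 0"
      unfolding p_def using w by (subst integral_diff) (auto simp: field_simps)
  qed
qed

text \<open>First variation: for small e of sign opposite to \<open>b\<close> the linear term
  outweighs the quadratic one. The value - b / (|c| + 1) is small enough.\<close>

lemma linear_coefficient_zero:
  fixes b c :: real
  assumes "\<And>e. 0 \<le> 2 * e * b + e\<^sup>2 * c"
  shows "b = 0"
proof (rule ccontr)
  assume b: "b \<noteq> 0"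
  define k where "k = \<bar>c\<bar> + 1"
  have k: "k > 0" "c \<le> k" by (auto simp: k_def)
  have "0 \<le> 2 * (- b / k) * b + (- b / k)\<^sup>2 * c" by (rule assms)
  also have "\<dots> \<le> 2 * (- b / k) * b + (- b / k)\<^sup>2 * k" by (intro add_left_mono mult_left_mono k) simp
  also have "\<dots> = - (b\<^sup>2 / k)" using k by (simp add: field_simps power2_eq_square)
  finally show False using b k(1) by (simp add: field_simps)
qed

context periodic_schroedinger
begin

section \<open>The periodic quadratic form\<close>

abbreviation q :: "real \<Rightarrow> complex ^ 'm \<Rightarrow> complex ^ 'm" where
  "q x v \<equiv> Q x *v v - E0 *\<^sub>R v"

text \<open>The lower bound of the form of \<open>H\<close> on a test function, followed by one
  integration by parts; the boundary terms vanish with f.\<close>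

lemma form_nonneg_compact_support:
  fixes f f' f'' :: "real \<Rightarrow> complex ^ 'm"
  assumes df: "\<And>x. (f has_vector_derivative f' x) (at x)" "\<And>x. (f' has_vector_derivative f'' x) (at x)"
    and cf: "continuous_on UNIV f''" and ab: "a \<le> b" and out: "\<And>x. x \<le> a \<or> b \<le> x \<Longrightarrow> f x = 0"
  shows "0 \<le> integral {a..b} (\<lambda>x. f' x \<bullet> f' x + q x (f x) \<bullet> f x)"
proof -
  have c: "continuous_on UNIV f" "continuous_on UNIV f'"
    using df by (auto intro!: continuous_at_imp_continuous_on has_vector_derivative_continuous)
  have supp: "f x = 0" if "max \<bar>a\<bar> \<bar>b\<bar> < \<bar>x\<bar>" for x
    by (rule out) (use that in \<open>auto simp: abs_if split: if_splits\<close>)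
  have f: "f \<in> D" by (rule test_function_in_dom(1)[where R="max \<bar>a\<bar> \<bar>b\<bar>", OF Q df cf supp])
  have Hf: "H f = (\<lambda>x. - f'' x + Q x *v f x)"
    by (rule test_function_in_dom(2)[where R="max \<bar>a\<bar> \<bar>b\<bar>", OF Q df cf supp])
  define T where "T = (\<lambda>x. cinner (- f'' x + q x (f x)) (f x))"
  have Teq: "T = (\<lambda>x. cinner (H f x - of_real E0 *s f x) (f x))"
    by (simp add: T_def Hf scaleR_eq_scale algebra_simps)
  have L: "(\<lambda>x. H f x - of_real E0 *s f x) \<in> L2 lebesgue" by (rule L2_diff_scale[OF H_L2[OF f] D_L2[OF f]])
  have iT: "integrable lebesgue T" unfolding Teq by (rule integrable_cinner(1)[OF L D_L2[OF f]])
  have T0: "T x = 0" if "x \<notin> {a..b}" for x using out[of x] that by (auto simp: T_def cinner_def)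
  have cT: "continuous_on UNIV T" unfolding T_def by (intro continuous_intros cf c Q)
  have "0 \<le> Re (L2_inner lebesgue (H f) f) - E0 * (L2_norm lebesgue f)\<^sup>2" using form_lower_bound[OF f] by simp
  also have "\<dots> = Re (L2_inner lebesgue (\<lambda>x. H f x - of_real E0 *s f x) f)"
    by (simp add: L2_inner_diff_scale_left[OF H_L2[OF f] D_L2[OF f] D_L2[OF f]] L2_inner_self del: of_real_power)
  also have "L2_inner lebesgue (\<lambda>x. H f x - of_real E0 *s f x) f = integral {a..b} T"
    unfolding L2_inner_eq Teq[symmetric] by (rule lebesgue_integral_compact_support[OF iT T0])
  also have "Re (integral {a..b} T) = integral {a..b} (\<lambda>x. Re (T x))"
    using integral_linear[OF integrable_continuous_real[OF continuous_on_subset[OF cT]] bounded_linear_Re, of a b] by (simp add: o_def)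
  also have "\<dots> = integral {a..b} (\<lambda>x. Re (T x)) + integral {a..b} (\<lambda>x. f'' x \<bullet> f x + f' x \<bullet> f' x)"
  proof -
    have "((\<lambda>x. f'' x \<bullet> f x + f' x \<bullet> f' x) has_integral f' b \<bullet> f b - f' a \<bullet> f a) {a..b}"
    proof (rule fundamental_theorem_of_calculus[OF ab])
      fix x
      have "((\<lambda>x. f' x \<bullet> f x) has_vector_derivative f' x \<bullet> f' x + f'' x \<bullet> f x) (at x)"
        by (rule bounded_bilinear.has_vector_derivative[OF bounded_bilinear_inner df(2) df(1)])
      then show "((\<lambda>x. f' x \<bullet> f x) has_vector_derivative f'' x \<bullet> f x + f' x \<bullet> f' x) (at x within {a..b})"
        by (simp add: has_vector_derivative_at_within add.commute)
    qed
    then show ?thesis using out[of a] out[of b] by (simp add: integral_unique)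
  qed
  also have "\<dots> = integral {a..b} (\<lambda>x. Re (T x) + (f'' x \<bullet> f x + f' x \<bullet> f' x))"
    by (rule integral_add[symmetric]; intro integrable_continuous_real continuous_on_subset[of UNIV _ "{a..b}"] continuous_intros cT c cf) auto
  also have "(\<lambda>x. Re (T x) + (f'' x \<bullet> f x + f' x \<bullet> f' x)) = (\<lambda>x. f' x \<bullet> f' x + q x (f x) \<bullet> f x)"
    by (simp add: T_def Re_cinner inner_add_left inner_diff_left algebra_simps)
  finally show ?thesis .
qed

text \<open>A periodic function cut off outside \<open>N\<close> periods has \<open>N\<close> times
  the form of one period plus two ramp contributions bounded independently of \<open>N\<close>. A
  negative value over one period would prevail for large \<open>N\<close>.\<close>

lemma periodic_form_nonneg:
  fixes g g' g'' :: "real \<Rightarrow> complex ^ 'm"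
  assumes dg: "\<And>x. (g has_vector_derivative g' x) (at x)" "\<And>x. (g' has_vector_derivative g'' x) (at x)"
    and cg: "continuous_on UNIV g''" and pg: "\<And>x. g (x + \<omega>) = g x" "\<And>x. g' (x + \<omega>) = g' x"
  shows "0 \<le> integral {0..\<omega>} (\<lambda>x. g' x \<bullet> g' x + q x (g x) \<bullet> g x)"
proof (rule ccontr)
  let ?F = "\<lambda>x. g' x \<bullet> g' x + q x (g x) \<bullet> g x"
  define I where "I = integral {0..\<omega>} ?F"
  assume "\<not> ?thesis"
  then have I: "I < 0" by (simp add: I_def)
  have c: "continuous_on UNIV g" "continuous_on UNIV g'"
    using dg by (auto intro!: continuous_at_imp_continuous_on has_vector_derivative_continuous)
  have cq: "continuous_on UNIV (\<lambda>x. q x (g x))" by (intro continuous_intros Q c)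
  obtain B1 where B1: "B1 \<ge> 0" "\<And>x. norm (g x) \<le> B1" using periodic_continuous_bounded[OF c(1) pg(1) w] by blast
  obtain B2 where B2: "B2 \<ge> 0" "\<And>x. norm (g' x) \<le> B2" using periodic_continuous_bounded[OF c(2) pg(2) w] by blast
  obtain B3 where B3: "B3 \<ge> 0" "\<And>x. norm (q x (g x)) \<le> B3"
    using periodic_continuous_bounded[OF cq _ w] pg(1) per by auto
  \<comment> \<open>A pointwise bound for the form density of the cut-off function, whose cutoff has
    slope at most 30 / \<omega>; each of the two ramps of length \<omega> thus contributes at most
    \<open>\<omega> * M\<close>.\<close>
  define M where "M = (30 / \<omega> * B1 + B2)\<^sup>2 + B3 * B1"
  obtain N :: nat where N: "2 * \<omega> * M / (- I) < real N" using reals_Archimedean2 by blast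
  define a b where "a = - \<omega>" and "b = real N * \<omega> + \<omega>"
  have Nw: "0 \<le> real N * \<omega>" using w by simp
  have e: "\<omega> > 0" "2 * \<omega> \<le> b - a" using w Nw by (auto simp: a_def b_def)
  obtain \<xi> \<xi>' \<xi>'' where \<xi>: "\<And>x. (\<xi> has_real_derivative \<xi>' x) (at x)" "\<And>x. (\<xi>' has_real_derivative \<xi>'' x) (at x)" "continuous_on UNIV \<xi>''"
    and \<xi>01: "\<And>x. 0 \<le> \<xi> x \<and> \<xi> x \<le> 1" and out: "\<And>x. x \<le> a \<or> b \<le> x \<Longrightarrow> \<xi> x = 0 \<and> \<xi>' x = 0 \<and> \<xi>'' x = 0"
    and one: "\<And>x. a + \<omega> \<le> x \<Longrightarrow> x \<le> b - \<omega> \<Longrightarrow> \<xi> x = 1 \<and> \<xi>' x = 0" and slope: "\<And>x. \<bar>\<xi>' x\<bar> \<le> 30 / \<omega>"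
    by (rule exists_cutoff[OF e]) (rule that)
  have c\<xi>: "continuous_on UNIV \<xi>" "continuous_on UNIV \<xi>'"
    using \<xi> by (auto intro!: continuous_at_imp_continuous_on DERIV_isCont)
  define f where "f = (\<lambda>x. \<xi> x *\<^sub>R g x)"
  define f' where "f' = (\<lambda>x. \<xi> x *\<^sub>R g' x + \<xi>' x *\<^sub>R g x)"
  define f'' where "f'' = (\<lambda>x. (\<xi> x *\<^sub>R g'' x + \<xi>' x *\<^sub>R g' x) + (\<xi>' x *\<^sub>R g' x + \<xi>'' x *\<^sub>R g x))"
  have df: "(f has_vector_derivative f' x) (at x)" "(f' has_vector_derivative f'' x) (at x)" for x
    unfolding f_def f'_def f''_def by (intro has_vector_derivative_add has_vector_derivative_scaleR \<xi> dg)+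
  have cf'': "continuous_on UNIV f''" unfolding f''_def by (intro continuous_intros c c\<xi> \<xi> cg)
  let ?G = "\<lambda>x. f' x \<bullet> f' x + q x (f x) \<bullet> f x"
  have cG: "continuous_on S ?G" for S
    by (rule continuous_on_subset[of UNIV]) (auto simp: f_def f'_def intro!: continuous_intros c c\<xi> Q)
  have iG: "?G integrable_on {x..y}" for x y by (intro integrable_continuous_real cG)
  have GM: "?G x \<le> M" for x
  proof -
    have s: "\<bar>\<xi> x\<bar> \<le> 1" using \<xi>01[of x] by auto
    have "norm (f' x) \<le> norm (\<xi> x *\<^sub>R g' x) + norm (\<xi>' x *\<^sub>R g x)" unfolding f'_def by (rule norm_triangle_ineq)
    also have "\<dots> \<le> 1 * B2 + 30 / \<omega> * B1"
      unfolding norm_scaleR by (intro add_mono mult_mono s slope B1 B2) (use w in auto)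
    finally have "(norm (f' x))\<^sup>2 \<le> (30 / \<omega> * B1 + B2)\<^sup>2" by (intro power_mono) (auto simp: add.commute)
    moreover have "q x (f x) \<bullet> f x \<le> B3 * B1"
    proof -
      have "q x (f x) \<bullet> f x = (\<xi> x)\<^sup>2 * (q x (g x) \<bullet> g x)"
        by (simp add: f_def matrix_vector_mult_scaleR_complex inner_diff_left power2_eq_square algebra_simps)
      also have "\<dots> \<le> (\<xi> x)\<^sup>2 * (norm (q x (g x)) * norm (g x))"
        by (intro mult_left_mono norm_cauchy_schwarz) simp
      also have "\<dots> \<le> 1\<^sup>2 * (norm (q x (g x)) * norm (g x))"
        using \<xi>01[of x] by (intro mult_right_mono power_mono) auto
      also have "\<dots> \<le> 1\<^sup>2 * (B3 * B1)" by (intro mult_left_mono mult_mono B1 B3) auto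
      finally show ?thesis by simp
    qed
    ultimately show ?thesis by (simp add: M_def power2_norm_eq_inner)
  qed
  have ends: "integral {x..y} ?G \<le> (y - x) * M" if "x \<le> y" for x y
    using integral_le[OF iG integrable_const_ivl GM, of x y] that by simp
  have "0 \<le> integral {a..b} ?G"
    by (rule form_nonneg_compact_support[OF df cf'']) (use e out in \<open>auto simp: f_def\<close>)
  also have "\<dots> = integral {a..0} ?G + (integral {0..real N * \<omega>} ?G + integral {real N * \<omega>..b} ?G)"
  proof -
    have "integral {a..0} ?G + integral {0..b} ?G = integral {a..b} ?G"
      "integral {0..real N * \<omega>} ?G + integral {real N * \<omega>..b} ?G = integral {0..b} ?G"
      using w Nw by (auto intro!: Henstock_Kurzweil_Integration.integral_combine iG simp: a_def b_def)
    then show ?thesis by simp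
  qed
  also have "integral {0..real N * \<omega>} ?G = integral {0..real N * \<omega>} ?F"
    by (rule integral_cong) (use one in \<open>simp add: f_def f'_def a_def b_def\<close>)
  also have "\<dots> = real N * I"
  proof -
    have "continuous_on UNIV ?F" by (intro continuous_intros Q c)
    from integral_periods[OF this _ w, of N] show ?thesis by (simp add: I_def pg per)
  qed
  also have "integral {a..0} ?G + (real N * I + integral {real N * \<omega>..b} ?G) \<le> \<omega> * M + (real N * I + \<omega> * M)"
    using ends[of a 0] ends[of "real N * \<omega>" b] w by (intro add_mono order_refl) (simp_all add: a_def b_def)
  also have "\<dots> < 0"
  proof -
    have "2 * \<omega> * M < real N * (- I)" using N I by (subst (asm) pos_divide_less_eq) auto
    then show ?thesis by (simp add: algebra_simps)
  qed
  finally show False by simp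
qed

lemma q_symmetric: "q x u \<bullet> v = u \<bullet> q x v"
  using hermitian_inner[OF herm, of x u v] by (simp add: inner_diff_left inner_diff_right)

lemma potential_orthogonal:
  fixes h h' h'' :: "real \<Rightarrow> complex ^ 'm"
  assumes dh: "\<And>x. (h has_vector_derivative h' x) (at x)" "\<And>x. (h' has_vector_derivative h'' x) (at x)"
    and ch: "continuous_on UNIV h''" and ph: "\<And>x. h (x + \<omega>) = h x" "\<And>x. h' (x + \<omega>) = h' x"
  shows "integral {0..\<omega>} (\<lambda>x. q x v \<bullet> h x) = 0"
proof -
  let ?a = "\<lambda>x. q x v \<bullet> v" and ?b = "\<lambda>x. q x v \<bullet> h x" and ?c = "\<lambda>x. h' x \<bullet> h' x + q x (h x) \<bullet> h x"
  have c: "continuous_on UNIV h" "continuous_on UNIV h'"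
    using dh by (auto intro!: continuous_at_imp_continuous_on has_vector_derivative_continuous)
  have i: "?a integrable_on {0..\<omega>}" "?b integrable_on {0..\<omega>}" "?c integrable_on {0..\<omega>}"
    by (intro integrable_continuous_real continuous_on_subset[of UNIV _ "{0..\<omega>}"] continuous_intros Q c, simp)+
  have "integral {0..\<omega>} ?a \<le> 0"
  proof -
    have "(\<lambda>x. Q x - E0 *\<^sub>R mat 1) integrable_on {0..\<omega>}"
      by (intro integrable_continuous_real continuous_on_subset[of UNIV _ "{0..\<omega>}"] continuous_intros Q) simp
    moreover have "bounded_linear (\<lambda>A :: complex ^ 'm ^ 'm. (A *v v) \<bullet> v)"
      by (rule bounded_linear_compose[OF bounded_linear_inner_left bounded_bilinear.bounded_linear_left[OF bounded_bilinear_matrix_vector]])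
    ultimately have "integral {0..\<omega>} ((\<lambda>A. (A *v v) \<bullet> v) \<circ> (\<lambda>x. Q x - E0 *\<^sub>R mat 1)) = (integral {0..\<omega>} (\<lambda>x. Q x - E0 *\<^sub>R mat 1) *v v) \<bullet> v"
      by (rule integral_linear)
    then show ?thesis
      using mean_nonpos[of v] by (simp add: o_def matrix_vector_mult_diff_rdistrib scaleR_matrix_vector_complex)
  qed
  moreover have "0 \<le> integral {0..\<omega>} ?a + (2 * e * integral {0..\<omega>} ?b + e\<^sup>2 * integral {0..\<omega>} ?c)" for e
  proof -
    have "0 \<le> integral {0..\<omega>} (\<lambda>x. (e *\<^sub>R h' x) \<bullet> (e *\<^sub>R h' x) + q x (v + e *\<^sub>R h x) \<bullet> (v + e *\<^sub>R h x))"
    proof (rule periodic_form_nonneg)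
      show "((\<lambda>x. v + e *\<^sub>R h x) has_vector_derivative e *\<^sub>R h' x) (at x)"
        "((\<lambda>x. e *\<^sub>R h' x) has_vector_derivative e *\<^sub>R h'' x) (at x)" for x
        using dh[of x] by (auto intro!: derivative_eq_intros)
      show "continuous_on UNIV (\<lambda>x. e *\<^sub>R h'' x)" by (intro continuous_intros ch)
    qed (simp_all add: ph)
    also have "(\<lambda>x. (e *\<^sub>R h' x) \<bullet> (e *\<^sub>R h' x) + q x (v + e *\<^sub>R h x) \<bullet> (v + e *\<^sub>R h x)) = (\<lambda>x. ?a x + ((2 * e) * ?b x + e\<^sup>2 * ?c x))"
    proof
      fix x
      have "q x (v + e *\<^sub>R h x) = q x v + e *\<^sub>R q x (h x)"
        by (simp add: matrix_vector_right_distrib matrix_vector_mult_scaleR_complex algebra_simps)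
      moreover have "q x (h x) \<bullet> v = ?b x" by (simp only: q_symmetric inner_commute[of "h x"])
      ultimately show "(e *\<^sub>R h' x) \<bullet> (e *\<^sub>R h' x) + q x (v + e *\<^sub>R h x) \<bullet> (v + e *\<^sub>R h x) = ?a x + ((2 * e) * ?b x + e\<^sup>2 * ?c x)"
        by (simp only: inner_add_left inner_add_right inner_scaleR_left inner_scaleR_right) (simp add: power2_eq_square distrib_left mult.assoc)
    qed
    also have "integral {0..\<omega>} \<dots> = integral {0..\<omega>} ?a + (2 * e * integral {0..\<omega>} ?b + e\<^sup>2 * integral {0..\<omega>} ?c)"
      using i by (simp only: integral_add integrable_add integrable_on_mult_right integral_mult_right)
    finally show ?thesis .
  qed
  ultimately have "0 \<le> 2 * e * integral {0..\<omega>} ?b + e\<^sup>2 * integral {0..\<omega>} ?c" for e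
    by (smt (verit, ccfv_threshold))
  then show ?thesis by (rule linear_coefficient_zero)
qed

text \<open>The test function is built from u = q v itself: u has mean zero and therefore a periodic
  second antiderivative h, with h' = p. Orthogonality of u to h and integration by parts make the
  integral of |p|^2 vanish, so p = 0 and u = p' = 0.\<close>

lemma potential_constant: "Q x = E0 *\<^sub>R mat 1"
proof -
  have "q x v = 0" for v
  proof -
    let ?u = "\<lambda>x. q x v"
    have pu: "?u (x + \<omega>) = ?u x" for x by (simp add: per)
    have cu: "continuous_on UNIV ?u" by (intro continuous_intros Q)
    have iu: "?u integrable_on {0..\<omega>}" by (intro integrable_continuous_real continuous_on_subset[OF cu]) auto
    have "integral {0..\<omega>} ?u \<bullet> integral {0..\<omega>} ?u = integral {0..\<omega>} (\<lambda>x. ?u x \<bullet> integral {0..\<omega>} ?u)"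
      using integral_linear[OF iu bounded_linear_inner_left] by (simp add: o_def)
    \<comment> \<open>Constant functions are admissible test functions and yield the mean.\<close>
    also have "\<dots> = 0" by (rule potential_orthogonal[where h'="\<lambda>_. 0" and h''="\<lambda>_. 0"]) auto
    finally have mean: "integral {0..\<omega>} ?u = 0" by simp
    obtain p where p: "\<And>x. (p has_vector_derivative ?u x) (at x)" "\<And>x. p (x + \<omega>) = p x" "integral {0..\<omega>} p = 0"
      by (rule periodic_antiderivative[OF cu pu w mean]) (rule that)
    have cp: "continuous_on UNIV p"
      using p(1) by (auto intro!: continuous_at_imp_continuous_on has_vector_derivative_continuous)
    obtain h where h: "\<And>x. (h has_vector_derivative p x) (at x)" "\<And>x. h (x + \<omega>) = h x"
      by (rule periodic_antiderivative[OF cp p(2) w p(3)]) (rule that)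
    have ch: "continuous_on UNIV h"
      using h(1) by (auto intro!: continuous_at_imp_continuous_on has_vector_derivative_continuous)
    have "((\<lambda>x. p x \<bullet> p x + ?u x \<bullet> h x) has_integral p \<omega> \<bullet> h \<omega> - p 0 \<bullet> h 0) {0..\<omega>}"
      by (rule fundamental_theorem_of_calculus)
         (use w in simp, rule has_vector_derivative_at_within[OF bounded_bilinear.has_vector_derivative[OF bounded_bilinear_inner p(1) h(1)]])
    then have "integral {0..\<omega>} (\<lambda>x. p x \<bullet> p x + ?u x \<bullet> h x) = 0" using p(2)[of 0] h(2)[of 0] by (simp add: integral_unique)
    moreover have "integral {0..\<omega>} (\<lambda>x. p x \<bullet> p x + ?u x \<bullet> h x) = integral {0..\<omega>} (\<lambda>x. p x \<bullet> p x) + integral {0..\<omega>} (\<lambda>x. ?u x \<bullet> h x)"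
      by (rule integral_add; intro integrable_continuous_real continuous_on_subset[of UNIV _ "{0..\<omega>}"] continuous_intros cp ch Q) auto
    ultimately have 0: "integral {0..\<omega>} (\<lambda>x. p x \<bullet> p x) = 0"
      using potential_orthogonal[OF h(1) p(1) cu h(2) p(2), of v] by simp
    have p0: "p x = 0" if "x \<in> {0..\<omega>}" for x
    proof -
      have "continuous_on {0..\<omega>} (\<lambda>x. p x \<bullet> p x)" by (intro continuous_intros continuous_on_subset[OF cp]) auto
      from integral_eq_0_iff[OF this w] 0 that show ?thesis by auto
    qed
    have "p x = 0" for x
    proof -
      define k where "k = - \<lfloor>x / \<omega>\<rfloor>"
      have "of_int \<lfloor>x / \<omega>\<rfloor> * \<omega> \<le> x" "x < (of_int \<lfloor>x / \<omega>\<rfloor> + 1) * \<omega>"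
        using floor_correct[of "x / \<omega>"] unfolding pos_le_divide_eq[OF w] pos_divide_less_eq[OF w] by auto
      then have "p (x + of_int k * \<omega>) = 0" by (intro p0) (auto simp: k_def algebra_simps)
      then show ?thesis using periodic_shift_int[where Q=p and k=k and x=x, OF p(2)] by simp
    qed
    then have "p = (\<lambda>_. 0)" by auto
    then have "(p has_vector_derivative 0) (at x)" by simp
    from vector_derivative_unique_at[OF p(1) this] show ?thesis .
  qed
  then have "Q x *v v = (E0 *\<^sub>R mat 1) *v v" for v by (simp add: scaleR_matrix_vector_complex)
  then show ?thesis by (simp add: matrix_eq)
qed

end

theorem corollary4p9:
  fixes Q :: "real \<Rightarrow> complex ^ 'm ^ 'm" and \<omega> E\<^sub>0 :: real
  assumes hermitian: "\<And>x. conj_transpose (Q x) = Q x"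
    and ac: "\<And>i j. (\<lambda>x. Q x $ i $ j) \<in> AC_loc"
    and period_pos: "\<omega> > 0"
    and periodic: "\<And>x. Q (x + \<omega>) = Q x"
    and multiplicity:
      "uniform_spectral_multiplicity TYPE('m + 'm) lebesgue (schroedinger_dom Q) (schroedinger Q)"
    and spectrum: "spectrum lebesgue (schroedinger_dom Q) (schroedinger Q) = complex_of_real ` {E\<^sub>0..}"
  shows "\<forall>x. Q x = E\<^sub>0 *\<^sub>R mat 1"
proof -
  obtain \<mu> :: "real measure" and U :: "(real \<Rightarrow> complex ^ 'm) \<Rightarrow> real \<Rightarrow> complex ^ ('m + 'm)"
    where U: "sets \<mu> = sets borel" "unitary_map lebesgue \<mu> U"
      "\<forall>f\<in>L2 lebesgue. (\<exists>g\<in>schroedinger_dom Q. AE x in lebesgue. f x = g x) \<longleftrightarrow> (\<exists>h\<in>mult_dom \<mu>. AE y in \<mu>. U f y = h y)"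
      "\<forall>g\<in>schroedinger_dom Q. \<forall>h\<in>mult_dom \<mu>. (AE y in \<mu>. U g y = h y) \<longrightarrow> (AE y in \<mu>. U (schroedinger Q g) y = mult_op h y)"
    using multiplicity unfolding uniform_spectral_multiplicity_def unitarily_equivalent_def by blast
  have "continuous_on UNIV Q"
    by (intro continuous_on_vec AC_loc_continuous ac)
  with U spectrum hermitian periodic period_pos interpret periodic_schroedinger Q E\<^sub>0 \<mu> U \<omega>
    by unfold_locales blast+
  show ?thesis using potential_constant by blast
qed

end
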